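(* Let $c$ satisfy assumption (A) and $c'(u)>0$ for all $u$, and let $(u_0,u_1)\in H^1(\mathbb R)\times L^2(\mathbb R)$ be smooth initial data for $u_{tt}-c(u)\big(c(u)u_x\big)_x=0$. Let $u^{cons}$ and $u^{diss}$ be the conservative and the dissipative solutions with these same initial data, as constructed in the context. Let $P=(X_0,Y_0)$ be a point of Type 2 for the conservative solution at which two new singular curves $\gamma^-,\gamma^+$ originate in the backward moving waves; that is, at $P$ the components of the conservative solution satisfy $$w=\pi,\qquad z\neq\pi,\qquad w_X=0,\qquad w_{XX}\neq0,\qquad \kappa=-\frac{w_{XX}}{2w_Y}>0 .$$ Set $(x_0,t_0)=(x(X_0,Y_0),t(X_0,Y_0))$, $t_0>0$, let $\gamma^-(t)<\gamma^+(t)$ be the two singular curves of the conservative solution starting at $(x_0,t_0)$, let $\tilde\gamma$ be the forward characteristic through $(x_0,t_0)$, and assume that this is the only singularity present, in the sense specified in the context. Then, for $t>t_0$ sufficiently close to $t_0$: - The conservative solution $u^{cons}(\cdot,t)$ has two strong singularities at $x=\gamma^-(t)$ and $x=\gamma^+(t)$, where $|u^{cons}_x|\to\infty$, and is smooth at all other points. - The dissipative solution $u^{diss}(\cdot,t)$ has a strong singularity at $x=\gamma^-(t)$, where $|u^{diss}_x|\to\infty$, and a weak singularity along the forward characteristic $x=\tilde\gamma(t)$, where $u^{diss}_x$ is continuous but the second derivative $u^{diss}_{xx}$ does not exist. - The difference between these two solutions can be estimated as $$\big\|u^{cons}(\cdot,t)-u^{diss}(\cdot,t)\big\|_{C^0(\mathbb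 R)}=\mathcal O(1)\cdot(t-t_0).$$
   Context: **Assumption (A).** $c:\mathbb R\to\mathbb R_+$ is smooth and uniformly positive, $c'(u)/c(u)$ is uniformly bounded, and $c'(u)=0$ implies $c''(u)\neq0$. **Semilinear systems.** Unknowns $(u,w,z,p,q,x,t)$ are functions of $(X,Y)$, with $c=c(u)$, $c'=c'(u)$: $$u_X=\frac{\sin w}{4c}p,\qquad u_Y=\frac{\sin z}{4c}q,$$ $$w_Y=\theta\,\frac{c'}{8c^2}(\cos z-\cos w)\,q,\qquad z_X=\theta\,\frac{c'}{8c^2}(\cos w-\cos z)\,p,$$ $$p_Y=\theta\,\frac{c'}{8c^2}(\sin z-\sin w)\,pq,\qquad q_X=\theta\,\frac{c'}{8c^2}(\sin w-\sin z)\,pq,$$ $$x_X=\frac{(1+\cos w)p}{4},\qquad x_Y=-\frac{(1+\cos z)q}{4},\qquad t_X=\frac{(1+\cos w)p}{4c},\qquad t_Y=\frac{(1+\cos z)q}{4c}.$$ *Conservative case:* $\theta\equiv1$ (with $w,z$ regarded modulo $2\pi$). *Dissipative case:* $\theta=1$ if $\max\{w,z\}<\pi$ and $\theta=0$ if $\max\{w,z\}\ge\pi$ (with $w,z$ real-valued; the components of this solution are Lipschitz continuous and the system is considered on $\{X+Y\ge0\}$). **Boundary data (both cases).** Put $R(s,0)=u_1(s)+c(u_0(s))u_0'(s)$ and $S(s,0)=u_1(s)-c(u_0(s))u_0'(s)$. At the point $(X,Y)=(s,-s)$ one prescribes $$u=u_0(s),\quad t=0,\quad x=s,\quad w=2\arctan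 R(s,0),\quad z=2\arctan S(s,0),\quad p=1+R^2(s,0),\quad q=1+S^2(s,0).$$ In each case the set of points $(x(X,Y),t(X,Y),u(X,Y))$ is the graph of a function of $(x,t)$, for $t\ge 0$: this is $u^{cons}(x,t)$ (resp. $u^{diss}(x,t)$), the conservative (resp. dissipative) solution of the Cauchy problem $u(x,0)=u_0(x)$, $u_t(x,0)=u_1(x)$. Dissipative solutions are characterized by the property that $R=u_t+c(u)u_x$ and $S=u_t-c(u)u_x$ are bounded below on compact subsets of $\{t>0\}$. **Curves.** Let $\Lambda(X,Y)=(x(X,Y),t(X,Y))$. For the conservative solution, near $P$ the level set $\{w=\pi\}$ is a curve $Y=Y_0+\kappa(X-X_0)^2+\mathcal O(1)|X-X_0|^3$; the images under the conservative map $\Lambda$ of its branches $X<X_0$ and $X>X_0$ are the singular curves $x=\gamma^-(t)$ and $x=\gamma^+(t)$, $t>t_0$, respectively. The forward characteristic $\tilde\gamma$ through $(x_0,t_0)$ is the image under $\Lambda$ of the half-line $\{Y=Y_0,\ X\ge X_0\}$, a curve $x=\tilde\gamma(t)$, $t\ge t_0$, with $\dot{\tilde\gamma}=c(u)$ (the same for the two solutions). **Only singularity present.** There is $\delta>0$ such that, at points $(X,Y)$ with $0\le t(X,Y)\le t_0+\delta$, the conservative solution has $w=\pi$ or $z=\pi$ only at $P$ and along the two branches $X<X_0$ and $X>X_0$, issuing from $P$, of the curve $\{w=\pi\}$ given near $P$ by $Y=Y_0+\kappa(X-X_0)^2+\mathcal O(1)|X-X_0|^3$ (the branches whose images under the conservative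 map $\Lambda$ are $\gamma^-$ and $\gamma^+$). In this setting the conservative and the dissipative solution coincide for $0\le t\le t_0$, and for $t>t_0$ (close to $t_0$) they coincide outside the set $\Omega=\{(x,t): t\ge t_0,\ \gamma^-(t)\le x\le\tilde\gamma(t)\}$. **Notation.** $|u_x|\to\infty$ at $x=\gamma(t)$ means $|u_x(x,t)|\to\infty$ as $x\to\gamma(t)$. $\mathcal O(1)$ denotes a quantity that remains bounded as $t\downarrow t_0$. *)

theory Defs
  imports "HOL-Analysis.Analysis" "HOL-Library.Landau_Symbols"
begin

text \<open>\<^term>\<open>S\<close> is meant to be open. In finite dimension, \<open>n + 1\<close> times continuously
  differentiable means differentiable with all directional derivatives \<open>n\<close> times continuously
  differentiable.\<close>

primrec Ck_on :: "nat \<Rightarrow> 'a::euclidean_space set \<Rightarrow> ('a \<Rightarrow> real) \<Rightarrow> bool" where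
  "Ck_on 0 S f \<longleftrightarrow> continuous_on S f"
| "Ck_on (Suc n) S f \<longleftrightarrow>
     (\<exists>f'. (\<forall>x\<in>S. (f has_derivative f' x) (at x)) \<and> (\<forall>v. Ck_on n S (\<lambda>x. f' x v)))"

definition smooth_on :: "'a::euclidean_space set \<Rightarrow> ('a \<Rightarrow> real) \<Rightarrow> bool" where
  "smooth_on S f \<longleftrightarrow> (\<forall>n. Ck_on n S f)"


definition assumption_A :: "(real \<Rightarrow> real) \<Rightarrow> bool" where
  "assumption_A c \<longleftrightarrow>
     smooth_on UNIV c \<and>
     (\<exists>c0>0. \<forall>v. c0 \<le> c v) \<and>
     bounded (range (\<lambda>v. deriv c v / c v)) \<and>
     (\<forall>v. deriv c v = 0 \<longrightarrow> deriv (deriv c) v \<noteq> 0)"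

text \<open>For a smooth function the weak derivative is the classical one, so membership in the Sobolev space of
  order one reduces to square integrability.\<close>

definition smooth_H1_L2_data :: "(real \<Rightarrow> real) \<Rightarrow> (real \<Rightarrow> real) \<Rightarrow> bool" where
  "smooth_H1_L2_data u0 u1 \<longleftrightarrow>
     smooth_on UNIV u0 \<and> smooth_on UNIV u1 \<and>
     integrable lborel (\<lambda>s. (u0 s)\<^sup>2) \<and>
     integrable lborel (\<lambda>s. (deriv u0 s)\<^sup>2) \<and>
     integrable lborel (\<lambda>s. (u1 s)\<^sup>2)"


text \<open>The unknowns of the semilinear systems, as functions of the characteristic coordinates
  \<open>X\<close> and \<open>Y\<close>.\<close>

record char_vars =
  cu :: "real \<Rightarrow> real \<Rightarrow> real"
  cw :: "real \<Rightarrow> real \<Rightarrow> real"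
  cz :: "real \<Rightarrow> real \<Rightarrow> real"
  cp :: "real \<Rightarrow> real \<Rightarrow> real"
  cq :: "real \<Rightarrow> real \<Rightarrow> real"
  cx :: "real \<Rightarrow> real \<Rightarrow> real"
  ct :: "real \<Rightarrow> real \<Rightarrow> real"

definition has_dX :: "(real \<Rightarrow> real \<Rightarrow> real) \<Rightarrow> real \<Rightarrow> real \<Rightarrow> real \<Rightarrow> bool" where
  "has_dX f d X Y \<longleftrightarrow> ((\<lambda>X'. f X' Y) has_real_derivative d) (at X)"

definition has_dY :: "(real \<Rightarrow> real \<Rightarrow> real) \<Rightarrow> real \<Rightarrow> real \<Rightarrow> real \<Rightarrow> bool" where
  "has_dY f d X Y \<longleftrightarrow> ((\<lambda>Y'. f X Y') has_real_derivative d) (at Y)"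

definition dX :: "(real \<Rightarrow> real \<Rightarrow> real) \<Rightarrow> real \<Rightarrow> real \<Rightarrow> real" where
  "dX f X Y = deriv (\<lambda>X'. f X' Y) X"

definition dY :: "(real \<Rightarrow> real \<Rightarrow> real) \<Rightarrow> real \<Rightarrow> real \<Rightarrow> real" where
  "dY f X Y = deriv (\<lambda>Y'. f X Y') Y"

definition semilinear_system_at ::
    "(real \<Rightarrow> real) \<Rightarrow> real \<Rightarrow> char_vars \<Rightarrow> real \<Rightarrow> real \<Rightarrow> bool" where
  "semilinear_system_at c \<theta> \<sigma> X Y \<longleftrightarrow>
     (let u = cu \<sigma> X Y; w = cw \<sigma> X Y; z = cz \<sigma> X Y; p = cp \<sigma> X Y; q = cq \<sigma> X Y;
          k = deriv c u / (8 * (c u)\<^sup>2)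
      in has_dX (cu \<sigma>) (sin w / (4 * c u) * p) X Y \<and>
         has_dY (cu \<sigma>) (sin z / (4 * c u) * q) X Y \<and>
         has_dY (cw \<sigma>) (\<theta> * k * (cos z - cos w) * q) X Y \<and>
         has_dX (cz \<sigma>) (\<theta> * k * (cos w - cos z) * p) X Y \<and>
         has_dY (cp \<sigma>) (\<theta> * k * (sin z - sin w) * p * q) X Y \<and>
         has_dX (cq \<sigma>) (\<theta> * k * (sin w - sin z) * p * q) X Y \<and>
         has_dX (cx \<sigma>) ((1 + cos w) * p / 4) X Y \<and>
         has_dY (cx \<sigma>) (- ((1 + cos z) * q / 4)) X Y \<and>
         has_dX (ct \<sigma>) ((1 + cos w) * p / (4 * c u)) X Y \<and>
         has_dY (ct \<sigma>) ((1 + cos z) * q / (4 * c u)) X Y)"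

definition boundary_data ::
    "(real \<Rightarrow> real) \<Rightarrow> (real \<Rightarrow> real) \<Rightarrow> (real \<Rightarrow> real) \<Rightarrow> char_vars \<Rightarrow> bool" where
  "boundary_data c u0 u1 \<sigma> \<longleftrightarrow>
     (\<forall>s. let R = u1 s + c (u0 s) * deriv u0 s; S = u1 s - c (u0 s) * deriv u0 s
          in cu \<sigma> s (-s) = u0 s \<and> ct \<sigma> s (-s) = 0 \<and> cx \<sigma> s (-s) = s \<and>
             cw \<sigma> s (-s) = 2 * arctan R \<and> cz \<sigma> s (-s) = 2 * arctan S \<and>
             cp \<sigma> s (-s) = 1 + R\<^sup>2 \<and> cq \<sigma> s (-s) = 1 + S\<^sup>2)"

text \<open>The angles \<open>w\<close> and \<open>z\<close> of the conservative solution live on the circle; they are represented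
  by their real-valued continuous lifts starting from the boundary data, so that ``\<open>w = \<pi>\<close>'' becomes
  membership in the class of \<open>\<pi>\<close>.\<close>

definition eq_pi_mod :: "real \<Rightarrow> bool" where
  "eq_pi_mod a \<longleftrightarrow> (\<exists>k::int. a = pi + 2 * pi * of_int k)"

definition conservative_vars ::
    "(real \<Rightarrow> real) \<Rightarrow> (real \<Rightarrow> real) \<Rightarrow> (real \<Rightarrow> real) \<Rightarrow> char_vars \<Rightarrow> bool" where
  "conservative_vars c u0 u1 \<sigma> \<longleftrightarrow>
     (\<forall>f\<in>{cu \<sigma>, cw \<sigma>, cz \<sigma>, cp \<sigma>, cq \<sigma>, cx \<sigma>, ct \<sigma>}. smooth_on UNIV (\<lambda>(X, Y). f X Y)) \<and>
     (\<forall>X Y. semilinear_system_at c 1 \<sigma> X Y) \<and>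
     boundary_data c u0 u1 \<sigma>"

definition half_plane :: "(real \<times> real) set" where
  "half_plane = {(X, Y). 0 \<le> X + Y}"

definition loc_lipschitz_X :: "(real \<Rightarrow> real \<Rightarrow> real) \<Rightarrow> bool" where
  "loc_lipschitz_X f \<longleftrightarrow>
     (\<forall>r. \<exists>L. \<forall>Y\<in>{-r..r}. L-lipschitz_on {X \<in> {-r..r}. (X, Y) \<in> half_plane} (\<lambda>X. f X Y))"

definition loc_lipschitz_Y :: "(real \<Rightarrow> real \<Rightarrow> real) \<Rightarrow> bool" where
  "loc_lipschitz_Y f \<longleftrightarrow>
     (\<forall>r. \<exists>L. \<forall>X\<in>{-r..r}. L-lipschitz_on {Y \<in> {-r..r}. (X, Y) \<in> half_plane} (\<lambda>Y. f X Y))"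

definition dissipative_theta :: "char_vars \<Rightarrow> real \<Rightarrow> real \<Rightarrow> real" where
  "dissipative_theta \<sigma> X Y = (if max (cw \<sigma> X Y) (cz \<sigma> X Y) < pi then 1 else 0)"

text \<open>Since \<open>\<theta>\<close> is discontinuous, the equations hold almost everywhere. Lipschitz continuity is
  required in every variable in which the system prescribes the derivative, together with joint
  continuity: joint Lipschitz continuity of \<open>w\<close>, \<open>z\<close>, \<open>p\<close>, \<open>q\<close> would be too much, because behind
  a point where a singularity forms \<open>z\<close> has a square-root behaviour in \<open>Y\<close>.\<close>

definition dissipative_vars ::
    "(real \<Rightarrow> real) \<Rightarrow> (real \<Rightarrow> real) \<Rightarrow> (real \<Rightarrow> real) \<Rightarrow> char_vars \<Rightarrow> bool" where
  "dissipative_vars c u0 u1 \<sigma> \<longleftrightarrow>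
     (\<forall>f\<in>{cu \<sigma>, cw \<sigma>, cz \<sigma>, cp \<sigma>, cq \<sigma>, cx \<sigma>, ct \<sigma>}. continuous_on half_plane (\<lambda>(X, Y). f X Y)) \<and>
     (\<forall>f\<in>{cu \<sigma>, cx \<sigma>, ct \<sigma>, cz \<sigma>, cq \<sigma>}. loc_lipschitz_X f) \<and>
     (\<forall>f\<in>{cu \<sigma>, cx \<sigma>, ct \<sigma>, cw \<sigma>, cp \<sigma>}. loc_lipschitz_Y f) \<and>
     (AE (X, Y) in lborel. 0 < X + Y \<longrightarrow>
        semilinear_system_at c (dissipative_theta \<sigma> X Y) \<sigma> X Y) \<and>
     boundary_data c u0 u1 \<sigma>"

definition is_graph_of :: "(real \<Rightarrow> real \<Rightarrow> real) \<Rightarrow> char_vars \<Rightarrow> bool" where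
  "is_graph_of U \<sigma> \<longleftrightarrow>
     {(cx \<sigma> X Y, ct \<sigma> X Y, cu \<sigma> X Y) | X Y. (X, Y) \<in> half_plane} = {(x, t, U x t) | x t. 0 \<le> t}"

text \<open>The parameter \<^term>\<open>\<sigma>\<close> makes the variables from which a solution \<^term>\<open>U\<close> is constructed
  available to the notions below.\<close>

definition conservative_solution ::
    "(real \<Rightarrow> real) \<Rightarrow> (real \<Rightarrow> real) \<Rightarrow> (real \<Rightarrow> real) \<Rightarrow> char_vars \<Rightarrow> (real \<Rightarrow> real \<Rightarrow> real) \<Rightarrow> bool" where
  "conservative_solution c u0 u1 \<sigma> U \<longleftrightarrow> conservative_vars c u0 u1 \<sigma> \<and> is_graph_of U \<sigma>"

definition dissipative_solution ::
    "(real \<Rightarrow> real) \<Rightarrow> (real \<Rightarrow> real) \<Rightarrow> (real \<Rightarrow> real) \<Rightarrow> (real \<Rightarrow> real \<Rightarrow> real) \<Rightarrow> bool" where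
  "dissipative_solution c u0 u1 U \<longleftrightarrow> (\<exists>\<sigma>. dissipative_vars c u0 u1 \<sigma> \<and> is_graph_of U \<sigma>)"


definition type2_origin_point :: "char_vars \<Rightarrow> real \<Rightarrow> real \<Rightarrow> real \<Rightarrow> bool" where
  "type2_origin_point \<sigma> X0 Y0 \<kappa> \<longleftrightarrow>
     eq_pi_mod (cw \<sigma> X0 Y0) \<and> \<not> eq_pi_mod (cz \<sigma> X0 Y0) \<and>
     dX (cw \<sigma>) X0 Y0 = 0 \<and> dX (dX (cw \<sigma>)) X0 Y0 \<noteq> 0 \<and>
     \<kappa> = - (dX (dX (cw \<sigma>)) X0 Y0 / (2 * dY (cw \<sigma>) X0 Y0)) \<and> 0 < \<kappa>"

definition level_curve ::
    "char_vars \<Rightarrow> real \<Rightarrow> real \<Rightarrow> real \<Rightarrow> real \<Rightarrow> (real \<Rightarrow> real) \<Rightarrow> bool" where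
  "level_curve \<sigma> X0 Y0 \<kappa> \<epsilon> \<psi> \<longleftrightarrow>
     0 < \<epsilon> \<and> continuous_on {X0-\<epsilon><..<X0+\<epsilon>} \<psi> \<and> \<psi> X0 = Y0 \<and>
     (\<forall>X\<in>{X0-\<epsilon><..<X0+\<epsilon>}. eq_pi_mod (cw \<sigma> X (\<psi> X))) \<and>
     (\<forall>\<^sub>F (X, Y) in nhds (X0, Y0). eq_pi_mod (cw \<sigma> X Y) \<longleftrightarrow> Y = \<psi> X) \<and>
     (\<lambda>X. \<psi> X - (Y0 + \<kappa> * (X - X0)\<^sup>2)) \<in> O[at X0](\<lambda>X. \<bar>X - X0\<bar> ^ 3)"

text \<open>The image under \<open>\<Lambda> = (x, t)\<close> of the part of a branch \<^term>\<open>B\<close> lying in \<open>t \<le> t0 + \<delta>\<close> is the curve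
  \<open>x = \<gamma>(t)\<close>, \<open>t0 < t \<le> t0 + \<delta>\<close>.\<close>

definition branch_image ::
    "char_vars \<Rightarrow> (real \<times> real) set \<Rightarrow> real \<Rightarrow> real \<Rightarrow> (real \<Rightarrow> real) \<Rightarrow> bool" where
  "branch_image \<sigma> B t0 \<delta> \<gamma> \<longleftrightarrow>
     {(cx \<sigma> X Y, ct \<sigma> X Y) | X Y. (X, Y) \<in> B \<and> ct \<sigma> X Y \<le> t0 + \<delta>} = {(\<gamma> t, t) | t. t \<in> {t0<..t0+\<delta>}}"

definition only_singularity ::
    "char_vars \<Rightarrow> real \<Rightarrow> real \<Rightarrow> real \<Rightarrow> (real \<Rightarrow> real) \<Rightarrow> (real \<Rightarrow> real) \<Rightarrow> bool" where
  "only_singularity \<sigma> X0 Y0 \<kappa> \<gamma>m \<gamma>p \<longleftrightarrow>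
     (\<exists>\<delta> \<epsilon> \<psi>. 0 < \<delta> \<and> level_curve \<sigma> X0 Y0 \<kappa> \<epsilon> \<psi> \<and>
        (let t0 = ct \<sigma> X0 Y0;
             Bm = {(X, \<psi> X) | X. X \<in> {X0-\<epsilon><..<X0}};
             Bp = {(X, \<psi> X) | X. X \<in> {X0<..<X0+\<epsilon>}}
         in branch_image \<sigma> Bm t0 \<delta> \<gamma>m \<and> branch_image \<sigma> Bp t0 \<delta> \<gamma>p \<and>
            (\<forall>t\<in>{t0<..t0+\<delta>}. \<gamma>m t < \<gamma>p t) \<and>
            (\<forall>X Y. 0 \<le> ct \<sigma> X Y \<and> ct \<sigma> X Y \<le> t0 + \<delta> \<and> (eq_pi_mod (cw \<sigma> X Y) \<or> eq_pi_mod (cz \<sigma> X Y))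
               \<longrightarrow> (X, Y) \<in> {(X0, Y0)} \<union> Bm \<union> Bp)))"

definition forward_characteristic :: "char_vars \<Rightarrow> real \<Rightarrow> real \<Rightarrow> (real \<Rightarrow> real) \<Rightarrow> bool" where
  "forward_characteristic \<sigma> X0 Y0 \<gamma> \<longleftrightarrow>
     {(cx \<sigma> X Y0, ct \<sigma> X Y0) | X. X0 \<le> X} = {(\<gamma> t, t) | t. ct \<sigma> X0 Y0 \<le> t}"


text \<open>Differentiability is stated explicitly because \<^const>\<open>deriv\<close> is total.\<close>

definition strong_singularity :: "(real \<Rightarrow> real) \<Rightarrow> real \<Rightarrow> bool" where
  "strong_singularity f a \<longleftrightarrow>
     (\<forall>\<^sub>F x in at a. f differentiable (at x)) \<and> filterlim (\<lambda>x. \<bar>deriv f x\<bar>) at_top (at a)"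

definition weak_singularity :: "(real \<Rightarrow> real) \<Rightarrow> real \<Rightarrow> bool" where
  "weak_singularity f a \<longleftrightarrow>
     (\<forall>\<^sub>F x in nhds a. f differentiable (at x)) \<and> isCont (deriv f) a \<and>
     \<not> (deriv f) differentiable (at a)"

end

theory Submission
  imports Defs
begin

text \<open>Write \<open>cv\<close> and \<open>dv\<close> for the variables of the conservative and of the dissipative solution, regarded as
functions of the characteristic coordinates. The systems differ only through the factor \<open>\<theta>\<close>, so both are
studied in one framework: \<open>u\<close>, \<open>x\<close>, \<open>t\<close> are continuously differentiable, because their equations do not
contain \<open>\<theta>\<close>; \<open>p\<close> and \<open>q\<close> are positive; \<open>x\<close> and \<open>t\<close> are monotone along characteristics; hence the map to the
\<open>(x, t)\<close> plane is locally invertible wherever neither angle is \<open>\<pi>\<close>, and there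
\<open>u_x = (tan (w/2) - tan (z/2)) / (2 c)\<close>. By uniqueness the two solutions agree at every point whose past
contains no singular point.

At the point \<open>P\<close> one has \<open>w_Y > 0\<close> and \<open>w_XX < 0\<close>, so \<open>{w = \<pi>}\<close> is a convex curve with vertex \<open>P\<close>. For the
conservative solution the blow up on both branches is read off from the formula for \<open>u_x\<close>
(\<open>conservative_conclusion\<close>). For the dissipative solution \<open>w\<close> stops as soon as it reaches \<open>\<pi>\<close>. The contact set
\<open>{w = \<pi>}\<close> meets each line \<open>Y = const\<close> in an interval that starts on the left branch
(\<open>contact_slices_are_intervals\<close>); \<open>x\<close> and \<open>t\<close> are constant on such an interval, so the contact set is mapped
to the curve \<open>\<gamma>\<^sup>-\<close> alone, and \<open>u_x\<close> blows up there (\<open>dissipative_strong_singularity\<close>).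

The forward characteristic is the line \<open>Y = Y0\<close>. Just above it the contact interval has length of order
\<open>sqrt (Y - Y0)\<close>. On this interval the dissipative \<open>z\<close> is frozen while the conservative \<open>z\<close>, which is smooth,
decreases; so their difference is of order \<open>sqrt (Y - Y0)\<close> (\<open>z_gap\<close>). Since \<open>z\<close> can be recovered from \<open>u_x\<close>, the
derivative \<open>u_x\<close> is continuous across the characteristic, but not differentiable there
(\<open>weak_singularity_on_forward_characteristic\<close>).

For the distance, both preimages of a point \<open>(x, t)\<close> are compared with points of the line \<open>Y = Y0\<close>, at the
cost of an error \<open>O(t - t0)\<close> in \<open>u\<close>. Let \<open>d\<close> be the difference of \<open>u\<close> at the two points of the line. The
function \<open>x + k t\<close>, with \<open>k\<close> the wave speed at one of them, differs at the two points by
\<open>O((t - t0) (d + t - t0))\<close>. On the line, with \<open>h = X - X0\<close>, this function grows at a rate at least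
proportional to \<open>h\<^sup>4\<close>, whereas \<open>u\<close> changes at a rate of at most \<open>O(h\<^sup>2)\<close>; so \<open>d\<^sup>2\<close> is bounded by a multiple of \<open>(t - t0) (d + t - t0)\<close>, which gives
\<open>d = O(t - t0)\<close> (\<open>solutions_close\<close>).\<close>

section \<open>Differential inequalities almost everywhere\<close>

text \<open>Lipschitz functions map null sets to null sets. If the increment were too large, then, for a slightly larger slope \<open>M'\<close>, the function \<open>f x - M' x\<close> would take every value of some interval for a last time at a point where the bound on the derivative fails; but these points form a null set.\<close>

lemma lipschitz_AE_deriv_le:
  fixes f :: "real => real"
  assumes ab: "a <= b"
    and lip: "L-lipschitz_on {a..b} f"
    and ae: "AE x in lborel. a < x \<and> x < b --> (\<exists>d. (f has_real_derivative d) (at x) \<and> d <= M)"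
  shows "f b - f a <= M * (b - a)"
proof (rule ccontr)
  assume "\<not> f b - f a <= M * (b - a)"
  then have gt: "f b - f a - M * (b - a) > 0" by simp
  with ab have ab': "a < b" by (cases "a = b") auto
  define e where "e = (f b - f a - M * (b - a)) / 2 / (b - a)"
  have e: "e > 0" using gt ab' by (simp add: e_def)
  define g where "g x = f x - (M + e) * x" for x
  have "b - a \<noteq> 0" using ab' by simp
  from nonzero_eq_divide_eq[THEN iffD1, OF this e_def]
  have "e * (b - a) = (f b - f a - M * (b - a)) / 2" .
  then have gdiff: "g b - g a = (f b - f a - M * (b - a)) / 2"
    by (simp add: g_def algebra_simps)
  then have gab: "g a < g b" using gt by simp
  have cf: "continuous_on {a..b} f" using lip by (rule lipschitz_on_continuous_on)
  have cg: "continuous_on {a..b} g" unfolding g_def by (intro continuous_intros cf)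
  obtain N where N: "N \<in> null_sets lborel"
    and Nsub: "{x. \<not> (a < x \<and> x < b --> (\<exists>d. (f has_real_derivative d) (at x) \<and> d <= M))} \<subseteq> N"
    using ae by (auto simp: eventually_ae_filter)
  define N' where "N' = N \<inter> {a..b}"
  have "negligible N"
    using N by (simp add: negligible_iff_null_sets null_sets_completionI)
  then have negN: "negligible N'" unfolding N'_def by (meson inf_le1 negligible_subset)
  have lipg: "\<bar>g y - g x\<bar> <= (L + \<bar>M + e\<bar>) * \<bar>y - x\<bar>" if "x \<in> {a..b}" "y \<in> {a..b}" for x y
  proof -
    have "\<bar>f y - f x\<bar> <= L * \<bar>y - x\<bar>"
      using lipschitz_onD[OF lip that(2) that(1)] by (simp add: dist_real_def)
    moreover have "g y - g x = (f y - f x) - (M + e) * (y - x)" by (simp add: g_def algebra_simps)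
    moreover have "\<bar>(M + e) * (y - x)\<bar> = \<bar>M + e\<bar> * \<bar>y - x\<bar>" by (rule abs_mult)
    ultimately show ?thesis
      using abs_triangle_ineq4[of "f y - f x" "(M + e) * (y - x)"] by (simp add: distrib_right)
  qed
  have "negligible (g ` N')"
    using negN
  proof (rule negligible_locally_Lipschitz_image[rotated])
    fix x assume "x \<in> N'"
    then show "\<exists>T B. open T \<and> x \<in> T \<and> (\<forall>y\<in>N' \<inter> T. norm (g y - g x) <= B * norm (y - x))"
      by (intro exI[of _ UNIV] exI[of _ "L + \<bar>M + e\<bar>"]) (auto simp: N'_def intro!: lipg)
  qed simp
  moreover have "{g a<..<g b} \<subseteq> g ` N'"
  proof
    fix y assume y: "y \<in> {g a<..<g b}"
    define S where "S = {x \<in> {a..b}. g x <= y}"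
    have "compact S"
    proof -
      have "S = {a..b} \<inter> g -` {..y}" by (auto simp: S_def)
      then show ?thesis
        using continuous_closed_preimage[OF cg, of "{..y}"] by (metis closed_atLeastAtMost closed_atMost
           compact_Icc compact_Int_closed inf.right_idem inf_commute inf_left_idem)
    qed
    moreover have "a \<in> S" using y ab by (auto simp: S_def)
    ultimately obtain s where s: "s \<in> S" "\<And>x. x \<in> S ==> x <= s"
      using compact_attains_sup[of S] by blast
    have sb: "s < b" using s(1) y by (auto simp: S_def less_le)
    have after: "g x > y" if "s < x" "x <= b" for x
      using s(1) s(2)[of x] that by (force simp: S_def)
    have gs: "g s = y"
    proof (rule ccontr)
      assume "g s \<noteq> y"
      then have "g s < y" using s(1) by (simp add: S_def)
      moreover have "y <= g b" using y by simp
      moreover have "continuous_on {s..b} g" using cg s(1) by (auto simp: S_def intro: continuous_on_subset)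
      ultimately obtain x where "s <= x" "x <= b" "g x = y"
        using IVT'[of g s y b] sb by (auto simp: less_imp_le)
      with \<open>g s \<noteq> y\<close> after[of x] show False by (cases "x = s") auto
    qed
    have "a < s" using gs y s(1) by (auto simp: S_def less_le)
    have "s \<in> N"
    proof (rule ccontr)
      assume "s \<notin> N"
      then obtain d where d: "(f has_real_derivative d) (at s)" "d <= M"
        using Nsub \<open>a < s\<close> sb by auto
      have "(g has_real_derivative (d - (M + e))) (at s)"
        unfolding g_def by (auto intro!: derivative_eq_intros d)
      then obtain h where h: "h > 0" "\<And>k. 0 < k ==> k < h ==> g (s + k) < g s"
        using DERIV_neg_dec_right[of g "d - (M + e)" s] d e by auto
      define k where "k = min (h / 2) (b - s)"
      have "0 < k" "k < h" "s + k <= b" using h(1) sb by (auto simp: k_def)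
      then show False using h(2)[of k] after[of "s + k"] gs by simp
    qed
    then show "y \<in> g ` N'" using gs s(1) by (auto simp: N'_def S_def)
  qed
  ultimately have "negligible {g a<..<g b}" by (rule negligible_subset)
  then show False
    using gab open_not_negligible[of "{g a<..<g b}"] by auto
qed

text \<open>A function that cannot grow while its values lie in the strip between \<open>0\<close> and \<open>\<epsilon>\<close> cannot cross it. In this form the lemma shows that an angle whose derivative vanishes from \<open>\<pi>\<close> on does not exceed \<open>\<pi>\<close>.\<close>

lemma lipschitz_barrier:
  fixes g :: "real => real"
  assumes ab: "a <= b"
    and lip: "L-lipschitz_on {a..b} g"
    and ga: "g a <= 0" and eps: "0 < \<epsilon>"
    and ae: "AE x in lborel. a < x \<and> x < b \<and> 0 < g x \<and> g x < \<epsilon> -->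
               (\<exists>d. (g has_real_derivative d) (at x) \<and> d <= 0)"
  shows "g b <= 0"
proof (rule ccontr)
  assume "\<not> g b <= 0"
  define y where "y = min (g b) (\<epsilon> / 2)"
  have y: "0 < y" "y <= g b" "y < \<epsilon>" using \<open>\<not> g b <= 0\<close> eps by (auto simp: y_def)
  have cg: "continuous_on {a..b} g" using lip by (rule lipschitz_on_continuous_on)
  have cpre: "compact ({a..b} \<inter> g -` C)" if "closed C" for C
    using continuous_closed_preimage[OF cg closed_atLeastAtMost that]
    by (meson compact_Icc compact_eq_bounded_closed bounded_Int)
  obtain r where r: "r \<in> {a..b}" "y <= g r" "\<And>x. a <= x ==> x <= b ==> y <= g x ==> r <= x"
  proof -
    have "{a..b} \<inter> g -` {y..} \<noteq> {}" using y ab by auto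
    from compact_attains_inf[OF cpre[of "{y..}"] this] obtain r
      where r: "r \<in> {a..b} \<inter> g -` {y..}" "\<forall>x\<in>{a..b} \<inter> g -` {y..}. r <= x" by auto
    show thesis by (rule that[of r]) (use r in auto)
  qed
  have ar: "a <= r" "r <= b" using r by auto
  have cpre2: "compact ({a..r} \<inter> g -` {..0})"
  proof -
    have "{a..r} \<inter> g -` {..0} = {a..r} \<inter> ({a..b} \<inter> g -` {..0})" using ar by auto
    then show ?thesis using cpre[of "{..0}"] by (metis closed_atMost compact_Icc compact_Int)
  qed
  obtain s where s: "s \<in> {a..r}" "g s <= 0" "\<And>x. a <= x ==> x <= r ==> g x <= 0 ==> x <= s"
  proof -
    have "{a..r} \<inter> g -` {..0} \<noteq> {}" using ga ar by auto
    from compact_attains_sup[OF cpre2 this] obtain s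
      where s: "s \<in> {a..r} \<inter> g -` {..0}" "\<forall>x\<in>{a..r} \<inter> g -` {..0}. x <= s" by auto
    show thesis by (rule that[of s]) (use s in auto)
  qed
  have "g r - g s <= 0 * (r - s)"
  proof (rule lipschitz_AE_deriv_le)
    show "s <= r" using s by auto
    show "L-lipschitz_on {s..r} g"
      by (rule lipschitz_on_subset[OF lip]) (use s ar in auto)
    show "AE x in lborel. s < x \<and> x < r --> (\<exists>d. (g has_real_derivative d) (at x) \<and> d <= 0)"
      using ae
    proof eventually_elim
      case (elim x)
      show ?case
      proof
        assume x: "s < x \<and> x < r"
        have "0 < g x" using s(3)[of x] x s(1) by force
        moreover have "g x < y" using r(3)[of x] x s(1) ar by force
        ultimately show "\<exists>d. (g has_real_derivative d) (at x) \<and> d <= 0"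
          using elim x y s(1) ar by auto
      qed
    qed
  qed
  then show False using s(2) r(2) y by simp
qed

text \<open>On a short interval a quantity whose growth is controlled by its own size loses at most half of its initial size. This propagates lower bounds for differences of \<open>w\<close> and of \<open>z\<close>.\<close>

lemma lipschitz_gronwall_neg:
  fixes f :: "real => real"
  assumes ab: "a <= b" and lip: "L-lipschitz_on {a..b} f"
    and fa: "f a <= - K" and K: "0 < K" and C: "0 <= C" and D: "0 <= D"
    and small: "(C * K + D) * (b - a) <= K / 2"
    and ae: "AE x in lborel. a < x \<and> x < b -->
               (\<exists>d. (f has_real_derivative d) (at x) \<and> d <= C * \<bar>f x\<bar> + D)"
  shows "f b <= - K / 2"
proof -
  define g where "g x = f x + K - (C * K + D) * (x - a)" for x
  have nn: "0 <= C * K + D" using C K D by simp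
  have lg: "(L + (C * K + D))-lipschitz_on {a..b} g"
  proof (rule lipschitz_onI)
    fix x y assume xy: "x \<in> {a..b}" "y \<in> {a..b}"
    have "\<bar>f x - f y\<bar> <= L * \<bar>x - y\<bar>" using lipschitz_onD[OF lip xy] by (simp add: dist_real_def)
    moreover have "g x - g y = (f x - f y) - (C * K + D) * (x - y)" by (simp add: g_def algebra_simps)
    moreover have "\<bar>(C * K + D) * (x - y)\<bar> = (C * K + D) * \<bar>x - y\<bar>" using nn by (simp add: abs_mult)
    ultimately show "dist (g x) (g y) <= (L + (C * K + D)) * dist x y"
      using abs_triangle_ineq4[of "f x - f y" "(C * K + D) * (x - y)"]
      by (simp add: dist_real_def distrib_right)
  qed (use lipschitz_on_nonneg[OF lip] nn in simp)
  have "g b <= 0"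
  proof (rule lipschitz_barrier[OF ab lg])
    show "g a <= 0" using fa by (simp add: g_def)
    show "0 < K" by fact
    show "AE x in lborel. a < x \<and> x < b \<and> 0 < g x \<and> g x < K -->
        (\<exists>d. (g has_real_derivative d) (at x) \<and> d <= 0)"
      using ae
    proof eventually_elim
      case (elim x)
      show ?case
      proof
        assume x: "a < x \<and> x < b \<and> 0 < g x \<and> g x < K"
        then obtain d where d: "(f has_real_derivative d) (at x)" "d <= C * \<bar>f x\<bar> + D" using elim by auto
        have b1: "0 <= (C * K + D) * (x - a)" using nn x by simp
        have b2: "(C * K + D) * (x - a) <= K / 2"
          using small nn x by (meson order_trans mult_left_mono diff_right_mono less_imp_le)
        have "f x = g x - K + (C * K + D) * (x - a)" by (simp add: g_def)
        then have "\<bar>f x\<bar> <= K" using x b1 b2 K by (auto simp: abs_le_iff)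
        then have "C * \<bar>f x\<bar> <= C * K" using C by (rule mult_left_mono)
        then have "d - (C * K + D) <= 0" using d by simp
        moreover have "(g has_real_derivative (d - (C * K + D))) (at x)"
          unfolding g_def by (auto intro!: derivative_eq_intros d)
        ultimately show "\<exists>d. (g has_real_derivative d) (at x) \<and> d <= 0" by blast
      qed
    qed
  qed
  then show ?thesis using small by (simp add: g_def)
qed

section \<open>Calculus of continuously differentiable functions\<close>

lemma has_derivative_eq_deriv_times:
  assumes "(f has_derivative f') (at (x::real))"
  shows "(f has_real_derivative f' 1) (at x)" "f' v = v * (f' 1 :: real)"
proof -
  interpret bounded_linear f' using assms by (rule has_derivative_bounded_linear)
  have eq: "f' v = v * f' 1" for v
  proof -
    have "f' (v *\<^sub>R 1) = v *\<^sub>R f' 1" by (rule scaleR)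
    then show ?thesis by (simp only: real_scaleR_def mult_1_right)
  qed
  then show "f' v = v * (f' 1 :: real)" .
  have m: "f' = (*) (f' 1)" by (rule ext) (subst eq, rule mult.commute)
  show "(f has_real_derivative f' 1) (at x)"
    unfolding has_field_derivative_def
    by (rule subst[OF m, of "\<lambda>g. (f has_derivative g) (at x)"]) (rule assms)
qed

lemma differentiable_imp_DERIV_deriv:
  assumes "f differentiable (at (x::real))"
  shows "(f has_real_derivative deriv f x) (at x)"
proof -
  from assms obtain D where "(f has_derivative D) (at x)" unfolding differentiable_def by blast
  then have D: "(f has_real_derivative D 1) (at x)" by (rule has_derivative_eq_deriv_times(1))
  show ?thesis unfolding DERIV_imp_deriv[OF D] by (rule D)
qed

lemma Ck_on_SucI:
  assumes "\<And>x. x \<in> S ==> (f has_derivative f' x) (at x)" "\<And>v. Ck_on n S (\<lambda>x. f' x v)"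
  shows "Ck_on (Suc n) S f"
  unfolding Ck_on.simps using assms by blast

lemma Ck_on_SucE:
  assumes "Ck_on (Suc n) S f"
  obtains f' where "\<And>x. x \<in> S ==> (f has_derivative f' x) (at x)" "\<And>v. Ck_on n S (\<lambda>x. f' x v)"
  using assms unfolding Ck_on.simps by blast

lemma Ck_on_cong:
  assumes "open S" "\<And>x. x \<in> S ==> f x = g x"
  shows "Ck_on n S f \<longleftrightarrow> Ck_on n S g"
proof -
  have imp: "Ck_on n S g" if C: "Ck_on n S f" and eq: "\<And>x. x \<in> S ==> f x = g x" for f g
  proof (cases n)
    case 0
    then show ?thesis using C eq by (simp cong: continuous_on_cong)
  next
    case (Suc m)
    obtain f' where f': "\<And>x. x \<in> S ==> (f has_derivative f' x) (at x)" "\<And>v. Ck_on m S (\<lambda>x. f' x v)"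
      using C[unfolded Suc] by (rule Ck_on_SucE) blast
    have "(g has_derivative f' x) (at x)" if "x \<in> S" for x
      using has_derivative_transform_within_open[OF f'(1)[OF that] assms(1) that eq] .
    then show ?thesis unfolding Suc using f'(2) by (intro Ck_on_SucI) auto
  qed
  show ?thesis using imp[of f g] imp[of g f] assms(2) by auto
qed

lemma Ck_on_subset: "Ck_on n S f ==> T \<subseteq> S ==> Ck_on n T f"
proof (induction n arbitrary: f)
  case 0
  then show ?case by (auto intro: continuous_on_subset)
next
  case (Suc n)
  then obtain f' where f': "\<And>x. x \<in> S ==> (f has_derivative f' x) (at x)" "\<And>v. Ck_on n S (\<lambda>x. f' x v)"
    by auto
  show ?case by (rule Ck_on_SucI[of _ _ f']) (use f' Suc in auto)
qed

lemma Ck_on_imp_continuous_on: "Ck_on n S f ==> continuous_on S f"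
proof (cases n)
  case (Suc m)
  assume "Ck_on n S f"
  then obtain f' where f': "\<And>x. x \<in> S ==> (f has_derivative f' x) (at x)" using Suc by auto
  then show ?thesis
    by (auto intro!: continuous_at_imp_continuous_on has_derivative_continuous)
qed simp

lemma Ck_on_SucD: "Ck_on (Suc n) S f ==> Ck_on n S f"
proof (induction n arbitrary: f)
  case 0
  then show ?case using Ck_on_imp_continuous_on[of "Suc 0"] by simp
next
  case (Suc n)
  obtain f' where f': "\<And>x. x \<in> S ==> (f has_derivative f' x) (at x)" "\<And>v. Ck_on (Suc n) S (\<lambda>x. f' x v)"
    using Suc.prems by (rule Ck_on_SucE) blast
  show ?case by (rule Ck_on_SucI[of _ _ f']) (use f' Suc in auto)
qed

lemma Ck_on_const: "Ck_on n S (\<lambda>_. k)"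
proof (induction n arbitrary: k)
  case (Suc n)
  show ?case by (rule Ck_on_SucI[of _ _ "\<lambda>_ _. 0"]) (use Suc in auto)
qed simp

lemma Ck_on_add: "Ck_on n S f ==> Ck_on n S g ==> Ck_on n S (\<lambda>x. f x + g x)"
proof (induction n arbitrary: f g)
  case 0
  then show ?case by (auto intro: continuous_intros)
next
  case (Suc n)
  obtain f' where d: "\<And>x. x \<in> S ==> (f has_derivative f' x) (at x)" "\<And>v. Ck_on n S (\<lambda>x. f' x v)"
    using Suc.prems(1) by (rule Ck_on_SucE) blast
  obtain g' where e: "\<And>x. x \<in> S ==> (g has_derivative g' x) (at x)" "\<And>v. Ck_on n S (\<lambda>x. g' x v)"
    using Suc.prems(2) by (rule Ck_on_SucE) blast
  show ?case
    by (rule Ck_on_SucI[of _ _ "\<lambda>x v. f' x v + g' x v"]) (use d e Suc.IH in \<open>auto intro!: has_derivative_add\<close>)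
qed

lemma Ck_on_mult: "Ck_on n S f ==> Ck_on n S g ==> Ck_on n S (\<lambda>x. f x * g x)"
proof (induction n arbitrary: f g)
  case 0
  then show ?case by (auto intro: continuous_intros)
next
  case (Suc n)
  obtain f' where d: "\<And>x. x \<in> S ==> (f has_derivative f' x) (at x)" "\<And>v. Ck_on n S (\<lambda>x. f' x v)"
    using Suc.prems(1) by (rule Ck_on_SucE) blast
  obtain g' where e: "\<And>x. x \<in> S ==> (g has_derivative g' x) (at x)" "\<And>v. Ck_on n S (\<lambda>x. g' x v)"
    using Suc.prems(2) by (rule Ck_on_SucE) blast
  show ?case
  proof (rule Ck_on_SucI[of _ _ "\<lambda>x v. f x * g' x v + f' x v * g x"])
    show "((\<lambda>x. f x * g x) has_derivative (\<lambda>v. f x * g' x v + f' x v * g x)) (at x)" if "x \<in> S" for x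
      by (rule has_derivative_mult[OF d(1)[OF that] e(1)[OF that]])
    show "Ck_on n S (\<lambda>x. f x * g' x v + f' x v * g x)" for v
      using d(2) e(2) Ck_on_SucD[OF Suc.prems(1)] Ck_on_SucD[OF Suc.prems(2)] by (intro Ck_on_add Suc.IH) auto
  qed
qed

lemma Ck_on_uminus: "Ck_on n S f ==> Ck_on n S (\<lambda>x. - f x)"
  using Ck_on_mult[OF Ck_on_const[of n S "-1"], of f] by simp

lemma Ck_on_inverse:
  assumes "Ck_on n S f" "\<And>x. x \<in> S ==> f x \<noteq> 0"
  shows "Ck_on n S (\<lambda>x. inverse (f x))"
  using assms
proof (induction n arbitrary: f)
  case 0
  then show ?case by (auto intro!: continuous_on_inverse)
next
  case (Suc n)
  obtain f' where d: "\<And>x. x \<in> S ==> (f has_derivative f' x) (at x)" "\<And>v. Ck_on n S (\<lambda>x. f' x v)"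
    using Suc.prems(1) by (rule Ck_on_SucE) blast
  show ?case
  proof (rule Ck_on_SucI[of _ _ "\<lambda>x v. - (inverse (f x) * f' x v * inverse (f x))"])
    show "((\<lambda>x. inverse (f x)) has_derivative (\<lambda>v. - (inverse (f x) * f' x v * inverse (f x)))) (at x)" if "x \<in> S" for x
      by (rule Deriv.has_derivative_inverse[OF _ d(1)[OF that]]) (use that Suc.prems(2) in auto)
    show "Ck_on n S (\<lambda>x. - (inverse (f x) * f' x v * inverse (f x)))" for v
      using d(2) Ck_on_SucD[OF Suc.prems(1)] Suc.prems(2) by (intro Ck_on_uminus Ck_on_mult Suc.IH) auto
  qed
qed

lemma Ck_on_divide:
  "Ck_on n S f ==> Ck_on n S g ==> (\<And>x. x \<in> S ==> g x \<noteq> 0) ==> Ck_on n S (\<lambda>x. f x / g x)"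
  unfolding divide_inverse by (intro Ck_on_mult Ck_on_inverse)

text \<open>In one variable every directional derivative is a multiple of the ordinary derivative, so the recursion can be run with \<open>deriv\<close>.\<close>

lemma Ck_on_real_Suc_iff:
  fixes f :: "real => real"
  assumes "open S"
  shows "Ck_on (Suc n) S f \<longleftrightarrow> (\<forall>x\<in>S. f differentiable (at x)) \<and> Ck_on n S (deriv f)"
proof
  assume "Ck_on (Suc n) S f"
  then obtain f' where d: "\<And>x. x \<in> S ==> (f has_derivative f' x) (at x)" "\<And>v. Ck_on n S (\<lambda>x. f' x v)"
    by (rule Ck_on_SucE) blast
  have "deriv f x = f' x 1" if "x \<in> S" for x
    using has_derivative_eq_deriv_times(1)[OF d(1)[OF that]] by (rule DERIV_imp_deriv)
  then have "Ck_on n S (deriv f)" using d(2)[of 1] Ck_on_cong[OF assms, of "deriv f" "\<lambda>x. f' x 1"] by auto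
  moreover have "\<forall>x\<in>S. f differentiable (at x)" unfolding differentiable_def using d(1) by blast
  ultimately show "(\<forall>x\<in>S. f differentiable (at x)) \<and> Ck_on n S (deriv f)" by blast
next
  assume a: "(\<forall>x\<in>S. f differentiable (at x)) \<and> Ck_on n S (deriv f)"
  show "Ck_on (Suc n) S f"
  proof (rule Ck_on_SucI[of _ _ "\<lambda>x v. v * deriv f x"])
    show "(f has_derivative (\<lambda>v. v * deriv f x)) (at x)" if "x \<in> S" for x
    proof -
      have "(f has_real_derivative deriv f x) (at x)"
        using a \<open>x \<in> S\<close> by (intro differentiable_imp_DERIV_deriv) blast
      moreover have "(*) (deriv f x) = (\<lambda>v. v * deriv f x)" by (simp add: fun_eq_iff mult.commute)
      ultimately show ?thesis by (simp add: has_field_derivative_def)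
    qed
    show "Ck_on n S (\<lambda>x. v * deriv f x)" for v using a by (intro Ck_on_mult Ck_on_const) auto
  qed
qed

lemma smooth_on_real_deriv:
  fixes \<phi> :: "real => real"
  assumes "smooth_on UNIV \<phi>"
  shows "(\<phi> has_real_derivative deriv \<phi> x) (at x)" "smooth_on UNIV (deriv \<phi>)"
proof -
  have C: "Ck_on n UNIV \<phi>" for n by (rule smooth_on_def[THEN iffD1, THEN spec, OF assms])
  have iff: "(\<forall>x\<in>UNIV. \<phi> differentiable (at x)) \<and> Ck_on n UNIV (deriv \<phi>)" for n
    by (rule Ck_on_real_Suc_iff[OF open_UNIV, THEN iffD1, OF C])
  show "smooth_on UNIV (deriv \<phi>)" unfolding smooth_on_def by (intro allI conjunct2[OF iff])
  have "\<phi> differentiable (at x)" by (rule bspec[OF conjunct1[OF iff] UNIV_I])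
  then show "(\<phi> has_real_derivative deriv \<phi> x) (at x)" by (rule differentiable_imp_DERIV_deriv)
qed

lemma Ck_on_compose:
  fixes \<phi> :: "real => real"
  assumes "smooth_on UNIV \<phi>" "Ck_on n S f"
  shows "Ck_on n S (\<lambda>x. \<phi> (f x))"
  using assms
proof (induction n arbitrary: f \<phi>)
  case 0
  have "Ck_on 0 UNIV \<phi>" by (rule smooth_on_def[THEN iffD1, THEN spec, OF 0(1)])
  then have "continuous_on UNIV \<phi>" by simp
  moreover have "continuous_on S f" using 0(2) by simp
  ultimately have "continuous_on S (\<lambda>x. \<phi> (f x))" by (rule continuous_on_compose2) simp
  then show ?case by simp
next
  case (Suc n)
  obtain f' where d: "\<And>x. x \<in> S ==> (f has_derivative f' x) (at x)" "\<And>v. Ck_on n S (\<lambda>x. f' x v)"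
    using Suc.prems(2) by (rule Ck_on_SucE) blast
  note \<phi> = smooth_on_real_deriv[OF Suc.prems(1)]
  show ?case
  proof (rule Ck_on_SucI[of _ _ "\<lambda>x v. deriv \<phi> (f x) * f' x v"])
    show "((\<lambda>x. \<phi> (f x)) has_derivative (\<lambda>v. deriv \<phi> (f x) * f' x v)) (at x)" if "x \<in> S" for x
      using has_derivative_compose[OF d(1)[OF that] \<phi>(1)[of "f x", unfolded has_field_derivative_def]] .
    show "Ck_on n S (\<lambda>x. deriv \<phi> (f x) * f' x v)" for v
      using d(2) Ck_on_SucD[OF Suc.prems(2)] by (intro Ck_on_mult Suc.IH[OF \<phi>(2)])
  qed
qed

lemma smooth_on_sin_cos: "smooth_on UNIV (sin :: real => real)" "smooth_on UNIV (cos :: real => real)"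
proof -
  have "Ck_on n UNIV (sin :: real => real) \<and> Ck_on n UNIV (cos :: real => real)" for n
  proof (induction n)
    case 0
    show ?case by (auto intro: continuous_intros)
  next
    case (Suc n)
    have ds: "deriv sin = (cos :: real => real)" "deriv cos = (\<lambda>x. - sin x :: real)"
      by (rule ext, rule DERIV_imp_deriv, auto intro!: derivative_eq_intros)+
    have di: "sin differentiable (at x)" "cos differentiable (at x)" for x :: real
      using DERIV_sin[of x] DERIV_cos[of x] real_differentiable_def by blast+
    show ?case
      unfolding Ck_on_real_Suc_iff[OF open_UNIV] ds using Suc Ck_on_uminus[of n UNIV sin] di by blast
  qed
  then show "smooth_on UNIV (sin :: real => real)" "smooth_on UNIV (cos :: real => real)"
    unfolding smooth_on_def by blast+
qed

lemma smooth_on_partials: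
  fixes F :: "real => real => real"
  assumes "smooth_on UNIV (\<lambda>(X, Y). F X Y)"
  shows "has_dX F (dX F X Y) X Y" "has_dY F (dY F X Y) X Y"
    "((\<lambda>(X, Y). F X Y) has_derivative (\<lambda>(h, k). h * dX F X Y + k * dY F X Y)) (at (X, Y))"
    "smooth_on UNIV (\<lambda>(X, Y). dX F X Y)" "smooth_on UNIV (\<lambda>(X, Y). dY F X Y)"
proof -
  have *: "has_dX F (F' (1, 0)) X Y \<and> has_dY F (F' (0, 1)) X Y \<and> (\<forall>h k. F' (h, k) = h * F' (1,0) + k * F' (0,1))"
    if "((\<lambda>(X, Y). F X Y) has_derivative F') (at (X, Y))" for F' X Y
  proof -
    interpret bounded_linear F' using that by (rule has_derivative_bounded_linear)
    have lin: "F' (h, k) = h * F' (1,0) + k * F' (0,1)" for h k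
    proof -
      have "F' (h, k) = F' (h *\<^sub>R (1,0) + k *\<^sub>R (0,1))" by simp
      then show ?thesis by (simp only: add scaleR real_scaleR_def)
    qed
    have "((\<lambda>X'. (X', Y)) has_derivative (\<lambda>h. (h, 0))) (at X)"
      by (intro has_derivative_Pair has_derivative_ident has_derivative_const)
    from has_derivative_compose[OF this that]
    have 1: "((\<lambda>X'. F X' Y) has_derivative (\<lambda>h. F' (h, 0))) (at X)" by simp
    have "((\<lambda>Y'. (X, Y')) has_derivative (\<lambda>h. (0, h))) (at Y)"
      by (intro has_derivative_Pair has_derivative_ident has_derivative_const)
    from has_derivative_compose[OF this that]
    have 2: "((\<lambda>Y'. F X Y') has_derivative (\<lambda>h. F' (0, h))) (at Y)" by simp
    show ?thesis unfolding has_dX_def has_dY_def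
      by (intro conjI allI lin has_derivative_eq_deriv_times(1)[OF 1] has_derivative_eq_deriv_times(1)[OF 2])
  qed
  have ex: "\<exists>F'. (\<forall>X Y. ((\<lambda>(X, Y). F X Y) has_derivative F' X Y) (at (X, Y))) \<and> (\<forall>v. Ck_on n UNIV (\<lambda>(X, Y). F' X Y v))" for n
  proof -
    have "Ck_on (Suc n) UNIV (\<lambda>(X, Y). F X Y)" by (rule smooth_on_def[THEN iffD1, THEN spec, OF assms])
    then obtain G where G: "\<And>x. ((\<lambda>(X, Y). F X Y) has_derivative G x) (at x)" "\<And>v. Ck_on n UNIV (\<lambda>x. G x v)"
      by (rule Ck_on_SucE) blast
    show ?thesis
      by (rule exI[of _ "\<lambda>X Y. G (X, Y)"]) (use G in \<open>simp add: split_def\<close>)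
  qed
  have eqs: "F' X Y (1, 0) = dX F X Y" "F' X Y (0, 1) = dY F X Y"
    if "\<And>X Y. ((\<lambda>(X, Y). F X Y) has_derivative F' X Y) (at (X, Y))" for F' X Y
  proof -
    note d = *[OF that[of X Y], unfolded has_dX_def has_dY_def]
    show "F' X Y (1, 0) = dX F X Y" unfolding dX_def by (rule sym, rule DERIV_imp_deriv, rule conjunct1[OF d])
    show "F' X Y (0, 1) = dY F X Y" unfolding dY_def
      by (rule sym, rule DERIV_imp_deriv, rule conjunct1[OF conjunct2[OF d]])
  qed
  obtain F' where F': "\<And>X Y. ((\<lambda>(X, Y). F X Y) has_derivative F' X Y) (at (X, Y))" using ex[of 0] by blast
  show "has_dX F (dX F X Y) X Y" "has_dY F (dY F X Y) X Y" using *[OF F'[of X Y]] unfolding eqs[OF F'] by blast+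
  have "F' X Y = (\<lambda>(h, k). h * dX F X Y + k * dY F X Y)" using *[OF F'[of X Y]] unfolding eqs[OF F'] by (auto simp only: fun_eq_iff split_paired_all prod.case)
  then show "((\<lambda>(X, Y). F X Y) has_derivative (\<lambda>(h, k). h * dX F X Y + k * dY F X Y)) (at (X, Y))"
    using F'[of X Y] by simp
  have C: "Ck_on n UNIV (\<lambda>(X, Y). dX F X Y) \<and> Ck_on n UNIV (\<lambda>(X, Y). dY F X Y)" for n
  proof -
    obtain G where G: "\<And>X Y. ((\<lambda>(X, Y). F X Y) has_derivative G X Y) (at (X, Y))"
      "\<And>v. Ck_on n UNIV (\<lambda>(X, Y). G X Y v)" using ex[of n] by blast
    show ?thesis
      by (rule conjI; use G(2)[of "(1,0)"] G(2)[of "(0,1)"] in \<open>simp only: eqs[OF G(1)]\<close>)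
  qed
  show "smooth_on UNIV (\<lambda>(X, Y). dX F X Y)" "smooth_on UNIV (\<lambda>(X, Y). dY F X Y)"
    unfolding smooth_on_def by (rule allI, rule conjunct1[OF C], rule allI, rule conjunct2[OF C])
qed

section \<open>Uniform comparison and exceptional null sets\<close>

text \<open>Boundedness is part of the definition so that the relation is preserved by products and by composition with continuously differentiable functions. It is used with the distance of two solutions, with the distance of two points, and with the distance from a line in the role of \<open>d\<close>.\<close>

definition close_on :: "'i set => ('i => real) => ('i => real) => ('i => real) => bool" where
  "close_on S d f g \<longleftrightarrow>
     (\<exists>B K. 0 <= B \<and> 0 <= K \<and> (\<forall>i\<in>S. \<bar>f i\<bar> <= B \<and> \<bar>g i\<bar> <= B \<and> \<bar>f i - g i\<bar> <= K * d i))"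

lemma close_onI:
  assumes "\<And>i. i \<in> S ==> \<bar>f i\<bar> <= B" "\<And>i. i \<in> S ==> \<bar>g i\<bar> <= B"
    "\<And>i. i \<in> S ==> 0 <= d i" "\<And>i. i \<in> S ==> \<bar>f i - g i\<bar> <= K * d i"
  shows "close_on S d f g"
  unfolding close_on_def
proof (rule exI[of _ "\<bar>B\<bar>"], rule exI[of _ "\<bar>K\<bar>"], intro conjI ballI)
  fix i assume i: "i \<in> S"
  show "\<bar>f i\<bar> <= \<bar>B\<bar>" "\<bar>g i\<bar> <= \<bar>B\<bar>" using assms(1,2)[OF i] by auto
  show "\<bar>f i - g i\<bar> <= \<bar>K\<bar> * d i"
    using assms(4)[OF i] mult_right_mono[OF abs_ge_self[of K] assms(3)[OF i]] by linarith
qed auto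

lemma close_onE:
  assumes "close_on S d f g"
  obtains K where "0 <= K" "\<And>i. i \<in> S ==> \<bar>f i - g i\<bar> <= K * d i"
  using assms unfolding close_on_def by blast

lemma close_on_mult:
  assumes "close_on S d f g" "close_on S d f' g'"
  shows "close_on S d (\<lambda>i. f i * f' i) (\<lambda>i. g i * g' i)"
proof -
  obtain B K where 1: "0 <= B" "0 <= K" "\<And>i. i \<in> S ==> \<bar>f i\<bar> <= B \<and> \<bar>g i\<bar> <= B \<and> \<bar>f i - g i\<bar> <= K * d i"
    using assms(1) unfolding close_on_def by blast
  obtain B' K' where 2: "0 <= B'" "0 <= K'" "\<And>i. i \<in> S ==> \<bar>f' i\<bar> <= B' \<and> \<bar>g' i\<bar> <= B' \<and> \<bar>f' i - g' i\<bar> <= K' * d i"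
    using assms(2) unfolding close_on_def by blast
  have "\<bar>f i * f' i\<bar> <= B * B' \<and> \<bar>g i * g' i\<bar> <= B * B' \<and>
        \<bar>f i * f' i - g i * g' i\<bar> <= (B * K' + K * B') * d i" if i: "i \<in> S" for i
  proof (intro conjI)
    show "\<bar>f i * f' i\<bar> <= B * B'" "\<bar>g i * g' i\<bar> <= B * B'"
      unfolding abs_mult using 1(1) 2(1) 1(3)[OF i] 2(3)[OF i] by (auto intro: mult_mono)
    have "f i * f' i - g i * g' i = f i * (f' i - g' i) + (f i - g i) * g' i" by (simp add: algebra_simps)
    then have "\<bar>f i * f' i - g i * g' i\<bar> <= \<bar>f i\<bar> * \<bar>f' i - g' i\<bar> + \<bar>f i - g i\<bar> * \<bar>g' i\<bar>"
      by (metis abs_mult abs_triangle_ineq)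
    also have "\<dots> <= B * (K' * d i) + (K * d i) * B'"
      using 1 2 1(3)[OF i] 2(3)[OF i] by (intro add_mono mult_mono) auto
    finally show "\<bar>f i * f' i - g i * g' i\<bar> <= (B * K' + K * B') * d i" by (simp add: algebra_simps)
  qed
  then show ?thesis unfolding close_on_def
    by (intro exI[of _ "B * B'"] exI[of _ "B * K' + K * B'"]) (use 1 2 in auto)
qed

lemma close_on_add:
  assumes "close_on S d f g" "close_on S d f' g'"
  shows "close_on S d (\<lambda>i. f i + f' i) (\<lambda>i. g i + g' i)"
proof -
  obtain B K where 1: "0 <= B" "0 <= K" "\<And>i. i \<in> S ==> \<bar>f i\<bar> <= B \<and> \<bar>g i\<bar> <= B \<and> \<bar>f i - g i\<bar> <= K * d i"
    using assms(1) unfolding close_on_def by blast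
  obtain B' K' where 2: "0 <= B'" "0 <= K'" "\<And>i. i \<in> S ==> \<bar>f' i\<bar> <= B' \<and> \<bar>g' i\<bar> <= B' \<and> \<bar>f' i - g' i\<bar> <= K' * d i"
    using assms(2) unfolding close_on_def by blast
  have "\<bar>f i + f' i\<bar> <= B + B' \<and> \<bar>g i + g' i\<bar> <= B + B' \<and>
        \<bar>(f i + f' i) - (g i + g' i)\<bar> <= (K + K') * d i" if i: "i \<in> S" for i
    using 1(3)[OF i] 2(3)[OF i] by (auto simp: distrib_right)
  then show ?thesis unfolding close_on_def
    by (intro exI[of _ "B + B'"] exI[of _ "K + K'"]) (use 1 2 in auto)
qed

lemma close_on_const:
  assumes "\<And>i. i \<in> S ==> 0 <= d i"
  shows "close_on S d (\<lambda>_. k) (\<lambda>_. k)"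
  by (rule close_onI[of _ _ "\<bar>k\<bar>" _ _ 0]) (use assms in auto)

lemma close_on_uminus: "close_on S d f g ==> close_on S d (\<lambda>i. - f i) (\<lambda>i. - g i)"
  unfolding close_on_def by (simp add: abs_minus_commute)

lemma close_on_diff:
  "close_on S d f g ==> close_on S d f' g' ==> close_on S d (\<lambda>i. f i - f' i) (\<lambda>i. g i - g' i)"
  using close_on_add[of S d f g "\<lambda>i. - f' i" "\<lambda>i. - g' i"] close_on_uminus[of S d f' g'] by simp

lemma close_on_compose:
  assumes cl: "close_on S d f g"
    and \<phi>: "\<And>x. (\<phi> has_real_derivative \<phi>' x) (at x)" and c: "continuous_on UNIV \<phi>'"
  shows "close_on S d (\<lambda>i. \<phi> (f i)) (\<lambda>i. \<phi> (g i))"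
proof -
  obtain B K where 1: "0 <= B" "0 <= K" "\<And>i. i \<in> S ==> \<bar>f i\<bar> <= B \<and> \<bar>g i\<bar> <= B \<and> \<bar>f i - g i\<bar> <= K * d i"
    using cl unfolding close_on_def by blast
  have "compact (\<phi>' ` {-B..B})"
    by (intro compact_continuous_image continuous_on_subset[OF c]) auto
  then obtain M where M: "\<And>x. x \<in> {-B..B} ==> \<bar>\<phi>' x\<bar> <= M"
    by (meson bounded_real compact_imp_bounded imageI)
  have "continuous_on UNIV \<phi>" using \<phi> by (meson DERIV_isCont continuous_at_imp_continuous_on)
  then have "compact (\<phi> ` {-B..B})"
    by (intro compact_continuous_image) (auto intro: continuous_on_subset)
  then obtain M' where M': "\<And>x. x \<in> {-B..B} ==> \<bar>\<phi> x\<bar> <= M'"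
    by (meson bounded_real compact_imp_bounded imageI)
  have M0: "0 <= M" using M[of 0] 1(1) abs_ge_zero[of "\<phi>' 0"] by simp
  have M0': "0 <= M'" using M'[of 0] 1(1) abs_ge_zero[of "\<phi> 0"] by simp
  have lip: "\<bar>\<phi> x - \<phi> y\<bar> <= M * \<bar>x - y\<bar>" if "x \<in> {-B..B}" "y \<in> {-B..B}" for x y
    using field_differentiable_bound[of "{-B..B}" \<phi> \<phi>' M x y] \<phi> M that
    by (auto intro: has_field_derivative_at_within)
  have "\<bar>\<phi> (f i)\<bar> <= M' \<and> \<bar>\<phi> (g i)\<bar> <= M' \<and> \<bar>\<phi> (f i) - \<phi> (g i)\<bar> <= (M * K) * d i" if i: "i \<in> S" for i
  proof (intro conjI)
    have r: "f i \<in> {-B..B}" "g i \<in> {-B..B}" using 1(3)[OF i] by auto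
    show "\<bar>\<phi> (f i)\<bar> <= M'" "\<bar>\<phi> (g i)\<bar> <= M'" using M' r by auto
    have "\<bar>\<phi> (f i) - \<phi> (g i)\<bar> <= M * \<bar>f i - g i\<bar>" by (rule lip[OF r])
    also have "\<dots> <= M * (K * d i)" using 1(3)[OF i] M0 by (intro mult_left_mono) auto
    finally show "\<bar>\<phi> (f i) - \<phi> (g i)\<bar> <= (M * K) * d i" by (simp add: mult.assoc)
  qed
  then show ?thesis unfolding close_on_def
    by (intro exI[of _ M'] exI[of _ "M * K"]) (use 1 M0 M0' in auto)
qed

text \<open>A violation in the interior would extend to an open set, which is not null; the end points are limits.\<close>

lemma AE_imp_le_continuous:
  fixes F :: "real => real"
  assumes "a < b" and c: "continuous_on {a..b} F" and ae: "AE y in lborel. a < y \<and> y < b --> F y <= 0"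
    and y: "y \<in> {a..b}"
  shows "F y <= 0"
proof -
  have op: "F x <= 0" if x: "a < x" "x < b" for x
  proof (rule ccontr)
    assume "\<not> F x <= 0"
    have "continuous_on {a<..<b} F" by (rule continuous_on_subset[OF c]) auto
    then have o: "open ({a<..<b} \<inter> F -` {0<..})"
      by (rule continuous_open_preimage) auto
    obtain N where N: "N \<in> null_sets lborel" "{y. \<not> (a < y \<and> y < b --> F y <= 0)} \<subseteq> N"
      using ae by (auto simp: eventually_ae_filter)
    then have "negligible N" by (simp add: negligible_iff_null_sets null_sets_completionI)
    moreover have "{a<..<b} \<inter> F -` {0<..} \<subseteq> N" using N(2) by (auto simp: not_le)
    ultimately have "negligible ({a<..<b} \<inter> F -` {0<..})" by (rule negligible_subset)
    moreover have "x \<in> {a<..<b} \<inter> F -` {0<..}" using \<open>\<not> F x <= 0\<close> x by simp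
    ultimately show False using open_not_negligible[OF o] by blast
  qed
  have "closed {x \<in> {a..b}. F x <= 0}"
    using continuous_closed_preimage[OF c closed_atLeastAtMost, of "{..0}"] by (simp add: vimage_def Int_def)
  moreover have "{a<..<b} \<subseteq> {x \<in> {a..b}. F x <= 0}" using op by auto
  ultimately have "closure {a<..<b} \<subseteq> {x \<in> {a..b}. F x <= 0}" by (rule closure_minimal[rotated])
  then show ?thesis using y \<open>a < b\<close> by auto
qed

text \<open>Fubini's theorem: almost every line parallel to an axis meets the exceptional set in a null set.\<close>

lemma AE_lborel_prodD:
  fixes P :: "real => real => bool"
  assumes "AE (X, Y) in lborel. P X Y"
  shows "AE X in lborel. AE Y in lborel. P X Y" "AE Y in lborel. AE X in lborel. P X Y"
proof -
  have ae: "AE x in lborel \<Otimes>\<^sub>M lborel. P (fst x) (snd x)"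
    unfolding lborel_prod using assms by (simp add: split_def)
  from lborel_pair.AE_pair[OF this] show "AE X in lborel. AE Y in lborel. P X Y" by simp
  obtain N where N: "N \<in> null_sets (lborel \<Otimes>\<^sub>M lborel :: (real \<times> real) measure)"
    and sub: "{x \<in> space (lborel \<Otimes>\<^sub>M lborel). \<not> P (fst x) (snd x)} \<subseteq> N"
    using ae unfolding eventually_ae_filter by blast
  have "AE x in lborel \<Otimes>\<^sub>M lborel. x \<notin> N" by (rule AE_not_in[OF N])
  from lborel_pair.AE_pair[OF this] have "AE X in lborel. AE Y in lborel. (X, Y) \<notin> N" .
  then have "AE Y in lborel. AE X in lborel. (X, Y) \<notin> N"
  proof (subst lborel_pair.AE_commute[symmetric])
    have "N \<in> sets (lborel \<Otimes>\<^sub>M lborel)" using N by auto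
    then show "{x \<in> space (lborel \<Otimes>\<^sub>M lborel). (fst x, snd x) \<notin> N} \<in> sets (lborel \<Otimes>\<^sub>M lborel)"
      using sets.compl_sets by (fastforce simp only: set_diff_eq prod.collapse)
  qed
  then show "AE Y in lborel. AE X in lborel. P X Y"
  proof eventually_elim
    case (elim Y)
    then show ?case
    proof eventually_elim
      case (elim X)
      moreover have "(X, Y) \<in> space (lborel \<Otimes>\<^sub>M lborel)" by (simp add: space_pair_measure)
      ultimately show ?case using sub by force
    qed
  qed
qed

section \<open>Functions on the half plane with prescribed partial derivatives\<close>

lemma loc_lipschitz_X_swap: "loc_lipschitz_X (\<lambda>X Y. f Y X) \<longleftrightarrow> loc_lipschitz_Y f"
  unfolding loc_lipschitz_X_def loc_lipschitz_Y_def half_plane_def by (simp add: add.commute)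

lemma has_dX_swap: "has_dX (\<lambda>X Y. f Y X) d X Y \<longleftrightarrow> has_dY f d Y X"
  unfolding has_dX_def has_dY_def ..

lemma continuous_on_half_plane_swap:
  assumes "continuous_on half_plane (\<lambda>(X, Y). f X Y)"
  shows "continuous_on half_plane (\<lambda>(X, Y). f Y X)"
proof -
  have "continuous_on half_plane (\<lambda>p. (\<lambda>(X, Y). f X Y) (snd p, fst p))"
    by (rule continuous_on_compose2[OF assms]) (auto intro!: continuous_intros simp: half_plane_def)
  then show ?thesis by (simp add: split_def)
qed

lemma loc_lipschitz_XE:
  assumes "loc_lipschitz_X f"
  obtains L where "0 <= L" "\<And>X X' Y. \<bar>X\<bar> <= r ==> \<bar>X'\<bar> <= r ==> \<bar>Y\<bar> <= r ==> 0 <= X + Y ==> 0 <= X' + Y ==>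
     \<bar>f X Y - f X' Y\<bar> <= L * \<bar>X - X'\<bar>"
proof -
  obtain L where L: "\<forall>Y\<in>{-r..r}. L-lipschitz_on {X \<in> {-r..r}. (X, Y) \<in> half_plane} (\<lambda>X. f X Y)"
    using assms unfolding loc_lipschitz_X_def by blast
  show thesis
  proof (rule that[of "\<bar>L\<bar>"])
    fix X X' Y assume a: "\<bar>X\<bar> <= r" "\<bar>X'\<bar> <= r" "\<bar>Y\<bar> <= r" "0 <= X + Y" "0 <= X' + Y"
    then have "Y \<in> {-r..r}" by auto
    with L have "L-lipschitz_on {X \<in> {-r..r}. (X, Y) \<in> half_plane} (\<lambda>X. f X Y)" by blast
    then have "\<bar>f X Y - f X' Y\<bar> <= L * \<bar>X - X'\<bar>"
      using lipschitz_onD[of L _ "\<lambda>X. f X Y" X X'] a by (auto simp: dist_real_def half_plane_def abs_le_iff)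
    also have "\<dots> <= \<bar>L\<bar> * \<bar>X - X'\<bar>" by (intro mult_right_mono) auto
    finally show "\<bar>f X Y - f X' Y\<bar> <= \<bar>L\<bar> * \<bar>X - X'\<bar>" .
  qed simp
qed

lemma loc_lipschitz_X_line:
  assumes "loc_lipschitz_X f" "0 <= a + Y"
  obtains L where "L-lipschitz_on {a..b} (\<lambda>X. f X Y)"
proof -
  define r where "r = \<bar>a\<bar> + \<bar>b\<bar> + \<bar>Y\<bar>"
  obtain L where L: "0 <= L" "\<And>X X' Y. \<bar>X\<bar> <= r ==> \<bar>X'\<bar> <= r ==> \<bar>Y\<bar> <= r ==> 0 <= X + Y ==> 0 <= X' + Y ==>
     \<bar>f X Y - f X' Y\<bar> <= L * \<bar>X - X'\<bar>" using loc_lipschitz_XE[OF assms(1)] by blast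
  show thesis
    by (rule that[of L], rule lipschitz_onI)
       (use L assms(2) in \<open>auto simp: dist_real_def r_def intro!: L(2)\<close>)
qed

lemma continuous_on_half_plane_line:
  assumes "continuous_on half_plane (\<lambda>(X, Y). f X Y)" "0 <= a + Y"
  shows "continuous_on {a..b} (\<lambda>X. f X Y)"
proof -
  have "continuous_on {a..b} (\<lambda>X. (\<lambda>(X, Y). f X Y) (X, Y))"
    by (rule continuous_on_compose2[OF assms(1)]) (use assms(2) in \<open>auto intro!: continuous_intros simp: half_plane_def\<close>)
  then show ?thesis by simp
qed

lemma continuous_on_half_plane_vline:
  assumes "continuous_on half_plane (\<lambda>(X, Y). f X Y)" "0 <= X + a"
  shows "continuous_on {a..b} (\<lambda>Y. f X Y)"
  using continuous_on_half_plane_line[OF continuous_on_half_plane_swap[OF assms(1)], of a X b] assms(2)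
  by (simp add: add.commute)

text \<open>On almost every horizontal line the one-dimensional estimate applies; continuity in \<open>Y\<close> carries it to the exceptional lines.\<close>

lemma increment_le_strip:
  assumes ab: "a <= b" and cd: "c < d" and hp: "0 <= a + c"
    and cf: "continuous_on half_plane (\<lambda>(X, Y). f X Y)" and lip: "loc_lipschitz_X f"
    and ae: "AE Y in lborel. c < Y \<and> Y < d -->
       (AE X in lborel. a < X \<and> X < b --> (\<exists>D. has_dX f D X Y \<and> D <= M))"
    and Y: "Y \<in> {c..d}"
  shows "f b Y - f a Y <= M * (b - a)"
proof -
  have "f b Y - f a Y - M * (b - a) <= 0"
  proof (rule AE_imp_le_continuous[OF cd _ _ Y])
    show "continuous_on {c..d} (\<lambda>Y. f b Y - f a Y - M * (b - a))"
      using ab hp by (intro continuous_intros continuous_on_half_plane_vline[OF cf]) auto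
    show "AE Y in lborel. c < Y \<and> Y < d --> f b Y - f a Y - M * (b - a) <= 0"
      using ae
    proof eventually_elim
      case (elim Y)
      show ?case
      proof
        assume cYd: "c < Y \<and> Y < d"
        then have "0 <= a + Y" using hp by simp
        then obtain L where L: "L-lipschitz_on {a..b} (\<lambda>X. f X Y)"
          using loc_lipschitz_X_line[OF lip] by blast
        have "f b Y - f a Y <= M * (b - a)"
          by (rule lipschitz_AE_deriv_le[OF ab L]) (use elim cYd in \<open>simp add: has_dX_def\<close>)
        then show "f b Y - f a Y - M * (b - a) <= 0" by simp
      qed
    qed
  qed
  then show ?thesis by simp
qed

lemma continuous_half_plane_box:
  assumes "continuous_on half_plane (\<lambda>(X, Y). g X Y)" "0 < X + Y" "(0::real) < e"
  obtains r where "0 < r" "\<And>X' Y'. \<bar>X' - X\<bar> <= r ==> \<bar>Y' - Y\<bar> <= r ==> 0 < X' + Y' \<and> \<bar>g X' Y' - g X Y\<bar> <= e"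
proof -
  have "(X, Y) \<in> half_plane" using assms(2) by (simp add: half_plane_def)
  then obtain d where d: "d > 0" "\<And>P. P \<in> half_plane ==> dist P (X, Y) < d ==> \<bar>(\<lambda>(X, Y). g X Y) P - g X Y\<bar> < e"
    using assms(1,3) unfolding continuous_on_iff by (fastforce simp: dist_real_def)
  define r where "r = min (d / 3) ((X + Y) / 3)"
  have r: "0 < r" "r <= d / 3" "r <= (X + Y) / 3"
    unfolding r_def using d(1) assms(2) by (simp_all only: min_less_iff_conj min.cobounded1 min.cobounded2) simp
  show thesis
  proof (rule that[OF r(1)])
    fix X' Y' assume a: "\<bar>X' - X\<bar> <= r" "\<bar>Y' - Y\<bar> <= r"
    have "X - r <= X'" "Y - r <= Y'" using a unfolding abs_le_iff by linarith+
    moreover have "3 * r <= X + Y" using r(3) by simp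
    ultimately have pos: "0 < X' + Y'" using r(1) by (simp add: algebra_simps)
    have "dist (X', Y') (X, Y) <= \<bar>X' - X\<bar> + \<bar>Y' - Y\<bar>"
      using norm_Pair_le[of "X' - X" "Y' - Y"] by (simp add: dist_norm)
    also have "\<dots> < d" using a r d(1) by linarith
    finally show "0 < X' + Y' \<and> \<bar>g X' Y' - g X Y\<bar> <= e"
      using d(2)[of "(X', Y')"] pos by (auto simp: half_plane_def)
  qed
qed

lemma increment_box_X:
  assumes cf: "continuous_on half_plane (\<lambda>(X, Y). f X Y)" and lip: "loc_lipschitz_X f"
    and cg: "continuous_on half_plane (\<lambda>(X, Y). g X Y)"
    and ae: "AE Y in lborel. AE X in lborel. 0 < X + Y --> has_dX f (g X Y) X Y"
    and XY: "0 < X + Y" and e: "0 < e"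
  obtains r where "0 < r" "\<And>X1 X2 Y'. \<bar>X1 - X\<bar> <= r ==> \<bar>X2 - X\<bar> <= r ==> \<bar>Y' - Y\<bar> <= r ==>
     \<bar>f X2 Y' - f X1 Y' - g X Y * (X2 - X1)\<bar> <= e * \<bar>X2 - X1\<bar>"
proof -
  obtain r where r: "0 < r" "\<And>X' Y'. \<bar>X' - X\<bar> <= r ==> \<bar>Y' - Y\<bar> <= r ==> 0 < X' + Y' \<and> \<bar>g X' Y' - g X Y\<bar> <= e"
    using continuous_half_plane_box[OF cg XY e] by blast
  have *: "\<bar>f X2 Y' - f X1 Y' - g X Y * (X2 - X1)\<bar> <= e * (X2 - X1)"
    if b: "\<bar>X1 - X\<bar> <= r" "\<bar>X2 - X\<bar> <= r" "\<bar>Y' - Y\<bar> <= r" "X1 <= X2" for X1 X2 Y'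
  proof -
    have hp: "0 <= X1 + (Y - r)" using r(2)[of X1 "Y - r"] b r(1) by auto
    have 1: "f X2 Y' - f X1 Y' <= (g X Y + e) * (X2 - X1)"
    proof (rule increment_le_strip[OF b(4) _ hp cf lip])
      show "Y - r < Y + r" "Y' \<in> {Y - r..Y + r}" using r(1) b by auto
      show "AE Y' in lborel. Y - r < Y' \<and> Y' < Y + r -->
        (AE X' in lborel. X1 < X' \<and> X' < X2 --> (\<exists>D. has_dX f D X' Y' \<and> D <= g X Y + e))"
        using ae
      proof eventually_elim
        case (elim Y')
        show ?case
        proof
          assume Y': "Y - r < Y' \<and> Y' < Y + r"
          show "AE X' in lborel. X1 < X' \<and> X' < X2 --> (\<exists>D. has_dX f D X' Y' \<and> D <= g X Y + e)"
            using elim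
          proof eventually_elim
            case (elim X')
            show ?case using r(2)[of X' Y'] elim b Y' by (fastforce simp: abs_le_iff)
          qed
        qed
      qed
    qed
    have 2: "- f X2 Y' - - f X1 Y' <= (- g X Y + e) * (X2 - X1)"
    proof (rule increment_le_strip[OF b(4) _ hp, where f="\<lambda>X Y. - f X Y"])
      show "Y - r < Y + r" "Y' \<in> {Y - r..Y + r}" using r(1) b by auto
      show "continuous_on half_plane (\<lambda>(X, Y). - f X Y)"
        using continuous_on_minus[OF cf] by (simp add: split_def)
      show "loc_lipschitz_X (\<lambda>X Y. - f X Y)" using lip unfolding loc_lipschitz_X_def by simp
      show "AE Y' in lborel. Y - r < Y' \<and> Y' < Y + r -->
        (AE X' in lborel. X1 < X' \<and> X' < X2 --> (\<exists>D. has_dX (\<lambda>X Y. - f X Y) D X' Y' \<and> D <= - g X Y + e))"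
        using ae
      proof eventually_elim
        case (elim Y')
        show ?case
        proof
          assume Y': "Y - r < Y' \<and> Y' < Y + r"
          show "AE X' in lborel. X1 < X' \<and> X' < X2 --> (\<exists>D. has_dX (\<lambda>X Y. - f X Y) D X' Y' \<and> D <= - g X Y + e)"
            using elim
          proof eventually_elim
            case (elim X')
            show ?case
            proof
              assume X': "X1 < X' \<and> X' < X2"
              have "0 < X' + Y' \<and> \<bar>g X' Y' - g X Y\<bar> <= e" using r(2)[of X' Y'] b Y' X' by (auto simp: abs_le_iff)
              moreover from this have "has_dX (\<lambda>X Y. - f X Y) (- g X' Y') X' Y'"
                using elim unfolding has_dX_def by (auto intro: DERIV_minus)
              ultimately show "\<exists>D. has_dX (\<lambda>X Y. - f X Y) D X' Y' \<and> D <= - g X Y + e"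
                by (intro exI[of _ "- g X' Y'"]) auto
            qed
          qed
        qed
      qed
    qed
    show ?thesis using 1 2 by (simp add: abs_le_iff algebra_simps)
  qed
  show thesis
  proof (rule that[OF r(1)])
    fix X1 X2 Y' assume b: "\<bar>X1 - X\<bar> <= r" "\<bar>X2 - X\<bar> <= r" "\<bar>Y' - Y\<bar> <= r"
    show "\<bar>f X2 Y' - f X1 Y' - g X Y * (X2 - X1)\<bar> <= e * \<bar>X2 - X1\<bar>"
    proof (cases "X1 <= X2")
      case True then show ?thesis using *[OF b True] by simp
    next
      case False
      then have "\<bar>f X1 Y' - f X2 Y' - g X Y * (X1 - X2)\<bar> <= e * (X1 - X2)" using *[OF b(2,1,3)] by simp
      moreover have "f X2 Y' - f X1 Y' - g X Y * (X2 - X1) = - (f X1 Y' - f X2 Y' - g X Y * (X1 - X2))"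
        by (simp add: algebra_simps)
      ultimately show ?thesis using False by (simp only: abs_minus_cancel) simp
    qed
  qed
qed

text \<open>Where the derivative given almost everywhere coincides with a continuous function \<open>g\<close>, difference quotients on small boxes are close to \<open>g\<close>, on the exceptional lines as well.\<close>

lemma has_dX_everywhere:
  assumes cf: "continuous_on half_plane (\<lambda>(X, Y). f X Y)" and lip: "loc_lipschitz_X f"
    and cg: "continuous_on half_plane (\<lambda>(X, Y). g X Y)"
    and ae: "AE Y in lborel. AE X in lborel. 0 < X + Y --> has_dX f (g X Y) X Y"
    and XY: "0 < X + Y"
  shows "has_dX f (g X Y) X Y"
  unfolding has_dX_def has_field_derivative_def has_derivative_at_alt
proof (intro conjI allI impI)
  show "bounded_linear ((*) (g X Y))" by (rule bounded_linear_mult_right)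
  fix e :: real assume "0 < e"
  then obtain r where r: "0 < r" "\<And>X1 X2 Y'. \<bar>X1 - X\<bar> <= r ==> \<bar>X2 - X\<bar> <= r ==> \<bar>Y' - Y\<bar> <= r ==>
     \<bar>f X2 Y' - f X1 Y' - g X Y * (X2 - X1)\<bar> <= e * \<bar>X2 - X1\<bar>"
    using increment_box_X[OF cf lip cg ae XY] by metis
  show "\<exists>d>0. \<forall>y. norm (y - X) < d --> norm (f y Y - f X Y - g X Y * (y - X)) <= e * norm (y - X)"
    by (rule exI[of _ r]) (use r in auto)
qed

lemma has_derivative_from_partials:
  assumes cf: "continuous_on half_plane (\<lambda>(X, Y). f X Y)"
    and lipX: "loc_lipschitz_X f" and lipY: "loc_lipschitz_Y f"
    and cg: "continuous_on half_plane (\<lambda>(X, Y). g X Y)" and ch: "continuous_on half_plane (\<lambda>(X, Y). h X Y)"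
    and aeX: "AE Y in lborel. AE X in lborel. 0 < X + Y --> has_dX f (g X Y) X Y"
    and aeY: "AE X in lborel. AE Y in lborel. 0 < X + Y --> has_dY f (h X Y) X Y"
    and XY: "0 < X + Y"
  shows "((\<lambda>(X, Y). f X Y) has_derivative (\<lambda>(a, b). g X Y * a + h X Y * b)) (at (X, Y))"
  unfolding has_derivative_at_alt
proof (intro conjI allI impI)
  show "bounded_linear (\<lambda>(a, b). g X Y * a + h X Y * b)"
    unfolding split_def
    by (intro bounded_linear_add bounded_linear_const_mult bounded_linear_fst bounded_linear_snd)
  fix e :: real assume "0 < e"
  then have e2: "0 < e / 2" by simp
  obtain r where r: "0 < r" "\<And>X1 X2 Y'. \<bar>X1 - X\<bar> <= r ==> \<bar>X2 - X\<bar> <= r ==> \<bar>Y' - Y\<bar> <= r ==>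
     \<bar>f X2 Y' - f X1 Y' - g X Y * (X2 - X1)\<bar> <= e / 2 * \<bar>X2 - X1\<bar>"
    using increment_box_X[OF cf lipX cg aeX XY e2] by metis
  have aeY': "AE X in lborel. AE Y in lborel. 0 < Y + X --> has_dX (\<lambda>X Y. f Y X) (h X Y) Y X"
    using aeY unfolding has_dX_swap by (simp add: add.commute)
  have YX: "0 < Y + X" using XY by simp
  obtain s where s: "0 < s" "\<And>Y1 Y2 X'. \<bar>Y1 - Y\<bar> <= s ==> \<bar>Y2 - Y\<bar> <= s ==> \<bar>X' - X\<bar> <= s ==>
     \<bar>f X' Y2 - f X' Y1 - h X Y * (Y2 - Y1)\<bar> <= e / 2 * \<bar>Y2 - Y1\<bar>"
  proof -
    have lipY': "loc_lipschitz_X (\<lambda>X Y. f Y X)" using lipY unfolding loc_lipschitz_X_swap .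
    show ?thesis
      by (rule increment_box_X[OF continuous_on_half_plane_swap[OF cf] lipY' continuous_on_half_plane_swap[OF ch] aeY' YX e2])
         (rule that)
  qed
  show "\<exists>d>0. \<forall>y. norm (y - (X, Y)) < d -->
      norm ((case y of (X, Y) => f X Y) - (case (X, Y) of (X, Y) => f X Y) - (case y - (X, Y) of (a, b) => g X Y * a + h X Y * b))
        <= e * norm (y - (X, Y))"
  proof (intro exI[of _ "min r s"] conjI allI impI)
    show "0 < min r s" using r(1) s(1) by simp
    fix y :: "real \<times> real" assume y: "norm (y - (X, Y)) < min r s"
    obtain X' Y' where yy: "y = (X', Y')" by (cases y)
    have n1: "\<bar>X' - X\<bar> <= norm (y - (X, Y))" and n2: "\<bar>Y' - Y\<bar> <= norm (y - (X, Y))"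
      unfolding yy using norm_fst_le[of "X' - X" "Y' - Y"] norm_snd_le[of "Y' - Y" "X' - X"] by simp_all
    have a: "\<bar>f X' Y - f X Y - g X Y * (X' - X)\<bar> <= e / 2 * \<bar>X' - X\<bar>"
      using r(2)[of X X' Y] r(1) n1 y by simp
    have b: "\<bar>f X' Y' - f X' Y - h X Y * (Y' - Y)\<bar> <= e / 2 * \<bar>Y' - Y\<bar>"
      using s(2)[of Y Y' X'] s(1) n1 n2 y by simp
    have "e / 2 * \<bar>X' - X\<bar> <= e / 2 * norm (y - (X, Y))" "e / 2 * \<bar>Y' - Y\<bar> <= e / 2 * norm (y - (X, Y))"
      using n1 n2 e2 by (auto intro!: mult_left_mono simp del: times_divide_eq_left)
    moreover have "f X' Y' - f X Y - (g X Y * (X' - X) + h X Y * (Y' - Y)) =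
        (f X' Y - f X Y - g X Y * (X' - X)) + (f X' Y' - f X' Y - h X Y * (Y' - Y))" by simp
    ultimately have "\<bar>f X' Y' - f X Y - (g X Y * (X' - X) + h X Y * (Y' - Y))\<bar>
        <= e / 2 * norm (y - (X, Y)) + e / 2 * norm (y - (X, Y))" using a b by linarith
    then show "norm ((case y of (X, Y) => f X Y) - (case (X, Y) of (X, Y) => f X Y) - (case y - (X, Y) of (a, b) => g X Y * a + h X Y * b))
        <= e * norm (y - (X, Y))"
      by (simp add: yy)
  qed
qed

text \<open>The logarithm of \<open>f\<close> has a bounded derivative, so \<open>f\<close> cannot fall to zero within a bounded distance from the boundary. Applied to \<open>p\<close> and \<open>q\<close>.\<close>

lemma positive_along_characteristics:
  assumes cf: "continuous_on half_plane (\<lambda>(X, Y). f X Y)" and lip: "loc_lipschitz_X f"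
    and bd: "\<And>s. 1 <= f s (-s)"
    and ae: "\<And>r. \<exists>C\<ge>0. AE Y in lborel. AE X in lborel. 0 < X + Y \<and> \<bar>X\<bar> <= r \<and> \<bar>Y\<bar> <= r -->
               (\<exists>D. has_dX f D X Y \<and> \<bar>D\<bar> <= C * \<bar>f X Y\<bar>)"
    and XY: "0 <= X + Y"
  shows "0 < f X Y"
proof -
  define r where "r = \<bar>X\<bar> + \<bar>Y\<bar> + 1"
  obtain C where C: "0 <= C" and ae': "AE Y in lborel. AE X in lborel. 0 < X + Y \<and> \<bar>X\<bar> <= r \<and> \<bar>Y\<bar> <= r -->
               (\<exists>D. has_dX f D X Y \<and> \<bar>D\<bar> <= C * \<bar>f X Y\<bar>)" using ae[of r] by blast
  have "exp (- C * (X + Y)) - f X Y <= 0"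
  proof (rule AE_imp_le_continuous[of Y "Y + 1" "\<lambda>Y'. exp (- C * (X + Y')) - f X Y'"])
    show "continuous_on {Y..Y + 1} (\<lambda>Y'. exp (- C * (X + Y')) - f X Y')"
      by (intro continuous_intros continuous_on_half_plane_vline[OF cf XY])
    show "AE Y' in lborel. Y < Y' \<and> Y' < Y + 1 --> exp (- C * (X + Y')) - f X Y' <= 0"
      using ae'
    proof eventually_elim
      case (elim Y')
      show ?case
      proof
        assume Y': "Y < Y' \<and> Y' < Y + 1"
        have pos: "- Y' <= X" using XY Y' by linarith
        obtain L where L: "L-lipschitz_on {-Y'..X} (\<lambda>X. f X Y')"
          using loc_lipschitz_X_line[OF lip, of "-Y'" Y'] by auto
        define b where "b x = exp (- C * (x + Y'))" for x
        have db: "(b has_real_derivative - C * b x) (at x)" for x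
          unfolding b_def by (auto intro!: derivative_eq_intros)
        have b1: "b x <= 1" if "- Y' <= x" for x using that C by (simp add: b_def)
        have lb: "C-lipschitz_on {-Y'..X} b"
        proof (rule bounded_derivative_imp_lipschitz[where f'="\<lambda>x h. (- C * b x) * h"])
          show "(b has_derivative (\<lambda>h. - C * b x * h)) (at x within {- Y'..X})" for x
            using db[of x] unfolding has_field_derivative_def by (rule has_derivative_at_withinI)
          show "onorm (\<lambda>h. - C * b x * h) <= C" if "x \<in> {- Y'..X}" for x
          proof (rule onorm_le)
            fix h :: real
            have "norm (- C * b x * h) = C * b x * \<bar>h\<bar>" using C by (simp add: abs_mult b_def)
            also have "\<dots> <= C * 1 * \<bar>h\<bar>" using C b1[of x] that by (intro mult_right_mono mult_left_mono) auto
            finally show "norm (- C * b x * h) <= C * norm h" by simp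
          qed
        qed (use C in auto)
        have lg: "(C + L)-lipschitz_on {-Y'..X} (\<lambda>x. b x - f x Y')"
          by (rule lipschitz_on_diff[OF lb L])
        have "b X - f X Y' <= 0"
        proof (rule lipschitz_barrier[OF pos lg])
          show "b (- Y') - f (- Y') Y' <= 0" using bd[of "-Y'"] by (simp add: b_def)
          show "0 < b X" by (simp add: b_def)
          show "AE x in lborel. - Y' < x \<and> x < X \<and> 0 < b x - f x Y' \<and> b x - f x Y' < b X -->
              (\<exists>d. ((\<lambda>x. b x - f x Y') has_real_derivative d) (at x) \<and> d <= 0)"
            using elim
          proof eventually_elim
            case (elim x)
            show ?case
            proof
              assume x: "- Y' < x \<and> x < X \<and> 0 < b x - f x Y' \<and> b x - f x Y' < b X"
              have "0 < x + Y' \<and> \<bar>x\<bar> <= r \<and> \<bar>Y'\<bar> <= r"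
                using x Y' XY unfolding r_def by linarith
              then obtain D where D: "has_dX f D x Y'" "\<bar>D\<bar> <= C * \<bar>f x Y'\<bar>" using elim by blast
              have "- C * X <= - C * x" using C x by (simp add: mult_left_mono)
              then have "b X <= b x" by (simp add: b_def algebra_simps)
              then have "0 < f x Y'" "f x Y' <= b x" using x by linarith+
              then have "C * \<bar>f x Y'\<bar> <= C * b x" using C by (intro mult_left_mono) auto
              then have "- C * b x - D <= 0" using D(2) by auto
              moreover have "((\<lambda>x. b x - f x Y') has_real_derivative (- C * b x - D)) (at x)"
                using db[of x] D(1) unfolding has_dX_def by (rule DERIV_diff)
              ultimately show "\<exists>d. ((\<lambda>x. b x - f x Y') has_real_derivative d) (at x) \<and> d <= 0" by blast
            qed
          qed
        qed
        then show "exp (- C * (X + Y')) - f X Y' <= 0" by (simp add: b_def)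
      qed
    qed
  qed auto
  then show ?thesis using exp_gt_zero[of "- C * (X + Y)"] by linarith
qed

section \<open>Solutions in characteristic coordinates\<close>

text \<open>The right-hand sides are named without the factor \<open>\<theta>\<close>, because the same expressions occur for both solutions and only their coefficients \<open>\<theta>\<close> differ.\<close>

definition rhs_uX :: "(real => real) => char_vars => real => real => real" where
  "rhs_uX c sv X Y = sin (cw sv X Y) / (4 * c (cu sv X Y)) * cp sv X Y"
definition rhs_uY :: "(real => real) => char_vars => real => real => real" where
  "rhs_uY c sv X Y = sin (cz sv X Y) / (4 * c (cu sv X Y)) * cq sv X Y"
definition rhs_w :: "(real => real) => char_vars => real => real => real" where
  "rhs_w c sv X Y = deriv c (cu sv X Y) / (8 * (c (cu sv X Y))\<^sup>2) * (cos (cz sv X Y) - cos (cw sv X Y)) * cq sv X Y"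
definition rhs_z :: "(real => real) => char_vars => real => real => real" where
  "rhs_z c sv X Y = deriv c (cu sv X Y) / (8 * (c (cu sv X Y))\<^sup>2) * (cos (cw sv X Y) - cos (cz sv X Y)) * cp sv X Y"
definition rhs_p :: "(real => real) => char_vars => real => real => real" where
  "rhs_p c sv X Y = deriv c (cu sv X Y) / (8 * (c (cu sv X Y))\<^sup>2) * (sin (cz sv X Y) - sin (cw sv X Y)) * cp sv X Y * cq sv X Y"
definition rhs_q :: "(real => real) => char_vars => real => real => real" where
  "rhs_q c sv X Y = deriv c (cu sv X Y) / (8 * (c (cu sv X Y))\<^sup>2) * (sin (cw sv X Y) - sin (cz sv X Y)) * cp sv X Y * cq sv X Y"
definition rhs_xX :: "char_vars => real => real => real" where
  "rhs_xX sv X Y = (1 + cos (cw sv X Y)) * cp sv X Y / 4"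
definition rhs_xY :: "char_vars => real => real => real" where
  "rhs_xY sv X Y = - ((1 + cos (cz sv X Y)) * cq sv X Y / 4)"
definition rhs_tX :: "(real => real) => char_vars => real => real => real" where
  "rhs_tX c sv X Y = (1 + cos (cw sv X Y)) * cp sv X Y / (4 * c (cu sv X Y))"
definition rhs_tY :: "(real => real) => char_vars => real => real => real" where
  "rhs_tY c sv X Y = (1 + cos (cz sv X Y)) * cq sv X Y / (4 * c (cu sv X Y))"

lemma semilinear_system_at_iff:
  "semilinear_system_at c \<theta> sv X Y \<longleftrightarrow>
     has_dX (cu sv) (rhs_uX c sv X Y) X Y \<and> has_dY (cu sv) (rhs_uY c sv X Y) X Y \<and>
     has_dY (cw sv) (\<theta> * rhs_w c sv X Y) X Y \<and> has_dX (cz sv) (\<theta> * rhs_z c sv X Y) X Y \<and>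
     has_dY (cp sv) (\<theta> * rhs_p c sv X Y) X Y \<and> has_dX (cq sv) (\<theta> * rhs_q c sv X Y) X Y \<and>
     has_dX (cx sv) (rhs_xX sv X Y) X Y \<and> has_dY (cx sv) (rhs_xY sv X Y) X Y \<and>
     has_dX (ct sv) (rhs_tX c sv X Y) X Y \<and> has_dY (ct sv) (rhs_tY c sv X Y) X Y"
  unfolding semilinear_system_at_def Let_def rhs_uX_def rhs_uY_def rhs_w_def rhs_z_def rhs_p_def rhs_q_def
    rhs_xX_def rhs_xY_def rhs_tX_def rhs_tY_def by (simp only: mult.assoc)

locale wave_speed =
  fixes c :: "real => real"
  assumes c_smooth: "smooth_on UNIV c" and c_pos: "\<And>v. 0 < c v"
begin

lemma c_deriv: "(c has_real_derivative deriv c v) (at v)"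
  by (rule smooth_on_real_deriv(1)[OF c_smooth])

lemma c_deriv2: "(deriv c has_real_derivative deriv (deriv c) v) (at v)"
  by (rule smooth_on_real_deriv(1)[OF smooth_on_real_deriv(2)[OF c_smooth]])

lemma cont_c: "continuous_on UNIV c" "continuous_on UNIV (deriv c)" "continuous_on UNIV (deriv (deriv c))"
proof -
  have "Ck_on 0 UNIV c" "Ck_on 0 UNIV (deriv c)" "Ck_on 0 UNIV (deriv (deriv c))"
    using c_smooth smooth_on_real_deriv(2) unfolding smooth_on_def by blast+
  then show "continuous_on UNIV c" "continuous_on UNIV (deriv c)" "continuous_on UNIV (deriv (deriv c))"
    by simp_all
qed

lemma c_ne: "c v \<noteq> 0" using c_pos[of v] by simp

end

text \<open>The common part of the two notions of solution: regularity as for the dissipative variables and equations almost everywhere, with an arbitrary factor \<open>\<theta>\<close> with values \<open>0\<close> and \<open>1\<close>.\<close>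

locale char_sol = wave_speed +
  fixes \<theta> :: "real => real => real" and sv :: char_vars and u0 u1 :: "real => real"
  assumes cont: "f \<in> {cu sv, cw sv, cz sv, cp sv, cq sv, cx sv, ct sv} ==> continuous_on half_plane (\<lambda>(X, Y). f X Y)"
    and lipX: "f \<in> {cu sv, cx sv, ct sv, cz sv, cq sv} ==> loc_lipschitz_X f"
    and lipY: "f \<in> {cu sv, cx sv, ct sv, cw sv, cp sv} ==> loc_lipschitz_Y f"
    and theta: "\<theta> X Y = 0 \<or> \<theta> X Y = 1"
    and sys: "AE (X, Y) in lborel. 0 < X + Y --> semilinear_system_at c (\<theta> X Y) sv X Y"
    and bdry: "boundary_data c u0 u1 sv"
begin

lemma cont_vars:
  "continuous_on half_plane (\<lambda>(X, Y). cu sv X Y)" "continuous_on half_plane (\<lambda>(X, Y). cw sv X Y)"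
  "continuous_on half_plane (\<lambda>(X, Y). cz sv X Y)" "continuous_on half_plane (\<lambda>(X, Y). cp sv X Y)"
  "continuous_on half_plane (\<lambda>(X, Y). cq sv X Y)" "continuous_on half_plane (\<lambda>(X, Y). cx sv X Y)"
  "continuous_on half_plane (\<lambda>(X, Y). ct sv X Y)"
  by (rule cont; simp)+

lemma cont_fst_snd:
  "continuous_on half_plane (\<lambda>x. cu sv (fst x) (snd x))" "continuous_on half_plane (\<lambda>x. cw sv (fst x) (snd x))"
  "continuous_on half_plane (\<lambda>x. cz sv (fst x) (snd x))" "continuous_on half_plane (\<lambda>x. cp sv (fst x) (snd x))"
  "continuous_on half_plane (\<lambda>x. cq sv (fst x) (snd x))" "continuous_on half_plane (\<lambda>x. cx sv (fst x) (snd x))"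
  "continuous_on half_plane (\<lambda>x. ct sv (fst x) (snd x))"
  using cont_vars by (simp_all add: split_def)

lemma cont_c_u:
  "continuous_on half_plane (\<lambda>x. c (cu sv (fst x) (snd x)))"
  "continuous_on half_plane (\<lambda>x. deriv c (cu sv (fst x) (snd x)))"
  by (rule continuous_on_compose2[OF cont_c(1) cont_fst_snd(1)]; simp)
     (rule continuous_on_compose2[OF cont_c(2) cont_fst_snd(1)]; simp)

lemma cont_rhs:
  "continuous_on half_plane (\<lambda>(X, Y). rhs_uX c sv X Y)" "continuous_on half_plane (\<lambda>(X, Y). rhs_uY c sv X Y)"
  "continuous_on half_plane (\<lambda>(X, Y). rhs_w c sv X Y)" "continuous_on half_plane (\<lambda>(X, Y). rhs_z c sv X Y)"
  "continuous_on half_plane (\<lambda>(X, Y). rhs_p c sv X Y)" "continuous_on half_plane (\<lambda>(X, Y). rhs_q c sv X Y)"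
  "continuous_on half_plane (\<lambda>(X, Y). rhs_xX sv X Y)" "continuous_on half_plane (\<lambda>(X, Y). rhs_xY sv X Y)"
  "continuous_on half_plane (\<lambda>(X, Y). rhs_tX c sv X Y)" "continuous_on half_plane (\<lambda>(X, Y). rhs_tY c sv X Y)"
  unfolding rhs_uX_def rhs_uY_def rhs_w_def rhs_z_def rhs_p_def rhs_q_def rhs_xX_def rhs_xY_def rhs_tX_def rhs_tY_def
    split_def
  by (intro continuous_intros cont_fst_snd cont_c_u ballI; simp add: c_ne)+

lemma sys_lines:
  "AE X in lborel. AE Y in lborel. 0 < X + Y --> semilinear_system_at c (\<theta> X Y) sv X Y"
  "AE Y in lborel. AE X in lborel. 0 < X + Y --> semilinear_system_at c (\<theta> X Y) sv X Y"
  using AE_lborel_prodD[OF sys] by auto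

lemma bdry_vals:
  "cu sv s (-s) = u0 s" "ct sv s (-s) = 0" "cx sv s (-s) = s"
  "cw sv s (-s) = 2 * arctan (u1 s + c (u0 s) * deriv u0 s)"
  "cz sv s (-s) = 2 * arctan (u1 s - c (u0 s) * deriv u0 s)"
  "cp sv s (-s) = 1 + (u1 s + c (u0 s) * deriv u0 s)\<^sup>2"
  "cq sv s (-s) = 1 + (u1 s - c (u0 s) * deriv u0 s)\<^sup>2"
  using bdry unfolding boundary_data_def Let_def by blast+

lemma AE_AE_mono:
  assumes "AE X in lborel. AE Y in lborel. P X Y" "\<And>X Y. P X Y ==> Q X Y"
  shows "AE X in (lborel :: real measure). AE Y in (lborel :: real measure). Q X Y"
  using assms(1) by eventually_elim (erule eventually_mono, erule assms(2))

text \<open>The equations for \<open>u\<close>, \<open>x\<close> and \<open>t\<close> do not contain the discontinuous factor \<open>\<theta>\<close>, so the derivatives given almost everywhere are continuous and hold everywhere.\<close>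

lemma C1:
  assumes XY: "0 < X + Y"
  shows "has_dX (cu sv) (rhs_uX c sv X Y) X Y" "has_dY (cu sv) (rhs_uY c sv X Y) X Y"
    "has_dX (cx sv) (rhs_xX sv X Y) X Y" "has_dY (cx sv) (rhs_xY sv X Y) X Y"
    "has_dX (ct sv) (rhs_tX c sv X Y) X Y" "has_dY (ct sv) (rhs_tY c sv X Y) X Y"
    "((\<lambda>(X, Y). cu sv X Y) has_derivative (\<lambda>(a, b). rhs_uX c sv X Y * a + rhs_uY c sv X Y * b)) (at (X, Y))"
    "((\<lambda>(X, Y). cx sv X Y) has_derivative (\<lambda>(a, b). rhs_xX sv X Y * a + rhs_xY sv X Y * b)) (at (X, Y))"
    "((\<lambda>(X, Y). ct sv X Y) has_derivative (\<lambda>(a, b). rhs_tX c sv X Y * a + rhs_tY c sv X Y * b)) (at (X, Y))"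
proof -
  have main: "has_dX f (g X Y) X Y \<and> has_dY f (h X Y) X Y \<and>
      ((\<lambda>(X, Y). f X Y) has_derivative (\<lambda>(a, b). g X Y * a + h X Y * b)) (at (X, Y))"
    if cf: "continuous_on half_plane (\<lambda>(X, Y). f X Y)" and l1: "loc_lipschitz_X f" and l2: "loc_lipschitz_Y f"
      and cg: "continuous_on half_plane (\<lambda>(X, Y). g X Y)" and ch: "continuous_on half_plane (\<lambda>(X, Y). h X Y)"
      and a: "\<And>X Y. semilinear_system_at c (\<theta> X Y) sv X Y ==> has_dX f (g X Y) X Y"
      and b: "\<And>X Y. semilinear_system_at c (\<theta> X Y) sv X Y ==> has_dY f (h X Y) X Y" for f g h
  proof -
    have aeX: "AE Y in lborel. AE X in lborel. 0 < X + Y --> has_dX f (g X Y) X Y"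
      by (rule AE_AE_mono[OF sys_lines(2)]) (use a in blast)
    have aeY: "AE X in lborel. AE Y in lborel. 0 < X + Y --> has_dY f (h X Y) X Y"
      by (rule AE_AE_mono[OF sys_lines(1)]) (use b in blast)
    have aeY': "AE X in lborel. AE Y in lborel. 0 < Y + X --> has_dX (\<lambda>X Y. f Y X) (h X Y) Y X"
      using aeY unfolding has_dX_swap by (simp add: add.commute)
    have "has_dX (\<lambda>X Y. f Y X) (h X Y) Y X"
      using has_dX_everywhere[OF continuous_on_half_plane_swap[OF cf] _ continuous_on_half_plane_swap[OF ch] aeY', of Y X]
        l2 XY unfolding loc_lipschitz_X_swap by (simp add: add.commute)
    then have hY: "has_dY f (h X Y) X Y" unfolding has_dX_swap .
    show ?thesis
      using hY has_dX_everywhere[OF cf l1 cg aeX XY] has_derivative_from_partials[OF cf l1 l2 cg ch aeX aeY XY] by blast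
  qed
  have u: "has_dX (cu sv) (rhs_uX c sv X Y) X Y \<and> has_dY (cu sv) (rhs_uY c sv X Y) X Y \<and>
     ((\<lambda>(X, Y). cu sv X Y) has_derivative (\<lambda>(a, b). rhs_uX c sv X Y * a + rhs_uY c sv X Y * b)) (at (X, Y))"
    by (rule main[OF cont_vars(1) _ _ cont_rhs(1,2)]) (auto intro: lipX lipY simp: semilinear_system_at_iff)
  have x: "has_dX (cx sv) (rhs_xX sv X Y) X Y \<and> has_dY (cx sv) (rhs_xY sv X Y) X Y \<and>
     ((\<lambda>(X, Y). cx sv X Y) has_derivative (\<lambda>(a, b). rhs_xX sv X Y * a + rhs_xY sv X Y * b)) (at (X, Y))"
    by (rule main[OF cont_vars(6) _ _ cont_rhs(7,8)]) (auto intro: lipX lipY simp: semilinear_system_at_iff)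
  have t: "has_dX (ct sv) (rhs_tX c sv X Y) X Y \<and> has_dY (ct sv) (rhs_tY c sv X Y) X Y \<and>
     ((\<lambda>(X, Y). ct sv X Y) has_derivative (\<lambda>(a, b). rhs_tX c sv X Y * a + rhs_tY c sv X Y * b)) (at (X, Y))"
    by (rule main[OF cont_vars(7) _ _ cont_rhs(9,10)]) (auto intro: lipX lipY simp: semilinear_system_at_iff)
  show "has_dX (cu sv) (rhs_uX c sv X Y) X Y" "has_dY (cu sv) (rhs_uY c sv X Y) X Y"
    "has_dX (cx sv) (rhs_xX sv X Y) X Y" "has_dY (cx sv) (rhs_xY sv X Y) X Y"
    "has_dX (ct sv) (rhs_tX c sv X Y) X Y" "has_dY (ct sv) (rhs_tY c sv X Y) X Y"
    "((\<lambda>(X, Y). cu sv X Y) has_derivative (\<lambda>(a, b). rhs_uX c sv X Y * a + rhs_uY c sv X Y * b)) (at (X, Y))"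
    "((\<lambda>(X, Y). cx sv X Y) has_derivative (\<lambda>(a, b). rhs_xX sv X Y * a + rhs_xY sv X Y * b)) (at (X, Y))"
    "((\<lambda>(X, Y). ct sv X Y) has_derivative (\<lambda>(a, b). rhs_tX c sv X Y * a + rhs_tY c sv X Y * b)) (at (X, Y))"
    using u x t by blast+
qed

lemma bounded_on_box:
  assumes "continuous_on half_plane (\<lambda>(X, Y). g X Y)"
  obtains C where "(0::real) <= C" "\<And>X Y. 0 <= X + Y ==> \<bar>X\<bar> <= r ==> \<bar>Y\<bar> <= r ==> \<bar>g X Y\<bar> <= C"
proof -
  define K where "K = ({-r..r} \<times> {-r..r}) \<inter> half_plane"
  have "closed half_plane"
  proof -
    have eq: "half_plane = (\<lambda>p. fst p + snd p) -` {0..}" by (auto simp: half_plane_def)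
    show ?thesis unfolding eq by (intro closed_vimage continuous_intros closed_atLeast)
  qed
  then have "compact K" unfolding K_def by (intro compact_Int_closed compact_Times compact_Icc)
  moreover have "continuous_on K (\<lambda>(X, Y). g X Y)"
    by (rule continuous_on_subset[OF assms]) (simp add: K_def)
  ultimately have "bounded ((\<lambda>(X, Y). g X Y) ` K)" using compact_continuous_image compact_imp_bounded by blast
  then obtain C where C: "\<And>x. x \<in> (\<lambda>(X, Y). g X Y) ` K ==> \<bar>x\<bar> <= C" by (meson bounded_real)
  show thesis
  proof (rule that[of "\<bar>C\<bar>"])
    fix X Y assume "0 <= X + Y" "\<bar>X\<bar> <= r" "\<bar>Y\<bar> <= r"
    then have "(X, Y) \<in> K" by (auto simp: K_def half_plane_def)
    then show "\<bar>g X Y\<bar> <= \<bar>C\<bar>" using C[of "g X Y"] by force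
  qed simp
qed

lemma p_pos: "0 <= X + Y ==> 0 < cp sv X Y" and q_pos: "0 <= X + Y ==> 0 < cq sv X Y"
proof -
  define a where "a X Y = deriv c (cu sv X Y) / (8 * (c (cu sv X Y))\<^sup>2) * (sin (cz sv X Y) - sin (cw sv X Y)) * cq sv X Y" for X Y
  define b where "b X Y = deriv c (cu sv X Y) / (8 * (c (cu sv X Y))\<^sup>2) * (sin (cw sv X Y) - sin (cz sv X Y)) * cp sv X Y" for X Y
  have ca: "continuous_on half_plane (\<lambda>(X, Y). a X Y)" and cb: "continuous_on half_plane (\<lambda>(X, Y). b X Y)"
    unfolding a_def b_def split_def by (intro continuous_intros cont_fst_snd cont_c_u ballI; simp add: c_ne)+
  have ab: "\<bar>\<theta> X Y * x * y\<bar> <= C * \<bar>y\<bar>" if "\<bar>x\<bar> <= C" for X Y x y C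
  proof -
    have "\<bar>\<theta> X Y * x\<bar> <= C" using theta[of X Y] that by auto
    then show ?thesis by (simp add: abs_mult mult_right_mono)
  qed
  have rp: "\<theta> X Y * rhs_p c sv X Y = \<theta> X Y * a X Y * cp sv X Y" and rq: "\<theta> X Y * rhs_q c sv X Y = \<theta> X Y * b X Y * cq sv X Y" for X Y
    by (simp_all add: rhs_p_def rhs_q_def a_def b_def algebra_simps)
  show "0 < cq sv X Y" if "0 <= X + Y" for X Y
  proof (rule positive_along_characteristics[OF cont_vars(5) _ _ _ that])
    show "loc_lipschitz_X (cq sv)" by (rule lipX) simp
    show "1 <= cq sv s (- s)" for s by (simp add: bdry_vals)
    fix r
    obtain C where C: "0 <= C" "\<And>X Y. 0 <= X + Y ==> \<bar>X\<bar> <= r ==> \<bar>Y\<bar> <= r ==> \<bar>b X Y\<bar> <= C"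
      using bounded_on_box[OF cb] by blast
    have "AE Y in lborel. AE X in lborel. 0 < X + Y \<and> \<bar>X\<bar> <= r \<and> \<bar>Y\<bar> <= r -->
               (\<exists>D. has_dX (cq sv) D X Y \<and> \<bar>D\<bar> <= C * \<bar>cq sv X Y\<bar>)"
    proof (rule AE_AE_mono[OF sys_lines(2)], intro impI)
      fix X Y assume s: "0 < Y + X --> semilinear_system_at c (\<theta> Y X) sv Y X" and h: "0 < Y + X \<and> \<bar>Y\<bar> <= r \<and> \<bar>X\<bar> <= r"
      then have "has_dX (cq sv) (\<theta> Y X * rhs_q c sv Y X) Y X" by (simp add: semilinear_system_at_iff)
      moreover have "\<bar>\<theta> Y X * rhs_q c sv Y X\<bar> <= C * \<bar>cq sv Y X\<bar>" unfolding rq by (rule ab, rule C(2)) (use h in auto)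
      ultimately show "\<exists>D. has_dX (cq sv) D Y X \<and> \<bar>D\<bar> <= C * \<bar>cq sv Y X\<bar>" by blast
    qed
    then show "\<exists>C\<ge>0. AE Y in lborel. AE X in lborel. 0 < X + Y \<and> \<bar>X\<bar> <= r \<and> \<bar>Y\<bar> <= r -->
               (\<exists>D. has_dX (cq sv) D X Y \<and> \<bar>D\<bar> <= C * \<bar>cq sv X Y\<bar>)" using C(1) by blast
  qed
  show "0 < cp sv X Y" if "0 <= X + Y" for X Y
  proof (rule positive_along_characteristics[where f="\<lambda>X Y. cp sv Y X" and X=Y and Y=X])
    show "continuous_on half_plane (\<lambda>(X, Y). cp sv Y X)" by (rule continuous_on_half_plane_swap[OF cont_vars(4)])
    show "loc_lipschitz_X (\<lambda>X Y. cp sv Y X)" unfolding loc_lipschitz_X_swap by (rule lipY) simp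
    show "1 <= cp sv (- s) s" for s using bdry_vals(6)[of "-s"] by simp
    show "0 <= Y + X" using that by simp
    fix r
    obtain C where C: "0 <= C" "\<And>X Y. 0 <= X + Y ==> \<bar>X\<bar> <= r ==> \<bar>Y\<bar> <= r ==> \<bar>a X Y\<bar> <= C"
      using bounded_on_box[OF ca] by blast
    have "AE Y in lborel. AE X in lborel. 0 < X + Y \<and> \<bar>X\<bar> <= r \<and> \<bar>Y\<bar> <= r -->
               (\<exists>D. has_dX (\<lambda>X Y. cp sv Y X) D X Y \<and> \<bar>D\<bar> <= C * \<bar>cp sv Y X\<bar>)"
    proof (rule AE_AE_mono[OF sys_lines(1)], intro impI)
      fix X Y assume s: "0 < X + Y --> semilinear_system_at c (\<theta> X Y) sv X Y" and h: "0 < Y + X \<and> \<bar>Y\<bar> <= r \<and> \<bar>X\<bar> <= r"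
      then have "has_dX (\<lambda>X Y. cp sv Y X) (\<theta> X Y * rhs_p c sv X Y) Y X"
        unfolding has_dX_swap by (simp add: semilinear_system_at_iff)
      moreover have "\<bar>\<theta> X Y * rhs_p c sv X Y\<bar> <= C * \<bar>cp sv X Y\<bar>" unfolding rp by (rule ab, rule C(2)) (use h in auto)
      ultimately show "\<exists>D. has_dX (\<lambda>X Y. cp sv Y X) D Y X \<and> \<bar>D\<bar> <= C * \<bar>cp sv X Y\<bar>" by blast
    qed
    then show "\<exists>C\<ge>0. AE Y in lborel. AE X in lborel. 0 < X + Y \<and> \<bar>X\<bar> <= r \<and> \<bar>Y\<bar> <= r -->
               (\<exists>D. has_dX (\<lambda>X Y. cp sv Y X) D X Y \<and> \<bar>D\<bar> <= C * \<bar>cp sv Y X\<bar>)" using C(1) by blast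
  qed
qed

end

section \<open>The map to the physical plane\<close>

lemma increasing_open_deriv:
  fixes f :: "real => real"
  assumes ab: "a <= b" and cf: "continuous_on {a..b} f"
    and d: "\<And>x. a < x ==> x < b ==> (f has_real_derivative g x) (at x)"
    and g: "\<And>x. a < x ==> x < b ==> 0 <= g x"
  shows "f a <= f b" "a < \<xi> ==> \<xi> < b ==> 0 < g \<xi> ==> f a < f b"
proof -
  have mono: "f x <= f y" if "a <= x" "x <= y" "y <= b" for x y
  proof (rule DERIV_nonneg_imp_increasing_open[OF that(2)])
    show "\<exists>D. (f has_real_derivative D) (at s) \<and> 0 <= D" if "x < s" "s < y" for s
      using d[of s] g[of s] that \<open>a <= x\<close> \<open>y <= b\<close> by (intro exI[of _ "g s"]) auto
    show "continuous_on {x..y} f" by (rule continuous_on_subset[OF cf]) (use that in auto)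
  qed
  show "f a <= f b" by (rule mono) (use ab in auto)
  show "f a < f b" if \<xi>: "a < \<xi>" "\<xi> < b" "0 < g \<xi>"
  proof -
    obtain e where e: "e > 0" "\<And>h. 0 < h ==> h < e ==> f \<xi> < f (\<xi> + h)"
      using DERIV_pos_inc_right[OF d[OF \<xi>(1,2)] \<xi>(3)] by blast
    define h where "h = min (e / 2) (b - \<xi>)"
    have h: "0 < h" "h < e" "\<xi> + h <= b" using e(1) \<xi> by (auto simp: h_def)
    have "f a <= f \<xi>" by (rule mono) (use \<xi> in auto)
    also have "\<dots> < f (\<xi> + h)" by (rule e(2)[OF h(1,2)])
    also have "\<dots> <= f b" by (rule mono) (use \<xi> h in auto)
    finally show ?thesis .
  qed
qed

lemma one_plus_cos_nonneg: "0 <= 1 + cos (x::real)"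
  using cos_ge_minus_one[of x] by linarith

lemma one_plus_cos_pos: "cos (x::real) \<noteq> -1 ==> 0 < 1 + cos x"
  using cos_ge_minus_one[of x] by linarith

context char_sol
begin

lemma rhs_signs:
  assumes "0 <= X + Y"
  shows "0 <= rhs_xX sv X Y" "rhs_xY sv X Y <= 0" "0 <= rhs_tX c sv X Y" "0 <= rhs_tY c sv X Y"
    "cos (cw sv X Y) \<noteq> -1 ==> 0 < rhs_xX sv X Y" "cos (cw sv X Y) \<noteq> -1 ==> 0 < rhs_tX c sv X Y"
    "cos (cz sv X Y) \<noteq> -1 ==> rhs_xY sv X Y < 0" "cos (cz sv X Y) \<noteq> -1 ==> 0 < rhs_tY c sv X Y"
  using p_pos[OF assms] q_pos[OF assms] c_pos[of "cu sv X Y"]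
    one_plus_cos_nonneg[of "cw sv X Y"] one_plus_cos_nonneg[of "cz sv X Y"]
    one_plus_cos_pos[of "cw sv X Y"] one_plus_cos_pos[of "cz sv X Y"]
  unfolding rhs_xX_def rhs_xY_def rhs_tX_def rhs_tY_def
  by (auto intro!: divide_nonneg_pos divide_pos_pos mult_nonneg_nonneg mult_pos_pos)

lemma rhs_x_t: "rhs_xX sv X Y = c (cu sv X Y) * rhs_tX c sv X Y" "rhs_xY sv X Y = - c (cu sv X Y) * rhs_tY c sv X Y"
  using c_ne by (auto simp: rhs_xX_def rhs_xY_def rhs_tX_def rhs_tY_def)

text \<open>Both derivatives carry the factor \<open>1 + cos w\<close>, which is nonnegative and vanishes only where \<open>w\<close> is \<open>\<pi>\<close> modulo \<open>2 \<pi>\<close>; one nondegenerate point on the way makes the increase strict.\<close>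

lemma mono_X:
  assumes "0 <= X1 + Y" "X1 <= X2"
  shows "cx sv X1 Y <= cx sv X2 Y" "ct sv X1 Y <= ct sv X2 Y"
    "X1 < \<xi> ==> \<xi> < X2 ==> cos (cw sv \<xi> Y) \<noteq> -1 ==> cx sv X1 Y < cx sv X2 Y"
    "X1 < \<xi> ==> \<xi> < X2 ==> cos (cw sv \<xi> Y) \<noteq> -1 ==> ct sv X1 Y < ct sv X2 Y"
proof -
  have cx: "continuous_on {X1..X2} (\<lambda>X. cx sv X Y)" by (rule continuous_on_half_plane_line[OF cont_vars(6) assms(1)])
  have ct: "continuous_on {X1..X2} (\<lambda>X. ct sv X Y)" by (rule continuous_on_half_plane_line[OF cont_vars(7) assms(1)])
  have dx: "((\<lambda>X. cx sv X Y) has_real_derivative rhs_xX sv X Y) (at X)" if "X1 < X" for X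
    using C1(3)[of X Y] that assms(1) unfolding has_dX_def by simp
  have dt: "((\<lambda>X. ct sv X Y) has_real_derivative rhs_tX c sv X Y) (at X)" if "X1 < X" for X
    using C1(5)[of X Y] that assms(1) unfolding has_dX_def by simp
  have px: "0 <= rhs_xX sv X Y" "0 <= rhs_tX c sv X Y" if "X1 < X" for X
    using rhs_signs(1,3)[of X Y] that assms(1) by auto
  show "cx sv X1 Y <= cx sv X2 Y"
    by (rule increasing_open_deriv(1)[where f="\<lambda>X. cx sv X Y", OF assms(2) cx dx px(1)])
  show "ct sv X1 Y <= ct sv X2 Y"
    by (rule increasing_open_deriv(1)[where f="\<lambda>X. ct sv X Y", OF assms(2) ct dt px(2)])
  assume \<xi>: "X1 < \<xi>" "\<xi> < X2" "cos (cw sv \<xi> Y) \<noteq> -1"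
  then have s: "0 < rhs_xX sv \<xi> Y" "0 < rhs_tX c sv \<xi> Y" using rhs_signs(5,6)[of \<xi> Y] assms(1) by auto
  show "cx sv X1 Y < cx sv X2 Y"
    by (rule increasing_open_deriv(2)[where f="\<lambda>X. cx sv X Y", OF assms(2) cx dx px(1) \<xi>(1,2) s(1)])
  show "ct sv X1 Y < ct sv X2 Y"
    by (rule increasing_open_deriv(2)[where f="\<lambda>X. ct sv X Y", OF assms(2) ct dt px(2) \<xi>(1,2) s(2)])
qed

lemma mono_Y:
  assumes "0 <= X + Y1" "Y1 <= Y2"
  shows "cx sv X Y2 <= cx sv X Y1" "ct sv X Y1 <= ct sv X Y2"
    "Y1 < \<xi> ==> \<xi> < Y2 ==> cos (cz sv X \<xi>) \<noteq> -1 ==> cx sv X Y2 < cx sv X Y1"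
    "Y1 < \<xi> ==> \<xi> < Y2 ==> cos (cz sv X \<xi>) \<noteq> -1 ==> ct sv X Y1 < ct sv X Y2"
proof -
  have cx: "continuous_on {Y1..Y2} (\<lambda>Y. - cx sv X Y)"
    by (intro continuous_on_minus continuous_on_half_plane_vline[OF cont_vars(6) assms(1)])
  have ct: "continuous_on {Y1..Y2} (\<lambda>Y. ct sv X Y)" by (rule continuous_on_half_plane_vline[OF cont_vars(7) assms(1)])
  have dx: "((\<lambda>Y. - cx sv X Y) has_real_derivative - rhs_xY sv X Y) (at Y)" if "Y1 < Y" for Y
    using C1(4)[of X Y] that assms(1) unfolding has_dY_def by (intro DERIV_minus) simp
  have dt: "((\<lambda>Y. ct sv X Y) has_real_derivative rhs_tY c sv X Y) (at Y)" if "Y1 < Y" for Y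
    using C1(6)[of X Y] that assms(1) unfolding has_dY_def by simp
  have px: "0 <= - rhs_xY sv X Y" "0 <= rhs_tY c sv X Y" if "Y1 < Y" for Y
    using rhs_signs(2,4)[of X Y] that assms(1) by auto
  show "cx sv X Y2 <= cx sv X Y1"
    using increasing_open_deriv(1)[where f="\<lambda>Y. - cx sv X Y", OF assms(2) cx dx px(1)] by simp
  show "ct sv X Y1 <= ct sv X Y2"
    by (rule increasing_open_deriv(1)[where f="\<lambda>Y. ct sv X Y", OF assms(2) ct dt px(2)])
  assume \<xi>: "Y1 < \<xi>" "\<xi> < Y2" "cos (cz sv X \<xi>) \<noteq> -1"
  then have s: "0 < - rhs_xY sv X \<xi>" "0 < rhs_tY c sv X \<xi>" using rhs_signs(7,8)[of X \<xi>] assms(1) by auto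
  show "cx sv X Y2 < cx sv X Y1"
    using increasing_open_deriv(2)[where f="\<lambda>Y. - cx sv X Y", OF assms(2) cx dx px(1) \<xi>(1,2) s(1)] by simp
  show "ct sv X Y1 < ct sv X Y2"
    by (rule increasing_open_deriv(2)[where f="\<lambda>Y. ct sv X Y", OF assms(2) ct dt px(2) \<xi>(1,2) s(2)])
qed

lemma t_nonneg: "0 <= X + Y ==> 0 <= ct sv X Y"
  using mono_X(2)[of "-Y" Y X] bdry_vals(2)[of "-Y"] by simp

lemma t_pos_imp_interior: "0 <= X + Y ==> 0 < ct sv X Y ==> 0 < X + Y"
  using bdry_vals(2)[of X] by (cases "X + Y = 0") (auto simp: eq_neg_iff_add_eq_0[symmetric] add.commute minus_equation_iff)

text \<open>By monotonicity the image of a point outside a rectangle around the segment is separated from the image of the segment in one of the four directions, with a margin given by the sides of the rectangle. The map may be degenerate on the segment itself, which is collapsed to a point, as long as there are nondegenerate points arbitrarily close to its ends.\<close>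

lemma localise:
  assumes hp: "0 < X1 + Y" and X12: "X1 <= X2"
    and eq: "cx sv X2 Y = cx sv X1 Y" "ct sv X2 Y = ct sv X1 Y"
    and right: "\<And>r. 0 < r ==> \<exists>\<xi>>X2. \<xi> < X2 + r \<and> cos (cw sv \<xi> Y) \<noteq> -1"
    and left: "\<And>r. 0 < r ==> \<exists>\<xi><X1. X1 - r < \<xi> \<and> cos (cw sv \<xi> Y) \<noteq> -1"
    and up: "\<And>r. 0 < r ==> \<exists>\<xi>>Y. \<xi> < Y + r \<and> cos (cz sv X1 \<xi>) \<noteq> -1"
    and down: "\<And>r. 0 < r ==> \<exists>\<xi><Y. Y - r < \<xi> \<and> cos (cz sv X2 \<xi>) \<noteq> -1"
    and r0: "0 < r0"
  obtains m where "0 < m" "\<And>A B. 0 <= A + B ==> \<bar>cx sv A B - cx sv X1 Y\<bar> < m ==> \<bar>ct sv A B - ct sv X1 Y\<bar> < m ==>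
     X1 - r0 < A \<and> A < X2 + r0 \<and> Y - r0 < B \<and> B < Y + r0"
proof -
  define r where "r = min r0 (X1 + Y)"
  have r: "0 < r" "r <= r0" "0 <= (X1 - r) + Y" using hp r0 by (auto simp: r_def)
  have hp': "0 <= X2 + (Y - r)" "0 <= X2 + Y" "0 <= X1 + Y" using r(3) X12 hp by auto
  let ?x = "cx sv X1 Y" and ?t = "ct sv X1 Y"
  have R: "?x < cx sv (X2 + r) Y" "?t < ct sv (X2 + r) Y"
    using right[OF r(1)] mono_X(3,4)[of X2 Y "X2 + r"] hp' r(1) unfolding eq[symmetric] by auto
  have L: "cx sv (X1 - r) Y < ?x" "ct sv (X1 - r) Y < ?t"
    using left[OF r(1)] mono_X(3,4)[of "X1 - r" Y X1] r by auto
  have Up: "cx sv X1 (Y + r) < ?x" "?t < ct sv X1 (Y + r)"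
    using up[OF r(1)] mono_Y(3,4)[of X1 Y "Y + r"] r hp' by auto
  have D: "?x < cx sv X2 (Y - r)" "ct sv X2 (Y - r) < ?t"
    using down[OF r(1)] mono_Y(3,4)[of X2 "Y - r" Y] r hp' unfolding eq[symmetric] by auto
  define M where "M = {cx sv (X2 + r) Y - ?x, ct sv (X2 + r) Y - ?t, ?x - cx sv (X1 - r) Y, ?t - ct sv (X1 - r) Y,
     ?x - cx sv X1 (Y + r), ct sv X1 (Y + r) - ?t, cx sv X2 (Y - r) - ?x, ?t - ct sv X2 (Y - r)}"
  have M: "finite M" "M \<noteq> {}" "\<And>a. a \<in> M ==> 0 < a" using R L Up D by (auto simp: M_def)
  show thesis
  proof (rule that[of "Min M"])
    show "0 < Min M" using M by simp
    fix A B assume hAB: "0 <= A + B" and a: "\<bar>cx sv A B - ?x\<bar> < Min M" and b: "\<bar>ct sv A B - ?t\<bar> < Min M"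
    have lt: "cx sv A B - ?x < e" "?x - cx sv A B < e" "ct sv A B - ?t < e" "?t - ct sv A B < e" if "e \<in> M" for e
      using Min_le[OF M(1) that] a b by linarith+
    have M1: "cx sv (X2 + r) Y - ?x \<in> M" "ct sv (X2 + r) Y - ?t \<in> M" "?x - cx sv (X1 - r) Y \<in> M" "?t - ct sv (X1 - r) Y \<in> M"
     "?x - cx sv X1 (Y + r) \<in> M" "ct sv X1 (Y + r) - ?t \<in> M" "cx sv X2 (Y - r) - ?x \<in> M" "?t - ct sv X2 (Y - r) \<in> M"
      by (auto simp: M_def)
    have "A < X2 + r"
    proof (rule ccontr)
      assume n: "\<not> A < X2 + r"
      show False
      proof (cases "Y <= B")
        case True
        have "ct sv (X2 + r) Y <= ct sv A Y" by (rule mono_X(2)) (use n hp' r in auto)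
        also have "\<dots> <= ct sv A B" by (rule mono_Y(2)) (use n hp' r True in auto)
        finally show False using lt(3)[OF M1(2)] by simp
      next
        case False
        have "cx sv (X2 + r) Y <= cx sv A Y" by (rule mono_X(1)) (use n hp' r in auto)
        also have "\<dots> <= cx sv A B" by (rule mono_Y(1)) (use hAB False in auto)
        finally show False using lt(1)[OF M1(1)] by simp
      qed
    qed
    moreover have "X1 - r < A"
    proof (rule ccontr)
      assume n: "\<not> X1 - r < A"
      show False
      proof (cases "Y <= B")
        case True
        have "cx sv A B <= cx sv (X1 - r) B" by (rule mono_X(1)) (use n hAB in auto)
        also have "\<dots> <= cx sv (X1 - r) Y" by (rule mono_Y(1)) (use r True in auto)
        finally show False using lt(2)[OF M1(3)] by simp
      next
        case False
        have "ct sv A B <= ct sv A Y" by (rule mono_Y(2)) (use hAB False in auto)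
        also have "\<dots> <= ct sv (X1 - r) Y" by (rule mono_X(2)) (use hAB False n in auto)
        finally show False using lt(4)[OF M1(4)] by simp
      qed
    qed
    moreover have "B < Y + r"
    proof (rule ccontr)
      assume n: "\<not> B < Y + r"
      show False
      proof (cases "X1 <= A")
        case True
        have "ct sv X1 (Y + r) <= ct sv X1 B" by (rule mono_Y(2)) (use n hp' r in auto)
        also have "\<dots> <= ct sv A B" by (rule mono_X(2)) (use n hp' r True in auto)
        finally show False using lt(3)[OF M1(6)] by simp
      next
        case False
        have "cx sv A B <= cx sv X1 B" by (rule mono_X(1)) (use hAB False in auto)
        also have "\<dots> <= cx sv X1 (Y + r)" by (rule mono_Y(1)) (use n hp' r in auto)
        finally show False using lt(2)[OF M1(5)] by simp
      qed
    qed
    moreover have "Y - r < B"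
    proof (rule ccontr)
      assume n: "\<not> Y - r < B"
      show False
      proof (cases "A <= X2")
        case True
        have "ct sv A B <= ct sv X2 B" by (rule mono_X(2)) (use hAB True in auto)
        also have "\<dots> <= ct sv X2 (Y - r)" by (rule mono_Y(2)) (use n hAB True in auto)
        finally show False using lt(4)[OF M1(8)] by simp
      next
        case False
        have "cx sv X2 (Y - r) <= cx sv A (Y - r)" by (rule mono_X(1)) (use hp' False in auto)
        also have "\<dots> <= cx sv A B" by (rule mono_Y(1)) (use hAB n in auto)
        finally show False using lt(1)[OF M1(7)] by simp
      qed
    qed
    ultimately show "X1 - r0 < A \<and> A < X2 + r0 \<and> Y - r0 < B \<and> B < Y + r0" using r(2) by linarith
  qed
qed

text \<open>The points where the map to the \<open>(x, t)\<close> plane has an invertible derivative.\<close>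

definition reg :: "real => real => bool" where
  "reg X Y \<longleftrightarrow> 0 < X + Y \<and> cos (cw sv X Y) \<noteq> -1 \<and> cos (cz sv X Y) \<noteq> -1"

lemma reg_nhd:
  assumes "reg X Y"
  obtains r where "0 < r" "\<And>X' Y'. \<bar>X' - X\<bar> <= r ==> \<bar>Y' - Y\<bar> <= r ==> reg X' Y'"
proof -
  have hp: "0 < X + Y" and w: "cos (cw sv X Y) \<noteq> -1" and z: "cos (cz sv X Y) \<noteq> -1" using assms by (auto simp: reg_def)
  have cw: "continuous_on half_plane (\<lambda>(X, Y). cos (cw sv X Y))" and cz: "continuous_on half_plane (\<lambda>(X, Y). cos (cz sv X Y))"
    unfolding split_def by (intro continuous_intros cont_fst_snd)+
  have ew: "0 < (1 + cos (cw sv X Y)) / 2" and ez: "0 < (1 + cos (cz sv X Y)) / 2"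
    using one_plus_cos_pos[OF w] one_plus_cos_pos[OF z] by auto
  obtain r1 where r1: "0 < r1" "\<And>X' Y'. \<bar>X' - X\<bar> <= r1 ==> \<bar>Y' - Y\<bar> <= r1 ==> 0 < X' + Y' \<and> \<bar>cos (cw sv X' Y') - cos (cw sv X Y)\<bar> <= (1 + cos (cw sv X Y)) / 2"
    using continuous_half_plane_box[OF cw hp ew] by blast
  obtain r2 where r2: "0 < r2" "\<And>X' Y'. \<bar>X' - X\<bar> <= r2 ==> \<bar>Y' - Y\<bar> <= r2 ==> 0 < X' + Y' \<and> \<bar>cos (cz sv X' Y') - cos (cz sv X Y)\<bar> <= (1 + cos (cz sv X Y)) / 2"
    using continuous_half_plane_box[OF cz hp ez] by blast
  show thesis
  proof (rule that[of "min r1 r2"])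
    show "0 < min r1 r2" using r1(1) r2(1) by simp
    fix X' Y' assume a: "\<bar>X' - X\<bar> <= min r1 r2" "\<bar>Y' - Y\<bar> <= min r1 r2"
    have "0 < X' + Y' \<and> \<bar>cos (cw sv X' Y') - cos (cw sv X Y)\<bar> <= (1 + cos (cw sv X Y)) / 2" using r1(2) a by simp
    moreover have "\<bar>cos (cz sv X' Y') - cos (cz sv X Y)\<bar> <= (1 + cos (cz sv X Y)) / 2" using r2(2) a by simp
    ultimately show "reg X' Y'" using ew ez unfolding reg_def by (auto simp: abs_le_iff)
  qed
qed

lemma localise_reg:
  assumes "reg X Y" "0 < r0"
  obtains m where "0 < m" "\<And>A B. 0 <= A + B ==> \<bar>cx sv A B - cx sv X Y\<bar> < m ==> \<bar>ct sv A B - ct sv X Y\<bar> < m ==>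
     \<bar>A - X\<bar> < r0 \<and> \<bar>B - Y\<bar> < r0"
proof -
  obtain s where s: "0 < s" "\<And>X' Y'. \<bar>X' - X\<bar> <= s ==> \<bar>Y' - Y\<bar> <= s ==> reg X' Y'" using reg_nhd[OF assms(1)] by blast
  have ex: "\<exists>h>0. h < r \<and> h <= s" if "0 < r" for r :: real
    by (rule exI[of _ "min (r / 2) s"]) (use that s(1) in auto)
  have hp: "0 < X + Y" using assms(1) by (simp add: reg_def)
  obtain m where m: "0 < m" "\<And>A B. 0 <= A + B ==> \<bar>cx sv A B - cx sv X Y\<bar> < m ==> \<bar>ct sv A B - ct sv X Y\<bar> < m ==>
     X - r0 < A \<and> A < X + r0 \<and> Y - r0 < B \<and> B < Y + r0"
  proof (rule localise[OF hp order_refl refl refl _ _ _ _ assms(2)])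
    fix r :: real assume "0 < r"
    then obtain h where h: "0 < h" "h < r" "h <= s" using ex by blast
    show "\<exists>\<xi>>X. \<xi> < X + r \<and> cos (cw sv \<xi> Y) \<noteq> -1"
      using s(2)[of "X + h" Y] h s(1) by (intro exI[of _ "X + h"]) (auto simp: reg_def)
    show "\<exists>\<xi><X. X - r < \<xi> \<and> cos (cw sv \<xi> Y) \<noteq> -1"
      using s(2)[of "X - h" Y] h s(1) by (intro exI[of _ "X - h"]) (auto simp: reg_def)
    show "\<exists>\<xi>>Y. \<xi> < Y + r \<and> cos (cz sv X \<xi>) \<noteq> -1"
      using s(2)[of X "Y + h"] h s(1) by (intro exI[of _ "Y + h"]) (auto simp: reg_def)
    show "\<exists>\<xi><Y. Y - r < \<xi> \<and> cos (cz sv X \<xi>) \<noteq> -1"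
      using s(2)[of X "Y - h"] h s(1) by (intro exI[of _ "Y - h"]) (auto simp: reg_def)
  qed blast
  show thesis
    by (rule that[OF m(1)]) (use m(2) in \<open>force simp: abs_less_iff\<close>)
qed

lemma reg_unique_preimage:
  assumes "reg X Y" "0 <= A + B" "cx sv A B = cx sv X Y" "ct sv A B = ct sv X Y"
  shows "A = X" "B = Y"
proof -
  have *: "\<bar>A - X\<bar> < r \<and> \<bar>B - Y\<bar> < r" if r: "0 < r" for r
  proof -
    obtain m where "0 < m" "\<And>A B. 0 <= A + B ==> \<bar>cx sv A B - cx sv X Y\<bar> < m ==> \<bar>ct sv A B - ct sv X Y\<bar> < m ==>
       \<bar>A - X\<bar> < r \<and> \<bar>B - Y\<bar> < r" using localise_reg[OF assms(1) r] by blast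
    then show ?thesis using assms(2-4) by simp
  qed
  show "A = X" using *[of "\<bar>A - X\<bar>"] by (cases "A = X") auto
  show "B = Y" using *[of "\<bar>B - Y\<bar>"] by (cases "B = Y") auto
qed

end

locale char_graph = char_sol +
  fixes U :: "real => real => real"
  assumes graph: "is_graph_of U sv"
begin

lemma U_eq: "0 <= X + Y ==> U (cx sv X Y) (ct sv X Y) = cu sv X Y"
proof -
  assume "0 <= X + Y"
  then have "(cx sv X Y, ct sv X Y, cu sv X Y) \<in> {(x, t, U x t) | x t. 0 <= t}"
    using graph unfolding is_graph_of_def half_plane_def by blast
  then show ?thesis by auto
qed

lemma ex_preimage: "0 <= t ==> \<exists>P. 0 <= fst P + snd P \<and> cx sv (fst P) (snd P) = x \<and> ct sv (fst P) (snd P) = t"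
proof -
  assume "0 <= t"
  then have "(x, t, U x t) \<in> {(cx sv X Y, ct sv X Y, cu sv X Y) | X Y. (X, Y) \<in> half_plane}"
    using graph unfolding is_graph_of_def by blast
  then obtain X Y where "0 <= X + Y" "cx sv X Y = x" "ct sv X Y = t" by (auto simp: half_plane_def)
  then show ?thesis by (intro exI[of _ "(X, Y)"]) simp
qed

text \<open>A preimage under the map to the \<open>(x, t)\<close> plane. It is uniquely determined at regular points; elsewhere any choice will do, as \<open>u\<close> is the same at all preimages.\<close>

definition pre :: "real => real => real \<times> real" where
  "pre x t = (SOME P. 0 <= fst P + snd P \<and> cx sv (fst P) (snd P) = x \<and> ct sv (fst P) (snd P) = t)"

lemma pre:
  assumes "0 <= t"
  shows "0 <= fst (pre x t) + snd (pre x t)" "cx sv (fst (pre x t)) (snd (pre x t)) = x" "ct sv (fst (pre x t)) (snd (pre x t)) = t"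
  using someI_ex[OF ex_preimage[OF assms, of x]] unfolding pre_def by blast+

lemma U_pre: "0 <= t ==> U x t = cu sv (fst (pre x t)) (snd (pre x t))"
  using U_eq[of "fst (pre x t)" "snd (pre x t)"] pre[of t x] by simp

lemma pre_reg: "reg X Y ==> pre (cx sv X Y) (ct sv X Y) = (X, Y)"
proof -
  assume r: "reg X Y"
  then have t: "0 <= ct sv X Y" by (intro t_nonneg) (simp add: reg_def)
  show ?thesis using reg_unique_preimage[OF r pre[OF t]] by (simp add: prod_eq_iff)
qed

text \<open>The inverse of the derivative of the map to the \<open>(x, t)\<close> plane.\<close>

definition inv_jac :: "real => real => real \<times> real => real \<times> real" where
  "inv_jac X Y = (\<lambda>(h, k). ((k + h / c (cu sv X Y)) / (2 * rhs_tX c sv X Y), (k - h / c (cu sv X Y)) / (2 * rhs_tY c sv X Y)))"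

text \<open>Localisation makes the chosen preimage continuous, and a continuous inverse of a map with invertible derivative is differentiable.\<close>

lemma pre_has_derivative:
  assumes r: "reg X Y" and t: "0 < ct sv X Y"
  shows "((\<lambda>(x, t). pre x t) has_derivative inv_jac X Y) (at (cx sv X Y, ct sv X Y))"
proof (rule has_derivative_inverse_basic[where f="\<lambda>(X, Y). (cx sv X Y, ct sv X Y)" and T="{p. 0 < snd p}" and
      f'="\<lambda>(a, b). (rhs_xX sv X Y * a + rhs_xY sv X Y * b, rhs_tX c sv X Y * a + rhs_tY c sv X Y * b)"])
  have hp: "0 < X + Y" using r by (simp add: reg_def)
  have pr: "(case (cx sv X Y, ct sv X Y) of (x, t) => pre x t) = (X, Y)" using pre_reg[OF r] by simp
  show "((\<lambda>(X, Y). (cx sv X Y, ct sv X Y)) has_derivative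
     (\<lambda>(a, b). (rhs_xX sv X Y * a + rhs_xY sv X Y * b, rhs_tX c sv X Y * a + rhs_tY c sv X Y * b)))
     (at (case (cx sv X Y, ct sv X Y) of (x, t) => pre x t))"
    unfolding pr using has_derivative_Pair[OF C1(8)[OF hp] C1(9)[OF hp]] by (simp add: split_def)
  show "bounded_linear (inv_jac X Y)"
    unfolding inv_jac_def split_def divide_inverse
    by (intro bounded_linear_Pair bounded_linear_mult_const bounded_linear_add bounded_linear_sub bounded_linear_fst bounded_linear_snd)
  have ne: "rhs_tX c sv X Y \<noteq> 0" "rhs_tY c sv X Y \<noteq> 0" "c (cu sv X Y) \<noteq> 0"
    using rhs_signs(6,8)[of X Y] r c_ne unfolding reg_def by auto
  show "inv_jac X Y \<circ> (\<lambda>(a, b). (rhs_xX sv X Y * a + rhs_xY sv X Y * b, rhs_tX c sv X Y * a + rhs_tY c sv X Y * b)) = id"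
    unfolding rhs_x_t inv_jac_def using ne by (auto simp: fun_eq_iff field_simps)
  show "open {p :: real \<times> real. 0 < snd p}"
    by (intro open_Collect_less continuous_intros)
  show "(cx sv X Y, ct sv X Y) \<in> {p. 0 < snd p}" using t by simp
  show "(\<lambda>(X, Y). (cx sv X Y, ct sv X Y)) (case p of (x, t) => pre x t) = p" if "p \<in> {p. 0 < snd p}" for p
    using that pre[of "snd p" "fst p"] by (cases p) (auto simp: split_def)
  show "continuous (at (cx sv X Y, ct sv X Y)) (\<lambda>(x, t). pre x t)"
    unfolding continuous_at_eps_delta
  proof (intro allI impI)
    fix e :: real assume e: "0 < e"
    then have e2: "0 < e / 2" by simp
    obtain m where m: "0 < m" "\<And>A B. 0 <= A + B ==> \<bar>cx sv A B - cx sv X Y\<bar> < m ==> \<bar>ct sv A B - ct sv X Y\<bar> < m ==>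
       \<bar>A - X\<bar> < e / 2 \<and> \<bar>B - Y\<bar> < e / 2" using localise_reg[OF r e2] by blast
    show "\<exists>d>0. \<forall>p. dist p (cx sv X Y, ct sv X Y) < d -->
        dist (case p of (x, t) => pre x t) (case (cx sv X Y, ct sv X Y) of (x, t) => pre x t) < e"
    proof (intro exI[of _ "min m (ct sv X Y)"] conjI allI impI)
      show "0 < min m (ct sv X Y)" using m t by simp
      fix p assume p: "dist p (cx sv X Y, ct sv X Y) < min m (ct sv X Y)"
      obtain x' t' where pp: "p = (x', t')" by (cases p)
      have d: "\<bar>x' - cx sv X Y\<bar> < m" "\<bar>t' - ct sv X Y\<bar> < m" "\<bar>t' - ct sv X Y\<bar> < ct sv X Y"
        using p dist_fst_le[of p "(cx sv X Y, ct sv X Y)"] dist_snd_le[of p "(cx sv X Y, ct sv X Y)"]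
        by (auto simp: pp dist_real_def)
      then have t': "0 <= t'" by linarith
      have "\<bar>fst (pre x' t') - X\<bar> < e / 2 \<and> \<bar>snd (pre x' t') - Y\<bar> < e / 2"
        by (rule m(2)) (use pre[OF t', of x'] d in auto)
      moreover have "dist (pre x' t') (X, Y) <= \<bar>fst (pre x' t') - X\<bar> + \<bar>snd (pre x' t') - Y\<bar>"
        using norm_Pair_le[of "fst (pre x' t') - X" "snd (pre x' t') - Y"] by (simp add: dist_norm minus_prod_def)
      ultimately show "dist (case p of (x, t) => pre x t) (case (cx sv X Y, ct sv X Y) of (x, t) => pre x t) < e"
        unfolding pr by (simp add: pp)
    qed
  qed
qed

lemma pre_deriv:
  assumes r: "reg X Y" and t: "0 < ct sv X Y"
  shows "((\<lambda>x. fst (pre x (ct sv X Y))) has_real_derivative 2 / ((1 + cos (cw sv X Y)) * cp sv X Y)) (at (cx sv X Y))"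
    "((\<lambda>x. snd (pre x (ct sv X Y))) has_real_derivative - 2 / ((1 + cos (cz sv X Y)) * cq sv X Y)) (at (cx sv X Y))"
proof -
  have i: "((\<lambda>x. (x, ct sv X Y)) has_derivative (\<lambda>h. (h, 0))) (at (cx sv X Y))"
    by (intro has_derivative_Pair has_derivative_ident has_derivative_const)
  have d: "((\<lambda>x. pre x (ct sv X Y)) has_derivative (\<lambda>h. inv_jac X Y (h, 0))) (at (cx sv X Y))"
    using has_derivative_compose[OF i pre_has_derivative[OF r t]] by simp
  have hp: "0 <= X + Y" using r by (simp add: reg_def)
  have ne: "c (cu sv X Y) \<noteq> 0" "1 + cos (cw sv X Y) \<noteq> 0" "1 + cos (cz sv X Y) \<noteq> 0" "cp sv X Y \<noteq> 0" "cq sv X Y \<noteq> 0"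
    using r c_ne p_pos[OF hp] q_pos[OF hp] one_plus_cos_pos[of "cw sv X Y"] one_plus_cos_pos[of "cz sv X Y"] unfolding reg_def by auto
  have e1: "fst (inv_jac X Y (1, 0)) = 2 / ((1 + cos (cw sv X Y)) * cp sv X Y)"
    using ne by (simp add: inv_jac_def rhs_tX_def divide_simps)
  have e2: "snd (inv_jac X Y (1, 0)) = - 2 / ((1 + cos (cz sv X Y)) * cq sv X Y)"
    using ne by (simp add: inv_jac_def rhs_tY_def divide_simps)
  show "((\<lambda>x. fst (pre x (ct sv X Y))) has_real_derivative 2 / ((1 + cos (cw sv X Y)) * cp sv X Y)) (at (cx sv X Y))"
    using has_derivative_eq_deriv_times(1)[OF has_derivative_fst[OF d]] unfolding e1 .
  show "((\<lambda>x. snd (pre x (ct sv X Y))) has_real_derivative - 2 / ((1 + cos (cz sv X Y)) * cq sv X Y)) (at (cx sv X Y))"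
    using has_derivative_eq_deriv_times(1)[OF has_derivative_snd[OF d]] unfolding e2 .
qed

lemma DERIV_along_pre:
  assumes r: "reg X Y" and t: "0 < ct sv X Y"
    and F: "((\<lambda>(X, Y). F X Y) has_derivative (\<lambda>(a, b). FX * a + FY * b)) (at (X, Y))"
  shows "((\<lambda>x. F (fst (pre x (ct sv X Y))) (snd (pre x (ct sv X Y)))) has_real_derivative
      2 * FX / ((1 + cos (cw sv X Y)) * cp sv X Y) - 2 * FY / ((1 + cos (cz sv X Y)) * cq sv X Y)) (at (cx sv X Y))"
proof -
  have F': "((\<lambda>(X, Y). F X Y) has_derivative (\<lambda>(a, b). FX * a + FY * b))
      (at (fst (pre (cx sv X Y) (ct sv X Y)), snd (pre (cx sv X Y) (ct sv X Y))))"
    using F pre_reg[OF r] by simp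
  have d: "((\<lambda>x. (fst (pre x (ct sv X Y)), snd (pre x (ct sv X Y)))) has_derivative
      (\<lambda>h. (2 / ((1 + cos (cw sv X Y)) * cp sv X Y) * h, - 2 / ((1 + cos (cz sv X Y)) * cq sv X Y) * h))) (at (cx sv X Y))"
    by (intro has_derivative_Pair pre_deriv[OF r t, unfolded has_field_derivative_def])
  have "((\<lambda>x. F (fst (pre x (ct sv X Y))) (snd (pre x (ct sv X Y)))) has_derivative
     (\<lambda>h. FX * (2 / ((1 + cos (cw sv X Y)) * cp sv X Y) * h) + FY * (- 2 / ((1 + cos (cz sv X Y)) * cq sv X Y) * h))) (at (cx sv X Y))"
    using has_derivative_compose[OF d F'] by (simp add: split_def)
  from has_derivative_eq_deriv_times(1)[OF this] show ?thesis by (simp add: mult.commute)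
qed

text \<open>This is \<open>(tan (w/2) - tan (z/2)) / (2 c)\<close>.\<close>

definition slope :: "real => real => real" where
  "slope X Y = (sin (cw sv X Y) / (1 + cos (cw sv X Y)) - sin (cz sv X Y) / (1 + cos (cz sv X Y))) / (2 * c (cu sv X Y))"

lemma U_deriv:
  assumes r: "reg X Y" and t: "0 < ct sv X Y"
  shows "((\<lambda>x. U x (ct sv X Y)) has_real_derivative slope X Y) (at (cx sv X Y))"
proof -
  have hp: "0 < X + Y" using r by (simp add: reg_def)
  then have hp0: "0 <= X + Y" by simp
  have ne: "c (cu sv X Y) \<noteq> 0" "1 + cos (cw sv X Y) \<noteq> 0" "1 + cos (cz sv X Y) \<noteq> 0" "cp sv X Y \<noteq> 0" "cq sv X Y \<noteq> 0"
    using r c_ne p_pos[OF hp0] q_pos[OF hp0] one_plus_cos_pos[of "cw sv X Y"] one_plus_cos_pos[of "cz sv X Y"] unfolding reg_def by auto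
  have "2 * rhs_uX c sv X Y / ((1 + cos (cw sv X Y)) * cp sv X Y) - 2 * rhs_uY c sv X Y / ((1 + cos (cz sv X Y)) * cq sv X Y) = slope X Y"
    using ne by (simp add: rhs_uX_def rhs_uY_def slope_def divide_simps)
  moreover have "(\<lambda>x. U x (ct sv X Y)) = (\<lambda>x. cu sv (fst (pre x (ct sv X Y))) (snd (pre x (ct sv X Y))))"
    using U_pre t by (intro ext) simp
  ultimately show ?thesis using DERIV_along_pre[OF r t C1(7)[OF hp]] by simp
qed

end

section \<open>Uniqueness as long as no angle reaches the critical value\<close>

lemma eq_pi_mod_iff_cos: "eq_pi_mod a \<longleftrightarrow> cos a = -1"
proof -
  have "cos a = -1 \<longleftrightarrow> cos (a - pi) = 1" by (auto simp: cos_diff)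
  also have "\<dots> \<longleftrightarrow> (\<exists>k::int. a - pi = real_of_int k * 2 * pi)" by (rule cos_one_2pi_int)
  also have "\<dots> \<longleftrightarrow> eq_pi_mod a" unfolding eq_pi_mod_def by (rule ex_cong1) (auto simp: algebra_simps)
  finally show ?thesis ..
qed

lemma C1_lipschitz_on_interval:
  fixes \<phi> :: "real => real"
  assumes \<phi>: "\<And>x. x \<in> {a..b} ==> (\<phi> has_real_derivative \<phi>' x) (at x)" and c: "continuous_on {a..b} \<phi>'"
  obtains L where "L-lipschitz_on {a..b} \<phi>"
proof -
  have "compact (\<phi>' ` {a..b})" by (intro compact_continuous_image c) auto
  then obtain M where M: "\<And>x. x \<in> {a..b} ==> \<bar>\<phi>' x\<bar> <= M"
    by (meson bounded_real compact_imp_bounded imageI)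
  show thesis
  proof (rule that[of "\<bar>M\<bar>"], rule lipschitz_onI)
    fix x y assume xy: "x \<in> {a..b}" "y \<in> {a..b}"
    have "norm (\<phi> x - \<phi> y) <= \<bar>M\<bar> * norm (x - y)"
    proof (rule field_differentiable_bound[where f'=\<phi>' and S="{a..b}"])
      show "(\<phi> has_real_derivative \<phi>' z) (at z within {a..b})" if "z \<in> {a..b}" for z
        by (rule has_field_derivative_at_within[OF \<phi>[OF that]])
      show "norm (\<phi>' z) <= \<bar>M\<bar>" if "z \<in> {a..b}" for z
        using M[OF that] by (simp add: order_trans[OF _ abs_ge_self])
    qed (use xy in auto)
    then show "dist (\<phi> x) (\<phi> y) <= \<bar>M\<bar> * dist x y" by (simp add: dist_norm)
  qed simp
qed

text \<open>Integrating the exponential weight from the boundary produces the factor \<open>1 / \<mu>\<close>, which becomes as small as desired for large \<open>\<mu>\<close>.\<close>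

lemma difference_growth_X:
  assumes c1: "continuous_on half_plane (\<lambda>(X, Y). f X Y)" and c2: "continuous_on half_plane (\<lambda>(X, Y). g X Y)"
    and l1: "loc_lipschitz_X f" and l2: "loc_lipschitz_X g"
    and bd: "\<And>s. f s (-s) = g s (-s)"
    and down: "\<And>X Y X' Y'. P X Y ==> X' <= X ==> Y' <= Y ==> P X' Y'"
    and ae: "AE Y in lborel. AE X in lborel. 0 < X + Y \<and> P X Y -->
       (\<exists>d1 d2. has_dX f d1 X Y \<and> has_dX g d2 X Y \<and> \<bar>d1 - d2\<bar> <= M * exp (\<mu> * (X + Y)))"
    and \<mu>: "0 < \<mu>" and M: "0 <= M" and XY: "0 <= X + Y" "P X Y"
  shows "\<bar>f X Y - g X Y\<bar> <= M / \<mu> * exp (\<mu> * (X + Y))"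
proof -
  have one: "f X Y - g X Y - M / \<mu> * exp (\<mu> * (X + Y)) <= 0"
    if c1: "continuous_on half_plane (\<lambda>(X, Y). f X Y)" and c2: "continuous_on half_plane (\<lambda>(X, Y). g X Y)"
    and l1: "loc_lipschitz_X f" and l2: "loc_lipschitz_X g"
    and bd: "\<And>s. f s (-s) = g s (-s)"
    and ae: "AE Y in lborel. AE X in lborel. 0 < X + Y \<and> P X Y -->
       (\<exists>d1 d2. has_dX f d1 X Y \<and> has_dX g d2 X Y \<and> \<bar>d1 - d2\<bar> <= M * exp (\<mu> * (X + Y)))" for f g
  proof (cases "X + Y = 0")
    case True
    then have "X = - Y" by simp
    then show ?thesis using bd[of X] M \<mu> by simp
  next
    case False
    then have pos: "- X < Y" using XY by simp
    show ?thesis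
    proof (rule AE_imp_le_continuous[OF pos, where F="\<lambda>Y. f X Y - g X Y - M / \<mu> * exp (\<mu> * (X + Y))"])
      show "continuous_on {- X..Y} (\<lambda>Y. f X Y - g X Y - M / \<mu> * exp (\<mu> * (X + Y)))"
        by (intro continuous_intros continuous_on_half_plane_vline[OF c1] continuous_on_half_plane_vline[OF c2]) auto
      show "AE Y' in lborel. - X < Y' \<and> Y' < Y --> f X Y' - g X Y' - M / \<mu> * exp (\<mu> * (X + Y')) <= 0"
        using ae
      proof eventually_elim
        case (elim Y')
        show ?case
        proof
          assume Y': "- X < Y' \<and> Y' < Y"
          have le: "- Y' <= X" using Y' by simp
          obtain L1 where L1: "L1-lipschitz_on {-Y'..X} (\<lambda>X. f X Y')" using loc_lipschitz_X_line[OF l1, of "-Y'" Y'] by auto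
          obtain L2 where L2: "L2-lipschitz_on {-Y'..X} (\<lambda>X. g X Y')" using loc_lipschitz_X_line[OF l2, of "-Y'" Y'] by auto
          define b where "b x = M / \<mu> * exp (\<mu> * (x + Y'))" for x
          have db: "(b has_real_derivative M * exp (\<mu> * (x + Y'))) (at x)" for x
            unfolding b_def using \<mu> by (auto intro!: derivative_eq_intros)
          obtain L3 where L3: "L3-lipschitz_on {-Y'..X} b"
            by (rule C1_lipschitz_on_interval[of "-Y'" X b "\<lambda>x. M * exp (\<mu> * (x + Y'))"])
               (auto intro!: db continuous_intros)
          have "(f X Y' - g X Y' - b X) - (f (-Y') Y' - g (-Y') Y' - b (-Y')) <= 0 * (X - (- Y'))"
          proof (rule lipschitz_AE_deriv_le[OF le lipschitz_on_diff[OF lipschitz_on_diff[OF L1 L2] L3]])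
            show "AE x in lborel. - Y' < x \<and> x < X -->
               (\<exists>d. ((\<lambda>x. f x Y' - g x Y' - b x) has_real_derivative d) (at x) \<and> d <= 0)"
              using elim
            proof eventually_elim
              case (elim x)
              show ?case
              proof
                assume x: "- Y' < x \<and> x < X"
                have "P x Y'" by (rule down[OF XY(2)]) (use x Y' in auto)
                then obtain d1 d2 where d: "has_dX f d1 x Y'" "has_dX g d2 x Y'" "\<bar>d1 - d2\<bar> <= M * exp (\<mu> * (x + Y'))"
                  using elim x by auto
                have "((\<lambda>x. f x Y' - g x Y' - b x) has_real_derivative (d1 - d2 - M * exp (\<mu> * (x + Y')))) (at x)"
                  using d(1,2) unfolding has_dX_def by (intro DERIV_diff db)
                moreover have "d1 - d2 - M * exp (\<mu> * (x + Y')) <= 0" using d(3) by linarith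
                ultimately show "\<exists>d. ((\<lambda>x. f x Y' - g x Y' - b x) has_real_derivative d) (at x) \<and> d <= 0" by blast
              qed
            qed
          qed
          moreover have "f (-Y') Y' = g (-Y') Y'" using bd[of "-Y'"] by simp
          moreover have "0 <= b (-Y')" using M \<mu> by (simp add: b_def)
          ultimately show "f X Y' - g X Y' - M / \<mu> * exp (\<mu> * (X + Y')) <= 0" by (simp add: b_def)
        qed
      qed
    qed (use pos in auto)
  qed
  have ae': "AE Y in lborel. AE X in lborel. 0 < X + Y \<and> P X Y -->
       (\<exists>d1 d2. has_dX g d1 X Y \<and> has_dX f d2 X Y \<and> \<bar>d1 - d2\<bar> <= M * exp (\<mu> * (X + Y)))"
    using ae by eventually_elim (erule eventually_mono, metis abs_minus_commute)
  have "f X Y - g X Y - M / \<mu> * exp (\<mu> * (X + Y)) <= 0" by (rule one[OF c1 c2 l1 l2 bd ae])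
  moreover have "g X Y - f X Y - M / \<mu> * exp (\<mu> * (X + Y)) <= 0" by (rule one[OF c2 c1 l2 l1 bd[symmetric] ae'])
  ultimately show ?thesis by (simp add: abs_le_iff)
qed

lemma difference_growth_Y:
  assumes c1: "continuous_on half_plane (\<lambda>(X, Y). f X Y)" and c2: "continuous_on half_plane (\<lambda>(X, Y). g X Y)"
    and l1: "loc_lipschitz_Y f" and l2: "loc_lipschitz_Y g"
    and bd: "\<And>s. f s (-s) = g s (-s)"
    and down: "\<And>X Y X' Y'. P X Y ==> X' <= X ==> Y' <= Y ==> P X' Y'"
    and ae: "AE X in lborel. AE Y in lborel. 0 < X + Y \<and> P X Y -->
       (\<exists>d1 d2. has_dY f d1 X Y \<and> has_dY g d2 X Y \<and> \<bar>d1 - d2\<bar> <= M * exp (\<mu> * (X + Y)))"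
    and \<mu>: "0 < \<mu>" and M: "0 <= M" and XY: "0 <= X + Y" "P X Y"
  shows "\<bar>f X Y - g X Y\<bar> <= M / \<mu> * exp (\<mu> * (X + Y))"
proof -
  have "\<bar>(\<lambda>X Y. f Y X) Y X - (\<lambda>X Y. g Y X) Y X\<bar> <= M / \<mu> * exp (\<mu> * (Y + X))"
  proof (rule difference_growth_X[where P="\<lambda>X Y. P Y X"])
    show "continuous_on half_plane (\<lambda>(X, Y). f Y X)" "continuous_on half_plane (\<lambda>(X, Y). g Y X)"
      by (rule continuous_on_half_plane_swap[OF c1], rule continuous_on_half_plane_swap[OF c2])
    show "loc_lipschitz_X (\<lambda>X Y. f Y X)" "loc_lipschitz_X (\<lambda>X Y. g Y X)"
      unfolding loc_lipschitz_X_swap by (rule l1 l2)+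
    show "f (- s) s = g (- s) s" for s using bd[of "-s"] by simp
    show "AE Y in lborel. AE X in lborel. 0 < X + Y \<and> P Y X -->
       (\<exists>d1 d2. has_dX (\<lambda>X Y. f Y X) d1 X Y \<and> has_dX (\<lambda>X Y. g Y X) d2 X Y \<and> \<bar>d1 - d2\<bar> <= M * exp (\<mu> * (X + Y)))"
      unfolding has_dX_swap using ae by (simp add: add.commute)
    show "P Y' X'" if "P Y X" "X' <= X" "Y' <= Y" for X Y X' Y' by (rule down[OF that(1,3,2)])
    show "0 < \<mu>" "0 <= M" "0 <= Y + X" "P X Y" using \<mu> M XY by simp_all
  qed
  then show ?thesis by (simp add: add.commute)
qed

context wave_speed
begin

lemma close_coeff:
  assumes "close_on S d u u'"
  shows "close_on S d (\<lambda>i. deriv c (u i) / (8 * (c (u i))\<^sup>2)) (\<lambda>i. deriv c (u' i) / (8 * (c (u' i))\<^sup>2))"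
    "close_on S d (\<lambda>i. 1 / (4 * c (u i))) (\<lambda>i. 1 / (4 * c (u' i)))"
proof -
  let ?\<phi>' = "\<lambda>v. (deriv (deriv c) v * (8 * (c v)\<^sup>2) - deriv c v * (8 * (2 * c v * deriv c v))) / ((8 * (c v)\<^sup>2) * (8 * (c v)\<^sup>2))"
  have "((\<lambda>v. deriv c v / (8 * (c v)\<^sup>2)) has_real_derivative ?\<phi>' v) (at v)" for v
    by (rule DERIV_divide[OF c_deriv2]) (auto intro!: derivative_eq_intros c_deriv simp: c_ne)
  moreover have "continuous_on UNIV ?\<phi>'"
    by (intro continuous_intros cont_c ballI) (simp add: c_ne)
  ultimately show "close_on S d (\<lambda>i. deriv c (u i) / (8 * (c (u i))\<^sup>2)) (\<lambda>i. deriv c (u' i) / (8 * (c (u' i))\<^sup>2))"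
    by (rule close_on_compose[OF assms])
  let ?\<psi>' = "\<lambda>v. (0 * (4 * c v) - 1 * (4 * deriv c v)) / ((4 * c v) * (4 * c v))"
  have "((\<lambda>v. 1 / (4 * c v)) has_real_derivative ?\<psi>' v) (at v)" for v
    by (rule DERIV_divide) (auto intro!: derivative_eq_intros c_deriv simp: c_ne)
  moreover have "continuous_on UNIV ?\<psi>'"
    by (intro continuous_intros cont_c ballI) (simp add: c_ne)
  ultimately show "close_on S d (\<lambda>i. 1 / (4 * c (u i))) (\<lambda>i. 1 / (4 * c (u' i)))"
    by (rule close_on_compose[OF assms])
qed

lemma close_cos: "close_on S d w w' ==> close_on S d (\<lambda>i. cos (w i)) (\<lambda>i. cos (w' i))"
  by (rule close_on_compose[where \<phi>'="\<lambda>x. - sin x"]) (auto intro!: derivative_eq_intros continuous_intros)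

lemma close_sin: "close_on S d w w' ==> close_on S d (\<lambda>i. sin (w i)) (\<lambda>i. sin (w' i))"
  by (rule close_on_compose[where \<phi>'="\<lambda>x. cos x"]) (auto intro!: derivative_eq_intros continuous_intros)

text \<open>The right-hand sides are built from the unknowns by products and smooth functions, hence are Lipschitz functions of them on bounded sets.\<close>

lemma close_rhs:
  assumes d: "\<And>i. i \<in> S ==> 0 <= d i"
    and u: "close_on S d (\<lambda>i. cu sv (X i) (Y i)) (\<lambda>i. cu sv' (X' i) (Y' i))"
    and w: "close_on S d (\<lambda>i. cw sv (X i) (Y i)) (\<lambda>i. cw sv' (X' i) (Y' i))"
    and z: "close_on S d (\<lambda>i. cz sv (X i) (Y i)) (\<lambda>i. cz sv' (X' i) (Y' i))"
  shows "close_on S d (\<lambda>i. cq sv (X i) (Y i)) (\<lambda>i. cq sv' (X' i) (Y' i)) ==>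
      close_on S d (\<lambda>i. rhs_w c sv (X i) (Y i)) (\<lambda>i. rhs_w c sv' (X' i) (Y' i))"
    and "close_on S d (\<lambda>i. cp sv (X i) (Y i)) (\<lambda>i. cp sv' (X' i) (Y' i)) ==>
      close_on S d (\<lambda>i. rhs_z c sv (X i) (Y i)) (\<lambda>i. rhs_z c sv' (X' i) (Y' i))"
    and "close_on S d (\<lambda>i. cp sv (X i) (Y i)) (\<lambda>i. cp sv' (X' i) (Y' i)) ==>
      close_on S d (\<lambda>i. cq sv (X i) (Y i)) (\<lambda>i. cq sv' (X' i) (Y' i)) ==>
      close_on S d (\<lambda>i. rhs_p c sv (X i) (Y i)) (\<lambda>i. rhs_p c sv' (X' i) (Y' i))"
    and "close_on S d (\<lambda>i. cp sv (X i) (Y i)) (\<lambda>i. cp sv' (X' i) (Y' i)) ==>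
      close_on S d (\<lambda>i. cq sv (X i) (Y i)) (\<lambda>i. cq sv' (X' i) (Y' i)) ==>
      close_on S d (\<lambda>i. rhs_q c sv (X i) (Y i)) (\<lambda>i. rhs_q c sv' (X' i) (Y' i))"
    and "close_on S d (\<lambda>i. cp sv (X i) (Y i)) (\<lambda>i. cp sv' (X' i) (Y' i)) ==>
      close_on S d (\<lambda>i. rhs_uX c sv (X i) (Y i)) (\<lambda>i. rhs_uX c sv' (X' i) (Y' i))"
    and "close_on S d (\<lambda>i. cp sv (X i) (Y i)) (\<lambda>i. cp sv' (X' i) (Y' i)) ==>
      close_on S d (\<lambda>i. rhs_tX c sv (X i) (Y i)) (\<lambda>i. rhs_tX c sv' (X' i) (Y' i))"
    and "close_on S d (\<lambda>i. cp sv (X i) (Y i)) (\<lambda>i. cp sv' (X' i) (Y' i)) ==>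
      close_on S d (\<lambda>i. rhs_xX sv (X i) (Y i)) (\<lambda>i. rhs_xX sv' (X' i) (Y' i))"
proof -
  have uX: "rhs_uX c sv X Y = sin (cw sv X Y) * (1 / (4 * c (cu sv X Y))) * cp sv X Y" for sv X Y
    by (simp add: rhs_uX_def)
  have tX: "rhs_tX c sv X Y = (1 + cos (cw sv X Y)) * cp sv X Y * (1 / (4 * c (cu sv X Y)))" for sv X Y
    by (simp add: rhs_tX_def)
  have xX: "rhs_xX sv X Y = (1 + cos (cw sv X Y)) * cp sv X Y * (1 / 4)" for sv X Y
    by (simp add: rhs_xX_def)
  note k = close_coeff[OF u] and cs = close_cos[OF w] close_cos[OF z] close_sin[OF w] close_sin[OF z]
  note I = close_on_mult close_on_diff close_on_add close_on_const
  show "close_on S d (\<lambda>i. rhs_w c sv (X i) (Y i)) (\<lambda>i. rhs_w c sv' (X' i) (Y' i))"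
    if q: "close_on S d (\<lambda>i. cq sv (X i) (Y i)) (\<lambda>i. cq sv' (X' i) (Y' i))"
    unfolding rhs_w_def by (rule close_on_mult[OF close_on_mult[OF k(1) close_on_diff[OF cs(2) cs(1)]] q])
  show "close_on S d (\<lambda>i. rhs_z c sv (X i) (Y i)) (\<lambda>i. rhs_z c sv' (X' i) (Y' i))"
    if p: "close_on S d (\<lambda>i. cp sv (X i) (Y i)) (\<lambda>i. cp sv' (X' i) (Y' i))"
    unfolding rhs_z_def by (rule close_on_mult[OF close_on_mult[OF k(1) close_on_diff[OF cs(1) cs(2)]] p])
  show "close_on S d (\<lambda>i. rhs_p c sv (X i) (Y i)) (\<lambda>i. rhs_p c sv' (X' i) (Y' i))"
    if p: "close_on S d (\<lambda>i. cp sv (X i) (Y i)) (\<lambda>i. cp sv' (X' i) (Y' i))"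
      and q: "close_on S d (\<lambda>i. cq sv (X i) (Y i)) (\<lambda>i. cq sv' (X' i) (Y' i))"
    unfolding rhs_p_def by (rule close_on_mult[OF close_on_mult[OF close_on_mult[OF k(1) close_on_diff[OF cs(4) cs(3)]] p] q])
  show "close_on S d (\<lambda>i. rhs_q c sv (X i) (Y i)) (\<lambda>i. rhs_q c sv' (X' i) (Y' i))"
    if p: "close_on S d (\<lambda>i. cp sv (X i) (Y i)) (\<lambda>i. cp sv' (X' i) (Y' i))"
      and q: "close_on S d (\<lambda>i. cq sv (X i) (Y i)) (\<lambda>i. cq sv' (X' i) (Y' i))"
    unfolding rhs_q_def by (rule close_on_mult[OF close_on_mult[OF close_on_mult[OF k(1) close_on_diff[OF cs(3) cs(4)]] p] q])
  show "close_on S d (\<lambda>i. rhs_uX c sv (X i) (Y i)) (\<lambda>i. rhs_uX c sv' (X' i) (Y' i))"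
    if p: "close_on S d (\<lambda>i. cp sv (X i) (Y i)) (\<lambda>i. cp sv' (X' i) (Y' i))"
    unfolding uX by (rule close_on_mult[OF close_on_mult[OF cs(3) k(2)] p])
  show "close_on S d (\<lambda>i. rhs_tX c sv (X i) (Y i)) (\<lambda>i. rhs_tX c sv' (X' i) (Y' i))"
    if p: "close_on S d (\<lambda>i. cp sv (X i) (Y i)) (\<lambda>i. cp sv' (X' i) (Y' i))"
    unfolding tX by (rule close_on_mult[OF close_on_mult[OF close_on_add[OF close_on_const[OF d] cs(1)] p] k(2)])
  show "close_on S d (\<lambda>i. rhs_xX sv (X i) (Y i)) (\<lambda>i. rhs_xX sv' (X' i) (Y' i))"
    if p: "close_on S d (\<lambda>i. cp sv (X i) (Y i)) (\<lambda>i. cp sv' (X' i) (Y' i))"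
    unfolding xX by (rule close_on_mult[OF close_on_mult[OF close_on_add[OF close_on_const[OF d] cs(1)] p] close_on_const[OF d]])
qed

end

definition same_vars :: "char_vars => char_vars => real => real => bool" where
  "same_vars sv sv' X Y \<longleftrightarrow> cu sv X Y = cu sv' X Y \<and> cw sv X Y = cw sv' X Y \<and> cz sv X Y = cz sv' X Y \<and>
     cp sv X Y = cp sv' X Y \<and> cq sv X Y = cq sv' X Y \<and> cx sv X Y = cx sv' X Y \<and> ct sv X Y = ct sv' X Y"

locale two_sols = A: char_sol c \<theta> sv u0 u1 + B: char_sol c \<theta>' sv' u0 u1
  for c \<theta> sv u0 u1 \<theta>' sv'
begin

definition vdist :: "real => real => real" where
  "vdist X Y = \<bar>cu sv X Y - cu sv' X Y\<bar> + \<bar>cw sv X Y - cw sv' X Y\<bar> + \<bar>cz sv X Y - cz sv' X Y\<bar> +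
     \<bar>cp sv X Y - cp sv' X Y\<bar> + \<bar>cq sv X Y - cq sv' X Y\<bar> + \<bar>cx sv X Y - cx sv' X Y\<bar> + \<bar>ct sv X Y - ct sv' X Y\<bar>"

lemma vdist_bounds: "0 <= vdist X Y" "\<bar>cu sv X Y - cu sv' X Y\<bar> <= vdist X Y" "\<bar>cw sv X Y - cw sv' X Y\<bar> <= vdist X Y"
   "\<bar>cz sv X Y - cz sv' X Y\<bar> <= vdist X Y" "\<bar>cp sv X Y - cp sv' X Y\<bar> <= vdist X Y" "\<bar>cq sv X Y - cq sv' X Y\<bar> <= vdist X Y"
   "vdist X Y = 0 \<longleftrightarrow> same_vars sv sv' X Y"
proof -
  have seven: "a1 <= a1 + a2 + a3 + a4 + a5 + a6 + a7" "a2 <= a1 + a2 + a3 + a4 + a5 + a6 + a7"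
    "a3 <= a1 + a2 + a3 + a4 + a5 + a6 + a7" "a4 <= a1 + a2 + a3 + a4 + a5 + a6 + a7"
    "a5 <= a1 + a2 + a3 + a4 + a5 + a6 + a7" "0 <= a1 + a2 + a3 + a4 + a5 + a6 + a7"
    "a1 + a2 + a3 + a4 + a5 + a6 + a7 = 0 \<longleftrightarrow> a1 = 0 \<and> a2 = 0 \<and> a3 = 0 \<and> a4 = 0 \<and> a5 = 0 \<and> a6 = 0 \<and> a7 = 0"
    if "0 <= a1" "0 <= a2" "0 <= a3" "0 <= a4" "0 <= a5" "0 <= a6" "0 <= a7" for a1 a2 a3 a4 a5 a6 a7 :: real
    using that by linarith+
  note s = seven[OF abs_ge_zero abs_ge_zero abs_ge_zero abs_ge_zero abs_ge_zero abs_ge_zero abs_ge_zero]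
  show "0 <= vdist X Y" "\<bar>cu sv X Y - cu sv' X Y\<bar> <= vdist X Y" "\<bar>cw sv X Y - cw sv' X Y\<bar> <= vdist X Y"
   "\<bar>cz sv X Y - cz sv' X Y\<bar> <= vdist X Y" "\<bar>cp sv X Y - cp sv' X Y\<bar> <= vdist X Y" "\<bar>cq sv X Y - cq sv' X Y\<bar> <= vdist X Y"
   unfolding vdist_def by (rule s)+
  show "vdist X Y = 0 \<longleftrightarrow> same_vars sv sv' X Y"
    unfolding vdist_def same_vars_def s(7) abs_eq_0 right_minus_eq ..
qed

lemma cont_vdist: "continuous_on half_plane (\<lambda>P. vdist (fst P) (snd P))"
  unfolding vdist_def by (intro continuous_intros A.cont_fst_snd B.cont_fst_snd)

text \<open>With \<open>\<theta> = 1\<close> the right-hand sides are Lipschitz functions of the unknowns. The maximum over the region of the distance weighted with \<open>exp (-\<mu> (X + Y))\<close> is then bounded by a fraction of itself.\<close>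

lemma unique_where_theta_1:
  fixes P :: "real => real => bool"
  assumes dn: "\<And>X Y X' Y'. P X Y ==> X' <= X ==> Y' <= Y ==> P X' Y'"
    and cl: "closed {(X, Y). P X Y}" and bd: "\<And>X Y. P X Y ==> X <= b \<and> Y <= b"
    and th: "\<And>X Y. 0 < X + Y ==> P X Y ==> \<theta> X Y = 1 \<and> \<theta>' X Y = 1"
    and XY: "0 <= X + Y" "P X Y"
  shows "same_vars sv sv' X Y"
proof -
  define S where "S = {(X, Y). 0 <= X + Y \<and> P X Y}"
  have S_r: "\<bar>X\<bar> <= \<bar>b\<bar> \<and> \<bar>Y\<bar> <= \<bar>b\<bar>" if "(X, Y) \<in> S" for X Y using bd[of X Y] that by (auto simp: S_def)
  have Seq: "S = ({-\<bar>b\<bar>..\<bar>b\<bar>} \<times> {-\<bar>b\<bar>..\<bar>b\<bar>}) \<inter> ({P. 0 <= fst P + snd P} \<inter> {(X, Y). P X Y})"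
  proof (rule set_eqI)
    fix i show "i \<in> S \<longleftrightarrow> i \<in> ({-\<bar>b\<bar>..\<bar>b\<bar>} \<times> {-\<bar>b\<bar>..\<bar>b\<bar>}) \<inter> ({P. 0 <= fst P + snd P} \<inter> {(X, Y). P X Y})"
      using S_r[of "fst i" "snd i"] by (cases i) (auto simp: S_def abs_le_iff)
  qed
  have "compact S" unfolding Seq
    by (intro compact_Int_closed compact_Times compact_Icc closed_Int cl closed_Collect_le continuous_intros)
  have SS: "S \<subseteq> half_plane" by (auto simp: S_def half_plane_def)
  let ?d = "\<lambda>i. vdist (fst i) (snd i)"
  have cl: "close_on S ?d (\<lambda>i. f (fst i) (snd i)) (\<lambda>i. g (fst i) (snd i))"
    if c1: "continuous_on half_plane (\<lambda>(X, Y). f X Y)" and c2: "continuous_on half_plane (\<lambda>(X, Y). g X Y)"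
      and d: "\<And>X Y. \<bar>f X Y - g X Y\<bar> <= vdist X Y" for f g
  proof -
    obtain C1 where C1: "\<And>X Y. 0 <= X + Y ==> \<bar>X\<bar> <= \<bar>b\<bar> ==> \<bar>Y\<bar> <= \<bar>b\<bar> ==> \<bar>f X Y\<bar> <= C1"
      using A.bounded_on_box[OF c1] by blast
    obtain C2 where C2: "\<And>X Y. 0 <= X + Y ==> \<bar>X\<bar> <= \<bar>b\<bar> ==> \<bar>Y\<bar> <= \<bar>b\<bar> ==> \<bar>g X Y\<bar> <= C2"
      using A.bounded_on_box[OF c2] by blast
    show ?thesis
    proof (rule close_onI[where B="max C1 C2" and K=1])
      fix i assume i: "i \<in> S"
      then have h: "0 <= fst i + snd i" "\<bar>fst i\<bar> <= \<bar>b\<bar>" "\<bar>snd i\<bar> <= \<bar>b\<bar>"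
        using S_r[of "fst i" "snd i"] by (auto simp: S_def)
      show "\<bar>f (fst i) (snd i)\<bar> <= max C1 C2" "\<bar>g (fst i) (snd i)\<bar> <= max C1 C2" using C1[OF h] C2[OF h] by auto
      show "\<bar>f (fst i) (snd i) - g (fst i) (snd i)\<bar> <= 1 * ?d i" using d by simp
    qed (rule vdist_bounds(1))
  qed
  note cvars = cl[OF A.cont_vars(1) B.cont_vars(1) vdist_bounds(2)] cl[OF A.cont_vars(2) B.cont_vars(2) vdist_bounds(3)]
     cl[OF A.cont_vars(3) B.cont_vars(3) vdist_bounds(4)] cl[OF A.cont_vars(4) B.cont_vars(4) vdist_bounds(5)]
     cl[OF A.cont_vars(5) B.cont_vars(5) vdist_bounds(6)]
  note cr = A.close_rhs[OF vdist_bounds(1) cvars(1-3)]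
  obtain K1 where K1: "0 <= K1" "\<And>i. i \<in> S ==> \<bar>rhs_w c sv (fst i) (snd i) - rhs_w c sv' (fst i) (snd i)\<bar> <= K1 * ?d i"
    using close_onE[OF cr(1)[OF cvars(5)]] by blast
  obtain K2 where K2: "0 <= K2" "\<And>i. i \<in> S ==> \<bar>rhs_z c sv (fst i) (snd i) - rhs_z c sv' (fst i) (snd i)\<bar> <= K2 * ?d i"
    using close_onE[OF cr(2)[OF cvars(4)]] by blast
  obtain K3 where K3: "0 <= K3" "\<And>i. i \<in> S ==> \<bar>rhs_p c sv (fst i) (snd i) - rhs_p c sv' (fst i) (snd i)\<bar> <= K3 * ?d i"
    using close_onE[OF cr(3)[OF cvars(4,5)]] by blast
  obtain K4 where K4: "0 <= K4" "\<And>i. i \<in> S ==> \<bar>rhs_q c sv (fst i) (snd i) - rhs_q c sv' (fst i) (snd i)\<bar> <= K4 * ?d i"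
    using close_onE[OF cr(4)[OF cvars(4,5)]] by blast
  obtain K5 where K5: "0 <= K5" "\<And>i. i \<in> S ==> \<bar>rhs_uX c sv (fst i) (snd i) - rhs_uX c sv' (fst i) (snd i)\<bar> <= K5 * ?d i"
    using close_onE[OF cr(5)[OF cvars(4)]] by blast
  obtain K6 where K6: "0 <= K6" "\<And>i. i \<in> S ==> \<bar>rhs_tX c sv (fst i) (snd i) - rhs_tX c sv' (fst i) (snd i)\<bar> <= K6 * ?d i"
    using close_onE[OF cr(6)[OF cvars(4)]] by blast
  obtain K7 where K7: "0 <= K7" "\<And>i. i \<in> S ==> \<bar>rhs_xX sv (fst i) (snd i) - rhs_xX sv' (fst i) (snd i)\<bar> <= K7 * ?d i"
    using close_onE[OF cr(7)[OF cvars(4)]] by blast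
  define K where "K = K1 + K2 + K3 + K4 + K5 + K6 + K7"
  have K: "0 <= K" using K1(1) K2(1) K3(1) K4(1) K5(1) K6(1) K7(1) by (simp add: K_def)
  have KI: "\<bar>e\<bar> <= K * vdist X Y" if "\<bar>e\<bar> <= k * vdist X Y" "k \<in> {K1, K2, K3, K4, K5, K6, K7}" for e k X Y
  proof -
    have "k <= K" using that(2) K1(1) K2(1) K3(1) K4(1) K5(1) K6(1) K7(1) unfolding K_def by auto
    then show ?thesis using that(1) mult_right_mono[OF _ vdist_bounds(1)[of X Y]] order_trans by blast
  qed
  define \<mu> where "\<mu> = 14 * K + 1"
  have \<mu>: "0 < \<mu>" using K by (simp add: \<mu>_def)
  define E where "E i = exp (- \<mu> * (fst i + snd i)) * ?d i" for i
  have cE: "continuous_on S E" unfolding E_def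
    by (intro continuous_intros continuous_on_subset[OF cont_vdist SS])
  have "S \<noteq> {}" using XY by (auto simp: S_def)
  then obtain m where m: "m \<in> S" "\<And>i. i \<in> S ==> E i <= E m"
    using continuous_attains_sup[OF \<open>compact S\<close> _ cE] by blast
  define D where "D = E m"
  have D0: "0 <= D" unfolding D_def E_def by (intro mult_nonneg_nonneg vdist_bounds) simp
  have dD: "vdist X Y <= D * exp (\<mu> * (X + Y))" if "(X, Y) \<in> S" for X Y
  proof -
    have "exp (- (\<mu> * (X + Y))) * vdist X Y <= D" using m(2)[OF that] by (simp add: E_def D_def)
    then have "exp (\<mu> * (X + Y)) * (exp (- (\<mu> * (X + Y))) * vdist X Y) <= exp (\<mu> * (X + Y)) * D"
      by (rule mult_left_mono) simp
    moreover have "exp a * (exp (- a) * v) = v" for a v :: real by (simp add: exp_minus)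
    ultimately show ?thesis by (simp only: mult.commute[of D])
  qed
  have KD: "\<bar>e\<bar> <= (K * D) * exp (\<mu> * (X + Y))" if "\<bar>e\<bar> <= k * vdist X Y" "k \<in> {K1, K2, K3, K4, K5, K6, K7}" "(X, Y) \<in> S" for e k X Y
  proof -
    have "\<bar>e\<bar> <= K * vdist X Y" by (rule KI[OF that(1,2)])
    also have "\<dots> <= K * (D * exp (\<mu> * (X + Y)))" by (intro mult_left_mono dD that K)
    finally show ?thesis by (simp add: mult.assoc)
  qed
  have KD0: "0 <= K * D" using K D0 by simp
  have PS: "(X, Y) \<in> S" if "0 < X + Y \<and> P X Y" for X Y using that by (auto simp: S_def)
  have stepX: "\<bar>f X Y - g X Y\<bar> <= K * D / \<mu> * exp (\<mu> * (X + Y))"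
    if c1: "continuous_on half_plane (\<lambda>(X, Y). f X Y)" and c2: "continuous_on half_plane (\<lambda>(X, Y). g X Y)"
      and l1: "loc_lipschitz_X f" and l2: "loc_lipschitz_X g" and bd: "\<And>s. f s (-s) = g s (-s)"
      and d1: "\<And>X Y. semilinear_system_at c 1 sv X Y ==> has_dX f (F X Y) X Y"
      and d2: "\<And>X Y. semilinear_system_at c 1 sv' X Y ==> has_dX g (G X Y) X Y"
      and k: "\<And>i. i \<in> S ==> \<bar>F (fst i) (snd i) - G (fst i) (snd i)\<bar> <= k * ?d i" "k \<in> {K1, K2, K3, K4, K5, K6, K7}"
      and S: "(X, Y) \<in> S"
    for f g F G k X Y
  proof (rule difference_growth_X[OF c1 c2 l1 l2 bd dn])
    show "AE Y in lborel. AE X in lborel. 0 < X + Y \<and> P X Y -->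
       (\<exists>d1 d2. has_dX f d1 X Y \<and> has_dX g d2 X Y \<and> \<bar>d1 - d2\<bar> <= K * D * exp (\<mu> * (X + Y)))"
      using A.sys_lines(2) B.sys_lines(2)
    proof eventually_elim
      case (elim Y)
      then show ?case
      proof eventually_elim
        case (elim X)
        show ?case
        proof
          assume h: "0 < X + Y \<and> P X Y"
          have "has_dX f (F X Y) X Y" "has_dX g (G X Y) X Y" using elim h th[of X Y] d1 d2 by auto
          moreover have "\<bar>F X Y - G X Y\<bar> <= K * D * exp (\<mu> * (X + Y))"
            by (rule KD[OF _ k(2) PS[OF h]]) (use k(1)[OF PS[OF h]] in simp)
          ultimately show "\<exists>d1 d2. has_dX f d1 X Y \<and> has_dX g d2 X Y \<and> \<bar>d1 - d2\<bar> <= K * D * exp (\<mu> * (X + Y))" by blast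
        qed
      qed
    qed
  qed (use \<mu> KD0 S in \<open>auto simp: S_def\<close>)
  have stepY: "\<bar>f X Y - g X Y\<bar> <= K * D / \<mu> * exp (\<mu> * (X + Y))"
    if c1: "continuous_on half_plane (\<lambda>(X, Y). f X Y)" and c2: "continuous_on half_plane (\<lambda>(X, Y). g X Y)"
      and l1: "loc_lipschitz_Y f" and l2: "loc_lipschitz_Y g" and bd: "\<And>s. f s (-s) = g s (-s)"
      and d1: "\<And>X Y. semilinear_system_at c 1 sv X Y ==> has_dY f (F X Y) X Y"
      and d2: "\<And>X Y. semilinear_system_at c 1 sv' X Y ==> has_dY g (G X Y) X Y"
      and k: "\<And>i. i \<in> S ==> \<bar>F (fst i) (snd i) - G (fst i) (snd i)\<bar> <= k * ?d i" "k \<in> {K1, K2, K3, K4, K5, K6, K7}"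
      and S: "(X, Y) \<in> S"
    for f g F G k X Y
  proof (rule difference_growth_Y[OF c1 c2 l1 l2 bd dn])
    show "AE X in lborel. AE Y in lborel. 0 < X + Y \<and> P X Y -->
       (\<exists>d1 d2. has_dY f d1 X Y \<and> has_dY g d2 X Y \<and> \<bar>d1 - d2\<bar> <= K * D * exp (\<mu> * (X + Y)))"
      using A.sys_lines(1) B.sys_lines(1)
    proof eventually_elim
      case (elim X)
      then show ?case
      proof eventually_elim
        case (elim Y)
        show ?case
        proof
          assume h: "0 < X + Y \<and> P X Y"
          have "has_dY f (F X Y) X Y" "has_dY g (G X Y) X Y" using elim h th[of X Y] d1 d2 by auto
          moreover have "\<bar>F X Y - G X Y\<bar> <= K * D * exp (\<mu> * (X + Y))"
            by (rule KD[OF _ k(2) PS[OF h]]) (use k(1)[OF PS[OF h]] in simp)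
          ultimately show "\<exists>d1 d2. has_dY f d1 X Y \<and> has_dY g d2 X Y \<and> \<bar>d1 - d2\<bar> <= K * D * exp (\<mu> * (X + Y))" by blast
        qed
      qed
    qed
  qed (use \<mu> KD0 S in \<open>auto simp: S_def\<close>)
  have sysI: "semilinear_system_at c 1 sv X Y ==> has_dX (cu sv) (rhs_uX c sv X Y) X Y"
    "semilinear_system_at c 1 sv X Y ==> has_dY (cw sv) (rhs_w c sv X Y) X Y"
    "semilinear_system_at c 1 sv X Y ==> has_dX (cz sv) (rhs_z c sv X Y) X Y"
    "semilinear_system_at c 1 sv X Y ==> has_dY (cp sv) (rhs_p c sv X Y) X Y"
    "semilinear_system_at c 1 sv X Y ==> has_dX (cq sv) (rhs_q c sv X Y) X Y"
    "semilinear_system_at c 1 sv X Y ==> has_dX (cx sv) (rhs_xX sv X Y) X Y"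
    "semilinear_system_at c 1 sv X Y ==> has_dX (ct sv) (rhs_tX c sv X Y) X Y" for sv X Y
    by (simp_all add: semilinear_system_at_iff)
  have all: "vdist X Y <= 7 * (K * D / \<mu> * exp (\<mu> * (X + Y)))" if S: "(X, Y) \<in> S" for X Y
  proof -
    have 1: "\<bar>cu sv X Y - cu sv' X Y\<bar> <= K * D / \<mu> * exp (\<mu> * (X + Y))"
      by (rule stepX[OF A.cont_vars(1) B.cont_vars(1) A.lipX B.lipX _ sysI(1) sysI(1) K5(2) _ S])
         (simp_all add: A.bdry_vals B.bdry_vals)
    have 2: "\<bar>cw sv X Y - cw sv' X Y\<bar> <= K * D / \<mu> * exp (\<mu> * (X + Y))"
      by (rule stepY[OF A.cont_vars(2) B.cont_vars(2) A.lipY B.lipY _ sysI(2) sysI(2) K1(2) _ S])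
         (simp_all add: A.bdry_vals B.bdry_vals)
    have 3: "\<bar>cz sv X Y - cz sv' X Y\<bar> <= K * D / \<mu> * exp (\<mu> * (X + Y))"
      by (rule stepX[OF A.cont_vars(3) B.cont_vars(3) A.lipX B.lipX _ sysI(3) sysI(3) K2(2) _ S])
         (simp_all add: A.bdry_vals B.bdry_vals)
    have 4: "\<bar>cp sv X Y - cp sv' X Y\<bar> <= K * D / \<mu> * exp (\<mu> * (X + Y))"
      by (rule stepY[OF A.cont_vars(4) B.cont_vars(4) A.lipY B.lipY _ sysI(4) sysI(4) K3(2) _ S])
         (simp_all add: A.bdry_vals B.bdry_vals)
    have 5: "\<bar>cq sv X Y - cq sv' X Y\<bar> <= K * D / \<mu> * exp (\<mu> * (X + Y))"
      by (rule stepX[OF A.cont_vars(5) B.cont_vars(5) A.lipX B.lipX _ sysI(5) sysI(5) K4(2) _ S])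
         (simp_all add: A.bdry_vals B.bdry_vals)
    have 6: "\<bar>cx sv X Y - cx sv' X Y\<bar> <= K * D / \<mu> * exp (\<mu> * (X + Y))"
      by (rule stepX[OF A.cont_vars(6) B.cont_vars(6) A.lipX B.lipX _ sysI(6) sysI(6) K7(2) _ S])
         (simp_all add: A.bdry_vals B.bdry_vals)
    have 7: "\<bar>ct sv X Y - ct sv' X Y\<bar> <= K * D / \<mu> * exp (\<mu> * (X + Y))"
      by (rule stepX[OF A.cont_vars(7) B.cont_vars(7) A.lipX B.lipX _ sysI(7) sysI(7) K6(2) _ S])
         (simp_all add: A.bdry_vals B.bdry_vals)
    have "vdist X Y <= K * D / \<mu> * exp (\<mu> * (X + Y)) + K * D / \<mu> * exp (\<mu> * (X + Y)) + K * D / \<mu> * exp (\<mu> * (X + Y)) +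
        K * D / \<mu> * exp (\<mu> * (X + Y)) + K * D / \<mu> * exp (\<mu> * (X + Y)) + K * D / \<mu> * exp (\<mu> * (X + Y)) +
        K * D / \<mu> * exp (\<mu> * (X + Y))"
      unfolding vdist_def by (intro add_mono 1 2 3 4 5 6 7)
    moreover have "v <= 7 * e" if "v <= e + e + e + e + e + e + e" for v e :: real using that by simp
    ultimately show ?thesis by blast
  qed
  have "D <= 7 * (K * D / \<mu>)"
  proof -
    obtain a b where ab: "m = (a, b)" by (cases m)
    have "exp (- (\<mu> * (a + b))) * vdist a b <= exp (- (\<mu> * (a + b))) * (7 * (K * D / \<mu> * exp (\<mu> * (a + b))))"
      using all[of a b] m(1) ab by (intro mult_left_mono) auto
    also have "\<dots> = 7 * (K * D / \<mu>)" by (simp add: exp_minus)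
    finally show ?thesis by (simp add: D_def E_def ab)
  qed
  also have "7 * (K * D / \<mu>) = (7 * K / \<mu>) * D" by simp
  also have "\<dots> <= (1 / 2) * D" using K D0 by (intro mult_right_mono) (auto simp: \<mu>_def divide_simps)
  finally have "D = 0" using D0 by simp
  then have "vdist X Y <= 0" using dD[of X Y] XY by (simp add: S_def)
  then show ?thesis using vdist_bounds(1)[of X Y] vdist_bounds(7) by (simp add: order_antisym)
qed

end

section \<open>The conservative and the dissipative solution\<close>

lemma smooth_on_imp_continuous: "smooth_on S f ==> continuous_on S f"
proof -
  assume "smooth_on S f"
  then have "Ck_on 0 S f" unfolding smooth_on_def by blast
  then show ?thesis by simp
qed

lemma smooth_imp_loc_lipschitz_X:
  assumes s: "smooth_on UNIV (\<lambda>(X, Y). F X Y)"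
  shows "loc_lipschitz_X F"
  unfolding loc_lipschitz_X_def
proof
  fix r :: real
  have "continuous_on ({-r..r} \<times> {-r..r}) (\<lambda>(X, Y). dX F X Y)"
    using smooth_on_imp_continuous[OF smooth_on_partials(4)[OF s]] by (rule continuous_on_subset) simp
  then have "bounded ((\<lambda>(X, Y). dX F X Y) ` ({-r..r} \<times> {-r..r}))"
    by (intro compact_imp_bounded compact_continuous_image compact_Times compact_Icc)
  then obtain M where M: "\<And>x. x \<in> (\<lambda>(X, Y). dX F X Y) ` ({-r..r} \<times> {-r..r}) ==> \<bar>x\<bar> <= M"
    by (meson bounded_real)
  have "\<bar>M\<bar>-lipschitz_on {X \<in> {-r..r}. (X, Y) \<in> half_plane} (\<lambda>X. F X Y)" if Y: "Y \<in> {-r..r}" for Y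
  proof (rule lipschitz_onI)
    fix x y assume xy: "x \<in> {X \<in> {-r..r}. (X, Y) \<in> half_plane}" "y \<in> {X \<in> {-r..r}. (X, Y) \<in> half_plane}"
    have "norm (F x Y - F y Y) <= \<bar>M\<bar> * norm (x - y)"
    proof (rule field_differentiable_bound[where f'="\<lambda>X. dX F X Y" and S="{-r..r}" and f="\<lambda>X. F X Y"])
      show "((\<lambda>X. F X Y) has_real_derivative dX F z Y) (at z within {-r..r})" for z
        using smooth_on_partials(1)[OF s, of z Y] unfolding has_dX_def by (rule has_field_derivative_at_within)
      show "norm (dX F z Y) <= \<bar>M\<bar>" if "z \<in> {-r..r}" for z
        using M[of "dX F z Y"] that Y by force
    qed (use xy in auto)
    then show "dist (F x Y) (F y Y) <= \<bar>M\<bar> * dist x y" by (simp add: dist_norm)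
  qed simp
  then show "\<exists>L. \<forall>Y\<in>{-r..r}. L-lipschitz_on {X \<in> {-r..r}. (X, Y) \<in> half_plane} (\<lambda>X. F X Y)" by blast
qed

lemma smooth_on_compose_linear:
  fixes F :: "real \<times> real => real"
  assumes "bounded_linear A" "Ck_on n UNIV F"
  shows "Ck_on n UNIV (\<lambda>p :: real \<times> real. F (A p))"
  using assms(2)
proof (induction n arbitrary: F)
  case 0
  then have "continuous_on UNIV F" by simp
  then have "continuous_on UNIV (\<lambda>p. F (A p))"
    by (rule continuous_on_compose2) (auto intro: bounded_linear.continuous_on[OF assms(1)] continuous_on_id)
  then show ?case by simp
next
  case (Suc n)
  obtain f' where d: "\<And>x. x \<in> UNIV ==> (F has_derivative f' x) (at x)" "\<And>v. Ck_on n UNIV (\<lambda>x. f' x v)"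
    using Suc.prems by (rule Ck_on_SucE) blast
  show ?case
  proof (rule Ck_on_SucI[of _ _ "\<lambda>x v. f' (A x) (A v)"])
    show "((\<lambda>p. F (A p)) has_derivative (\<lambda>v. f' (A x) (A v))) (at x)" for x
      by (rule has_derivative_compose[OF bounded_linear_imp_has_derivative[OF assms(1)] d(1)[OF UNIV_I]])
    show "Ck_on n UNIV (\<lambda>x. f' (A x) (A v))" for v using Suc.IH[OF d(2)[of "A v"]] .
  qed
qed

lemma smooth_swap:
  fixes F :: "real => real => real"
  assumes "smooth_on UNIV (\<lambda>(X, Y). F X Y)"
  shows "smooth_on UNIV (\<lambda>(X, Y). F Y X)"
proof -
  have "bounded_linear (\<lambda>p :: real \<times> real. (snd p, fst p))"
    by (intro bounded_linear_Pair bounded_linear_snd bounded_linear_fst)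
  note C = smooth_on_compose_linear[OF this]
  show ?thesis unfolding smooth_on_def
  proof
    fix n
    have "Ck_on n UNIV (\<lambda>(X, Y). F X Y)" by (rule smooth_on_def[THEN iffD1, THEN spec, OF assms])
    from C[OF this] show "Ck_on n UNIV (\<lambda>(X, Y). F Y X)" by (simp add: split_def)
  qed
qed

lemma smooth_imp_loc_lipschitz_Y:
  assumes "smooth_on UNIV (\<lambda>(X, Y). F X Y)"
  shows "loc_lipschitz_Y F"
proof -
  have "loc_lipschitz_X (\<lambda>X Y. F Y X)" by (rule smooth_imp_loc_lipschitz_X[OF smooth_swap[OF assms]])
  then show ?thesis unfolding loc_lipschitz_X_swap .
qed

lemma conservative_char_graph:
  assumes "wave_speed c" "conservative_vars c u0 u1 cv" "is_graph_of U cv"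
  shows "char_graph c (\<lambda>_ _. 1) cv u0 u1 U"
proof -
  have sm: "smooth_on UNIV (\<lambda>(X, Y). f X Y)" if "f \<in> {cu cv, cw cv, cz cv, cp cv, cq cv, cx cv, ct cv}" for f
    using assms(2) that unfolding conservative_vars_def by blast
  have sy: "semilinear_system_at c 1 cv X Y" for X Y
    using assms(2) unfolding conservative_vars_def by blast
  interpret wave_speed c by (rule assms(1))
  show ?thesis
  proof unfold_locales
    show "continuous_on half_plane (\<lambda>(X, Y). f X Y)" if "f \<in> {cu cv, cw cv, cz cv, cp cv, cq cv, cx cv, ct cv}" for f
      using smooth_on_imp_continuous[OF sm[OF that]] by (rule continuous_on_subset) simp
    show "loc_lipschitz_X f" if "f \<in> {cu cv, cx cv, ct cv, cz cv, cq cv}" for f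
      by (rule smooth_imp_loc_lipschitz_X[OF sm]) (use that in blast)
    show "loc_lipschitz_Y f" if "f \<in> {cu cv, cx cv, ct cv, cw cv, cp cv}" for f
      by (rule smooth_imp_loc_lipschitz_Y[OF sm]) (use that in blast)
    show "AE (X, Y) in lborel. 0 < X + Y --> semilinear_system_at c 1 cv X Y"
      by (rule AE_I2) (simp add: split_def sy)
    show "boundary_data c u0 u1 cv" using assms(2) unfolding conservative_vars_def by blast
    show "is_graph_of U cv" by (rule assms(3))
  qed auto
qed

lemma dissipative_char_graph:
  assumes "wave_speed c" "dissipative_vars c u0 u1 dv" "is_graph_of U dv"
  shows "char_graph c (dissipative_theta dv) dv u0 u1 U"
proof -
  interpret wave_speed c by (rule assms(1))
  show ?thesis
    by unfold_locales (use assms in \<open>auto simp: dissipative_vars_def dissipative_theta_def\<close>)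
qed

lemma avoids_pi:
  fixes f :: "real => real"
  assumes "a <= b" "continuous_on {a..b} f" "- pi < f a" "f a < pi" "\<And>x. a <= x ==> x <= b ==> cos (f x) \<noteq> -1"
  shows "- pi < f b \<and> f b < pi"
proof (rule ccontr)
  assume "\<not> ?thesis"
  then have "f b <= - pi \<or> pi <= f b" by auto
  then obtain x where "a <= x" "x <= b" "f x = - pi \<or> f x = pi"
    using IVT2'[of f b "-pi" a] IVT'[of f a pi b] assms(1-4) by fastforce
  then show False using assms(5)[of x] by auto
qed

locale cons_diss = A: char_graph c "\<lambda>_ _. 1" cv u0 u1 ucons + B: char_graph c "dissipative_theta dv" dv u0 u1 udiss
  for c cv u0 u1 ucons dv udiss
begin

sublocale two_sols c "\<lambda>_ _. 1" cv u0 u1 "dissipative_theta dv" dv ..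

definition nonsing :: "real => real => bool" where
  "nonsing X Y \<longleftrightarrow> cos (cw cv X Y) \<noteq> -1 \<and> cos (cz cv X Y) \<noteq> -1"

lemma boundary_angles: "- pi < cw cv X (-X)" "cw cv X (-X) < pi" "- pi < cz cv X (-X)" "cz cv X (-X) < pi"
  unfolding A.bdry_vals using arctan_lbound arctan_ubound by (simp_all add: minus_less_iff) (smt (verit) arctan_bounded field_sum_of_halves)+

text \<open>The angles start in the open interval between \<open>-\<pi>\<close> and \<open>\<pi>\<close> and can leave it only through its ends.\<close>

lemma angles_if_nonsing:
  assumes "0 <= X + Y" "\<And>Y'. - X <= Y' ==> Y' <= Y ==> nonsing X Y'"
  shows "- pi < cw cv X Y \<and> cw cv X Y < pi" "- pi < cz cv X Y \<and> cz cv X Y < pi"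
proof -
  have le: "- X <= Y" using assms(1) by simp
  show "- pi < cw cv X Y \<and> cw cv X Y < pi"
    by (rule avoids_pi[of "-X" Y "\<lambda>Y. cw cv X Y", OF le continuous_on_half_plane_vline[OF A.cont_vars(2)] boundary_angles(1,2)])
       (use assms(2) in \<open>auto simp: nonsing_def\<close>)
  show "- pi < cz cv X Y \<and> cz cv X Y < pi"
    by (rule avoids_pi[of "-X" Y "\<lambda>Y. cz cv X Y", OF le continuous_on_half_plane_vline[OF A.cont_vars(3)] boundary_angles(3,4)])
       (use assms(2) in \<open>auto simp: nonsing_def\<close>)
qed

lemma same_vars_limit_X:
  assumes ab: "a < b" and hp: "0 <= a + Y" and s: "\<And>X. a < X ==> X < b ==> same_vars cv dv X Y" and X: "X \<in> {a..b}"
  shows "same_vars cv dv X Y"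
proof -
  have c: "continuous_on half_plane (\<lambda>(X, Y). vdist X Y)" using cont_vdist by (simp add: split_def)
  have "vdist X Y <= 0"
    by (rule AE_imp_le_continuous[OF ab continuous_on_half_plane_line[OF c hp] _ X])
       (rule AE_I2, use s vdist_bounds(7)[THEN iffD2] in auto)
  then show ?thesis using vdist_bounds(1)[of X Y] vdist_bounds(7)[of X Y] by simp
qed

lemma same_vars_limit_Y:
  assumes ab: "a < b" and hp: "0 <= X + a" and s: "\<And>Y. a < Y ==> Y < b ==> same_vars cv dv X Y" and Y: "Y \<in> {a..b}"
  shows "same_vars cv dv X Y"
proof -
  have c: "continuous_on half_plane (\<lambda>(X, Y). vdist X Y)" using cont_vdist by (simp add: split_def)
  have "vdist X Y <= 0"
    by (rule AE_imp_le_continuous[OF ab continuous_on_half_plane_vline[OF c hp] _ Y])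
       (rule AE_I2, use s vdist_bounds(7)[THEN iffD2] in auto)
  then show ?thesis using vdist_bounds(1)[of X Y] vdist_bounds(7)[of X Y] by simp
qed

lemma same_vars_boundary: "same_vars cv dv X (-X)"
  unfolding same_vars_def by (simp add: A.bdry_vals B.bdry_vals)

text \<open>Consider a point of the past with least \<open>X + Y\<close> at which a dissipative angle has reached \<open>\<pi>\<close>. Up to that value of \<open>X + Y\<close> the factor \<open>\<theta>\<close> is \<open>1\<close> and the solutions agree; so a conservative angle has reached \<open>\<pi>\<close> as well, which cannot happen without a singular point.\<close>

lemma agree_nonsing:
  assumes XY: "0 <= X + Y" and ns: "\<And>X' Y'. 0 <= X' + Y' ==> X' <= X ==> Y' <= Y ==> nonsing X' Y'"
  shows "same_vars cv dv X Y"
proof -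
  define T where "T = {(X', Y'). 0 <= X' + Y' \<and> X' <= X \<and> Y' <= Y}"
  define r where "r = \<bar>X\<bar> + \<bar>Y\<bar>"
  have Teq: "T = ({-r..r} \<times> {-r..r}) \<inter> ({P. 0 <= fst P + snd P} \<inter> ({P. fst P <= X} \<inter> {P. snd P <= Y}))"
    by (auto simp: T_def r_def)
  have cT: "compact T" unfolding Teq
    by (intro compact_Int_closed compact_Times compact_Icc closed_Int closed_Collect_le continuous_intros)
  have TH: "T \<subseteq> half_plane" by (auto simp: T_def half_plane_def)
  define Bad where "Bad = {i \<in> T. pi <= max (cw dv (fst i) (snd i)) (cz dv (fst i) (snd i))}"
  have sub: "same_vars cv dv X' Y'"
    if s: "\<And>i. i \<in> Bad ==> s < fst i + snd i" and p: "(X', Y') \<in> T" "X' + Y' <= s" for s X' Y'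
  proof (rule unique_where_theta_1[where P="\<lambda>X' Y'. X' <= X \<and> Y' <= Y \<and> X' + Y' <= s" and b="max X Y"])
    show "closed {(X', Y'). X' <= X \<and> Y' <= Y \<and> X' + Y' <= s}"
    proof -
      have eq: "{(X', Y'). X' <= X \<and> Y' <= Y \<and> X' + Y' <= s} = {P. fst P <= X} \<inter> ({P. snd P <= Y} \<inter> {P. fst P + snd P <= s})" by auto
      show ?thesis unfolding eq by (intro closed_Int closed_Collect_le continuous_intros)
    qed
    show "1 = (1::real) \<and> dissipative_theta dv A B = 1" if "0 < A + B" "A <= X \<and> B <= Y \<and> A + B <= s" for A B
    proof -
      have "(A, B) \<in> T" using that by (simp add: T_def)
      then have "(A, B) \<notin> Bad ==> max (cw dv A B) (cz dv A B) < pi" by (auto simp: Bad_def)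
      moreover have "(A, B) \<notin> Bad" using s[of "(A, B)"] that by auto
      ultimately show ?thesis by (simp add: dissipative_theta_def)
    qed
  qed (use p in \<open>auto simp: T_def\<close>)
  have "Bad = {}"
  proof (rule ccontr)
    assume ne: "Bad \<noteq> {}"
    have cm: "continuous_on T (\<lambda>i. max (cw dv (fst i) (snd i)) (cz dv (fst i) (snd i)))"
      by (intro continuous_on_max continuous_on_subset[OF B.cont_fst_snd(2) TH] continuous_on_subset[OF B.cont_fst_snd(3) TH])
    have "Bad = T \<inter> (T \<inter> (\<lambda>i. max (cw dv (fst i) (snd i)) (cz dv (fst i) (snd i))) -` {pi..})"
      by (auto simp: Bad_def)
    then have "compact Bad"
      using compact_Int_closed[OF cT continuous_closed_preimage[OF cm compact_imp_closed[OF cT] closed_atLeast[of pi]]]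
      by simp
    moreover have "continuous_on Bad (\<lambda>i. fst i + snd i)" by (intro continuous_intros)
    ultimately obtain m where m: "m \<in> Bad" "\<And>i. i \<in> Bad ==> fst m + snd m <= fst i + snd i"
      using continuous_attains_inf[of Bad "\<lambda>i. fst i + snd i"] ne by blast
    obtain a b where ab: "m = (a, b)" by (cases m)
    have T: "0 <= a + b" "a <= X" "b <= Y" and bad: "pi <= max (cw dv a b) (cz dv a b)"
      using m(1) by (auto simp: ab Bad_def T_def)
    have good: "cw cv a b < pi" "cz cv a b < pi"
    proof -
      have "nonsing a Y'" if "- a <= Y'" "Y' <= b" for Y' by (rule ns) (use that T in auto)
      with angles_if_nonsing[of a b] T show "cw cv a b < pi" "cz cv a b < pi" by auto
    qed
    have "same_vars cv dv a b"
    proof (cases "a + b = 0")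
      case True
      then have "b = - a" by simp
      then show ?thesis using same_vars_boundary by simp
    next
      case False
      then have pos: "- b < a" using T by simp
      show ?thesis
      proof (rule same_vars_limit_X[OF pos])
        fix A assume A: "- b < A" "A < a"
        show "same_vars cv dv A b"
        proof (rule sub[of "A + b"])
          show "A + b < fst i + snd i" if "i \<in> Bad" for i using m(2)[OF that] ab A by simp
          show "(A, b) \<in> T" using A T by (simp add: T_def)
        qed simp
      qed (use pos in auto)
    qed
    then show False using good bad unfolding same_vars_def by auto
  qed
  then show ?thesis using sub[of "X + Y" X Y] XY by (simp add: T_def)
qed

text \<open>The top side of the past triangle may be singular, since the solutions are continuous and agree at all points below it.\<close>

lemma agree_below:
  assumes XY: "0 <= X + Y" and ns: "\<And>X' Y'. 0 <= X' + Y' ==> X' <= X ==> Y' < Y ==> nonsing X' Y'"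
  shows "same_vars cv dv X Y"
proof (cases "X + Y = 0")
  case True
  then have "Y = - X" by simp
  then show ?thesis using same_vars_boundary by simp
next
  case False
  then have pos: "- X < Y" using XY by simp
  show ?thesis
  proof (rule same_vars_limit_Y[OF pos])
    fix Y' assume Y': "- X < Y'" "Y' < Y"
    show "same_vars cv dv X Y'" by (rule agree_nonsing) (use Y' ns in auto)
  qed (use pos in auto)
qed

end

section \<open>The point where the singular curves originate\<close>

lemma cos_eq_minus_one_near_pi:
  assumes "pi / 2 < w" "w < 3 * pi / 2"
  shows "cos w = -1 \<longleftrightarrow> w = pi"
proof
  assume "cos w = -1"
  then obtain k :: int where k: "w = pi + 2 * pi * of_int k"
    unfolding eq_pi_mod_iff_cos[symmetric] eq_pi_mod_def by blast
  have "pi * (1 / 2) < pi * (1 + 2 * of_int k)" "pi * (1 + 2 * of_int k) < pi * (3 / 2)"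
    using assms unfolding k by (simp_all add: algebra_simps)
  then have "1 / 2 < 1 + 2 * real_of_int k" "1 + 2 * real_of_int k < 3 / 2"
    by (simp_all only: mult_less_cancel_left_pos[OF pi_gt_zero])
  then have "real_of_int k > -1" "real_of_int k < 1" by linarith+
  then have "k = 0" by linarith
  then show "w = pi" using k by simp
qed simp

lemma cos_ne_minus_one: "- pi < z ==> z < pi ==> cos z \<noteq> -1"
proof
  assume z: "- pi < z" "z < pi" "cos z = -1"
  then obtain k :: int where k: "z = pi + 2 * pi * of_int k"
    unfolding eq_pi_mod_iff_cos[symmetric] eq_pi_mod_def by blast
  have "pi * (-1) < pi * (1 + 2 * of_int k)" "pi * (1 + 2 * of_int k) < pi * 1"
    using z(1,2) unfolding k by (simp_all add: algebra_simps)
  then have "-1 < 1 + 2 * real_of_int k" "1 + 2 * real_of_int k < 1"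
    by (simp_all only: mult_less_cancel_left_pos[OF pi_gt_zero])
  then have "real_of_int (-1) < real_of_int k" "real_of_int k < real_of_int 0" by simp_all
  then have "-1 < k" "k < 0" unfolding of_int_less_iff .
  then show False by simp
qed

lemma concave_gt_between:
  fixes f :: "real => real"
  assumes d: "\<And>x. a <= x ==> x <= c ==> (f has_real_derivative f' x) (at x)"
    and d2: "\<And>x. a <= x ==> x <= c ==> (f' has_real_derivative f'' x) (at x)"
    and neg: "\<And>x. a <= x ==> x <= c ==> f'' x < 0"
    and abc: "a < b" "b < c" and k: "k <= f a" "k <= f c" "k < f a \<or> k < f c"
  shows "k < f b"
proof (rule ccontr)
  assume n: "\<not> k < f b"
  obtain \<xi> where \<xi>: "a < \<xi>" "\<xi> < b" "f b - f a = (b - a) * f' \<xi>"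
    using MVT2[OF abc(1), of f f'] d abc by auto
  obtain \<eta> where \<eta>: "b < \<eta>" "\<eta> < c" "f c - f b = (c - b) * f' \<eta>"
    using MVT2[OF abc(2), of f f'] d abc by auto
  have "f' \<eta> < f' \<xi>"
  proof (rule DERIV_neg_imp_decreasing[where f=f'])
    show "\<xi> < \<eta>" using \<xi> \<eta> by simp
    fix x assume "\<xi> <= x" "x <= \<eta>"
    then have "a <= x" "x <= c" using \<xi> \<eta> by simp_all
    then show "\<exists>y. (f' has_real_derivative y) (at x) \<and> y < 0" using d2 neg by blast
  qed
  moreover have "f' \<xi> <= 0"
  proof (rule ccontr)
    assume "\<not> f' \<xi> <= 0" then have "0 < (b - a) * f' \<xi>" using abc by simp
    then show False using \<xi>(3) n k by linarith
  qed
  moreover have "0 <= f' \<eta>"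
  proof (rule ccontr)
    assume "\<not> 0 <= f' \<eta>" then have "(c - b) * f' \<eta> < 0" using abc by (simp add: mult_pos_neg)
    then show False using \<eta>(3) n k by linarith
  qed
  ultimately show False by linarith
qed

lemma second_order_bounds:
  fixes f :: "real => real"
  assumes d: "\<And>x. \<bar>x - x0\<bar> <= r ==> (f has_real_derivative f' x) (at x)"
    and d2: "\<And>x. \<bar>x - x0\<bar> <= r ==> (f' has_real_derivative f'' x) (at x)"
    and z: "f' x0 = 0" and b: "\<And>x. \<bar>x - x0\<bar> <= r ==> - B2 <= f'' x \<and> f'' x <= - B1"
    and x: "\<bar>x - x0\<bar> <= r"
  shows "f x <= f x0 - B1 / 2 * (x - x0)\<^sup>2" "f x0 - B2 / 2 * (x - x0)\<^sup>2 <= f x"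
    "x0 <= x ==> f' x <= - B1 * (x - x0)"
proof -
  have "\<exists>t. \<bar>t - x0\<bar> <= r \<and> f x = f x0 + f'' t / 2 * (x - x0)\<^sup>2"
  proof (cases "x = x0")
    case True then show ?thesis using x by (intro exI[of _ x0]) auto
  next
    case False
    define diff where "diff m = (if m = 0 then f else if m = 1 then f' else f'')" for m :: nat
    have "\<exists>t. (if x < x0 then x < t \<and> t < x0 else x0 < t \<and> t < x) \<and>
        f x = (\<Sum>m<2. diff m x0 / fact m * (x - x0) ^ m) + diff 2 t / fact 2 * (x - x0) ^ 2"
    proof (rule Taylor[where a="x0 - r" and b="x0 + r"])
      show "\<forall>(m::nat) t. m < 2 \<and> x0 - r <= t \<and> t <= x0 + r --> (diff m has_real_derivative diff (Suc m) t) (at t)"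
      proof (intro allI impI)
        fix m :: nat and t assume a: "m < 2 \<and> x0 - r <= t \<and> t <= x0 + r"
        then have "\<bar>t - x0\<bar> <= r" by (simp add: abs_le_iff)
        moreover have "m = 0 \<or> m = 1" using a by auto
        ultimately show "(diff m has_real_derivative diff (Suc m) t) (at t)" using d d2 by (auto simp: diff_def)
      qed
    qed (use x False in \<open>auto simp: diff_def abs_le_iff\<close>)
    then obtain t where t: "if x < x0 then x < t \<and> t < x0 else x0 < t \<and> t < x"
      "f x = (\<Sum>m<2. diff m x0 / fact m * (x - x0) ^ m) + diff 2 t / fact 2 * (x - x0) ^ 2" by blast
    have "f x = f x0 + f'' t / 2 * (x - x0)\<^sup>2"
      using t(2) z by (simp add: diff_def numeral_2_eq_2)
    moreover have "\<bar>t - x0\<bar> <= r" using t(1) x by (auto split: if_splits)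
    ultimately show ?thesis by blast
  qed
  then obtain t where t: "\<bar>t - x0\<bar> <= r" "f x = f x0 + f'' t / 2 * (x - x0)\<^sup>2" by blast
  have bt: "- B2 <= f'' t" "f'' t <= - B1" using b[OF t(1)] by auto
  have "f'' t / 2 * (x - x0)\<^sup>2 <= - B1 / 2 * (x - x0)\<^sup>2" "- B2 / 2 * (x - x0)\<^sup>2 <= f'' t / 2 * (x - x0)\<^sup>2"
    using bt by (intro mult_right_mono; simp)+
  then show "f x <= f x0 - B1 / 2 * (x - x0)\<^sup>2" "f x0 - B2 / 2 * (x - x0)\<^sup>2 <= f x" using t(2) by simp_all
  assume x0: "x0 <= x"
  show "f' x <= - B1 * (x - x0)"
  proof (cases "x0 = x")
    case True then show ?thesis using z by simp
  next
    case False
    then obtain s where s: "x0 < s" "s < x" "f' x - f' x0 = (x - x0) * f'' s"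
      using MVT2[of x0 x f' f''] d2 x x0 by (force simp: abs_le_iff)
    have "(x - x0) * f'' s <= (x - x0) * (- B1)" using b[of s] s x x0 by (intro mult_left_mono) (auto simp: abs_le_iff)
    then show ?thesis using s(3) z by (simp add: algebra_simps)
  qed
qed

text \<open>The hypotheses of the theorem, with names for the objects whose existence they assert.\<close>

locale singular_origin = cons_diss c cv u0 u1 ucons dv udiss
  for c cv u0 u1 ucons dv udiss +
  fixes X0 Y0 \<kappa> \<delta> \<epsilon> :: real and \<psi> \<gamma>m \<gamma>p :: "real => real"
  assumes c'_pos: "\<And>v. 0 < deriv c v"
    and cons: "conservative_vars c u0 u1 cv"
    and type2: "type2_origin_point cv X0 Y0 \<kappa>"
    and t0_pos: "0 < ct cv X0 Y0"
    and lc: "level_curve cv X0 Y0 \<kappa> \<epsilon> \<psi>" and delta_pos: "0 < \<delta>"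
    and bm: "branch_image cv {(X, \<psi> X) | X. X \<in> {X0-\<epsilon><..<X0}} (ct cv X0 Y0) \<delta> \<gamma>m"
    and bp: "branch_image cv {(X, \<psi> X) | X. X \<in> {X0<..<X0+\<epsilon>}} (ct cv X0 Y0) \<delta> \<gamma>p"
    and gamma_less: "\<And>t. ct cv X0 Y0 < t ==> t <= ct cv X0 Y0 + \<delta> ==> \<gamma>m t < \<gamma>p t"
    and only: "\<And>X Y. 0 <= ct cv X Y ==> ct cv X Y <= ct cv X0 Y0 + \<delta> ==> eq_pi_mod (cw cv X Y) \<or> eq_pi_mod (cz cv X Y)
        ==> (X, Y) \<in> {(X0, Y0)} \<union> {(X, \<psi> X) | X. X \<in> {X0-\<epsilon><..<X0}} \<union> {(X, \<psi> X) | X. X \<in> {X0<..<X0+\<epsilon>}}"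
begin

abbreviation t0 :: real where "t0 \<equiv> ct cv X0 Y0"

lemma smooth_vars:
  "smooth_on UNIV (\<lambda>(X, Y). cu cv X Y)" "smooth_on UNIV (\<lambda>(X, Y). cw cv X Y)" "smooth_on UNIV (\<lambda>(X, Y). cz cv X Y)"
  "smooth_on UNIV (\<lambda>(X, Y). cp cv X Y)" "smooth_on UNIV (\<lambda>(X, Y). cq cv X Y)" "smooth_on UNIV (\<lambda>(X, Y). ct cv X Y)"
  using cons unfolding conservative_vars_def by blast+

lemma system_everywhere: "semilinear_system_at c 1 cv X Y"
  using cons unfolding conservative_vars_def by blast

lemma continuous_UNIV:
  "continuous_on UNIV (\<lambda>P. cu cv (fst P) (snd P))" "continuous_on UNIV (\<lambda>P. cw cv (fst P) (snd P))"
  "continuous_on UNIV (\<lambda>P. cz cv (fst P) (snd P))" "continuous_on UNIV (\<lambda>P. cq cv (fst P) (snd P))"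
  using smooth_vars(1,2,3,5)[THEN smooth_on_imp_continuous] by (simp_all add: split_def)

text \<open>The conservative variables also solve the system below the line \<open>X + Y = 0\<close>. Reflection in this line turns the estimate above it into one below.\<close>

lemma p_pos_below: "X + Y <= 0 ==> 0 < cp cv X Y"
proof -
  assume XY: "X + Y <= 0"
  have A: "bounded_linear (\<lambda>P :: real \<times> real. (- snd P, - fst P))"
    by (intro bounded_linear_Pair bounded_linear_minus bounded_linear_fst bounded_linear_snd)
  have sm: "smooth_on UNIV (\<lambda>(X, Y). cp cv (- Y) (- X))"
    unfolding smooth_on_def
  proof
    fix n
    have "Ck_on n UNIV (\<lambda>(X, Y). cp cv X Y)" by (rule smooth_on_def[THEN iffD1, THEN spec, OF smooth_vars(4)])
    from smooth_on_compose_linear[OF A this] show "Ck_on n UNIV (\<lambda>(X, Y). cp cv (- Y) (- X))" by (simp add: split_def)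
  qed
  define a where "a X Y = deriv c (cu cv (-Y) (-X)) / (8 * (c (cu cv (-Y) (-X)))\<^sup>2) *
     (sin (cz cv (-Y) (-X)) - sin (cw cv (-Y) (-X))) * cq cv (-Y) (-X)" for X Y
  have comp: "continuous_on half_plane (\<lambda>P. f (- snd P) (- fst P))"
    if "continuous_on UNIV (\<lambda>P. f (fst P) (snd P))" for f :: "real => real => real"
  proof -
    have "continuous_on half_plane (\<lambda>P. (\<lambda>P. f (fst P) (snd P)) (- snd P, - fst P))"
      by (rule continuous_on_compose2[OF that]) (auto intro!: continuous_intros)
    then show ?thesis by simp
  qed
  note C = continuous_UNIV[THEN comp]
  have "continuous_on half_plane (\<lambda>P. c (cu cv (- snd P) (- fst P)))" "continuous_on half_plane (\<lambda>P. deriv c (cu cv (- snd P) (- fst P)))"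
    by (rule continuous_on_compose2[OF A.cont_c(1) C(1)]; simp) (rule continuous_on_compose2[OF A.cont_c(2) C(1)]; simp)
  then have ca: "continuous_on half_plane (\<lambda>(X, Y). a X Y)"
    unfolding a_def split_def by (intro continuous_intros C ballI; simp add: A.c_ne)+
  have "0 < cp cv (- (- X)) (- (- Y))"
  proof (rule positive_along_characteristics[where f="\<lambda>X Y. cp cv (- Y) (- X)" and X="-Y" and Y="-X"])
    show "continuous_on half_plane (\<lambda>(X, Y). cp cv (- Y) (- X))"
      using smooth_on_imp_continuous[OF sm] by (rule continuous_on_subset) simp
    show "loc_lipschitz_X (\<lambda>X Y. cp cv (- Y) (- X))" by (rule smooth_imp_loc_lipschitz_X[OF sm])
    show "1 <= cp cv (- (- s)) (- s)" for s using A.bdry_vals(6)[of s] by simp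
    show "0 <= - Y + - X" using XY by simp
    fix r :: real
    obtain C where C: "0 <= C" "\<And>X Y. 0 <= X + Y ==> \<bar>X\<bar> <= r ==> \<bar>Y\<bar> <= r ==> \<bar>a X Y\<bar> <= C"
      using A.bounded_on_box[OF ca] by blast
    have "\<exists>D. has_dX (\<lambda>X Y. cp cv (- Y) (- X)) D X Y \<and> \<bar>D\<bar> <= C * \<bar>cp cv (- Y) (- X)\<bar>"
      if h: "0 < X + Y \<and> \<bar>X\<bar> <= r \<and> \<bar>Y\<bar> <= r" for X Y
    proof -
      have "((\<lambda>Y'. cp cv (- Y) Y') has_real_derivative rhs_p c cv (- Y) (- X)) (at (- X))"
        using system_everywhere[of "-Y" "-X"] by (simp add: semilinear_system_at_iff has_dY_def)
      from DERIV_chain2[OF this DERIV_minus[OF DERIV_ident]]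
      have "has_dX (\<lambda>X Y. cp cv (- Y) (- X)) (- rhs_p c cv (- Y) (- X)) X Y"
        unfolding has_dX_def by simp
      moreover have "- rhs_p c cv (- Y) (- X) = - a X Y * cp cv (- Y) (- X)" by (simp add: rhs_p_def a_def)
      moreover have "\<bar>- a X Y * cp cv (- Y) (- X)\<bar> <= C * \<bar>cp cv (- Y) (- X)\<bar>"
        using C(2)[of X Y] h by (simp add: abs_mult mult_right_mono)
      ultimately show ?thesis by metis
    qed
    then show "\<exists>C\<ge>0. AE Y in lborel. AE X in lborel. 0 < X + Y \<and> \<bar>X\<bar> <= r \<and> \<bar>Y\<bar> <= r -->
               (\<exists>D. has_dX (\<lambda>X Y. cp cv (- Y) (- X)) D X Y \<and> \<bar>D\<bar> <= C * \<bar>cp cv (- Y) (- X)\<bar>)"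
      using C(1) by (intro exI[of _ C]) simp
  qed
  then show ?thesis by simp
qed

text \<open>Consequently the point \<open>P\<close>, where \<open>t > 0\<close>, lies above the initial line.\<close>

lemma t_nonpos_below: "X + Y <= 0 ==> ct cv X Y <= 0"
proof -
  assume XY: "X + Y <= 0"
  have "ct cv X Y <= ct cv (- Y) Y"
  proof (rule DERIV_nonneg_imp_nondecreasing[where f="\<lambda>X. ct cv X Y"])
    fix x assume x: "X <= x" "x <= - Y"
    have "0 <= rhs_tX c cv x Y"
      unfolding rhs_tX_def using p_pos_below[of x Y] x A.c_pos[of "cu cv x Y"] one_plus_cos_nonneg[of "cw cv x Y"]
      by (intro divide_nonneg_pos mult_nonneg_nonneg) auto
    then show "\<exists>D. ((\<lambda>X. ct cv X Y) has_real_derivative D) (at x) \<and> 0 <= D"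
      using system_everywhere[of x Y] by (auto simp: semilinear_system_at_iff has_dX_def)
  qed (use XY in simp)
  also have "ct cv (- Y) Y = 0" using A.bdry_vals(2)[of "-Y"] by simp
  finally show ?thesis .
qed

lemma P_interior: "0 < X0 + Y0"
  using t_nonpos_below[of X0 Y0] t0_pos by linarith

lemma nonsing_iff: "nonsing X Y \<longleftrightarrow> \<not> (eq_pi_mod (cw cv X Y) \<or> eq_pi_mod (cz cv X Y))"
  unfolding nonsing_def eq_pi_mod_iff_cos by simp

lemma eps_pos: "0 < \<epsilon>" and psi_cont: "continuous_on {X0-\<epsilon><..<X0+\<epsilon>} \<psi>" and psi_X0: "\<psi> X0 = Y0"
  and psi_level: "\<forall>\<^sub>F P in nhds (X0, Y0). eq_pi_mod (cw cv (fst P) (snd P)) \<longleftrightarrow> snd P = \<psi> (fst P)"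
  using lc unfolding level_curve_def by (simp_all add: split_def)

lemma branch_m:
  assumes "X0 - \<epsilon> < X" "X < X0" "ct cv X (\<psi> X) <= t0 + \<delta>"
  shows "t0 < ct cv X (\<psi> X)" "cx cv X (\<psi> X) = \<gamma>m (ct cv X (\<psi> X))"
proof -
  have "(cx cv X (\<psi> X), ct cv X (\<psi> X)) \<in> {(\<gamma>m t, t) | t. t \<in> {t0<..t0+\<delta>}}"
    unfolding bm[unfolded branch_image_def, symmetric] using assms by auto
  then show "t0 < ct cv X (\<psi> X)" "cx cv X (\<psi> X) = \<gamma>m (ct cv X (\<psi> X))" by auto
qed

lemma branch_p:
  assumes "X0 < X" "X < X0 + \<epsilon>" "ct cv X (\<psi> X) <= t0 + \<delta>"
  shows "t0 < ct cv X (\<psi> X)" "cx cv X (\<psi> X) = \<gamma>p (ct cv X (\<psi> X))"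
proof -
  have "(cx cv X (\<psi> X), ct cv X (\<psi> X)) \<in> {(\<gamma>p t, t) | t. t \<in> {t0<..t0+\<delta>}}"
    unfolding bp[unfolded branch_image_def, symmetric] using assms by auto
  then show "t0 < ct cv X (\<psi> X)" "cx cv X (\<psi> X) = \<gamma>p (ct cv X (\<psi> X))" by auto
qed

lemma singular_cases:
  assumes "0 <= X + Y" "ct cv X Y <= t0 + \<delta>" "\<not> nonsing X Y"
  shows "(X = X0 \<and> Y = Y0) \<or> (X0 - \<epsilon> < X \<and> X < X0 \<and> Y = \<psi> X) \<or> (X0 < X \<and> X < X0 + \<epsilon> \<and> Y = \<psi> X)"
  using only[OF A.t_nonneg[OF assms(1)] assms(2)] assms(3) unfolding nonsing_iff by auto

lemma nonsing_early:
  assumes "0 <= X + Y" "ct cv X Y <= t0" "X \<noteq> X0 \<or> Y \<noteq> Y0"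
  shows "nonsing X Y"
proof (rule ccontr)
  assume n: "\<not> nonsing X Y"
  show False
    using singular_cases[OF assms(1) _ n] branch_m(1)[of X] branch_p(1)[of X] assms(2,3) delta_pos by auto
qed

lemma same_at_P: "same_vars cv dv X0 Y0"
proof (rule agree_below)
  show "0 <= X0 + Y0" using P_interior by simp
  fix X' Y' assume a: "0 <= X' + Y'" "X' <= X0" "Y' < Y0"
  have "ct cv X' Y' <= ct cv X0 Y'" by (rule A.mono_X(2)) (use a in auto)
  also have "\<dots> <= t0" by (rule A.mono_Y(2)) (use a in auto)
  finally show "nonsing X' Y'" using nonsing_early a by auto
qed

lemma rhs_w_pos:
  assumes "0 <= X + Y" "cos (cw cv X Y) < cos (cz cv X Y)"
  shows "0 < rhs_w c cv X Y"
  unfolding rhs_w_def using A.q_pos[OF assms(1)] assms(2) c'_pos[of "cu cv X Y"] A.c_pos[of "cu cv X Y"] by simp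

lemma zP_ne: "cos (cz cv X0 Y0) \<noteq> -1" and wP_cos: "cos (cw cv X0 Y0) = -1"
  using type2 unfolding type2_origin_point_def eq_pi_mod_iff_cos by auto

lemma wY_P: "has_dY (cw cv) (rhs_w c cv X Y) X Y"
  using system_everywhere[of X Y] by (simp add: semilinear_system_at_iff)

lemma rhs_w_P_pos: "0 < rhs_w c cv X0 Y0"
  by (rule rhs_w_pos) (use P_interior zP_ne wP_cos one_plus_cos_pos[of "cz cv X0 Y0"] in auto)

lemma angles_below_P:
  assumes "- X0 <= Y" "Y < Y0"
  shows "- pi < cw cv X0 Y \<and> cw cv X0 Y < pi" "- pi < cz cv X0 Y \<and> cz cv X0 Y < pi"
proof -
  have ns: "nonsing X0 Y'" if "- X0 <= Y'" "Y' <= Y" for Y'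
  proof (rule nonsing_early)
    show "ct cv X0 Y' <= t0" by (rule A.mono_Y(2)) (use that assms in auto)
  qed (use that assms in auto)
  show "- pi < cw cv X0 Y \<and> cw cv X0 Y < pi" "- pi < cz cv X0 Y \<and> cz cv X0 Y < pi"
    using angles_if_nonsing[of X0 Y] ns assms by auto
qed

text \<open>The angle is a lift that starts in the open interval between \<open>-\<pi>\<close> and \<open>\<pi>\<close>. Below \<open>P\<close> on the same vertical line there is no singular point, so it stays there; it is increasing at \<open>P\<close>, so it reaches \<open>\<pi>\<close>, not \<open>-\<pi>\<close>.\<close>

lemma w_P: "cw cv X0 Y0 = pi"
proof -
  have d: "((\<lambda>Y. cw cv X0 Y) has_real_derivative rhs_w c cv X0 Y0) (at Y0)"
    using wY_P[of X0 Y0] unfolding has_dY_def .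
  obtain e where e: "e > 0" "\<And>h. 0 < h ==> h < e ==> cw cv X0 (Y0 - h) < cw cv X0 Y0"
    using DERIV_pos_inc_left[OF d rhs_w_P_pos] by blast
  define h where "h = min (e / 2) (X0 + Y0)"
  have h: "0 < h" "h < e" "- X0 <= Y0 - h" using e(1) P_interior by (auto simp: h_def)
  have lo: "- pi < cw cv X0 Y0" using e(2)[OF h(1,2)] angles_below_P(1)[of "Y0 - h"] h by simp
  have hi: "cw cv X0 Y0 - pi <= 0"
  proof (rule AE_imp_le_continuous[of "-X0" Y0 "\<lambda>Y. cw cv X0 Y - pi"])
    show "continuous_on {- X0..Y0} (\<lambda>Y. cw cv X0 Y - pi)"
      by (intro continuous_intros continuous_on_half_plane_vline[OF A.cont_vars(2)]) simp
    show "AE Y in lborel. - X0 < Y \<and> Y < Y0 --> cw cv X0 Y - pi <= 0"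
    proof (rule AE_I2, intro impI)
      fix Y assume "- X0 < Y \<and> Y < Y0"
      then show "cw cv X0 Y - pi <= 0" using angles_below_P(1)[of Y] by simp
    qed
  qed (use P_interior in auto)
  show ?thesis
  proof (cases "cw cv X0 Y0 = pi")
    case False
    then show ?thesis using cos_ne_minus_one[of "cw cv X0 Y0"] lo hi wP_cos by simp
  qed
qed

lemma z_P: "- pi < cz cv X0 Y0" "cz cv X0 Y0 < pi"
proof -
  have c: "continuous_on {- X0..Y0} (\<lambda>Y. cz cv X0 Y)" by (rule continuous_on_half_plane_vline[OF A.cont_vars(3)]) simp
  have "cz cv X0 Y0 - pi <= 0"
    by (rule AE_imp_le_continuous[of "-X0" Y0 "\<lambda>Y. cz cv X0 Y - pi"])
       (use P_interior angles_below_P(2) in \<open>auto intro!: continuous_intros c AE_I2 less_imp_le\<close>)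
  moreover have "- pi - cz cv X0 Y0 <= 0"
  proof (rule AE_imp_le_continuous[of "-X0" Y0 "\<lambda>Y. - pi - cz cv X0 Y"])
    show "AE Y in lborel. - X0 < Y \<and> Y < Y0 --> - pi - cz cv X0 Y <= 0"
    proof (rule AE_I2, intro impI)
      fix Y assume "- X0 < Y \<and> Y < Y0"
      then show "- pi - cz cv X0 Y <= 0" using angles_below_P(2)[of Y] by simp
    qed
  qed (use P_interior in \<open>auto intro!: continuous_intros c\<close>)
  moreover have "cz cv X0 Y0 \<noteq> pi" "cz cv X0 Y0 \<noteq> - pi" using zP_ne by auto
  ultimately show "- pi < cz cv X0 Y0" "cz cv X0 Y0 < pi" by auto
qed

text \<open>Since \<open>w_Y\<close> is positive, the sign follows from \<open>\<kappa> > 0\<close>.\<close>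

lemma wXX_P_neg: "dX (dX (cw cv)) X0 Y0 < 0"
proof -
  have "dY (cw cv) X0 Y0 = rhs_w c cv X0 Y0"
    using wY_P[of X0 Y0] unfolding has_dY_def dY_def by (rule DERIV_imp_deriv)
  moreover have "0 < - (dX (dX (cw cv)) X0 Y0 / (2 * dY (cw cv) X0 Y0))"
    using type2 unfolding type2_origin_point_def by auto
  ultimately show ?thesis using rhs_w_P_pos by (simp add: divide_less_0_iff)
qed

lemma wX_P: "dX (cw cv) X0 Y0 = 0"
  using type2 unfolding type2_origin_point_def by auto

definition inbox :: "real => real => real => bool" where
  "inbox r X Y \<longleftrightarrow> \<bar>X - X0\<bar> <= r \<and> \<bar>Y - Y0\<bar> <= r"

text \<open>A square around \<open>P\<close> in which the strict inequalities valid at \<open>P\<close> persist for both solutions, so that \<open>w_Y > 0\<close> and \<open>w\<close> is concave in \<open>X\<close>, and in which \<open>{w = \<pi>}\<close> is the given curve.\<close>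

definition good_box :: "real => bool" where
  "good_box r \<longleftrightarrow> 0 < r \<and> r < \<epsilon> \<and> (\<forall>X Y. inbox r X Y --> 0 < X + Y \<and>
     pi / 2 < cw cv X Y \<and> cw cv X Y < 3 * pi / 2 \<and> pi / 2 < cw dv X Y \<and> cw dv X Y < 3 * pi / 2 \<and>
     - pi < cz cv X Y \<and> cz cv X Y < pi \<and> - pi < cz dv X Y \<and> cz dv X Y < pi \<and>
     cos (cw cv X Y) < cos (cz cv X Y) \<and> cos (cw dv X Y) < cos (cz dv X Y) \<and>
     dX (dX (cw cv)) X Y < 0 \<and> (cw cv X Y = pi \<longleftrightarrow> Y = \<psi> X))"

lemma ex_good_box: "\<exists>r. good_box r"
proof -
  have iH: "(X0, Y0) \<in> interior half_plane"
  proof -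
    have "open {P :: real \<times> real. 0 < fst P + snd P}" by (intro open_Collect_less continuous_intros)
    moreover have "{P. 0 < fst P + snd P} \<subseteq> half_plane" by (auto simp: half_plane_def)
    moreover have "(X0, Y0) \<in> {P. 0 < fst P + snd P}" using P_interior by simp
    ultimately show ?thesis by (metis interiorI)
  qed
  have tend: "((\<lambda>P. f (fst P) (snd P)) \<longlongrightarrow> f X0 Y0) (nhds (X0, Y0))"
    if "continuous_on half_plane (\<lambda>P. f (fst P) (snd P))" for f :: "real => real => real"
  proof -
    have "(\<lambda>P. f (fst P) (snd P)) \<midarrow>(X0, Y0)\<rightarrow> (\<lambda>P. f (fst P) (snd P)) (X0, Y0)"
      using continuous_on_interior[OF that iH] unfolding isCont_def .
    then have "((\<lambda>P. f (fst P) (snd P)) \<longlongrightarrow> (\<lambda>P. f (fst P) (snd P)) (X0, Y0)) (nhds (X0, Y0))"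
      by (rule tendsto_at_iff_tendsto_nhds[THEN iffD1])
    then show ?thesis by simp
  qed
  note L = tend[OF A.cont_fst_snd(2)] tend[OF A.cont_fst_snd(3)] tend[OF B.cont_fst_snd(2)] tend[OF B.cont_fst_snd(3)]
  have P: "cw dv X0 Y0 = pi" "cz dv X0 Y0 = cz cv X0 Y0" using same_at_P w_P unfolding same_vars_def by auto
  have "continuous_on half_plane (\<lambda>P. dX (dX (cw cv)) (fst P) (snd P))"
    using smooth_on_imp_continuous[OF smooth_on_partials(4)[OF smooth_on_partials(4)[OF smooth_vars(2)]]]
    by (auto simp: split_def intro: continuous_on_subset)
  note LX = tend[OF this]
  have cz1: "-1 < cos (cz cv X0 Y0)" using one_plus_cos_pos[OF zP_ne] by simp
  have pib: "pi / 2 < pi" "pi < 3 * pi / 2" using pi_gt_zero by auto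
  have Ls: "((\<lambda>P. cos (cz cv (fst P) (snd P)) - cos (cw cv (fst P) (snd P))) \<longlongrightarrow> cos (cz cv X0 Y0) - cos pi) (nhds (X0, Y0))"
    "((\<lambda>P. cos (cz dv (fst P) (snd P)) - cos (cw dv (fst P) (snd P))) \<longlongrightarrow> cos (cz cv X0 Y0) - cos pi) (nhds (X0, Y0))"
    by (intro tendsto_diff tendsto_cos L[unfolded w_P P])+
  have Lsum: "((\<lambda>P. fst P + snd P) \<longlongrightarrow> X0 + Y0) (nhds (X0, Y0))"
    using tendsto_add[OF tendsto_fst[OF filterlim_ident] tendsto_snd[OF filterlim_ident]] by fastforce
  have cpos: "0 < cos (cz cv X0 Y0) - cos pi" using cz1 by simp
  have ev: "\<forall>\<^sub>F P in nhds (X0, Y0). 0 < fst P + snd P \<and>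
     pi / 2 < cw cv (fst P) (snd P) \<and> cw cv (fst P) (snd P) < 3 * pi / 2 \<and> pi / 2 < cw dv (fst P) (snd P) \<and> cw dv (fst P) (snd P) < 3 * pi / 2 \<and>
     - pi < cz cv (fst P) (snd P) \<and> cz cv (fst P) (snd P) < pi \<and> - pi < cz dv (fst P) (snd P) \<and> cz dv (fst P) (snd P) < pi \<and>
     0 < cos (cz cv (fst P) (snd P)) - cos (cw cv (fst P) (snd P)) \<and> 0 < cos (cz dv (fst P) (snd P)) - cos (cw dv (fst P) (snd P)) \<and>
     dX (dX (cw cv)) (fst P) (snd P) < 0 \<and> (eq_pi_mod (cw cv (fst P) (snd P)) \<longleftrightarrow> snd P = \<psi> (fst P))"
    using pib z_P
    by (intro eventually_conj psi_level order_tendstoD(1)[OF Lsum P_interior]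
       order_tendstoD(1)[OF L(1)] order_tendstoD(2)[OF L(1)] order_tendstoD(1)[OF L(2)] order_tendstoD(2)[OF L(2)]
       order_tendstoD(1)[OF L(3)] order_tendstoD(2)[OF L(3)] order_tendstoD(1)[OF L(4)] order_tendstoD(2)[OF L(4)]
       order_tendstoD(1)[OF Ls(1)] order_tendstoD(1)[OF Ls(2)] order_tendstoD(2)[OF LX])
       (simp_all only: w_P P wXX_P_neg cpos)
  then obtain d where d: "d > 0" "\<And>P. dist P (X0, Y0) < d ==> 0 < fst P + snd P \<and>
     pi / 2 < cw cv (fst P) (snd P) \<and> cw cv (fst P) (snd P) < 3 * pi / 2 \<and> pi / 2 < cw dv (fst P) (snd P) \<and> cw dv (fst P) (snd P) < 3 * pi / 2 \<and>
     - pi < cz cv (fst P) (snd P) \<and> cz cv (fst P) (snd P) < pi \<and> - pi < cz dv (fst P) (snd P) \<and> cz dv (fst P) (snd P) < pi \<and>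
     0 < cos (cz cv (fst P) (snd P)) - cos (cw cv (fst P) (snd P)) \<and> 0 < cos (cz dv (fst P) (snd P)) - cos (cw dv (fst P) (snd P)) \<and>
     dX (dX (cw cv)) (fst P) (snd P) < 0 \<and> (eq_pi_mod (cw cv (fst P) (snd P)) \<longleftrightarrow> snd P = \<psi> (fst P))"
    unfolding eventually_nhds_metric by blast
  define r where "r = min (d / 3) (\<epsilon> / 2)"
  have r: "0 < r" "r < \<epsilon>" "r <= d / 3" using d(1) eps_pos by (auto simp: r_def)
  have "good_box r"
    unfolding good_box_def
  proof (intro conjI[OF r(1)] conjI[OF r(2)] allI impI)
    fix X Y assume b: "inbox r X Y"
    have "dist (X, Y) (X0, Y0) <= \<bar>X - X0\<bar> + \<bar>Y - Y0\<bar>"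
      using norm_Pair_le[of "X - X0" "Y - Y0"] by (simp add: dist_norm)
    also have "\<dots> <= 2 * (d / 3)" using b r(3) unfolding inbox_def by linarith
    also have "\<dots> < d" using d(1) by simp
    finally have D: "dist (X, Y) (X0, Y0) < d" .
    from d(2)[OF this] have
      *: "pi / 2 < cw cv X Y" "cw cv X Y < 3 * pi / 2" "eq_pi_mod (cw cv X Y) \<longleftrightarrow> Y = \<psi> X" by auto
    show "0 < X + Y \<and>
     pi / 2 < cw cv X Y \<and> cw cv X Y < 3 * pi / 2 \<and> pi / 2 < cw dv X Y \<and> cw dv X Y < 3 * pi / 2 \<and>
     - pi < cz cv X Y \<and> cz cv X Y < pi \<and> - pi < cz dv X Y \<and> cz dv X Y < pi \<and>
     cos (cw cv X Y) < cos (cz cv X Y) \<and> cos (cw dv X Y) < cos (cz dv X Y) \<and>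
     dX (dX (cw cv)) X Y < 0 \<and> (cw cv X Y = pi \<longleftrightarrow> Y = \<psi> X)"
      using d(2)[OF D] cos_eq_minus_one_near_pi[OF *(1,2)] *(3) unfolding eq_pi_mod_iff_cos by auto
  qed
  then show ?thesis ..
qed

end

section \<open>The level curve near its vertex\<close>

lemma ex_less_four:
  fixes a b c d :: real
  assumes "0 < a" "0 < b" "0 < c" "0 < d"
  shows "\<exists>h>0. h < a \<and> h < b \<and> h < c \<and> h < d"
  by (rule exI[of _ "min (min a b) (min c d) / 2"]) (use assms in \<open>auto simp: min_def\<close>)

context singular_origin
begin

lemma good_boxD:
  assumes "good_box r" "inbox r X Y"
  shows "0 < X + Y" "0 <= X + Y" "pi / 2 < cw cv X Y" "cw cv X Y < 3 * pi / 2" "pi / 2 < cw dv X Y" "cw dv X Y < 3 * pi / 2"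
    "- pi < cz cv X Y" "cz cv X Y < pi" "- pi < cz dv X Y" "cz dv X Y < pi"
    "cos (cw cv X Y) < cos (cz cv X Y)" "cos (cw dv X Y) < cos (cz dv X Y)"
    "dX (dX (cw cv)) X Y < 0" "cw cv X Y = pi \<longleftrightarrow> Y = \<psi> X"
    "cos (cw cv X Y) = -1 \<longleftrightarrow> cw cv X Y = pi" "cos (cw dv X Y) = -1 \<longleftrightarrow> cw dv X Y = pi"
    "cos (cz cv X Y) \<noteq> -1" "cos (cz dv X Y) \<noteq> -1"
proof -
  have g: "0 < X + Y \<and>
     pi / 2 < cw cv X Y \<and> cw cv X Y < 3 * pi / 2 \<and> pi / 2 < cw dv X Y \<and> cw dv X Y < 3 * pi / 2 \<and>
     - pi < cz cv X Y \<and> cz cv X Y < pi \<and> - pi < cz dv X Y \<and> cz dv X Y < pi \<and>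
     cos (cw cv X Y) < cos (cz cv X Y) \<and> cos (cw dv X Y) < cos (cz dv X Y) \<and>
     dX (dX (cw cv)) X Y < 0 \<and> (cw cv X Y = pi \<longleftrightarrow> Y = \<psi> X)"
    using assms unfolding good_box_def by blast
  then show "0 < X + Y" "pi / 2 < cw cv X Y" "cw cv X Y < 3 * pi / 2" "pi / 2 < cw dv X Y" "cw dv X Y < 3 * pi / 2"
    "- pi < cz cv X Y" "cz cv X Y < pi" "- pi < cz dv X Y" "cz dv X Y < pi"
    "cos (cw cv X Y) < cos (cz cv X Y)" "cos (cw dv X Y) < cos (cz dv X Y)"
    "dX (dX (cw cv)) X Y < 0" "cw cv X Y = pi \<longleftrightarrow> Y = \<psi> X" by blast+
  show "0 <= X + Y" using g by simp
  show "cos (cw cv X Y) = -1 \<longleftrightarrow> cw cv X Y = pi" "cos (cw dv X Y) = -1 \<longleftrightarrow> cw dv X Y = pi"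
    using cos_eq_minus_one_near_pi[of "cw cv X Y"] cos_eq_minus_one_near_pi[of "cw dv X Y"] g by blast+
  show "cos (cz cv X Y) \<noteq> -1" "cos (cz dv X Y) \<noteq> -1"
    using cos_ne_minus_one[of "cz cv X Y"] cos_ne_minus_one[of "cz dv X Y"] g by blast+
qed

lemma good_box_pos: "good_box r ==> 0 < r" and good_box_eps: "good_box r ==> r < \<epsilon>"
  unfolding good_box_def by blast+

lemma w_strict_Y:
  assumes g: "good_box r" and b: "inbox r X Y1" "inbox r X Y2" and lt: "Y1 < Y2"
  shows "cw cv X Y1 < cw cv X Y2"
proof (rule DERIV_pos_imp_increasing[where f="\<lambda>Y. cw cv X Y", OF lt])
  fix y assume y: "Y1 <= y" "y <= Y2"
  have iy: "inbox r X y" using b y unfolding inbox_def by (auto simp: abs_le_iff)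
  show "\<exists>D. ((\<lambda>Y. cw cv X Y) has_real_derivative D) (at y) \<and> 0 < D"
    using wY_P[of X y] rhs_w_pos[of X y] good_boxD[OF g iy] unfolding has_dY_def by blast
qed

lemma wX_derivs:
  "((\<lambda>X. cw cv X Y) has_real_derivative dX (cw cv) X Y) (at X)"
  "((\<lambda>X. dX (cw cv) X Y) has_real_derivative dX (dX (cw cv)) X Y) (at X)"
  using smooth_on_partials(1)[OF smooth_vars(2)] smooth_on_partials(1)[OF smooth_on_partials(4)[OF smooth_vars(2)]]
  unfolding has_dX_def by blast+

lemma w_concave:
  assumes g: "good_box r" and b: "inbox r A Y" "inbox r D Y" and lt: "A < B" "B < D"
    and k: "k <= cw cv A Y" "k <= cw cv D Y" "k < cw cv A Y \<or> k < cw cv D Y"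
  shows "k < cw cv B Y"
proof (rule concave_gt_between[where f="\<lambda>X. cw cv X Y" and a=A and c=D, OF wX_derivs _ lt k])
  fix x assume "A <= x" "x <= D"
  then have "inbox r x Y" using b unfolding inbox_def by (auto simp: abs_le_iff)
  then show "dX (dX (cw cv)) x Y < 0" by (rule good_boxD(13)[OF g])
qed

text \<open>On the line \<open>Y = Y0\<close> the angle is strictly concave with critical value \<open>\<pi>\<close> at \<open>P\<close>.\<close>

lemma w_on_line:
  assumes g: "good_box r" and X: "\<bar>X - X0\<bar> <= r" "X \<noteq> X0"
  shows "cw cv X Y0 < pi"
proof -
  have b: "inbox r x Y0" if "\<bar>x - X0\<bar> <= r" for x using that good_box_pos[OF g] by (simp add: inbox_def)
  have dec: "dX (cw cv) y Y0 < dX (cw cv) x Y0" if "x < y" "\<bar>x - X0\<bar> <= r" "\<bar>y - X0\<bar> <= r" for x y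
  proof (rule DERIV_neg_imp_decreasing[where f="\<lambda>X. dX (cw cv) X Y0", OF that(1)])
    fix s assume "x <= s" "s <= y"
    then have "inbox r s Y0" using that by (intro b) (auto simp: abs_le_iff)
    then show "\<exists>D. ((\<lambda>X. dX (cw cv) X Y0) has_real_derivative D) (at s) \<and> D < 0"
      using wX_derivs(2) good_boxD(13)[OF g] by blast
  qed
  show ?thesis
  proof (cases "X < X0")
    case True
    have "cw cv X Y0 < cw cv X0 Y0"
    proof (rule DERIV_pos_imp_increasing_open[OF True])
      fix x assume x: "X < x" "x < X0"
      have "0 < dX (cw cv) x Y0" using dec[of x X0] x X wX_P by simp
      then show "\<exists>D. ((\<lambda>X. cw cv X Y0) has_real_derivative D) (at x) \<and> 0 < D" using wX_derivs(1) by blast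
    next
      show "continuous_on {X..X0} (\<lambda>X. cw cv X Y0)"
        using wX_derivs(1) by (meson DERIV_isCont continuous_at_imp_continuous_on)
    qed
    then show ?thesis using w_P by simp
  next
    case False
    then have lt: "X0 < X" using X by simp
    have "cw cv X Y0 < cw cv X0 Y0"
    proof (rule DERIV_neg_imp_decreasing_open[OF lt])
      fix x assume x: "X0 < x" "x < X"
      have "dX (cw cv) x Y0 < 0" using dec[of X0 x] x X wX_P good_box_pos[OF g] by simp
      then show "\<exists>D. ((\<lambda>X. cw cv X Y0) has_real_derivative D) (at x) \<and> D < 0" using wX_derivs(1) by blast
    next
      show "continuous_on {X0..X} (\<lambda>X. cw cv X Y0)"
        using wX_derivs(1) by (meson DERIV_isCont continuous_at_imp_continuous_on)
    qed
    then show ?thesis using w_P by simp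
  qed
qed

lemma w_on_axis:
  assumes g: "good_box r" and Y: "\<bar>Y - Y0\<bar> <= r" "Y0 < Y"
  shows "pi < cw cv X0 Y"
proof -
  have "inbox r X0 Y0" "inbox r X0 Y" using good_box_pos[OF g] Y by (auto simp: inbox_def)
  then show ?thesis using w_strict_Y[OF g, of X0 Y0 Y] Y w_P by simp
qed

text \<open>Above \<open>Y0\<close> the angle exceeds \<open>\<pi>\<close> on the axis \<open>X = X0\<close>; by concavity it exceeds \<open>\<pi>\<close> between the axis and any point of the same height where it is at least \<open>\<pi>\<close>.\<close>

lemma w_between:
  assumes g: "good_box r" and b: "inbox r X Y" "Y0 < Y" and k: "pi <= cw cv X Y"
    and X': "(X < X' \<and> X' <= X0) \<or> (X0 <= X' \<and> X' < X)"
  shows "pi < cw cv X' Y"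
proof -
  have bY: "\<bar>Y - Y0\<bar> <= r" using b by (simp add: inbox_def)
  have ax: "pi < cw cv X0 Y" by (rule w_on_axis[OF g bY b(2)])
  have b0: "inbox r X0 Y" using bY good_box_pos[OF g] by (simp add: inbox_def)
  show ?thesis
  proof (cases "X' = X0")
    case False
    then show ?thesis
      using w_concave[OF g b(1) b0, of X' pi] w_concave[OF g b0 b(1), of X' pi] k ax X' by force
  qed (simp add: ax)
qed

lemma w_pi_above:
  assumes g: "good_box r" and b: "inbox r X Y" and k: "pi <= cw cv X Y"
  shows "Y0 <= Y" "X \<noteq> X0 ==> Y0 < Y"
proof -
  have b0: "inbox r X Y0" using b good_box_pos[OF g] by (simp add: inbox_def)
  have le: "cw cv X Y0 <= pi" using w_on_line[OF g, of X] b w_P by (cases "X = X0") (auto simp: inbox_def)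
  show "Y0 <= Y"
  proof (rule ccontr)
    assume "\<not> Y0 <= Y" then show False using w_strict_Y[OF g b b0] le k by simp
  qed
  show "Y0 < Y" if "X \<noteq> X0"
    using w_on_line[OF g, of X] b that k \<open>Y0 <= Y\<close> by (cases "Y = Y0") (auto simp: inbox_def)
qed

lemma curve_localise:
  assumes g: "good_box r" and b: "\<bar>X - X0\<bar> < r" "\<bar>Y - Y0\<bar> < r" and X: "X \<noteq> X0" and w: "cw cv X Y = pi" and r0: "0 < r0"
  obtains m where "0 < m" "\<And>A B. 0 <= A + B ==> \<bar>cx cv A B - cx cv X Y\<bar> < m ==> \<bar>ct cv A B - ct cv X Y\<bar> < m ==>
     X - r0 < A \<and> A < X + r0 \<and> Y - r0 < B \<and> B < Y + r0"
proof -
  have ib: "inbox r X Y" using b by (simp add: inbox_def)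
  have Yg: "Y0 < Y" by (rule w_pi_above(2)[OF g ib _ X]) (simp add: w)
  have hp: "0 < X + Y" by (rule good_boxD(1)[OF g ib])
  have key: "cos (cw cv \<xi> Y) \<noteq> -1" if \<xi>: "inbox r \<xi> Y" "\<xi> \<noteq> X" "(\<xi> < X0 \<and> X < X0) \<or> (X0 < \<xi> \<and> X0 < X)" for \<xi>
  proof
    assume "cos (cw cv \<xi> Y) = -1"
    then have w': "cw cv \<xi> Y = pi" using good_boxD(15)[OF g \<xi>(1)] by simp
    consider "X < \<xi>" | "\<xi> < X" using \<xi>(2) by linarith
    then show False
      using w_between[OF g ib Yg, of \<xi>] w_between[OF g \<xi>(1) Yg, of X] w w' \<xi>(3) by cases auto
  qed
  have ex: "\<exists>h>0. h < s \<and> \<bar>X - X0\<bar> + h <= r \<and> \<bar>Y - Y0\<bar> + h <= r \<and> h < \<bar>X - X0\<bar>" if s: "0 < s" for s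
  proof -
    obtain h where "0 < h" "h < s" "h < r - \<bar>X - X0\<bar>" "h < r - \<bar>Y - Y0\<bar>" "h < \<bar>X - X0\<bar>"
      using ex_less_four[of s "r - \<bar>X - X0\<bar>" "r - \<bar>Y - Y0\<bar>" "\<bar>X - X0\<bar>"] s b X by auto
    then show ?thesis by (intro exI[of _ h]) linarith
  qed
  show thesis
  proof (rule A.localise[OF hp order_refl refl refl _ _ _ _ r0])
    fix s :: real assume "0 < s"
    then obtain h where h: "0 < h" "h < s" "\<bar>X - X0\<bar> + h <= r" "\<bar>Y - Y0\<bar> + h <= r" "h < \<bar>X - X0\<bar>" using ex by blast
    have i: "inbox r (X + h) Y" "inbox r (X - h) Y" "inbox r X (Y + h)" "inbox r X (Y - h)"
      using h unfolding inbox_def by (auto simp: abs_le_iff)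
    have side: "(X + h < X0 \<and> X < X0) \<or> (X0 < X + h \<and> X0 < X)" "(X - h < X0 \<and> X < X0) \<or> (X0 < X - h \<and> X0 < X)"
      using h by linarith+
    show "\<exists>\<xi>>X. \<xi> < X + s \<and> cos (cw cv \<xi> Y) \<noteq> -1" using key[OF i(1)] side h by (intro exI[of _ "X + h"]) auto
    show "\<exists>\<xi><X. X - s < \<xi> \<and> cos (cw cv \<xi> Y) \<noteq> -1" using key[OF i(2)] side h by (intro exI[of _ "X - h"]) auto
    show "\<exists>\<xi>>Y. \<xi> < Y + s \<and> cos (cz cv X \<xi>) \<noteq> -1" using good_boxD(17)[OF g i(3)] h by (intro exI[of _ "Y + h"]) auto
    show "\<exists>\<xi><Y. Y - s < \<xi> \<and> cos (cz cv X \<xi>) \<noteq> -1" using good_boxD(17)[OF g i(4)] h by (intro exI[of _ "Y - h"]) auto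
  qed (rule that)
qed

lemma curve_unique_preimage:
  assumes "good_box r" "\<bar>X - X0\<bar> < r" "\<bar>Y - Y0\<bar> < r" "X \<noteq> X0" "cw cv X Y = pi"
    and "0 <= A + B" "cx cv A B = cx cv X Y" "ct cv A B = ct cv X Y"
  shows "A = X" "B = Y"
proof -
  have *: "X - r0 < A \<and> A < X + r0 \<and> Y - r0 < B \<and> B < Y + r0" if r0: "0 < r0" for r0
  proof -
    obtain m where "0 < m" "\<And>A B. 0 <= A + B ==> \<bar>cx cv A B - cx cv X Y\<bar> < m ==> \<bar>ct cv A B - ct cv X Y\<bar> < m ==>
       X - r0 < A \<and> A < X + r0 \<and> Y - r0 < B \<and> B < Y + r0"
      using curve_localise[OF assms(1-5) r0] by blast
    then show ?thesis using assms(6-8) by simp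
  qed
  show "A = X"
  proof (rule ccontr)
    assume "A \<noteq> X" then have "0 < \<bar>A - X\<bar>" by simp
    from *[OF this] show False by linarith
  qed
  show "B = Y"
  proof (rule ccontr)
    assume "B \<noteq> Y" then have "0 < \<bar>B - Y\<bar>" by simp
    from *[OF this] show False by linarith
  qed
qed

text \<open>By the intermediate value theorem every time shortly after \<open>t0\<close> is attained on each branch inside the box. A branch point outside the box at the same time would have the same image on the singular curve, but curve points in the box have only one preimage.\<close>

lemma singular_set_near_P:
  assumes g: "good_box r" and a: "0 < a" "a <= r"
  obtains \<eta> where "0 < \<eta>" "\<eta> < \<delta>"
    "\<And>X Y. 0 <= X + Y ==> ct cv X Y <= t0 + \<eta> ==> \<not> nonsing X Y ==>
       \<bar>X - X0\<bar> < a \<and> \<bar>Y - Y0\<bar> < a \<and> cw cv X Y = pi \<and> (X = X0 --> Y = Y0) \<and>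
       (X < X0 --> cx cv X Y = \<gamma>m (ct cv X Y)) \<and> (X0 < X --> cx cv X Y = \<gamma>p (ct cv X Y))"
    "\<And>t. t0 < t ==> t <= t0 + \<eta> ==>
       \<exists>X Y. X0 - a < X \<and> X < X0 \<and> \<bar>Y - Y0\<bar> < a \<and> cw cv X Y = pi \<and> ct cv X Y = t \<and> cx cv X Y = \<gamma>m t"
    "\<And>t. t0 < t ==> t <= t0 + \<eta> ==>
       \<exists>X Y. X0 < X \<and> X < X0 + a \<and> \<bar>Y - Y0\<bar> < a \<and> cw cv X Y = pi \<and> ct cv X Y = t \<and> cx cv X Y = \<gamma>p t"
proof -
  have "isCont \<psi> X0"
    using continuous_on_interior[OF psi_cont, of X0] eps_pos by simp
  then obtain d where d: "d > 0" "\<And>X. \<bar>X - X0\<bar> < d ==> \<bar>\<psi> X - Y0\<bar> < a"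
    unfolding continuous_at_eps_delta using a(1) psi_X0 by (metis dist_real_def)
  define b where "b = min (d / 2) (a / 2)"
  have b: "0 < b" "b < a" "b < r" "b < \<epsilon>" "\<And>X. \<bar>X - X0\<bar> <= b ==> \<bar>\<psi> X - Y0\<bar> < a"
    using d a good_box_eps[OF g] by (auto simp: b_def)
  have ib: "inbox r X (\<psi> X)" if "\<bar>X - X0\<bar> <= b" for X
    using b(5)[OF that] that b(3) a unfolding inbox_def by linarith
  have wpsi: "cw cv X (\<psi> X) = pi" if "\<bar>X - X0\<bar> <= b" for X using good_boxD(14)[OF g ib[OF that]] by simp
  define tt where "tt X = ct cv X (\<psi> X)" for X
  have ctt: "continuous_on {X0 - b..X0 + b} tt"
  proof -
    have cp: "continuous_on {X0 - b..X0 + b} \<psi>" by (rule continuous_on_subset[OF psi_cont]) (use b in auto)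
    have "continuous_on {X0 - b..X0 + b} (\<lambda>X. (\<lambda>P. ct cv (fst P) (snd P)) (X, \<psi> X))"
      by (rule continuous_on_compose2[OF A.cont_fst_snd(7)])
         (use good_boxD(2)[OF g ib] in \<open>auto intro!: continuous_intros cp simp: half_plane_def abs_le_iff\<close>)
    then show ?thesis by (simp add: tt_def)
  qed
  have tt0: "tt X0 = t0" by (simp add: tt_def psi_X0)
  have pos_m: "t0 < tt (X0 - b)"
    using branch_m(1)[of "X0 - b"] b delta_pos unfolding tt_def by (cases "ct cv (X0 - b) (\<psi> (X0 - b)) <= t0 + \<delta>") auto
  have pos_p: "t0 < tt (X0 + b)"
    using branch_p(1)[of "X0 + b"] b delta_pos unfolding tt_def by (cases "ct cv (X0 + b) (\<psi> (X0 + b)) <= t0 + \<delta>") auto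
  define \<eta> where "\<eta> = Min {tt (X0 - b) - t0, tt (X0 + b) - t0, \<delta>} / 2"
  have \<eta>: "0 < \<eta>" "\<eta> < \<delta>" "t0 + \<eta> < tt (X0 - b)" "t0 + \<eta> < tt (X0 + b)"
  proof -
    have "0 < \<eta>" "2 * \<eta> <= tt (X0 - b) - t0" "2 * \<eta> <= tt (X0 + b) - t0" "2 * \<eta> <= \<delta>"
      using pos_m pos_p delta_pos by (simp_all add: \<eta>_def)
    then show "0 < \<eta>" "\<eta> < \<delta>" "t0 + \<eta> < tt (X0 - b)" "t0 + \<eta> < tt (X0 + b)" by linarith+
  qed
  have exm: "\<exists>X. X0 - b < X \<and> X < X0 \<and> tt X = t" if t: "t0 < t" "t <= t0 + \<eta>" for t
  proof -
    have "continuous_on {X0 - b..X0} tt" by (rule continuous_on_subset[OF ctt]) (use b in auto)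
    then obtain X where "X0 - b <= X" "X <= X0" "tt X = t"
      using IVT2'[of tt X0 t "X0 - b"] tt0 t \<eta>(3) b by auto
    then show ?thesis using tt0 t \<eta>(3) by (metis le_less less_irrefl not_less)
  qed
  have exp: "\<exists>X. X0 < X \<and> X < X0 + b \<and> tt X = t" if t: "t0 < t" "t <= t0 + \<eta>" for t
  proof -
    have "continuous_on {X0..X0 + b} tt" by (rule continuous_on_subset[OF ctt]) (use b in auto)
    then obtain X where "X0 <= X" "X <= X0 + b" "tt X = t"
      using IVT'[of tt X0 t "X0 + b"] tt0 t \<eta>(4) b by auto
    then show ?thesis using tt0 t \<eta>(4) by (metis le_less less_irrefl not_less)
  qed
  show thesis
  proof (rule that[OF \<eta>(1,2)])
    fix t assume t: "t0 < t" "t <= t0 + \<eta>"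
    obtain X where X: "X0 - b < X" "X < X0" "tt X = t" using exm[OF t] by blast
    have le: "\<bar>X - X0\<bar> <= b" using X by auto
    have "cx cv X (\<psi> X) = \<gamma>m t" using branch_m(2)[of X] X b t \<eta>(2) unfolding tt_def by simp
    then show "\<exists>X Y. X0 - a < X \<and> X < X0 \<and> \<bar>Y - Y0\<bar> < a \<and> cw cv X Y = pi \<and> ct cv X Y = t \<and> cx cv X Y = \<gamma>m t"
      using X b(2) b(5)[OF le] wpsi[OF le] unfolding tt_def by (intro exI[of _ X] exI[of _ "\<psi> X"]) auto
  next
    fix t assume t: "t0 < t" "t <= t0 + \<eta>"
    obtain X where X: "X0 < X" "X < X0 + b" "tt X = t" using exp[OF t] by blast
    have le: "\<bar>X - X0\<bar> <= b" using X by auto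
    have "cx cv X (\<psi> X) = \<gamma>p t" using branch_p(2)[of X] X b t \<eta>(2) unfolding tt_def by simp
    then show "\<exists>X Y. X0 < X \<and> X < X0 + a \<and> \<bar>Y - Y0\<bar> < a \<and> cw cv X Y = pi \<and> ct cv X Y = t \<and> cx cv X Y = \<gamma>p t"
      using X b(2) b(5)[OF le] wpsi[OF le] unfolding tt_def by (intro exI[of _ X] exI[of _ "\<psi> X"]) auto
  next
    fix X Y assume s: "0 <= X + Y" "ct cv X Y <= t0 + \<eta>" "\<not> nonsing X Y"
    have td: "ct cv X Y <= t0 + \<delta>" using s(2) \<eta>(2) by simp
    consider "X = X0" "Y = Y0" | "X0 - \<epsilon> < X" "X < X0" "Y = \<psi> X" | "X0 < X" "X < X0 + \<epsilon>" "Y = \<psi> X"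
      using singular_cases[OF s(1) td s(3)] by blast
    then show "\<bar>X - X0\<bar> < a \<and> \<bar>Y - Y0\<bar> < a \<and> cw cv X Y = pi \<and> (X = X0 --> Y = Y0) \<and>
       (X < X0 --> cx cv X Y = \<gamma>m (ct cv X Y)) \<and> (X0 < X --> cx cv X Y = \<gamma>p (ct cv X Y))"
    proof cases
      case 1
      then show ?thesis using a w_P by simp
    next
      case 2
      note side = 2(1,2)
      have t: "t0 < ct cv X Y" "cx cv X Y = \<gamma>m (ct cv X Y)" using branch_m[of X] 2 td by auto
      obtain X' where X': "X0 - b < X'" "X' < X0" "tt X' = ct cv X Y" using exm[OF t(1) s(2)] by blast
      have le: "\<bar>X' - X0\<bar> <= b" using X' by auto
      have "cx cv X' (\<psi> X') = \<gamma>m (ct cv X Y)" using branch_m(2)[of X'] X' b td unfolding tt_def by simp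
      then have cxe: "cx cv X Y = cx cv X' (\<psi> X')" using t(2) by metis
      have cte: "ct cv X Y = ct cv X' (\<psi> X')" using X'(3) unfolding tt_def by (rule sym)
      have r1: "\<bar>X' - X0\<bar> < r" using le b(3) by linarith
      have r2: "\<bar>\<psi> X' - Y0\<bar> < r" using b(5)[OF le] a(2) by linarith
      have ne: "X' \<noteq> X0" using X'(1,2) by simp
      note e = curve_unique_preimage[OF g r1 r2 ne wpsi[OF le] s(1) cxe cte]
      have 1: "\<bar>X - X0\<bar> < a" unfolding e(1) using le b(2) by linarith
      have 2: "\<bar>Y - Y0\<bar> < a" unfolding e(2) by (rule b(5)[OF le])
      have 3: "cw cv X Y = pi" unfolding e by (rule wpsi[OF le])
      have 4: "\<not> X0 < X" "X \<noteq> X0" using side by auto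
      show ?thesis by (intro conjI impI 1 2 3) (use 4 t(2) in auto)
    next
      case 3
      note side = 3(1,2)
      have t: "t0 < ct cv X Y" "cx cv X Y = \<gamma>p (ct cv X Y)" using branch_p[of X] 3 td by auto
      obtain X' where X': "X0 < X'" "X' < X0 + b" "tt X' = ct cv X Y" using exp[OF t(1) s(2)] by blast
      have le: "\<bar>X' - X0\<bar> <= b" using X' by auto
      have "cx cv X' (\<psi> X') = \<gamma>p (ct cv X Y)" using branch_p(2)[of X'] X' b td unfolding tt_def by simp
      then have cxe: "cx cv X Y = cx cv X' (\<psi> X')" using t(2) by metis
      have cte: "ct cv X Y = ct cv X' (\<psi> X')" using X'(3) unfolding tt_def by (rule sym)
      have r1: "\<bar>X' - X0\<bar> < r" using le b(3) by linarith
      have r2: "\<bar>\<psi> X' - Y0\<bar> < r" using b(5)[OF le] a(2) by linarith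
      have ne: "X' \<noteq> X0" using X'(1,2) by simp
      note e = curve_unique_preimage[OF g r1 r2 ne wpsi[OF le] s(1) cxe cte]
      have 1: "\<bar>X - X0\<bar> < a" unfolding e(1) using le b(2) by linarith
      have 2: "\<bar>Y - Y0\<bar> < a" unfolding e(2) by (rule b(5)[OF le])
      have 3: "cw cv X Y = pi" unfolding e by (rule wpsi[OF le])
      have 4: "\<not> X < X0" "X \<noteq> X0" using side by auto
      show ?thesis by (intro conjI impI 1 2 3) (use 4 t(2) in auto)
    qed
  qed
qed

end

section \<open>Strong singularities\<close>

text \<open>The quotient is \<open>tan (w/2)\<close>, and \<open>sin\<^sup>2 w = (1 - cos w) (1 + cos w)\<close> is at least \<open>1 + cos w\<close>.\<close>

lemma half_angle_ratio_large:
  fixes w Z :: real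
  assumes "0 < 1 + cos w" "cos w <= 0" "(1 + cos w) * Z\<^sup>2 <= 1"
  shows "Z <= \<bar>sin w / (1 + cos w)\<bar>"
proof -
  have ne: "1 + cos w \<noteq> 0" using assms(1) by simp
  have "(sin w)\<^sup>2 = (1 - cos w) * (1 + cos w)"
    using sin_cos_squared_add[of w] by (simp add: power2_eq_square algebra_simps)
  then have "(sin w / (1 + cos w))\<^sup>2 = (1 - cos w) / (1 + cos w)"
    using ne by (simp add: power_divide power2_eq_square)
  moreover have "Z\<^sup>2 <= 1 / (1 + cos w)" using assms(1,3) by (simp add: pos_le_divide_eq mult.commute)
  moreover have "1 / (1 + cos w) <= (1 - cos w) / (1 + cos w)" using assms by (intro divide_right_mono) auto
  ultimately have "Z\<^sup>2 <= (sin w / (1 + cos w))\<^sup>2" by linarith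
  then have "\<bar>Z\<bar> <= \<bar>sin w / (1 + cos w)\<bar>" by (simp only: abs_le_square_iff)
  then show ?thesis by linarith
qed

lemma strong_singularityI:
  assumes "\<And>Z. \<exists>m>0. \<forall>x. 0 < \<bar>x - a\<bar> \<and> \<bar>x - a\<bar> < m --> (\<exists>D. (f has_real_derivative D) (at x) \<and> Z <= \<bar>D\<bar>)"
  shows "strong_singularity f a"
proof -
  have ev: "\<forall>\<^sub>F x in at a. \<exists>D. (f has_real_derivative D) (at x) \<and> Z <= \<bar>D\<bar>" for Z
    unfolding eventually_at using assms[of Z] by (metis dist_real_def zero_less_dist_iff)
  have "\<forall>\<^sub>F x in at a. f differentiable (at x)"
    using ev[of 0] by eventually_elim (auto simp: real_differentiable_def)
  moreover have "filterlim (\<lambda>x. \<bar>deriv f x\<bar>) at_top (at a)"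
    unfolding filterlim_at_top
  proof
    fix Z
    show "\<forall>\<^sub>F x in at a. Z <= \<bar>deriv f x\<bar>"
      using ev[of Z]
    proof eventually_elim
      case (elim x)
      then obtain D where "(f has_real_derivative D) (at x)" "Z <= \<bar>D\<bar>" by blast
      then show ?case using DERIV_imp_deriv by metis
    qed
  qed
  ultimately show ?thesis unfolding strong_singularity_def by blast
qed

context char_graph
begin

text \<open>Near the image of the segment all preimages lie near the segment, where \<open>1 + cos w\<close> is small while \<open>z\<close> stays away from \<open>\<pi>\<close>. So the term with \<open>w\<close> dominates the slope. The segment may be a single point, as on the curves of the conservative solution, or a contact segment of the dissipative one.\<close>

lemma strong_singularity_segment:
  assumes t: "0 < ct sv X1 Y" and X12: "X1 <= X2" and r1: "0 < r1" and hp: "0 < (X1 - r1) + (Y - r1)"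
    and loc: "\<And>r. 0 < r ==> \<exists>m>0. \<forall>A B. 0 <= A + B --> \<bar>cx sv A B - cx sv X1 Y\<bar> < m --> \<bar>ct sv A B - ct sv X1 Y\<bar> < m -->
       X1 - r < A \<and> A < X2 + r \<and> Y - r < B \<and> B < Y + r"
    and seg: "\<And>\<xi>. X1 <= \<xi> ==> \<xi> <= X2 ==> cos (cw sv \<xi> Y) = -1"
    and zr: "\<And>A B. X1 - r1 <= A ==> A <= X2 + r1 ==> Y - r1 <= B ==> B <= Y + r1 ==> cos (cz sv A B) \<noteq> -1"
    and wr: "\<And>A B. X1 - r1 < A ==> A < X2 + r1 ==> Y - r1 < B ==> B < Y + r1 ==> ct sv A B = ct sv X1 Y ==>
       cx sv A B \<noteq> cx sv X1 Y ==> cos (cw sv A B) \<noteq> -1"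
  shows "strong_singularity (\<lambda>x. U x (ct sv X1 Y)) (cx sv X1 Y)"
proof (rule strong_singularityI)
  fix Z :: real
  let ?x = "cx sv X1 Y" and ?t = "ct sv X1 Y"
  define K where "K = {X1 - r1..X2 + r1} \<times> {Y - r1..Y + r1}"
  have cK: "compact K" unfolding K_def by (intro compact_Times compact_Icc)
  have KH: "K \<subseteq> half_plane" using hp r1 X12 by (auto simp: K_def half_plane_def)
  have inK: "(A, B) \<in> K \<longleftrightarrow> X1 - r1 <= A \<and> A <= X2 + r1 \<and> Y - r1 <= B \<and> B <= Y + r1" for A B by (auto simp: K_def)
  have bnd: "\<exists>M. \<forall>P\<in>K. \<bar>f P\<bar> <= M" if "continuous_on K f" for f :: "real \<times> real => real"
    using compact_imp_bounded[OF compact_continuous_image[OF that cK]] unfolding bounded_real by auto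
  have "continuous_on K (\<lambda>P. sin (cz sv (fst P) (snd P)) / (1 + cos (cz sv (fst P) (snd P))))"
  proof (intro continuous_intros continuous_on_subset[OF cont_fst_snd(3) KH] ballI)
    fix P assume "P \<in> K"
    then have "cos (cz sv (fst P) (snd P)) \<noteq> -1" using zr[of "fst P" "snd P"] inK[of "fst P" "snd P"] by simp
    then show "1 + cos (cz sv (fst P) (snd P)) \<noteq> 0" using one_plus_cos_pos by fastforce
  qed
  then obtain B where B: "\<And>P. P \<in> K ==> \<bar>sin (cz sv (fst P) (snd P)) / (1 + cos (cz sv (fst P) (snd P)))\<bar> <= B" using bnd by meson
  obtain M where M: "\<And>P. P \<in> K ==> \<bar>c (cu sv (fst P) (snd P))\<bar> <= M"
    using bnd[OF continuous_on_subset[OF cont_c_u(1) KH]] by meson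
  define Z' where "Z' = 2 * \<bar>M\<bar> * \<bar>Z\<bar> + \<bar>B\<bar>"
  define s where "s = 1 / (Z'\<^sup>2 + 1)"
  have s: "0 < s" "s <= 1" "s * Z'\<^sup>2 <= 1"
  proof -
    have q: "0 < Z'\<^sup>2 + 1" by (simp add: add_nonneg_pos)
    show "0 < s" "s <= 1" "s * Z'\<^sup>2 <= 1" unfolding s_def using q by (simp_all add: divide_le_eq)
  qed
  have "uniformly_continuous_on K (\<lambda>P. cos (cw sv (fst P) (snd P)))"
    by (intro compact_uniformly_continuous cK continuous_intros continuous_on_subset[OF cont_fst_snd(2) KH])
  then obtain d where d: "0 < d" "\<And>P Q. P \<in> K ==> Q \<in> K ==> dist Q P < d ==>
      \<bar>cos (cw sv (fst Q) (snd Q)) - cos (cw sv (fst P) (snd P))\<bar> < s"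
    unfolding uniformly_continuous_on_def dist_real_def using s(1) by metis
  define r where "r = min r1 (d / 2)"
  have r: "0 < r" "r <= r1" "2 * r <= d" using r1 d(1) by (auto simp: r_def)
  obtain m where m: "0 < m" "\<And>A B. 0 <= A + B ==> \<bar>cx sv A B - ?x\<bar> < m ==> \<bar>ct sv A B - ?t\<bar> < m ==>
       X1 - r < A \<and> A < X2 + r \<and> Y - r < B \<and> B < Y + r" using loc[OF r(1)] by meson
  show "\<exists>m>0. \<forall>x. 0 < \<bar>x - ?x\<bar> \<and> \<bar>x - ?x\<bar> < m -->
     (\<exists>D. ((\<lambda>x. U x ?t) has_real_derivative D) (at x) \<and> Z <= \<bar>D\<bar>)"
  proof (rule exI[of _ m], rule conjI[OF m(1)], intro allI impI)
    fix x assume x: "0 < \<bar>x - ?x\<bar> \<and> \<bar>x - ?x\<bar> < m"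
    define A where "A = fst (pre x ?t)"
    define b where "b = snd (pre x ?t)"
    have pr: "0 <= A + b" "cx sv A b = x" "ct sv A b = ?t" unfolding A_def b_def using pre[of ?t x] t by auto
    have lo: "X1 - r < A" "A < X2 + r" "Y - r < b" "b < Y + r" using m(2)[OF pr(1)] pr x m(1) by auto
    have AK: "(A, b) \<in> K" using lo r(2) by (simp add: inK)
    have w: "cos (cw sv A b) \<noteq> -1" by (rule wr) (use lo r(2) pr x in auto)
    have z: "cos (cz sv A b) \<noteq> -1" using zr[of A b] AK inK by simp
    have rg: "reg A b" unfolding reg_def using w z t_pos_imp_interior[OF pr(1)] pr(3) t by simp
    define \<xi> where "\<xi> = max X1 (min A X2)"
    have \<xi>: "X1 <= \<xi>" "\<xi> <= X2" "\<bar>A - \<xi>\<bar> < r" using lo X12 r(1) unfolding \<xi>_def by auto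
    have \<xi>K: "(\<xi>, Y) \<in> K" using \<xi> r1 by (simp add: inK)
    have "dist (A, b) (\<xi>, Y) <= \<bar>A - \<xi>\<bar> + \<bar>b - Y\<bar>"
      using norm_Pair_le[of "A - \<xi>" "b - Y"] by (simp add: dist_norm)
    also have "\<dots> < d" using \<xi>(3) lo(3,4) r(3) by linarith
    finally have "\<bar>cos (cw sv A b) - cos (cw sv \<xi> Y)\<bar> < s" using d(2)[OF \<xi>K AK] by simp
    then have cs: "1 + cos (cw sv A b) < s" using seg[OF \<xi>(1,2)] by simp
    have cp: "0 < 1 + cos (cw sv A b)" by (rule one_plus_cos_pos[OF w])
    have "(1 + cos (cw sv A b)) * Z'\<^sup>2 <= s * Z'\<^sup>2" using cs by (intro mult_right_mono) auto
    then have big: "Z' <= \<bar>sin (cw sv A b) / (1 + cos (cw sv A b))\<bar>"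
      using cp cs s by (intro half_angle_ratio_large) auto
    have bz: "\<bar>sin (cz sv A b) / (1 + cos (cz sv A b))\<bar> <= \<bar>B\<bar>" using B[OF AK] by simp
    have cM: "0 < c (cu sv A b)" "c (cu sv A b) <= \<bar>M\<bar>" using c_pos M[OF AK] by auto
    have "2 * \<bar>M\<bar> * \<bar>Z\<bar> <= \<bar>sin (cw sv A b) / (1 + cos (cw sv A b)) - sin (cz sv A b) / (1 + cos (cz sv A b))\<bar>"
      using big bz abs_triangle_ineq2[of "sin (cw sv A b) / (1 + cos (cw sv A b))" "sin (cz sv A b) / (1 + cos (cz sv A b))"]
      unfolding Z'_def by linarith
    then have "\<bar>Z\<bar> * (2 * c (cu sv A b)) <= \<bar>sin (cw sv A b) / (1 + cos (cw sv A b)) - sin (cz sv A b) / (1 + cos (cz sv A b))\<bar>"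
      using mult_right_mono[OF cM(2) abs_ge_zero[of Z]] by (simp add: mult.commute mult.left_commute)
    then have "\<bar>Z\<bar> <= \<bar>slope A b\<bar>"
      unfolding slope_def abs_divide using cM(1) by (simp add: pos_le_divide_eq)
    then have "Z <= \<bar>slope A b\<bar>" by linarith
    moreover have "((\<lambda>x. U x ?t) has_real_derivative slope A b) (at x)"
      using U_deriv[OF rg] pr t by simp
    ultimately show "\<exists>D. ((\<lambda>x. U x ?t) has_real_derivative D) (at x) \<and> Z <= \<bar>D\<bar>" by blast
  qed
qed

lemma open_reg: "open {P. reg (fst P) (snd P)}"
  unfolding open_contains_ball
proof
  fix P assume "P \<in> {P. reg (fst P) (snd P)}"
  then have r: "reg (fst P) (snd P)" by simp
  obtain e where e: "0 < e" "\<And>X' Y'. \<bar>X' - fst P\<bar> <= e ==> \<bar>Y' - snd P\<bar> <= e ==> reg X' Y'"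
    using reg_nhd[OF r] by blast
  have "ball P e \<subseteq> {P. reg (fst P) (snd P)}"
  proof
    fix Q assume "Q \<in> ball P e"
    then have d: "dist Q P < e" by (simp add: dist_commute)
    have "\<bar>fst Q - fst P\<bar> <= e" "\<bar>snd Q - snd P\<bar> <= e"
      using dist_fst_le[of Q P] dist_snd_le[of Q P] d by (auto simp: dist_real_def)
    then show "Q \<in> {P. reg (fst P) (snd P)}" using e(2) by simp
  qed
  then show "\<exists>e>0. ball P e \<subseteq> {P. reg (fst P) (snd P)}" using e(1) by blast
qed

text \<open>Induction on the order: the derivative of a composition with the preimage is a composition of the same kind, because the derivative of the preimage is a function of the angles and of \<open>p\<close> and \<open>q\<close>.\<close>

lemma Ck_on_along_pre:
  assumes sw: "smooth_on UNIV (\<lambda>(X, Y). cw sv X Y)" and sz: "smooth_on UNIV (\<lambda>(X, Y). cz sv X Y)"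
    and sp: "smooth_on UNIV (\<lambda>(X, Y). cp sv X Y)" and sq: "smooth_on UNIV (\<lambda>(X, Y). cq sv X Y)"
    and t: "0 < t" and S: "\<And>x. x \<in> S ==> reg (fst (pre x t)) (snd (pre x t))"
    and F: "Ck_on n {P. reg (fst P) (snd P)} F"
  shows "Ck_on n S (\<lambda>x. F (pre x t))"
  using F
proof (induction n arbitrary: F)
  let ?O = "{P. reg (fst P) (snd P)}"
  have dpre: "((\<lambda>x. (fst (pre x t), snd (pre x t))) has_derivative
      (\<lambda>h. (2 / ((1 + cos (cw sv (fst (pre x t)) (snd (pre x t)))) * cp sv (fst (pre x t)) (snd (pre x t))) * h,
            - 2 / ((1 + cos (cz sv (fst (pre x t)) (snd (pre x t)))) * cq sv (fst (pre x t)) (snd (pre x t))) * h))) (at x)"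
    if x: "x \<in> S" for x
  proof -
    note D = pre_deriv[OF S[OF x], unfolded pre(2)[OF less_imp_le[OF t]] pre(3)[OF less_imp_le[OF t]], OF t]
    show ?thesis
      by (rule has_derivative_Pair[OF D(1)[unfolded has_field_derivative_def] D(2)[unfolded has_field_derivative_def]])
  qed
  {
    case 0
    then have "continuous_on ?O F" by simp
    then have cF: "isCont F P" if "reg (fst P) (snd P)" for P
      using continuous_on_eq_continuous_at[OF open_reg] that by blast
    have "isCont (\<lambda>x. F (fst (pre x t), snd (pre x t))) x" if x: "x \<in> S" for x
      by (rule isCont_o2[OF has_derivative_continuous[OF dpre[OF x]]]) (use cF S[OF x] in simp)
    then show ?case by (simp add: continuous_at_imp_continuous_on)
  next
    case (Suc n)
    obtain F' where d: "\<And>P. P \<in> ?O ==> (F has_derivative F' P) (at P)" "\<And>v. Ck_on n ?O (\<lambda>P. F' P v)"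
      using Suc.prems by (rule Ck_on_SucE) blast
    define a where "a P = 2 / ((1 + cos (cw sv (fst P) (snd P))) * cp sv (fst P) (snd P))" for P
    define b where "b P = - 2 / ((1 + cos (cz sv (fst P) (snd P))) * cq sv (fst P) (snd P))" for P
    have CkO: "Ck_on n ?O (\<lambda>P. f (fst P) (snd P))" if "smooth_on UNIV (\<lambda>(X, Y). f X Y)" for f
    proof -
      have "Ck_on n UNIV (\<lambda>(X, Y). f X Y)" by (rule smooth_on_def[THEN iffD1, THEN spec, OF that])
      then show ?thesis using Ck_on_subset[of n UNIV "\<lambda>P. f (fst P) (snd P)" ?O] by (simp add: split_def)
    qed
    have ne: "(1 + cos (cw sv (fst P) (snd P))) * cp sv (fst P) (snd P) \<noteq> 0"
      "(1 + cos (cz sv (fst P) (snd P))) * cq sv (fst P) (snd P) \<noteq> 0" if "P \<in> ?O" for P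
    proof -
      have r: "0 <= fst P + snd P" "cos (cw sv (fst P) (snd P)) \<noteq> -1" "cos (cz sv (fst P) (snd P)) \<noteq> -1"
        using that by (auto simp: reg_def)
      show "(1 + cos (cw sv (fst P) (snd P))) * cp sv (fst P) (snd P) \<noteq> 0"
        "(1 + cos (cz sv (fst P) (snd P))) * cq sv (fst P) (snd P) \<noteq> 0"
        using one_plus_cos_pos[OF r(2)] one_plus_cos_pos[OF r(3)] p_pos[OF r(1)] q_pos[OF r(1)] by simp_all
    qed
    have ab: "Ck_on n ?O a" "Ck_on n ?O b"
      unfolding a_def b_def
      by (intro Ck_on_divide Ck_on_const Ck_on_mult Ck_on_add Ck_on_compose[OF smooth_on_sin_cos(2)] CkO sw sp ne; assumption)
         (intro Ck_on_divide Ck_on_const Ck_on_mult Ck_on_add Ck_on_compose[OF smooth_on_sin_cos(2)] CkO sz sq ne; assumption)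
    define G where "G P = a P * F' P (1, 0) + b P * F' P (0, 1)" for P
    have CG: "Ck_on n ?O G" unfolding G_def by (intro Ck_on_add Ck_on_mult ab d(2))
    show ?case
    proof (rule Ck_on_SucI[of _ _ "\<lambda>x v. v * G (pre x t)"])
      show "((\<lambda>x. F (pre x t)) has_derivative (\<lambda>v. v * G (pre x t))) (at x)" if x: "x \<in> S" for x
      proof -
        have FP: "(F has_derivative F' (pre x t)) (at (fst (pre x t), snd (pre x t)))" using d(1)[of "pre x t"] S[OF x] by simp
        interpret L: bounded_linear "F' (pre x t)" using FP by (rule has_derivative_bounded_linear)
        have lin: "F' (pre x t) (h, k) = h * F' (pre x t) (1, 0) + k * F' (pre x t) (0, 1)" for h k
        proof -
          have "F' (pre x t) (h, k) = F' (pre x t) (h *\<^sub>R (1,0) + k *\<^sub>R (0,1))" by simp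
          then show ?thesis by (simp only: L.add L.scaleR real_scaleR_def)
        qed
        have "((\<lambda>x. F (pre x t)) has_derivative (\<lambda>v. F' (pre x t) (a (pre x t) * v, b (pre x t) * v))) (at x)"
          using has_derivative_compose[OF dpre[OF x] FP] by (simp add: a_def b_def)
        moreover have "(\<lambda>v. F' (pre x t) (a (pre x t) * v, b (pre x t) * v)) = (\<lambda>v. v * G (pre x t))"
          by (rule ext, subst lin) (simp add: G_def algebra_simps)
        ultimately show ?thesis by simp
      qed
      show "Ck_on n S (\<lambda>x. v * G (pre x t))" for v by (intro Ck_on_mult Ck_on_const Suc.IH CG)
    qed
  }
qed

end

context singular_origin
begin

text \<open>Until time \<open>t0 + \<eta>\<close> the singular set lies in a window of size \<open>a\<close> around \<open>P\<close>, and it consists of \<open>P\<close> and points mapped to the two singular curves, each of which is covered.\<close>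

definition separated :: "real => real => bool" where
  "separated a \<eta> \<longleftrightarrow> 0 < \<eta> \<and> \<eta> < \<delta> \<and>
    (\<forall>X Y. 0 <= X + Y --> ct cv X Y <= t0 + \<eta> --> \<not> nonsing X Y -->
       \<bar>X - X0\<bar> < a \<and> \<bar>Y - Y0\<bar> < a \<and> cw cv X Y = pi \<and> (X = X0 --> Y = Y0) \<and>
       (X < X0 --> cx cv X Y = \<gamma>m (ct cv X Y)) \<and> (X0 < X --> cx cv X Y = \<gamma>p (ct cv X Y))) \<and>
    (\<forall>t. t0 < t --> t <= t0 + \<eta> -->
       (\<exists>X Y. X0 - a < X \<and> X < X0 \<and> \<bar>Y - Y0\<bar> < a \<and> cw cv X Y = pi \<and> ct cv X Y = t \<and> cx cv X Y = \<gamma>m t)) \<and>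
    (\<forall>t. t0 < t --> t <= t0 + \<eta> -->
       (\<exists>X Y. X0 < X \<and> X < X0 + a \<and> \<bar>Y - Y0\<bar> < a \<and> cw cv X Y = pi \<and> ct cv X Y = t \<and> cx cv X Y = \<gamma>p t))"

lemma ex_separated:
  assumes g: "good_box r" and a: "0 < a" "a <= r"
  shows "\<exists>\<eta>. separated a \<eta>"
proof (rule singular_set_near_P[OF g a])
  fix \<eta>
  assume *: "0 < \<eta>" "\<eta> < \<delta>"
    "\<And>X Y. 0 <= X + Y ==> ct cv X Y <= t0 + \<eta> ==> \<not> nonsing X Y ==>
       \<bar>X - X0\<bar> < a \<and> \<bar>Y - Y0\<bar> < a \<and> cw cv X Y = pi \<and> (X = X0 --> Y = Y0) \<and>
       (X < X0 --> cx cv X Y = \<gamma>m (ct cv X Y)) \<and> (X0 < X --> cx cv X Y = \<gamma>p (ct cv X Y))"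
    "\<And>t. t0 < t ==> t <= t0 + \<eta> ==>
       \<exists>X Y. X0 - a < X \<and> X < X0 \<and> \<bar>Y - Y0\<bar> < a \<and> cw cv X Y = pi \<and> ct cv X Y = t \<and> cx cv X Y = \<gamma>m t"
    "\<And>t. t0 < t ==> t <= t0 + \<eta> ==>
       \<exists>X Y. X0 < X \<and> X < X0 + a \<and> \<bar>Y - Y0\<bar> < a \<and> cw cv X Y = pi \<and> ct cv X Y = t \<and> cx cv X Y = \<gamma>p t"
  show ?thesis unfolding separated_def
    by (rule exI[of _ \<eta>], intro conjI allI impI *(1,2)) (use *(3-5) in blast)+
qed

lemma separatedD:
  assumes "separated a \<eta>"
  shows "0 < \<eta>" "\<eta> < \<delta>"
    "0 <= X + Y ==> ct cv X Y <= t0 + \<eta> ==> \<not> nonsing X Y ==>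
       \<bar>X - X0\<bar> < a \<and> \<bar>Y - Y0\<bar> < a \<and> cw cv X Y = pi \<and> (X = X0 --> Y = Y0) \<and>
       (X < X0 --> cx cv X Y = \<gamma>m (ct cv X Y)) \<and> (X0 < X --> cx cv X Y = \<gamma>p (ct cv X Y))"
    "t0 < t ==> t <= t0 + \<eta> ==>
       \<exists>X Y. X0 - a < X \<and> X < X0 \<and> \<bar>Y - Y0\<bar> < a \<and> cw cv X Y = pi \<and> ct cv X Y = t \<and> cx cv X Y = \<gamma>m t"
    "t0 < t ==> t <= t0 + \<eta> ==>
       \<exists>X Y. X0 < X \<and> X < X0 + a \<and> \<bar>Y - Y0\<bar> < a \<and> cw cv X Y = pi \<and> ct cv X Y = t \<and> cx cv X Y = \<gamma>p t"
  using assms unfolding separated_def by blast+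

lemma curve_strong_singularity:
  assumes g: "good_box r" and X: "\<bar>X - X0\<bar> < r" "\<bar>Y - Y0\<bar> < r" "X \<noteq> X0" and w: "cw cv X Y = pi" and t: "0 < ct cv X Y"
    and sing: "\<And>A B. 0 <= A + B ==> ct cv A B = ct cv X Y ==> \<not> nonsing A B ==>
       (X < X0 \<and> A < X0) \<or> (X0 < X \<and> X0 < A) ==> cx cv A B = cx cv X Y"
  shows "strong_singularity (\<lambda>x. ucons x (ct cv X Y)) (cx cv X Y)"
proof -
  obtain h where h: "0 < h" "h < r - \<bar>X - X0\<bar>" "h < r - \<bar>Y - Y0\<bar>" "h < \<bar>X - X0\<bar>"
    using ex_less_four[of "r - \<bar>X - X0\<bar>" "r - \<bar>X - X0\<bar>" "r - \<bar>Y - Y0\<bar>" "\<bar>X - X0\<bar>"] X by auto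
  have ib: "inbox r A B" if "X - h <= A" "A <= X + h" "Y - h <= B" "B <= Y + h" for A B
  proof -
    have "\<bar>A - X\<bar> <= h" "\<bar>B - Y\<bar> <= h" using that by (auto simp: abs_le_iff)
    then show ?thesis using h unfolding inbox_def by linarith
  qed
  show ?thesis
  proof (rule A.strong_singularity_segment[OF t order_refl h(1)])
    show "0 < X - h + (Y - h)" by (rule good_boxD(1)[OF g ib]) (use h in auto)
    show "\<exists>m>0. \<forall>A B. 0 <= A + B --> \<bar>cx cv A B - cx cv X Y\<bar> < m --> \<bar>ct cv A B - ct cv X Y\<bar> < m -->
       X - s < A \<and> A < X + s \<and> Y - s < B \<and> B < Y + s" if "0 < s" for s
      using curve_localise[OF g X w that] by metis
    show "cos (cw cv \<xi> Y) = -1" if "X <= \<xi>" "\<xi> <= X" for \<xi> using that w by simp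
    show "cos (cz cv A B) \<noteq> -1" if "X - h <= A" "A <= X + h" "Y - h <= B" "B <= Y + h" for A B
      by (rule good_boxD(17)[OF g ib[OF that]])
    show "cos (cw cv A B) \<noteq> -1" if a: "X - h < A" "A < X + h" "Y - h < B" "B < Y + h" "ct cv A B = ct cv X Y" "cx cv A B \<noteq> cx cv X Y" for A B
    proof
      assume "cos (cw cv A B) = -1"
      then have ns: "\<not> nonsing A B" by (simp add: nonsing_def)
      have "0 <= A + B" by (rule good_boxD(2)[OF g ib]) (use a in auto)
      moreover have "(X < X0 \<and> A < X0) \<or> (X0 < X \<and> X0 < A)" using a(1,2) h(4) X(3) by linarith
      ultimately show False using sing[OF _ a(5) ns] a(6) by blast
    qed
  qed
qed

lemma conservative_conclusion:
  "\<forall>\<^sub>F t in at_right t0.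
        strong_singularity (\<lambda>x. ucons x t) (\<gamma>m t) \<and>
        strong_singularity (\<lambda>x. ucons x t) (\<gamma>p t) \<and>
        smooth_on (- {\<gamma>m t, \<gamma>p t}) (\<lambda>x. ucons x t)"
proof -
  obtain r where g: "good_box r" using ex_good_box by blast
  have r0: "0 < r" by (rule good_box_pos[OF g])
  obtain \<eta> where sep: "separated r \<eta>" using ex_separated[OF g r0 order_refl] by blast
  note \<eta> = separatedD(1,2)[OF sep] and sing = separatedD(3)[OF sep] and exm = separatedD(4)[OF sep] and exp = separatedD(5)[OF sep]
  have "strong_singularity (\<lambda>x. ucons x t) (\<gamma>m t) \<and> strong_singularity (\<lambda>x. ucons x t) (\<gamma>p t) \<and>
        smooth_on (- {\<gamma>m t, \<gamma>p t}) (\<lambda>x. ucons x t)" if t: "t0 < t" "t < t0 + \<eta>" for t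
  proof (intro conjI)
    have tp: "0 < t" using t t0_pos by simp
    have tle: "t <= t0 + \<eta>" using t by simp
    obtain X Y where XY: "X0 - r < X" "X < X0" "\<bar>Y - Y0\<bar> < r" "cw cv X Y = pi" "ct cv X Y = t" "cx cv X Y = \<gamma>m t"
      using exm[OF t(1) tle] by blast
    have ax: "\<bar>X - X0\<bar> < r" "X \<noteq> X0" using XY(1,2) by auto
    have "strong_singularity (\<lambda>x. ucons x (ct cv X Y)) (cx cv X Y)"
    proof (rule curve_strong_singularity[OF g ax(1) XY(3) ax(2) XY(4)])
      show "0 < ct cv X Y" using XY(5) tp by simp
      fix A B assume h: "0 <= A + B" "ct cv A B = ct cv X Y" "\<not> nonsing A B" "(X < X0 \<and> A < X0) \<or> (X0 < X \<and> X0 < A)"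
      have tAB: "ct cv A B = t" using h(2) XY(5) by simp
      have "A < X0" using h(4) XY(1,2) by linarith
      moreover have "ct cv A B <= t0 + \<eta>" using tAB tle by simp
      ultimately have "cx cv A B = \<gamma>m (ct cv A B)" using sing[OF h(1) _ h(3)] by blast
      then show "cx cv A B = cx cv X Y" unfolding tAB XY(6) .
    qed
    then show "strong_singularity (\<lambda>x. ucons x t) (\<gamma>m t)" unfolding XY(5,6) .
    obtain X Y where XY: "X0 < X" "X < X0 + r" "\<bar>Y - Y0\<bar> < r" "cw cv X Y = pi" "ct cv X Y = t" "cx cv X Y = \<gamma>p t"
      using exp[OF t(1) tle] by blast
    have ax: "\<bar>X - X0\<bar> < r" "X \<noteq> X0" using XY(1,2) by auto
    have "strong_singularity (\<lambda>x. ucons x (ct cv X Y)) (cx cv X Y)"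
    proof (rule curve_strong_singularity[OF g ax(1) XY(3) ax(2) XY(4)])
      show "0 < ct cv X Y" using XY(5) tp by simp
      fix A B assume h: "0 <= A + B" "ct cv A B = ct cv X Y" "\<not> nonsing A B" "(X < X0 \<and> A < X0) \<or> (X0 < X \<and> X0 < A)"
      have tAB: "ct cv A B = t" using h(2) XY(5) by simp
      have "X0 < A" using h(4) XY(1,2) by linarith
      moreover have "ct cv A B <= t0 + \<eta>" using tAB tle by simp
      ultimately have "cx cv A B = \<gamma>p (ct cv A B)" using sing[OF h(1) _ h(3)] by blast
      then show "cx cv A B = cx cv X Y" unfolding tAB XY(6) .
    qed
    then show "strong_singularity (\<lambda>x. ucons x t) (\<gamma>p t)" unfolding XY(5,6) .
    have rg: "A.reg (fst (A.pre x t)) (snd (A.pre x t))" if x: "x \<in> - {\<gamma>m t, \<gamma>p t}" for x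
    proof -
      define X where "X = fst (A.pre x t)"
      define Y where "Y = snd (A.pre x t)"
      have p: "0 <= X + Y" "cx cv X Y = x" "ct cv X Y = t" unfolding X_def Y_def using A.pre[of t x] tp by auto
      have "nonsing X Y"
      proof (rule ccontr)
        assume "\<not> nonsing X Y"
        moreover have "ct cv X Y <= t0 + \<eta>" using p(3) tle by simp
        ultimately have s: "X = X0 --> Y = Y0" "X < X0 --> cx cv X Y = \<gamma>m (ct cv X Y)" "X0 < X --> cx cv X Y = \<gamma>p (ct cv X Y)"
          using sing[OF p(1)] by blast+
        consider "X < X0" | "X = X0" | "X0 < X" by linarith
        then show False
        proof cases
          case 1 then show False using s(2) x unfolding p(2,3) by blast
        next
          case 2 then show False using s(1) p(3) t(1) by simp
        next
          case 3 then show False using s(3) x unfolding p(2,3) by blast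
        qed
      qed
      moreover have "0 < X + Y" using A.t_pos_imp_interior[OF p(1)] p(3) tp by simp
      ultimately show ?thesis unfolding A.reg_def nonsing_def X_def Y_def by simp
    qed
    show "smooth_on (- {\<gamma>m t, \<gamma>p t}) (\<lambda>x. ucons x t)"
      unfolding smooth_on_def
    proof
      fix n
      have "Ck_on n UNIV (\<lambda>(X, Y). cu cv X Y)" by (rule smooth_on_def[THEN iffD1, THEN spec, OF smooth_vars(1)])
      then have "Ck_on n {P. A.reg (fst P) (snd P)} (\<lambda>(X, Y). cu cv X Y)" by (rule Ck_on_subset) simp
      from A.Ck_on_along_pre[OF smooth_vars(2-5) tp rg this]
      have "Ck_on n (- {\<gamma>m t, \<gamma>p t}) (\<lambda>x. (\<lambda>(X, Y). cu cv X Y) (A.pre x t))" .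
      then show "Ck_on n (- {\<gamma>m t, \<gamma>p t}) (\<lambda>x. ucons x t)"
        unfolding A.U_pre[OF less_imp_le[OF tp]] split_def .
    qed
  qed
  then have "\<forall>y>t0. y < t0 + \<eta> --> strong_singularity (\<lambda>x. ucons x y) (\<gamma>m y) \<and>
      strong_singularity (\<lambda>x. ucons x y) (\<gamma>p y) \<and> smooth_on (- {\<gamma>m y, \<gamma>p y}) (\<lambda>x. ucons x y)" by blast
  moreover have "t0 < t0 + \<eta>" using \<eta>(1) by simp
  ultimately show ?thesis unfolding eventually_at_right_field by blast
qed

end

section \<open>The region of disagreement\<close>

context singular_origin
begin

lemma compact_box: "compact {P. inbox r (fst P) (snd P)}"
proof -
  have "{P. inbox r (fst P) (snd P)} = {X0 - r..X0 + r} \<times> {Y0 - r..Y0 + r}"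
    by (auto simp: inbox_def abs_le_iff)
  then show ?thesis by (simp add: compact_Times)
qed

lemma box_half_plane: "good_box r ==> {P. inbox r (fst P) (snd P)} \<subseteq> half_plane"
  using good_boxD(2) by (fastforce simp: half_plane_def)

lemma box_bounded:
  assumes g: "good_box r" and c: "continuous_on half_plane (\<lambda>(X, Y). f X Y)"
  shows "\<exists>M\<ge>0. \<forall>X Y. inbox r X Y --> \<bar>f X Y :: real\<bar> <= M"
proof -
  have "bounded ((\<lambda>(X, Y). f X Y) ` {P. inbox r (fst P) (snd P)})"
    by (intro compact_imp_bounded compact_continuous_image compact_box continuous_on_subset[OF c box_half_plane[OF g]])
  then obtain M where M: "\<And>x. x \<in> (\<lambda>(X, Y). f X Y) ` {P. inbox r (fst P) (snd P)} ==> \<bar>x\<bar> <= M"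
    by (meson bounded_real)
  have "\<bar>f X Y\<bar> <= \<bar>M\<bar>" if "inbox r X Y" for X Y using M[of "f X Y"] that by force
  then show ?thesis by (intro exI[of _ "\<bar>M\<bar>"]) simp
qed

lemma box_lower:
  assumes g: "good_box r" and c: "continuous_on half_plane (\<lambda>(X, Y). f X Y)"
    and pos: "\<And>X Y. inbox r X Y ==> (0::real) < f X Y"
  shows "\<exists>m>0. \<forall>X Y. inbox r X Y --> m <= f X Y"
proof -
  have ne: "{P. inbox r (fst P) (snd P)} \<noteq> {}"
  proof -
    have "(X0, Y0) \<in> {P. inbox r (fst P) (snd P)}" using good_box_pos[OF g] by (simp add: inbox_def)
    then show ?thesis by blast
  qed
  obtain P where P: "inbox r (fst P) (snd P)" "\<And>Q. inbox r (fst Q) (snd Q) ==> (\<lambda>(X, Y). f X Y) P <= (\<lambda>(X, Y). f X Y) Q"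
    using continuous_attains_inf[OF compact_box ne continuous_on_subset[OF c box_half_plane[OF g]]] by auto
  show ?thesis
    by (rule exI[of _ "f (fst P) (snd P)"]) (use pos[OF P(1)] P(2) in \<open>force simp: split_def\<close>)
qed

text \<open>The region in which the two solutions agree, up to the time until which the singular set is controlled: in the past of one of its points, at strictly smaller \<open>Y\<close>, no singular point occurs. It consists of the points not above the line \<open>Y = Y0\<close>, those to the left of the window, and those to the left of the axis and below the curve.\<close>

definition in_E :: "real => real => real => real => bool" where
  "in_E r a X Y \<longleftrightarrow> Y <= Y0 \<or> X <= X0 - a \<or> (X <= X0 \<and> inbox r X Y \<and> cw cv X Y <= pi)"

text \<open>Box size, window and time span are coupled so that before time \<open>t0 + \<eta>\<close> the complement of the region of agreement lies in the box; the two inequalities for the time close it on the right and at the top.\<close>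

definition regime :: "real => real => real => bool" where
  "regime r a \<eta> \<longleftrightarrow> good_box r \<and> 0 < a \<and> a <= r \<and> separated a \<eta> \<and>
     t0 + \<eta> < ct cv (X0 + a) Y0 \<and> t0 + \<eta> < ct cv (X0 - a) (Y0 + r)"

lemma regimeD:
  assumes "regime r a \<eta>"
  shows "good_box r" "0 < a" "a <= r" "separated a \<eta>" "t0 + \<eta> < ct cv (X0 + a) Y0" "t0 + \<eta> < ct cv (X0 - a) (Y0 + r)"
    "0 < r" "0 < \<eta>"
  using assms good_box_pos separatedD(1) unfolding regime_def by blast+

lemma separated_mono: "separated a \<eta> ==> 0 < \<eta>' ==> \<eta>' <= \<eta> ==> separated a \<eta>'"
  unfolding separated_def by (intro conjI allI impI; (linarith | force))

lemma line_after_P: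
  assumes "good_box r" "0 < h" "h <= r"
  shows "t0 < ct cv (X0 + h) Y0"
proof (rule A.mono_X(4)[of X0 Y0 "X0 + h" "X0 + h / 2"])
  have "inbox r (X0 + h / 2) Y0" using assms by (simp add: inbox_def)
  then show "cos (cw cv (X0 + h / 2) Y0) \<noteq> -1"
    using w_on_line[OF assms(1), of "X0 + h / 2"] good_boxD(15)[OF assms(1)] assms by (auto simp: inbox_def)
qed (use assms P_interior in auto)

lemma axis_after_P:
  assumes "good_box r" "0 < h" "h <= r"
  shows "t0 < ct cv X0 (Y0 + h)"
proof (rule A.mono_Y(4)[of X0 Y0 "Y0 + h" "Y0 + h / 2"])
  have "inbox r X0 (Y0 + h / 2)" using assms by (simp add: inbox_def)
  then show "cos (cz cv X0 (Y0 + h / 2)) \<noteq> -1" by (rule good_boxD(17)[OF assms(1)])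
qed (use assms P_interior in auto)

lemma ex_regime:
  assumes g: "good_box r" and a1: "0 < a1" "a1 <= r"
  shows "\<exists>a \<eta>. a <= a1 \<and> regime r a \<eta>"
proof -
  have r0: "0 < r" by (rule good_box_pos[OF g])
  have up: "t0 < ct cv X0 (Y0 + r)" by (rule axis_after_P[OF g r0 order_refl])
  have hp: "0 < X0 + (Y0 + r)" using P_interior r0 by simp
  obtain d where d: "0 < d" "\<And>X' Y'. \<bar>X' - X0\<bar> <= d ==> \<bar>Y' - (Y0 + r)\<bar> <= d ==>
      0 < X' + Y' \<and> \<bar>ct cv X' Y' - ct cv X0 (Y0 + r)\<bar> <= (ct cv X0 (Y0 + r) - t0) / 2"
    using continuous_half_plane_box[OF A.cont_vars(7) hp, of "(ct cv X0 (Y0 + r) - t0) / 2"] up by auto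
  define a where "a = min d a1"
  have a: "0 < a" "a <= a1" "a <= d" "a <= r" using d(1) a1 by (auto simp: a_def)
  have "\<bar>ct cv (X0 - a) (Y0 + r) - ct cv X0 (Y0 + r)\<bar> <= (ct cv X0 (Y0 + r) - t0) / 2"
    using d(2)[of "X0 - a" "Y0 + r"] a d(1) by simp
  moreover have "s < u" if "\<bar>u - v\<bar> <= (v - s) / 2" "s < v" for s u v :: real
    using abs_le_D2[OF that(1)] that(2) by (simp add: field_simps)
  ultimately have c1: "t0 < ct cv (X0 - a) (Y0 + r)" using up by blast
  have c2: "t0 < ct cv (X0 + a) Y0" by (rule line_after_P[OF g a(1,4)])
  obtain \<eta> where sep: "separated a \<eta>" using ex_separated[OF g a(1,4)] by blast
  obtain \<eta>' where \<eta>': "0 < \<eta>'" "\<eta>' < \<eta>" "\<eta>' < ct cv (X0 - a) (Y0 + r) - t0" "\<eta>' < ct cv (X0 + a) Y0 - t0"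
    using ex_less_four[of \<eta> "ct cv (X0 - a) (Y0 + r) - t0" "ct cv (X0 + a) Y0 - t0" \<eta>] separatedD(1)[OF sep] c1 c2 by auto
  have "regime r a \<eta>'"
    unfolding regime_def using g a separated_mono[OF sep \<eta>'(1)] \<eta>' by auto
  then show ?thesis using a(2) by blast
qed

lemma same_in_E:
  assumes R: "regime r a \<eta>" and XY: "0 <= X + Y" and t: "ct cv X Y <= t0 + \<eta>" and E: "in_E r a X Y"
  shows "same_vars cv dv X Y"
proof (rule agree_below[OF XY])
  note g = regimeD(1)[OF R]
  fix X' Y' assume a: "0 <= X' + Y'" "X' <= X" "Y' < Y"
  show "nonsing X' Y'"
  proof (rule ccontr)
    assume n: "\<not> nonsing X' Y'"
    have "ct cv X' Y' <= ct cv X Y'" by (rule A.mono_X(2)[OF a(1,2)])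
    also have "\<dots> <= ct cv X Y" by (rule A.mono_Y(2)) (use a in auto)
    also note t
    finally have s: "\<bar>X' - X0\<bar> < a" "\<bar>Y' - Y0\<bar> < a" "cw cv X' Y' = pi"
      using separatedD(3)[OF regimeD(4)[OF R] a(1) _ n] by blast+
    have ib: "inbox r X' Y'" using s(1,2) regimeD(3)[OF R] unfolding inbox_def by linarith
    have Y: "Y0 < Y" using w_pi_above(1)[OF g ib] s(3) a(3) by simp
    have X: "X0 - a < X" using s(1) a(2) by (simp add: abs_less_iff)
    have c: "X <= X0" "inbox r X Y" "cw cv X Y <= pi" using E Y X unfolding in_E_def by auto
    have ib': "inbox r X' Y" using c(2) ib unfolding inbox_def by simp
    have w': "pi < cw cv X' Y" using w_strict_Y[OF g ib ib' a(3)] s(3) by simp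
    show False
    proof (cases "X' = X")
      case True then show False using w' c(3) by simp
    next
      case False
      then have "pi < cw cv X Y" using w_between[OF g ib' Y, of X] w' a(2) c(1) by simp
      then show False using c(3) by simp
    qed
  qed
qed

lemma in_E_left:
  assumes R: "regime r a \<eta>" and E: "in_E r a X Y" and X': "X' <= X"
  shows "in_E r a X' Y"
proof (rule ccontr)
  note g = regimeD(1)[OF R]
  assume n: "\<not> in_E r a X' Y"
  then have 1: "Y0 < Y" "X0 - a < X'" unfolding in_E_def by auto
  then have c: "X <= X0" "inbox r X Y" "cw cv X Y <= pi" using E X' unfolding in_E_def by auto
  have ib: "inbox r X' Y" using 1 c X' regimeD(3)[OF R] unfolding inbox_def by (auto simp: abs_le_iff)
  then have w: "pi < cw cv X' Y" using n c(1) X' unfolding in_E_def by auto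
  show False
  proof (cases "X' = X")
    case True then show False using w c by simp
  next
    case False
    then have "pi < cw cv X Y" using w_between[OF g ib 1(1), of X] w X' c(1) by simp
    then show False using c(3) by simp
  qed
qed

text \<open>The time bound is assumed for the dissipative time only. If the conservative time were larger, it would equal \<open>t0 + \<eta>\<close> at a point further to the left, where the two times agree.\<close>

lemma tau_in_E:
  assumes R: "regime r a \<eta>" and XY: "0 <= X + Y" and E: "in_E r a X Y" and t: "ct dv X Y < t0 + \<eta>"
  shows "ct cv X Y < t0 + \<eta>" "same_vars cv dv X Y"
proof -
  show lt: "ct cv X Y < t0 + \<eta>"
  proof (rule ccontr)
    assume n: "\<not> ct cv X Y < t0 + \<eta>"
    have b: "ct cv (- Y) Y = 0" using A.bdry_vals(2)[of "-Y"] by simp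
    have p: "0 < t0 + \<eta>" using t0_pos regimeD(8)[OF R] by simp
    have "continuous_on {- Y..X} (\<lambda>X. ct cv X Y)" by (rule continuous_on_half_plane_line[OF A.cont_vars(7)]) simp
    then obtain X' where X': "- Y <= X'" "X' <= X" "ct cv X' Y = t0 + \<eta>"
      using IVT'[of "\<lambda>X. ct cv X Y" "-Y" "t0 + \<eta>" X] n b p XY by auto
    have hp: "0 <= X' + Y" using X'(1) by simp
    have "same_vars cv dv X' Y" by (rule same_in_E[OF R hp _ in_E_left[OF R E X'(2)]]) (simp add: X'(3))
    then have "ct dv X' Y = t0 + \<eta>" using X'(3) unfolding same_vars_def by simp
    moreover have "ct dv X' Y <= ct dv X Y" by (rule B.mono_X(2)[OF hp X'(2)])
    ultimately show False using t by simp
  qed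
  show "same_vars cv dv X Y" by (rule same_in_E[OF R XY _ E]) (use lt in simp)
qed

lemma box_hp: "good_box r ==> \<bar>X - X0\<bar> <= r ==> Y0 <= Y ==> 0 < X + Y"
  using good_boxD(1)[of r X Y0] good_box_pos[of r] by (simp add: inbox_def)

lemma sigma_outside_E:
  assumes R: "regime r a \<eta>" and XY: "0 <= X + Y" and t: "ct cv X Y < t0 + \<eta>" and nE: "\<not> in_E r a X Y"
  shows "X0 - a < X" "X < X0 + a" "Y0 < Y" "inbox r X Y" "X <= X0 ==> pi < cw cv X Y"
proof -
  note g = regimeD(1)[OF R]
  have hl: "0 <= (X0 - a) + Y'" if "Y0 <= Y'" for Y'
    using box_hp[OF g _ that, of "X0 - a"] regimeD(2,3)[OF R] by simp
  have 1: "X0 - a < X" "Y0 < Y" using nE unfolding in_E_def by auto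
  have Y: "Y < Y0 + r"
  proof (rule ccontr)
    assume n: "\<not> Y < Y0 + r"
    have "ct cv (X0 - a) (Y0 + r) <= ct cv (X0 - a) Y" by (rule A.mono_Y(2)) (use hl regimeD(7)[OF R] n in auto)
    also have "\<dots> <= ct cv X Y" by (rule A.mono_X(2)) (use hl 1 in auto)
    finally show False using t regimeD(6)[OF R] by simp
  qed
  have X: "X < X0 + a"
  proof (rule ccontr)
    assume n: "\<not> X < X0 + a"
    have "ct cv (X0 + a) Y0 <= ct cv X Y0" by (rule A.mono_X(2)) (use P_interior regimeD(2)[OF R] n in auto)
    also have "\<dots> <= ct cv X Y" by (rule A.mono_Y(2)) (use P_interior regimeD(2)[OF R] n 1 in auto)
    finally show False using t regimeD(5)[OF R] by simp
  qed
  show "X0 - a < X" "X < X0 + a" "Y0 < Y" using 1 X by auto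
  show ib: "inbox r X Y" using 1 X Y regimeD(3)[OF R] unfolding inbox_def by (auto simp: abs_le_iff)
  show "pi < cw cv X Y" if "X <= X0" using nE ib that unfolding in_E_def by auto
qed

lemma tau_outside_E:
  assumes R: "regime r a \<eta>" and XY: "0 <= X + Y" and t: "ct dv X Y < t0 + \<eta>" and nE: "\<not> in_E r a X Y"
  shows "X0 - a < X" "X < X0 + a" "Y0 < Y" "inbox r X Y" "X <= X0 ==> pi < cw cv X Y"
proof -
  note g = regimeD(1)[OF R]
  have hl: "0 <= (X0 - a) + Y'" if "Y0 <= Y'" for Y'
    using box_hp[OF g _ that, of "X0 - a"] regimeD(2,3)[OF R] by simp
  have 1: "X0 - a < X" "Y0 < Y" using nE unfolding in_E_def by auto
  have Y: "Y < Y0 + r"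
  proof (rule ccontr)
    assume n: "\<not> Y < Y0 + r"
    have "ct dv (X0 - a) Y <= ct dv X Y" by (rule B.mono_X(2)) (use hl 1 in auto)
    then have "ct cv (X0 - a) Y < t0 + \<eta>"
      by (intro tau_in_E(1)[OF R]) (use hl 1 t in \<open>auto simp: in_E_def\<close>)
    moreover have "ct cv (X0 - a) (Y0 + r) <= ct cv (X0 - a) Y" by (rule A.mono_Y(2)) (use hl regimeD(7)[OF R] n in auto)
    ultimately show False using regimeD(6)[OF R] by simp
  qed
  have X: "X < X0 + a"
  proof (rule ccontr)
    assume n: "\<not> X < X0 + a"
    have hp: "0 <= X + Y0" using P_interior regimeD(2)[OF R] n by simp
    have "ct dv X Y0 <= ct dv X Y" by (rule B.mono_Y(2)) (use hp 1 in auto)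
    then have "ct cv X Y0 < t0 + \<eta>"
      by (intro tau_in_E(1)[OF R hp]) (use t in \<open>auto simp: in_E_def\<close>)
    moreover have "ct cv (X0 + a) Y0 <= ct cv X Y0" by (rule A.mono_X(2)) (use P_interior regimeD(2)[OF R] n in auto)
    ultimately show False using regimeD(5)[OF R] by simp
  qed
  show "X0 - a < X" "X < X0 + a" "Y0 < Y" using 1 X by auto
  show ib: "inbox r X Y" using 1 X Y regimeD(3)[OF R] unfolding inbox_def by (auto simp: abs_le_iff)
  show "pi < cw cv X Y" if "X <= X0" using nE ib that unfolding in_E_def by auto
qed

lemma rhs_signs_box:
  assumes g: "good_box r" and b: "inbox r X Y"
  shows "0 < rhs_w c cv X Y" "0 < rhs_w c dv X Y" "rhs_z c cv X Y < 0"
proof -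
  note hp = good_boxD(2)[OF g b]
  have k: "0 < deriv c v / (8 * (c v)\<^sup>2)" for v using c'_pos[of v] A.c_pos[of v] by simp
  show "0 < rhs_w c cv X Y" "0 < rhs_w c dv X Y"
    unfolding rhs_w_def using k good_boxD(11,12)[OF g b] A.q_pos[OF hp] B.q_pos[OF hp] by (simp_all only: mult_pos_pos diff_gt_0_iff_gt)
  have "0 < deriv c (cu cv X Y) / (8 * (c (cu cv X Y))\<^sup>2) * (cos (cz cv X Y) - cos (cw cv X Y)) * cp cv X Y"
    using k good_boxD(11)[OF g b] A.p_pos[OF hp] by (simp only: mult_pos_pos diff_gt_0_iff_gt)
  moreover have "k * (a - b) * p = - (k * (b - a) * p)" for k a b p :: real by (simp add: algebra_simps)
  ultimately show "rhs_z c cv X Y < 0" unfolding rhs_z_def by (metis neg_less_0_iff_less)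
qed

lemma theta_box:
  assumes "good_box r" "inbox r X Y"
  shows "cw dv X Y < pi ==> dissipative_theta dv X Y = 1" "pi <= cw dv X Y ==> dissipative_theta dv X Y = 0"
  using good_boxD(9,10)[OF assms] unfolding dissipative_theta_def by auto

text \<open>The vertical lines on which the equations of the dissipative solution hold almost everywhere.\<close>

definition good_X :: "real => bool" where
  "good_X X \<longleftrightarrow> (AE Y in lborel. 0 < X + Y --> semilinear_system_at c (dissipative_theta dv X Y) dv X Y)"

lemma AE_good_X: "AE X in lborel. good_X X"
  unfolding good_X_def by (rule B.sys_lines(1))

lemma tau_w_line:
  assumes "0 <= X + Y1"
  obtains L where "L-lipschitz_on {Y1..Y2} (\<lambda>Y. cw dv X Y)"
proof -
  have "loc_lipschitz_X (\<lambda>X Y. cw dv Y X)" unfolding loc_lipschitz_X_swap by (rule B.lipY) simp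
  from loc_lipschitz_X_line[OF this, of Y1 X Y2] show thesis using that assms by (auto simp: add.commute)
qed

lemma good_X_deriv:
  assumes "good_X X"
  shows "AE Y in lborel. 0 < X + Y --> ((\<lambda>Y. cw dv X Y) has_real_derivative dissipative_theta dv X Y * rhs_w c dv X Y) (at Y)"
  using assms unfolding good_X_def by eventually_elim (simp add: semilinear_system_at_iff has_dY_def)

lemma w_tau_no_overshoot:
  assumes g: "good_box r" and b: "inbox r X Y1" "inbox r X Y2" "Y1 <= Y2" and good: "good_X X" and w: "cw dv X Y1 <= pi"
  shows "cw dv X Y2 <= pi"
proof -
  have hp: "0 < X + Y1" by (rule good_boxD(1)[OF g b(1)])
  obtain L where L: "L-lipschitz_on {Y1..Y2} (\<lambda>Y. cw dv X Y)" using tau_w_line[of X Y1 Y2] hp by auto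
  have "cw dv X Y2 - pi <= 0"
  proof (rule lipschitz_barrier[where \<epsilon>=1, OF b(3) lipschitz_on_diff[OF L lipschitz_on_constant]])
    show "AE x in lborel. Y1 < x \<and> x < Y2 \<and> 0 < cw dv X x - pi \<and> cw dv X x - pi < 1 -->
        (\<exists>d. ((\<lambda>Y. cw dv X Y - pi) has_real_derivative d) (at x) \<and> d <= 0)"
      using good_X_deriv[OF good]
    proof eventually_elim
      case (elim y)
      show ?case
      proof
        assume y: "Y1 < y \<and> y < Y2 \<and> 0 < cw dv X y - pi \<and> cw dv X y - pi < 1"
        have ib: "inbox r X y" using b y unfolding inbox_def by (auto simp: abs_le_iff)
        have "((\<lambda>Y. cw dv X Y) has_real_derivative dissipative_theta dv X y * rhs_w c dv X y) (at y)" using elim y hp by simp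
        then have "((\<lambda>Y. cw dv X Y - pi) has_real_derivative 0) (at y)"
          using theta_box(2)[OF g ib] y by (auto intro!: derivative_eq_intros)
        then show "\<exists>d. ((\<lambda>Y. cw dv X Y - pi) has_real_derivative d) (at y) \<and> d <= 0" by blast
      qed
    qed
  qed (use w in auto)
  then show ?thesis by simp
qed

text \<open>Once \<open>w\<close> has reached \<open>\<pi>\<close> it remains there: above \<open>\<pi>\<close> its derivative vanishes, below \<open>\<pi>\<close> it is positive.\<close>

lemma w_tau_persists:
  assumes g: "good_box r" and b: "inbox r X Y1" "inbox r X Y2" "Y1 <= Y2" and good: "good_X X" and w: "cw dv X Y1 = pi"
  shows "cw dv X Y2 = pi"
proof (rule antisym)
  show "cw dv X Y2 <= pi" by (rule w_tau_no_overshoot[OF g b good]) (simp add: w)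
  have hp: "0 < X + Y1" by (rule good_boxD(1)[OF g b(1)])
  obtain L where L: "L-lipschitz_on {Y1..Y2} (\<lambda>Y. cw dv X Y)" using tau_w_line[of X Y1 Y2] hp by auto
  have "pi - cw dv X Y2 <= 0"
  proof (rule lipschitz_barrier[where \<epsilon>=1, OF b(3) lipschitz_on_diff[OF lipschitz_on_constant L]])
    show "AE x in lborel. Y1 < x \<and> x < Y2 \<and> 0 < pi - cw dv X x \<and> pi - cw dv X x < 1 -->
        (\<exists>d. ((\<lambda>Y. pi - cw dv X Y) has_real_derivative d) (at x) \<and> d <= 0)"
      using good_X_deriv[OF good]
    proof eventually_elim
      case (elim y)
      show ?case
      proof
        assume y: "Y1 < y \<and> y < Y2 \<and> 0 < pi - cw dv X y \<and> pi - cw dv X y < 1"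
        have ib: "inbox r X y" using b y unfolding inbox_def by (auto simp: abs_le_iff)
        have "((\<lambda>Y. cw dv X Y) has_real_derivative dissipative_theta dv X y * rhs_w c dv X y) (at y)" using elim y hp by simp
        then have "((\<lambda>Y. pi - cw dv X Y) has_real_derivative (- rhs_w c dv X y)) (at y)"
          using theta_box(1)[OF g ib] y by (auto intro!: derivative_eq_intros)
        then show "\<exists>d. ((\<lambda>Y. pi - cw dv X Y) has_real_derivative d) (at y) \<and> d <= 0"
          using rhs_signs_box(2)[OF g ib] by (meson less_imp_le neg_le_0_iff_le)
      qed
    qed
  qed (use w in auto)
  then show "pi <= cw dv X Y2" by simp
qed

text \<open>Each vertical line enters the set through the curve, where the solutions still agree and \<open>w = \<pi>\<close>. The exceptional lines follow by continuity in \<open>X\<close>.\<close>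

lemma w_tau_behind_curve:
  assumes R: "regime r a \<eta>" and b: "inbox r X Y" and X: "X0 - a < X" "X <= X0" and t: "ct dv X Y < t0 + \<eta>" and w: "pi <= cw cv X Y"
  shows "cw dv X Y = pi"
proof -
  note g = regimeD(1)[OF R]
  have good: "cw dv X Y = pi"
    if b: "inbox r X Y" and X: "X0 - a < X" "X < X0" and t: "ct dv X Y < t0 + \<eta>" and w: "pi <= cw cv X Y" and gX: "good_X X" for X
  proof -
    have Y: "Y0 <= Y" by (rule w_pi_above(1)[OF g b w])
    have wl: "cw cv X Y0 < pi" by (rule w_on_line[OF g]) (use b X in \<open>auto simp: inbox_def\<close>)
    have ib: "inbox r X y" if "Y0 <= y" "y <= Y" for y using b that unfolding inbox_def by (auto simp: abs_le_iff)
    have "continuous_on {Y0..Y} (\<lambda>Y. cw cv X Y)"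
      by (rule continuous_on_half_plane_vline[OF A.cont_vars(2)]) (use good_boxD(2)[OF g ib[OF order_refl Y]] in simp)
    then obtain Y1 where Y1: "Y0 <= Y1" "Y1 <= Y" "cw cv X Y1 = pi"
      using IVT'[of "\<lambda>Y. cw cv X Y" Y0 pi Y] wl w Y by auto
    note i1 = ib[OF Y1(1,2)]
    have "ct dv X Y1 <= ct dv X Y" by (rule B.mono_Y(2)[OF good_boxD(2)[OF g i1] Y1(2)])
    then have "same_vars cv dv X Y1"
      by (intro tau_in_E(2)[OF R good_boxD(2)[OF g i1]]) (use X i1 Y1 t in \<open>auto simp: in_E_def\<close>)
    then have "cw dv X Y1 = pi" using Y1(3) unfolding same_vars_def by simp
    then show ?thesis by (rule w_tau_persists[OF g i1 b Y1(2) gX])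
  qed
  show ?thesis
  proof (cases "cw cv X Y = pi")
    case True
    then have "same_vars cv dv X Y"
      by (intro tau_in_E(2)[OF R good_boxD(2)[OF g b]]) (use X b t in \<open>auto simp: in_E_def\<close>)
    then show ?thesis using True unfolding same_vars_def by simp
  next
    case False
    then have wg: "pi < cw cv X Y" using w by simp
    have hp: "0 < X + Y" by (rule good_boxD(1)[OF g b])
    obtain d where d: "0 < d" "\<And>X' Y'. \<bar>X' - X\<bar> <= d ==> \<bar>Y' - Y\<bar> <= d ==> 0 < X' + Y' \<and> \<bar>cw cv X' Y' - cw cv X Y\<bar> <= cw cv X Y - pi"
      using continuous_half_plane_box[OF A.cont_vars(2) hp, of "cw cv X Y - pi"] wg by auto
    obtain h where h: "0 < h" "h < d" "h < X - (X0 - a)" using ex_less_four[of d d d "X - (X0 - a)"] d(1) X by auto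
    have eq: "cw dv X' Y = pi" if X': "X - h < X'" "X' < X" and gX: "good_X X'" for X'
    proof (rule good[OF _ _ _ _ _ gX])
      have dd: "0 < X' + Y \<and> \<bar>cw cv X' Y - cw cv X Y\<bar> <= cw cv X Y - pi" using d(2)[of X' Y] X' h d(1) by simp
      then show "pi <= cw cv X' Y" by (simp add: abs_le_iff)
      show "inbox r X' Y" using b X' X h regimeD(3)[OF R] unfolding inbox_def by (auto simp: abs_le_iff)
      show "X0 - a < X'" "X' < X0" using X' h X by auto
      have "ct dv X' Y <= ct dv X Y" by (rule B.mono_X(2)) (use dd X' in auto)
      then show "ct dv X' Y < t0 + \<eta>" using t by simp
    qed
    have c: "continuous_on {X - h..X} (\<lambda>X. cw dv X Y)"
      by (rule continuous_on_half_plane_line[OF B.cont_vars(2)]) (use d(2)[of "X - h" Y] h d(1) in auto)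
    have lt: "X - h < X" using h by simp
    have "cw dv X Y - pi <= 0"
      by (rule AE_imp_le_continuous[OF lt _ eventually_mono[OF AE_good_X]]) (use eq h in \<open>auto intro!: continuous_intros c\<close>)
    moreover have "pi - cw dv X Y <= 0"
      by (rule AE_imp_le_continuous[OF lt _ eventually_mono[OF AE_good_X]]) (use eq h in \<open>auto intro!: continuous_intros c\<close>)
    ultimately show ?thesis by simp
  qed
qed

lemma w_tau_le_pi_right:
  assumes R: "regime r a \<eta>" and b: "inbox r X Y" and X: "X0 <= X" and Y: "Y0 <= Y" and t: "ct dv X Y < t0 + \<eta>"
  shows "cw dv X Y <= pi"
proof -
  note g = regimeD(1)[OF R]
  have iX0: "inbox r X0 Y0" "inbox r X0 Y" using b regimeD(7)[OF R] by (auto simp: inbox_def)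
  have good: "cw dv X' Y <= pi" if X': "X0 < X'" "X' <= X" and gX: "good_X X'" for X'
  proof -
    have i: "inbox r X' Y" "inbox r X' Y0" using b X' X regimeD(7)[OF R] unfolding inbox_def by (auto simp: abs_le_iff)
    have "ct dv X' Y0 <= ct dv X' Y" by (rule B.mono_Y(2)[OF good_boxD(2)[OF g i(2)] Y])
    also have "\<dots> <= ct dv X Y" by (rule B.mono_X(2)[OF good_boxD(2)[OF g i(1)] X'(2)])
    finally have "same_vars cv dv X' Y0"
      by (intro tau_in_E(2)[OF R good_boxD(2)[OF g i(2)]]) (use t in \<open>auto simp: in_E_def\<close>)
    then have "cw dv X' Y0 <= pi" using w_on_line[OF g, of X'] X' i(2) unfolding same_vars_def inbox_def by auto
    then show ?thesis by (rule w_tau_no_overshoot[OF g i(2,1) Y gX])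
  qed
  show ?thesis
  proof (cases "X = X0")
    case True
    have "pi <= cw cv X0 Y" using w_on_axis[OF g, of Y] iX0(2) Y w_P by (cases "Y = Y0") (auto simp: inbox_def)
    then have "cw dv X0 Y = pi"
      by (intro w_tau_behind_curve[OF R iX0(2)]) (use regimeD(2)[OF R] t True in auto)
    then show ?thesis using True by simp
  next
    case False
    then have lt: "X0 < X" using X by simp
    have c: "continuous_on {X0..X} (\<lambda>X. cw dv X Y)"
      by (rule continuous_on_half_plane_line[OF B.cont_vars(2)]) (use good_boxD(2)[OF g iX0(2)] in simp)
    have "cw dv X Y - pi <= 0"
      by (rule AE_imp_le_continuous[OF lt _ eventually_mono[OF AE_good_X]]) (use good lt in \<open>auto intro!: continuous_intros c\<close>)
    then show ?thesis by simp
  qed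
qed

end

section \<open>The contact set of the dissipative solution\<close>

context singular_origin
begin

lemma box_lipschitz_X:
  assumes g: "good_box r" and l: "loc_lipschitz_X f"
  shows "\<exists>L\<ge>0. \<forall>X1 X2 Y. inbox r X1 Y --> inbox r X2 Y --> \<bar>f X2 Y - f X1 Y\<bar> <= L * \<bar>X2 - X1\<bar>"
proof -
  define R where "R = \<bar>X0\<bar> + \<bar>Y0\<bar> + r"
  have R: "\<bar>X\<bar> <= R" "\<bar>Y\<bar> <= R" if "inbox r X Y" for X Y
  proof -
    have "\<bar>x\<bar> <= \<bar>x0\<bar> + s" if "\<bar>x - x0\<bar> <= s" for x x0 s :: real using that by (simp add: abs_if split: if_splits)
    then show "\<bar>X\<bar> <= R" "\<bar>Y\<bar> <= R" using that unfolding inbox_def R_def by fastforce+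
  qed
  from loc_lipschitz_XE[OF l, of R] obtain L where L: "0 <= L" "\<And>X X' Y. \<bar>X\<bar> <= R ==> \<bar>X'\<bar> <= R ==> \<bar>Y\<bar> <= R ==> 0 <= X + Y ==> 0 <= X' + Y ==>
     \<bar>f X Y - f X' Y\<bar> <= L * \<bar>X - X'\<bar>" by blast
  show ?thesis
  proof (intro exI[of _ L] conjI L(1) allI impI)
    fix X1 X2 Y assume b: "inbox r X1 Y" "inbox r X2 Y"
    show "\<bar>f X2 Y - f X1 Y\<bar> <= L * \<bar>X2 - X1\<bar>"
      by (rule L(2)[OF R(1)[OF b(2)] R(1)[OF b(1)] R(2)[OF b(1)] good_boxD(2)[OF g b(2)] good_boxD(2)[OF g b(1)]])
  qed
qed

lemma box_lipschitz_Y: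
  assumes g: "good_box r" and l: "loc_lipschitz_Y f"
  shows "\<exists>L\<ge>0. \<forall>X Y1 Y2. inbox r X Y1 --> inbox r X Y2 --> \<bar>f X Y2 - f X Y1\<bar> <= L * \<bar>Y2 - Y1\<bar>"
proof -
  define R where "R = \<bar>X0\<bar> + \<bar>Y0\<bar> + r"
  have R: "\<bar>X\<bar> <= R" "\<bar>Y\<bar> <= R" "0 <= Y + X" if "inbox r X Y" for X Y
  proof -
    have "\<bar>x\<bar> <= \<bar>x0\<bar> + s" if "\<bar>x - x0\<bar> <= s" for x x0 s :: real using that by (simp add: abs_if split: if_splits)
    then show "\<bar>X\<bar> <= R" "\<bar>Y\<bar> <= R" using that unfolding inbox_def R_def by fastforce+
    show "0 <= Y + X" using good_boxD(2)[OF g that] by simp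
  qed
  have l': "loc_lipschitz_X (\<lambda>X Y. f Y X)" using l unfolding loc_lipschitz_X_swap .
  from loc_lipschitz_XE[OF l', of R] obtain L where L: "0 <= L" "\<And>X X' Y. \<bar>X\<bar> <= R ==> \<bar>X'\<bar> <= R ==> \<bar>Y\<bar> <= R ==> 0 <= X + Y ==> 0 <= X' + Y ==>
     \<bar>f Y X - f Y X'\<bar> <= L * \<bar>X - X'\<bar>" by blast
  show ?thesis
  proof (intro exI[of _ L] conjI L(1) allI impI)
    fix X Y1 Y2 assume b: "inbox r X Y1" "inbox r X Y2"
    show "\<bar>f X Y2 - f X Y1\<bar> <= L * \<bar>Y2 - Y1\<bar>"
      by (rule L(2)[OF R(2)[OF b(2)] R(2)[OF b(1)] R(1)[OF b(1)] R(3)[OF b(2)] R(3)[OF b(1)]])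
  qed
qed

text \<open>For the dissipative solution \<open>u\<close>, \<open>z\<close> and \<open>q\<close> are Lipschitz continuous in \<open>X\<close>; the angle \<open>w\<close> need not be, and its variation is kept on the right-hand side.\<close>

lemma rhs_w_tau_lipschitz_X:
  assumes g: "good_box r"
  shows "\<exists>C\<ge>0. \<forall>X1 X2 Y. inbox r X1 Y --> inbox r X2 Y -->
     \<bar>rhs_w c dv X2 Y - rhs_w c dv X1 Y\<bar> <= C * (\<bar>X2 - X1\<bar> + \<bar>cw dv X2 Y - cw dv X1 Y\<bar>)"
proof -
  define S where "S = {i :: real \<times> real \<times> real. inbox r (fst i) (snd (snd i)) \<and> inbox r (fst (snd i)) (snd (snd i))}"
  define d where "d i = \<bar>fst (snd i) - fst i\<bar> + \<bar>cw dv (fst (snd i)) (snd (snd i)) - cw dv (fst i) (snd (snd i))\<bar>" for i :: "real \<times> real \<times> real"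
  have d0: "0 <= d i" for i by (simp add: d_def)
  have cl: "close_on S d (\<lambda>i. f (fst (snd i)) (snd (snd i))) (\<lambda>i. f (fst i) (snd (snd i)))"
    if c: "continuous_on half_plane (\<lambda>(X, Y). f X Y)"
      and L: "\<exists>L\<ge>0. \<forall>i\<in>S. \<bar>f (fst (snd i)) (snd (snd i)) - f (fst i) (snd (snd i))\<bar> <= L * d i" for f
  proof -
    obtain M where M: "\<forall>X Y. inbox r X Y --> \<bar>f X Y\<bar> <= M" using box_bounded[OF g c] by blast
    obtain L where "\<forall>i\<in>S. \<bar>f (fst (snd i)) (snd (snd i)) - f (fst i) (snd (snd i))\<bar> <= L * d i" using L by blast
    then show ?thesis by (intro close_onI[where B=M and K=L] d0) (use M in \<open>auto simp: S_def\<close>)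
  qed
  have lx: "\<exists>L\<ge>0. \<forall>i\<in>S. \<bar>f (fst (snd i)) (snd (snd i)) - f (fst i) (snd (snd i))\<bar> <= L * d i" if l: "loc_lipschitz_X f" for f
  proof -
    obtain L where L: "0 <= L" "\<forall>X1 X2 Y. inbox r X1 Y --> inbox r X2 Y --> \<bar>f X2 Y - f X1 Y\<bar> <= L * \<bar>X2 - X1\<bar>"
      using box_lipschitz_X[OF g l] by blast
    have "\<bar>f (fst (snd i)) (snd (snd i)) - f (fst i) (snd (snd i))\<bar> <= L * d i" if i: "i \<in> S" for i
    proof -
      have "\<bar>f (fst (snd i)) (snd (snd i)) - f (fst i) (snd (snd i))\<bar> <= L * \<bar>fst (snd i) - fst i\<bar>"
        using L(2) i by (simp add: S_def)
      also have "\<dots> <= L * d i" using L(1) by (intro mult_left_mono) (auto simp: d_def)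
      finally show ?thesis .
    qed
    then show ?thesis using L(1) by blast
  qed
  have lw: "\<exists>L\<ge>0. \<forall>i\<in>S. \<bar>cw dv (fst (snd i)) (snd (snd i)) - cw dv (fst i) (snd (snd i))\<bar> <= L * d i"
    by (rule exI[of _ 1]) (simp add: d_def)
  have "loc_lipschitz_X (cu dv)" "loc_lipschitz_X (cz dv)" "loc_lipschitz_X (cq dv)" by (rule B.lipX; simp)+
  note cc = cl[OF B.cont_vars(1) lx[OF this(1)]] cl[OF B.cont_vars(2) lw] cl[OF B.cont_vars(3) lx[OF this(2)]] cl[OF B.cont_vars(5) lx[OF this(3)]]
  obtain K where K: "0 <= K" "\<And>i. i \<in> S ==> \<bar>rhs_w c dv (fst (snd i)) (snd (snd i)) - rhs_w c dv (fst i) (snd (snd i))\<bar> <= K * d i"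
    using close_onE[OF A.close_rhs(1)[OF d0 cc(1,2,3,4)]] by blast
  show ?thesis
  proof (intro exI[of _ K] conjI K(1) allI impI)
    fix X1 X2 Y assume "inbox r X1 Y" "inbox r X2 Y"
    then have "(X1, X2, Y) \<in> S" by (simp add: S_def)
    from K(2)[OF this] show "\<bar>rhs_w c dv X2 Y - rhs_w c dv X1 Y\<bar> <= K * (\<bar>X2 - X1\<bar> + \<bar>cw dv X2 Y - cw dv X1 Y\<bar>)"
      by (simp add: d_def)
  qed
qed

text \<open>On \<open>Y = Y0\<close> the solutions agree, and \<open>u\<close>, \<open>w\<close> and \<open>p\<close> are Lipschitz continuous in \<open>Y\<close> for both of them. The angle \<open>z\<close> is not, because of its square root behaviour, and is kept on the right-hand side.\<close>

lemma rhs_z_difference: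
  assumes g: "good_box r"
  shows "\<exists>C\<ge>0. \<forall>X Y. inbox r X Y --> same_vars cv dv X Y0 -->
     \<bar>rhs_z c cv X Y - rhs_z c dv X Y\<bar> <= C * (\<bar>cz cv X Y - cz dv X Y\<bar> + \<bar>Y - Y0\<bar>)"
proof -
  define S where "S = {i :: real \<times> real. inbox r (fst i) (snd i) \<and> same_vars cv dv (fst i) Y0}"
  define d where "d i = \<bar>cz cv (fst i) (snd i) - cz dv (fst i) (snd i)\<bar> + \<bar>snd i - Y0\<bar>" for i :: "real \<times> real"
  have d0: "0 <= d i" for i by (simp add: d_def)
  have cl: "close_on S d (\<lambda>i. f (fst i) (snd i)) (\<lambda>i. h (fst i) (snd i))"
    if c: "continuous_on half_plane (\<lambda>(X, Y). f X Y)" "continuous_on half_plane (\<lambda>(X, Y). h X Y)"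
      and L: "\<exists>L\<ge>0. \<forall>i\<in>S. \<bar>f (fst i) (snd i) - h (fst i) (snd i)\<bar> <= L * d i" for f h
  proof -
    obtain M where M: "\<forall>X Y. inbox r X Y --> \<bar>f X Y\<bar> <= M" using box_bounded[OF g c(1)] by blast
    obtain M' where M': "\<forall>X Y. inbox r X Y --> \<bar>h X Y\<bar> <= M'" using box_bounded[OF g c(2)] by blast
    obtain L where "\<forall>i\<in>S. \<bar>f (fst i) (snd i) - h (fst i) (snd i)\<bar> <= L * d i" using L by blast
    then show ?thesis by (intro close_onI[where B="max M M'" and K=L] d0) (use M M' in \<open>auto simp: S_def le_max_iff_disj\<close>)
  qed
  have ly: "\<exists>L\<ge>0. \<forall>i\<in>S. \<bar>f (fst i) (snd i) - h (fst i) (snd i)\<bar> <= L * d i"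
    if l: "loc_lipschitz_Y f" "loc_lipschitz_Y h" and same: "\<And>X. same_vars cv dv X Y0 ==> f X Y0 = h X Y0" for f h
  proof -
    obtain L where L: "0 <= L" "\<forall>X Y1 Y2. inbox r X Y1 --> inbox r X Y2 --> \<bar>f X Y2 - f X Y1\<bar> <= L * \<bar>Y2 - Y1\<bar>"
      using box_lipschitz_Y[OF g l(1)] by blast
    obtain L' where L': "0 <= L'" "\<forall>X Y1 Y2. inbox r X Y1 --> inbox r X Y2 --> \<bar>h X Y2 - h X Y1\<bar> <= L' * \<bar>Y2 - Y1\<bar>"
      using box_lipschitz_Y[OF g l(2)] by blast
    have "\<bar>f (fst i) (snd i) - h (fst i) (snd i)\<bar> <= (L + L') * d i" if i: "i \<in> S" for i
    proof -
      have b: "inbox r (fst i) (snd i)" "inbox r (fst i) Y0" using i good_box_pos[OF g] by (auto simp: S_def inbox_def)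
      have e: "f (fst i) Y0 = h (fst i) Y0" using same i by (simp add: S_def)
      have 1: "\<bar>f (fst i) (snd i) - f (fst i) Y0\<bar> <= L * \<bar>snd i - Y0\<bar>" using L(2) b by blast
      have 2: "\<bar>h (fst i) (snd i) - h (fst i) Y0\<bar> <= L' * \<bar>snd i - Y0\<bar>" using L'(2) b by blast
      have "\<bar>f (fst i) (snd i) - h (fst i) (snd i)\<bar> <= L * \<bar>snd i - Y0\<bar> + L' * \<bar>snd i - Y0\<bar>"
        using 1 2 e by linarith
      also have "\<dots> = (L + L') * \<bar>snd i - Y0\<bar>" by (simp add: distrib_right)
      also have "\<dots> <= (L + L') * d i" using L(1) L'(1) by (intro mult_left_mono) (auto simp: d_def)
      finally show ?thesis .
    qed
    then show ?thesis using L(1) L'(1) by (intro exI[of _ "L + L'"]) simp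
  qed
  have lz: "\<exists>L\<ge>0. \<forall>i\<in>S. \<bar>cz cv (fst i) (snd i) - cz dv (fst i) (snd i)\<bar> <= L * d i"
    by (rule exI[of _ 1]) (simp add: d_def)
  have lu: "loc_lipschitz_Y (cu cv)" "loc_lipschitz_Y (cu dv)" by (rule A.lipY B.lipY; simp)+
  have lw: "loc_lipschitz_Y (cw cv)" "loc_lipschitz_Y (cw dv)" by (rule A.lipY B.lipY; simp)+
  have lp: "loc_lipschitz_Y (cp cv)" "loc_lipschitz_Y (cp dv)" by (rule A.lipY B.lipY; simp)+
  have sm: "same_vars cv dv X Y0 ==> cu cv X Y0 = cu dv X Y0" "same_vars cv dv X Y0 ==> cw cv X Y0 = cw dv X Y0"
    "same_vars cv dv X Y0 ==> cp cv X Y0 = cp dv X Y0" for X unfolding same_vars_def by blast+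
  note cc = cl[OF A.cont_vars(1) B.cont_vars(1) ly[OF lu sm(1)]] cl[OF A.cont_vars(2) B.cont_vars(2) ly[OF lw sm(2)]]
    cl[OF A.cont_vars(3) B.cont_vars(3) lz] cl[OF A.cont_vars(4) B.cont_vars(4) ly[OF lp sm(3)]]
  obtain K where K: "0 <= K" "\<And>i. i \<in> S ==> \<bar>rhs_z c cv (fst i) (snd i) - rhs_z c dv (fst i) (snd i)\<bar> <= K * d i"
    using close_onE[OF A.close_rhs(2)[OF d0 cc(1,2,3,4)]] by blast
  show ?thesis
  proof (intro exI[of _ K] conjI K(1) allI impI)
    fix X Y assume "inbox r X Y" "same_vars cv dv X Y0"
    then have "(X, Y) \<in> S" by (simp add: S_def)
    from K(2)[OF this] show "\<bar>rhs_z c cv X Y - rhs_z c dv X Y\<bar> <= K * (\<bar>cz cv X Y - cz dv X Y\<bar> + \<bar>Y - Y0\<bar>)"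
      by (simp add: d_def)
  qed
qed

text \<open>Taylor's formula at \<open>P\<close>, where the first derivative vanishes and the second is negative.\<close>

lemma w_line_quadratic:
  assumes g: "good_box r"
  obtains \<beta> B where "0 < \<beta>" "0 <= B" "\<And>X. \<bar>X - X0\<bar> <= r ==> cw cv X Y0 <= pi - \<beta> / 2 * (X - X0)\<^sup>2"
    "\<And>X. \<bar>X - X0\<bar> <= r ==> pi - B / 2 * (X - X0)\<^sup>2 <= cw cv X Y0"
    "\<And>X. X0 <= X ==> X <= X0 + r ==> dX (cw cv) X Y0 <= - \<beta> * (X - X0)"
proof -
  have "continuous_on UNIV (\<lambda>(X, Y). dX (dX (cw cv)) X Y)"
    by (rule smooth_on_imp_continuous[OF smooth_on_partials(4)[OF smooth_on_partials(4)[OF smooth_vars(2)]]])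
  then have c: "continuous_on half_plane (\<lambda>(X, Y). dX (dX (cw cv)) X Y)" by (rule continuous_on_subset) simp
  have c': "continuous_on half_plane (\<lambda>(X, Y). - dX (dX (cw cv)) X Y)"
    using continuous_on_minus[OF c] by (simp add: split_def)
  obtain \<beta> where \<beta>: "0 < \<beta>" "\<forall>X Y. inbox r X Y --> \<beta> <= - dX (dX (cw cv)) X Y"
    using box_lower[OF g c'] good_boxD(13)[OF g] by (metis neg_0_less_iff_less)
  obtain B where B: "0 <= B" "\<forall>X Y. inbox r X Y --> \<bar>dX (dX (cw cv)) X Y\<bar> <= B" using box_bounded[OF g c] by blast
  have b: "- B <= dX (dX (cw cv)) X Y0 \<and> dX (dX (cw cv)) X Y0 <= - \<beta>" if "\<bar>X - X0\<bar> <= r" for X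
  proof -
    have i: "inbox r X Y0" using that good_box_pos[OF g] by (simp add: inbox_def)
    have "\<beta> <= - dX (dX (cw cv)) X Y0" "\<bar>dX (dX (cw cv)) X Y0\<bar> <= B" using \<beta>(2) B(2) i by blast+
    then show ?thesis by (simp add: abs_le_iff)
  qed
  note so = second_order_bounds[where f="\<lambda>X. cw cv X Y0" and f'="\<lambda>X. dX (cw cv) X Y0" and f''="\<lambda>X. dX (dX (cw cv)) X Y0" and
      ?x0.0=X0 and r=r, OF wX_derivs wX_P b, unfolded w_P]
  show thesis
  proof (rule that[OF \<beta>(1) B(1)])
    show "dX (cw cv) X Y0 <= - \<beta> * (X - X0)" if "X0 <= X" "X <= X0 + r" for X by (rule so(3)) (use that in auto)
  qed (use so(1,2) in auto)
qed

text \<open>To the right of \<open>P\<close> the angle \<open>w\<close> is decreasing in \<open>X\<close> on the line \<open>Y = Y0\<close>, with a slope proportional to \<open>X - X0\<close>. While contact is not reached at \<open>X1\<close>, \<open>w\<close> grows there at a positive rate, so only heights with \<open>Y - Y0 = O((X1 - X0)^2)\<close> occur; over so short an interval the differences of \<open>w\<close> between \<open>X1\<close> and points to the right remain negative. So these points are not in contact either.\<close>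

lemma contact_slices_are_intervals:
  assumes g: "good_box r"
  obtains a1 where "0 < a1" "a1 <= r" "\<And>a \<eta> X1 X2 Y. a <= a1 ==> regime r a \<eta> ==> X0 <= X1 ==> X1 <= X2 ==> X2 < X0 + a ==>
     Y0 < Y ==> Y <= Y0 + r ==> ct dv X2 Y < t0 + \<eta> ==> cw dv X2 Y = pi ==> cw dv X1 Y = pi"
proof -
  obtain C where C: "0 <= C" "\<forall>X1 X2 Y. inbox r X1 Y --> inbox r X2 Y -->
     \<bar>rhs_w c dv X2 Y - rhs_w c dv X1 Y\<bar> <= C * (\<bar>X2 - X1\<bar> + \<bar>cw dv X2 Y - cw dv X1 Y\<bar>)"
    using rhs_w_tau_lipschitz_X[OF g] by blast
  obtain m where m: "0 < m" "\<forall>X Y. inbox r X Y --> m <= rhs_w c dv X Y"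
    using box_lower[OF g B.cont_rhs(3)] rhs_signs_box(2)[OF g] by blast
  obtain \<beta> B where \<beta>: "0 < \<beta>" and B: "0 <= B"
    and lo: "\<And>X. \<bar>X - X0\<bar> <= r ==> pi - B / 2 * (X - X0)\<^sup>2 <= cw cv X Y0"
    and dw: "\<And>X. X0 <= X ==> X <= X0 + r ==> dX (cw cv) X Y0 <= - \<beta> * (X - X0)"
    using w_line_quadratic[OF g] by metis
  define G where "G = B / (2 * m)"
  have G: "0 <= G" using B m(1) by (simp add: G_def)
  \<comment> \<open>The last two bounds serve for heights with \<open>Y - Y0 <= G h^2\<close>, where \<open>h <= a1\<close>: they keep \<open>C (Y - Y0)\<close> below a quarter of \<open>\<beta> h\<close> and of \<open>1\<close>.\<close>
  define a1 where "a1 = Min {r, 1, \<beta> / (4 * (C * G + 1)), 1 / (4 * (C * G + 1))}"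
  have CG: "0 <= C * G" using C(1) G by simp
  have a1: "0 < a1" "a1 <= r" "a1 <= 1" "a1 <= \<beta> / (4 * (C * G + 1))" "a1 <= 1 / (4 * (C * G + 1))"
    using good_box_pos[OF g] \<beta> CG by (auto simp: a1_def add_nonneg_pos)
  have a1': "(C * G) * a1 <= \<beta> / 4" "(C * G) * a1 <= 1 / 4"
  proof -
    have p: "0 < 4 * (C * G + 1)" using CG by simp
    have "a1 * (4 * (C * G + 1)) <= \<beta>" "a1 * (4 * (C * G + 1)) <= 1"
      using a1(4,5) p by (simp_all add: pos_le_divide_eq)
    moreover have "a1 * (4 * (C * G + 1)) = 4 * ((C * G) * a1) + 4 * a1" by (simp add: algebra_simps)
    ultimately show "(C * G) * a1 <= \<beta> / 4" "(C * G) * a1 <= 1 / 4" using a1(1) by simp_all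
  qed
  show thesis
  proof (rule that[OF a1(1,2)])
    fix a \<eta> X1 X2 Y
    assume a: "a <= a1" and R: "regime r a \<eta>" and X: "X0 <= X1" "X1 <= X2" "X2 < X0 + a"
      and Y: "Y0 < Y" "Y <= Y0 + r" and t: "ct dv X2 Y < t0 + \<eta>" and w: "cw dv X2 Y = pi"
    have ib: "inbox r x y" if "X0 <= x" "x <= X2" "Y0 <= y" "y <= Y" for x y
      using that X Y regimeD(3)[OF R] unfolding inbox_def by (auto simp: abs_le_iff)
    have live: "ct dv x y < t0 + \<eta>" if "X0 <= x" "x <= X2" "Y0 <= y" "y <= Y" for x y
    proof -
      have "ct dv x y <= ct dv x Y" by (rule B.mono_Y(2)) (use good_boxD(2)[OF g ib[OF that]] that in auto)
      also have "\<dots> <= ct dv X2 Y" by (rule B.mono_X(2)) (use good_boxD(2)[OF g ib[of x Y]] that Y in auto)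
      finally show ?thesis using t by simp
    qed
    have same: "same_vars cv dv x Y0" if "X0 <= x" "x <= X2" for x
      by (rule tau_in_E(2)[OF R good_boxD(2)[OF g ib]]) (use that Y live[of x Y0] in \<open>auto simp: in_E_def\<close>)
    have le: "cw dv x y <= pi" if "X0 <= x" "x <= X2" "Y0 <= y" "y <= Y" for x y
      by (rule w_tau_le_pi_right[OF R ib[OF that] that(1,3) live[OF that]])
    have gap: "cw dv x2 Y - cw dv x1 Y <= - (\<beta> * (x1 - X0) * (x2 - x1)) / 2"
      if x: "X0 < x1" "x1 < x2" "x2 <= X2" and g1: "good_X x1" and g2: "good_X x2" and lt: "cw dv x1 Y < pi" for x1 x2
    proof -
      have i1: "inbox r x1 y" "inbox r x2 y" if "Y0 <= y" "y <= Y" for y using ib x that by auto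
      have hp: "0 < x1 + Y0" "0 < x2 + Y0" using good_boxD(1)[OF g i1(1)] good_boxD(1)[OF g i1(2)] Y by auto
      have Yle: "Y0 <= Y" using Y by simp
      have lty: "cw dv x1 y < pi" if y: "Y0 <= y" "y <= Y" for y
      proof (rule ccontr)
        assume "\<not> cw dv x1 y < pi"
        then have "cw dv x1 y = pi" using le[of x1 y] x y by simp
        then show False using w_tau_persists[OF g i1(1)[OF y] i1(1)[OF Yle order_refl] y(2) g1] lt by simp
      qed
      obtain L1 where L1: "L1-lipschitz_on {Y0..Y} (\<lambda>Y. cw dv x1 Y)" using tau_w_line[of x1 Y0 Y] hp by auto
      obtain L2 where L2: "L2-lipschitz_on {Y0..Y} (\<lambda>Y. cw dv x2 Y)" using tau_w_line[of x2 Y0 Y] hp by auto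
      have "- cw dv x1 Y - - cw dv x1 Y0 <= - m * (Y - Y0)"
      proof (rule lipschitz_AE_deriv_le[where f="\<lambda>Y. - cw dv x1 Y", OF Yle])
        show "L1-lipschitz_on {Y0..Y} (\<lambda>Y. - cw dv x1 Y)" using L1 by simp
        show "AE y in lborel. Y0 < y \<and> y < Y --> (\<exists>d. ((\<lambda>Y. - cw dv x1 Y) has_real_derivative d) (at y) \<and> d <= - m)"
          using good_X_deriv[OF g1]
        proof eventually_elim
          case (elim y)
          show ?case
          proof
            assume y: "Y0 < y \<and> y < Y"
            then have b: "inbox r x1 y" using i1 by auto
            have th: "dissipative_theta dv x1 y = 1" by (rule theta_box(1)[OF g b]) (use lty y in auto)
            have "0 < x1 + y" by (rule good_boxD(1)[OF g b])
            with elim have "((\<lambda>Y. cw dv x1 Y) has_real_derivative rhs_w c dv x1 y) (at y)" unfolding th by simp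
            then have "((\<lambda>Y. - cw dv x1 Y) has_real_derivative - rhs_w c dv x1 y) (at y)" by (rule DERIV_minus)
            moreover have "- rhs_w c dv x1 y <= - m" using m(2) b by simp
            ultimately show "\<exists>d. ((\<lambda>Y. - cw dv x1 Y) has_real_derivative d) (at y) \<and> d <= - m" by blast
          qed
        qed
      qed
      moreover have "cw dv x1 Y0 = cw cv x1 Y0" "cw dv x2 Y0 = cw cv x2 Y0"
        using same[of x1] same[of x2] x unfolding same_vars_def by auto
      moreover have xr: "\<bar>x1 - X0\<bar> <= r" "x1 - X0 < a" using x X(3) regimeD(3)[OF R] by (auto simp: abs_le_iff)
      moreover note lo[OF xr(1)]
      ultimately have mL: "m * (Y - Y0) <= B / 2 * (x1 - X0)\<^sup>2" using lt by simp
      have YG: "Y - Y0 <= G * (x1 - X0)\<^sup>2"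
      proof -
        have "m * (G * (x1 - X0)\<^sup>2) = B / 2 * (x1 - X0)\<^sup>2" using m(1) by (simp add: G_def)
        then show ?thesis using mL m(1) by (metis mult_le_cancel_left_pos)
      qed
      define h where "h = x1 - X0"
      have h: "0 < h" "h <= a1" "h <= 1" using x xr(2) a a1(3) by (auto simp: h_def)
      define K where "K = \<beta> * h * (x2 - x1)"
      have K: "0 < K" using \<beta> h x by (simp add: K_def)
      have CL: "C * (Y - Y0) <= (C * G * a1) * h"
      proof -
        have "C * (Y - Y0) <= C * (G * (h * h))" using YG C(1) by (intro mult_left_mono) (simp_all add: h_def power2_eq_square)
        also have "\<dots> = (C * G) * (h * h)" by simp
        also have "\<dots> <= (C * G) * (a1 * h)" using CG h by (intro mult_left_mono mult_right_mono) auto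
        finally show ?thesis by (simp add: mult.assoc)
      qed
      have CL1: "C * (Y - Y0) <= \<beta> / 4 * h" "C * (Y - Y0) <= 1 / 4"
      proof -
        have "(C * G * a1) * h <= \<beta> / 4 * h" using a1'(1) h by (intro mult_right_mono) auto
        then show "C * (Y - Y0) <= \<beta> / 4 * h" using CL by linarith
        have "(C * G * a1) * h <= 1 / 4 * 1" using a1'(2) h CG a1(1) by (intro mult_mono) auto
        then show "C * (Y - Y0) <= 1 / 4" using CL by linarith
      qed
      have "cw dv x2 Y - cw dv x1 Y <= - K / 2"
      proof (rule lipschitz_gronwall_neg[where f="\<lambda>Y. cw dv x2 Y - cw dv x1 Y" and C=C and D="C * (x2 - x1)", OF Yle lipschitz_on_diff[OF L2 L1] _ K C(1)])
        show "0 <= C * (x2 - x1)" using C(1) x by simp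
        show "cw dv x2 Y0 - cw dv x1 Y0 <= - K"
        proof -
          obtain \<xi> where \<xi>: "x1 < \<xi>" "\<xi> < x2" "cw cv x2 Y0 - cw cv x1 Y0 = (x2 - x1) * dX (cw cv) \<xi> Y0"
            using MVT2[OF x(2), of "\<lambda>X. cw cv X Y0" "\<lambda>X. dX (cw cv) X Y0"] wX_derivs(1) by blast
          have "dX (cw cv) \<xi> Y0 <= - \<beta> * (\<xi> - X0)" by (rule dw) (use \<xi> x X regimeD(3)[OF R] in auto)
          also have "\<dots> <= - \<beta> * h" using \<xi> \<beta> by (simp add: h_def)
          finally have "(x2 - x1) * dX (cw cv) \<xi> Y0 <= (x2 - x1) * (- \<beta> * h)" using x by (intro mult_left_mono) auto
          moreover have "(x2 - x1) * (- \<beta> * h) = - K" by (simp add: K_def)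
          moreover have "cw dv x1 Y0 = cw cv x1 Y0" "cw dv x2 Y0 = cw cv x2 Y0"
            using same[of x1] same[of x2] x unfolding same_vars_def by auto
          ultimately show ?thesis using \<xi>(3) by simp
        qed
        show "(C * K + C * (x2 - x1)) * (Y - Y0) <= K / 2"
        proof -
          have "K * (C * (Y - Y0)) <= K * (1 / 4)" using CL1(2) K by (intro mult_left_mono) auto
          moreover have "(x2 - x1) * (C * (Y - Y0)) <= (x2 - x1) * (\<beta> / 4 * h)" using CL1(1) x by (intro mult_left_mono) auto
          moreover have "(x2 - x1) * (\<beta> / 4 * h) = K / 4" by (simp add: K_def)
          moreover have "(C * K + C * (x2 - x1)) * (Y - Y0) = K * (C * (Y - Y0)) + (x2 - x1) * (C * (Y - Y0))" by (simp add: algebra_simps)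
          ultimately show ?thesis by linarith
        qed
        show "AE y in lborel. Y0 < y \<and> y < Y --> (\<exists>d. ((\<lambda>Y. cw dv x2 Y - cw dv x1 Y) has_real_derivative d) (at y) \<and>
            d <= C * \<bar>cw dv x2 y - cw dv x1 y\<bar> + C * (x2 - x1))"
          using good_X_deriv[OF g1] good_X_deriv[OF g2]
        proof eventually_elim
          case (elim y)
          show ?case
          proof
            assume y: "Y0 < y \<and> y < Y"
            then have b: "inbox r x1 y" "inbox r x2 y" using i1 by auto
            have th: "dissipative_theta dv x1 y = 1" by (rule theta_box(1)[OF g b(1)]) (use lty y in auto)
            have d1: "((\<lambda>Y. cw dv x1 Y) has_real_derivative rhs_w c dv x1 y) (at y)"
              using elim(1) good_boxD(1)[OF g b(1)] th by simp
            have d2: "((\<lambda>Y. cw dv x2 Y) has_real_derivative dissipative_theta dv x2 y * rhs_w c dv x2 y) (at y)"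
              using elim(2) good_boxD(1)[OF g b(2)] by simp
            have "dissipative_theta dv x2 y * rhs_w c dv x2 y <= rhs_w c dv x2 y"
              using B.theta[of x2 y] rhs_signs_box(2)[OF g b(2)] by auto
            moreover have "rhs_w c dv x2 y - rhs_w c dv x1 y <= C * (\<bar>x2 - x1\<bar> + \<bar>cw dv x2 y - cw dv x1 y\<bar>)"
              using C(2) b by (meson abs_le_D1)
            moreover have "C * (\<bar>x2 - x1\<bar> + \<bar>cw dv x2 y - cw dv x1 y\<bar>) = C * \<bar>cw dv x2 y - cw dv x1 y\<bar> + C * (x2 - x1)"
              using x by (simp add: algebra_simps)
            ultimately have "dissipative_theta dv x2 y * rhs_w c dv x2 y - rhs_w c dv x1 y <= C * \<bar>cw dv x2 y - cw dv x1 y\<bar> + C * (x2 - x1)"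
              by linarith
            then show "\<exists>d. ((\<lambda>Y. cw dv x2 Y - cw dv x1 Y) has_real_derivative d) (at y) \<and>
              d <= C * \<bar>cw dv x2 y - cw dv x1 y\<bar> + C * (x2 - x1)" using DERIV_diff[OF d2 d1] by blast
          qed
        qed
      qed
      then show ?thesis by (simp add: K_def h_def)
    qed
    show "cw dv X1 Y = pi"
    proof (rule ccontr)
      assume "cw dv X1 Y \<noteq> pi"
      then have lt: "cw dv X1 Y < pi" using le[of X1 Y] X Y by simp
      have "X1 \<noteq> X0"
      proof
        assume e: "X1 = X0"
        have "pi <= cw cv X0 Y" using w_on_axis[OF g _ Y(1)] Y by simp
        then have "cw dv X0 Y = pi"
          by (intro w_tau_behind_curve[OF R ib[of X0 Y]]) (use X Y regimeD(2)[OF R] live[of X0 Y] in auto)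
        then show False using lt e by simp
      qed
      then have X1: "X0 < X1" using X by simp
      have X12: "X1 < X2" using lt w X(2) by (cases "X1 = X2") auto
      have hp1: "0 < X1 + Y" by (rule good_boxD(1)[OF g ib]) (use X Y in auto)
      obtain d where d: "0 < d" "\<And>X' Y'. \<bar>X' - X1\<bar> <= d ==> \<bar>Y' - Y\<bar> <= d ==> 0 < X' + Y' \<and> \<bar>cw dv X' Y' - cw dv X1 Y\<bar> <= (pi - cw dv X1 Y) / 2"
        using continuous_half_plane_box[OF B.cont_vars(2) hp1, of "(pi - cw dv X1 Y) / 2"] lt by auto
      obtain h where h: "0 < h" "h < d" "h < X1 - X0" "h < X2 - X1" using ex_less_four[of d "X1 - X0" "X2 - X1" d] d(1) X1 X12 by auto
      have ex_good: "\<exists>x. u < x \<and> x < v \<and> good_X x" if "u < v" for u v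
      proof (rule ccontr)
        assume n: "\<not> (\<exists>x. u < x \<and> x < v \<and> good_X x)"
        have "(1::real) <= 0"
          by (rule AE_imp_le_continuous[OF that, of "\<lambda>_. 1" u]) (use that n in \<open>auto intro!: eventually_mono[OF AE_good_X]\<close>)
        then show False by simp
      qed
      obtain x1 where x1: "X1 - h < x1" "x1 < X1" "good_X x1" using ex_good[of "X1 - h" X1] h(1) by auto
      have "\<bar>cw dv x1 Y - cw dv X1 Y\<bar> <= (pi - cw dv X1 Y) / 2" using d(2)[of x1 Y] x1 h d(1) by simp
      moreover have "u < s" if "\<bar>u - v\<bar> <= (s - v) / 2" "v < s" for s u v :: real
        using abs_le_D1[OF that(1)] that(2) by (simp add: field_simps)
      ultimately have lt1: "cw dv x1 Y < pi" using lt by blast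
      have x10: "X0 < x1" "x1 < X2" using x1 h X12 by auto
      have "cw dv X2 Y - cw dv x1 Y + (\<beta> * (x1 - X0) * (X2 - x1)) / 2 <= 0"
      proof (rule AE_imp_le_continuous[OF x10(2), where F="\<lambda>x2. cw dv x2 Y - cw dv x1 Y + (\<beta> * (x1 - X0) * (x2 - x1)) / 2"])
        have "0 <= x1 + Y" by (rule good_boxD(2)[OF g ib]) (use x10 Y in auto)
        then show "continuous_on {x1..X2} (\<lambda>x2. cw dv x2 Y - cw dv x1 Y + (\<beta> * (x1 - X0) * (x2 - x1)) / 2)"
          by (intro continuous_intros continuous_on_half_plane_line[OF B.cont_vars(2)]) auto
        show "AE x2 in lborel. x1 < x2 \<and> x2 < X2 --> cw dv x2 Y - cw dv x1 Y + (\<beta> * (x1 - X0) * (x2 - x1)) / 2 <= 0"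
          using AE_good_X
        proof eventually_elim
          case (elim x2)
          show ?case
          proof
            assume "x1 < x2 \<and> x2 < X2"
            then show "cw dv x2 Y - cw dv x1 Y + (\<beta> * (x1 - X0) * (x2 - x1)) / 2 <= 0"
              using gap[OF x10(1) _ _ x1(3) elim lt1] by simp
          qed
        qed
      qed (use x10 in auto)
      moreover have "0 < \<beta> * (x1 - X0) * (X2 - x1)" using \<beta> x10 by simp
      ultimately have "cw dv X2 Y < cw dv x1 Y" by simp
      then show False using w lt1 by simp
    qed
  qed
qed

end

section \<open>The singularity of the dissipative solution on the left branch\<close>

context char_sol
begin

lemma constant_along_contact:
  assumes hp: "0 <= X1 + Y" and X12: "X1 <= X2" and w: "\<And>\<xi>. X1 <= \<xi> ==> \<xi> <= X2 ==> cw sv \<xi> Y = pi"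
  shows "cx sv X2 Y = cx sv X1 Y" "ct sv X2 Y = ct sv X1 Y"
proof -
  have d: "((\<lambda>X. cx sv X Y) has_real_derivative 0) (at \<xi>)" "((\<lambda>X. ct sv X Y) has_real_derivative 0) (at \<xi>)"
    if "X1 < \<xi>" "\<xi> < X2" for \<xi>
    using C1(3,5)[of \<xi> Y] w[of \<xi>] that hp unfolding has_dX_def rhs_xX_def rhs_tX_def by simp_all
  have c: "continuous_on {X1..X2} (\<lambda>X. cx sv X Y)" "continuous_on {X1..X2} (\<lambda>X. ct sv X Y)"
    by (rule continuous_on_half_plane_line[OF cont_vars(6) hp] continuous_on_half_plane_line[OF cont_vars(7) hp])+
  have "cx sv X2 Y = cx sv X1 Y \<and> ct sv X2 Y = ct sv X1 Y"
  proof (cases "X1 = X2")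
    case False
    then have lt: "X1 < X2" using X12 by simp
    show ?thesis
      using DERIV_isconst2[of X1 X2 "\<lambda>X. cx sv X Y" X2, OF lt c(1) d(1)]
        DERIV_isconst2[of X1 X2 "\<lambda>X. ct sv X Y" X2, OF lt c(2) d(2)] lt by simp
  qed simp
  then show "cx sv X2 Y = cx sv X1 Y" "ct sv X2 Y = ct sv X1 Y" by blast+
qed

end

context singular_origin
begin

text \<open>At the left edge of the window \<open>w\<close> is below \<open>\<pi>\<close>; the intermediate value theorem gives a point of the left branch at the same height.\<close>

lemma left_end_of_contact:
  assumes R: "regime r a \<eta>" and Y: "Y0 < Y" "Y <= Y0 + r" and X: "X0 - a < X" "X <= X0"
    and t: "ct dv X Y < t0 + \<eta>" and w: "pi <= cw cv X Y"
  obtains X' where "X0 - a < X'" "X' <= X" "X' < X0" "cw cv X' Y = pi" "same_vars cv dv X' Y"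
    "\<And>\<xi>. X' <= \<xi> ==> \<xi> <= X ==> cw dv \<xi> Y = pi" "\<And>\<xi>. X' < \<xi> ==> \<xi> <= X0 ==> pi < cw cv \<xi> Y"
proof -
  note g = regimeD(1)[OF R] and ra = regimeD(2,3)[OF R]
  have ib: "inbox r \<xi> Y" if "X0 - a <= \<xi>" "\<xi> <= X0" for \<xi>
    using that ra Y unfolding inbox_def by (auto simp: abs_le_iff)
  have hp: "0 <= \<xi> + Y" if "X0 - a <= \<xi>" "\<xi> <= X0" for \<xi> by (rule good_boxD(2)[OF g ib[OF that]])
  have live: "ct dv \<xi> Y < t0 + \<eta>" if "X0 - a <= \<xi>" "\<xi> <= X" for \<xi>
  proof -
    have "ct dv \<xi> Y <= ct dv X Y" by (rule B.mono_X(2)) (use hp that X in auto)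
    then show ?thesis using t by simp
  qed
  have lt: "cw cv (X0 - a) Y < pi"
  proof -
    have h: "0 <= (X0 - a) + Y" using hp[of "X0 - a"] ra by simp
    have s: "ct cv (X0 - a) Y < t0 + \<eta>"
      by (rule tau_in_E(1)[OF R h]) (use live[of "X0 - a"] X in \<open>auto simp: in_E_def\<close>)
    have "nonsing (X0 - a) Y'" if Y': "- (X0 - a) <= Y'" "Y' <= Y" for Y'
    proof (rule ccontr)
      assume n: "\<not> nonsing (X0 - a) Y'"
      have h': "0 <= (X0 - a) + Y'" using Y' by simp
      have "ct cv (X0 - a) Y' <= ct cv (X0 - a) Y" by (rule A.mono_Y(2)[OF h' Y'(2)])
      then have "\<bar>X0 - a - X0\<bar> < a" using separatedD(3)[OF regimeD(4)[OF R] h' _ n] s by simp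
      then show False by simp
    qed
    then show ?thesis using angles_if_nonsing(1)[OF h] by blast
  qed
  have "continuous_on {X0 - a..X} (\<lambda>X. cw cv X Y)"
    by (rule continuous_on_half_plane_line[OF A.cont_vars(2)]) (use hp[of "X0 - a"] ra in simp)
  then obtain X' where X': "X0 - a <= X'" "X' <= X" "cw cv X' Y = pi"
    using IVT'[of "\<lambda>X. cw cv X Y" "X0 - a" pi X] lt w X by auto
  have ax: "pi < cw cv X0 Y" using w_on_axis[OF g _ Y(1)] Y by simp
  have l: "X0 - a < X'" using X'(1,3) lt by (cases "X' = X0 - a") auto
  have r: "X' < X0" using X'(2,3) X ax by (cases "X' = X0") auto
  have i': "inbox r X' Y" by (rule ib) (use l r in auto)
  have bt: "pi < cw cv \<xi> Y" if "X' < \<xi>" "\<xi> <= X0" for \<xi>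
    using w_between[OF g i' Y(1), of \<xi>] X'(3) that by simp
  have ct: "cw dv \<xi> Y = pi" if "X' <= \<xi>" "\<xi> <= X" for \<xi>
  proof (rule w_tau_behind_curve[OF R])
    show "pi <= cw cv \<xi> Y" using bt[of \<xi>] X'(3) that X by (cases "\<xi> = X'") auto
  qed (use that X l ib live in auto)
  have sm: "same_vars cv dv X' Y"
    by (rule tau_in_E(2)[OF R hp]) (use l r X' i' live in \<open>auto simp: in_E_def\<close>)
  show thesis by (rule that[OF l X'(2) r X'(3) sm ct bt])
qed

lemma tau_late_at_right_end:
  assumes R: "regime r a \<eta>" and Y: "Y0 <= Y"
  shows "t0 + \<eta> <= ct dv (X0 + a) Y"
proof (rule ccontr)
  assume n: "\<not> t0 + \<eta> <= ct dv (X0 + a) Y"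
  have hp: "0 <= (X0 + a) + Y0" using P_interior regimeD(2)[OF R] by simp
  have "ct dv (X0 + a) Y0 <= ct dv (X0 + a) Y" by (rule B.mono_Y(2)[OF hp Y])
  then have "ct cv (X0 + a) Y0 < t0 + \<eta>" by (intro tau_in_E(1)[OF R hp]) (use n in \<open>auto simp: in_E_def\<close>)
  then show False using regimeD(5)[OF R] by simp
qed

text \<open>The contact interval is collapsed to the image of its left end, which is a point of the left branch, where the solutions agree.\<close>

lemma contact_points_on_gamma_m:
  assumes R: "regime r a \<eta>"
    and ivl: "\<And>X1 X2 Y. X0 <= X1 ==> X1 <= X2 ==> X2 < X0 + a ==>
     Y0 < Y ==> Y <= Y0 + r ==> ct dv X2 Y < t0 + \<eta> ==> cw dv X2 Y = pi ==> cw dv X1 Y = pi"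
    and X: "X0 - a < X" "X < X0 + a" and Y: "Y0 < Y" "Y <= Y0 + r" and t: "ct dv X Y < t0 + \<eta>" and w: "cw dv X Y = pi"
  shows "cx dv X Y = \<gamma>m (ct dv X Y)"
proof -
  note g = regimeD(1)[OF R] and ra = regimeD(2,3)[OF R]
  define A where "A = min X X0"
  have A: "X0 - a < A" "A <= X0" "A <= X" using X ra by (auto simp: A_def)
  have ibA: "inbox r A Y" using A ra Y unfolding inbox_def by (auto simp: abs_le_iff)
  have "ct dv A Y <= ct dv X Y" by (rule B.mono_X(2)[OF good_boxD(2)[OF g ibA] A(3)])
  then have tA: "ct dv A Y < t0 + \<eta>" using t by simp
  have wA: "pi <= cw cv A Y"
  proof (rule ccontr)
    assume n: "\<not> pi <= cw cv A Y"
    then have "A \<noteq> X0" using w_on_axis[OF g _ Y(1)] Y by auto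
    then have AX: "A = X" unfolding A_def by auto
    have "same_vars cv dv A Y"
      by (rule tau_in_E(2)[OF R good_boxD(2)[OF g ibA] _ tA]) (use A ibA n in \<open>auto simp: in_E_def\<close>)
    then show False using n w unfolding same_vars_def AX by simp
  qed
  show ?thesis
  proof (rule left_end_of_contact[OF R Y A(1,2) tA wA])
    fix X' assume X': "X0 - a < X'" "X' <= A" "X' < X0" "cw cv X' Y = pi" "same_vars cv dv X' Y"
    "\<And>\<xi>. X' <= \<xi> ==> \<xi> <= A ==> cw dv \<xi> Y = pi"
    have "inbox r X' Y" using X'(1,3) ra Y unfolding inbox_def by (auto simp: abs_le_iff)
    then have hp: "0 <= X' + Y" by (rule good_boxD(2)[OF g])
    have seg: "cw dv \<xi> Y = pi" if "X' <= \<xi>" "\<xi> <= X" for \<xi>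
    proof (cases "\<xi> <= A")
      case True then show ?thesis using X'(6) that by blast
    next
      case False
      then have "X0 <= \<xi>" using that(2) unfolding A_def by auto
      then show ?thesis using ivl[of \<xi> X Y] that(2) X(2) Y t w by blast
    qed
    have XX: "X' <= X" using X'(2) A(3) by simp
    note e = B.constant_along_contact[OF hp XX seg]
    have s: "cx dv X' Y = cx cv X' Y" "ct dv X' Y = ct cv X' Y" using X'(5) unfolding same_vars_def by auto
    have "\<not> nonsing X' Y" using X'(4) by (simp add: nonsing_def)
    moreover have "ct cv X' Y <= t0 + \<eta>" using e(2) s(2) t by simp
    ultimately have "cx cv X' Y = \<gamma>m (ct cv X' Y)" using separatedD(3)[OF regimeD(4)[OF R] hp] X'(3) by blast
    then show ?thesis using e s by simp
  qed
qed

text \<open>A point of \<open>\<gamma>\<^sup>-\<close> is the image of a whole contact segment, which begins on the left branch and may extend beyond the axis \<open>X = X0\<close>.\<close>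

lemma dissipative_strong_singularity:
  assumes R: "regime r a \<eta>"
    and ivl: "\<And>X1 X2 Y. X0 <= X1 ==> X1 <= X2 ==> X2 < X0 + a ==>
     Y0 < Y ==> Y <= Y0 + r ==> ct dv X2 Y < t0 + \<eta> ==> cw dv X2 Y = pi ==> cw dv X1 Y = pi"
    and t: "t0 < t" "t < t0 + \<eta>"
  shows "strong_singularity (\<lambda>x. udiss x t) (\<gamma>m t)"
proof -
  note g = regimeD(1)[OF R] and ra = regimeD(2,3)[OF R]
  obtain XQ YQ where Q: "X0 - a < XQ" "XQ < X0" "\<bar>YQ - Y0\<bar> < a" "cw cv XQ YQ = pi" "ct cv XQ YQ = t" "cx cv XQ YQ = \<gamma>m t"
    using separatedD(4)[OF regimeD(4)[OF R] t(1)] t(2) by auto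
  have ib: "inbox r X YQ" if "X0 - a <= X" "X <= X0 + a" for X
    using that Q(3) ra unfolding inbox_def by (auto simp: abs_le_iff abs_less_iff)
  have iQ: "inbox r XQ YQ" by (rule ib) (use Q ra in auto)
  have Yg: "Y0 < YQ" by (rule w_pi_above(2)[OF g iQ]) (use Q in auto)
  have sm: "same_vars cv dv XQ YQ"
    by (rule same_in_E[OF R good_boxD(2)[OF g iQ]]) (use Q t iQ in \<open>auto simp: in_E_def\<close>)
  then have tQ: "ct dv XQ YQ = t" "cx dv XQ YQ = \<gamma>m t" "cw dv XQ YQ = pi" using Q unfolding same_vars_def by auto
  have hpQ: "0 < XQ + YQ" by (rule good_boxD(1)[OF g iQ])
  have cW: "continuous_on {XQ..X} (\<lambda>X. cw dv X YQ)" for X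
    by (rule continuous_on_half_plane_line[OF B.cont_vars(2)]) (use hpQ in simp)
  \<comment> \<open>The contact segment issuing from the curve point ends where \<open>w\<close> first leaves \<open>pi\<close> to the right.\<close>
  define N where "N = {X \<in> {XQ..X0 + a}. cw dv X YQ \<noteq> pi}"
  have N: "N \<noteq> {}"
  proof
    assume "N = {}"
    then have "ct dv (X0 + a) YQ = ct dv XQ YQ"
      by (intro B.constant_along_contact(2)) (use hpQ Q ra in \<open>auto simp: N_def\<close>)
    then show False using tau_late_at_right_end[OF R, of YQ] Yg tQ t by simp
  qed
  have bd: "bdd_below N" by (rule bdd_belowI[of _ XQ]) (simp add: N_def)
  define X2 where "X2 = Inf N"
  have X2: "XQ <= X2" unfolding X2_def by (rule cInf_greatest[OF N]) (simp add: N_def)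
  have op: "cw dv \<xi> YQ = pi" if "XQ <= \<xi>" "\<xi> < X2" for \<xi>
  proof (rule ccontr)
    assume n: "cw dv \<xi> YQ \<noteq> pi"
    have "X2 <= X0 + a" using N cInf_lower[OF _ bd] unfolding X2_def N_def by fastforce
    then have "\<xi> \<in> N" using n that unfolding N_def by auto
    then show False using cInf_lower[OF _ bd, of \<xi>] that(2) unfolding X2_def by simp
  qed
  have wX2: "cw dv X2 YQ = pi"
  proof (cases "X2 = XQ")
    case False
    then have lt: "XQ < X2" using X2 by simp
    have "cw dv X2 YQ - pi <= 0"
      by (rule AE_imp_le_continuous[OF lt]) (use op lt in \<open>auto intro!: continuous_intros cW AE_I2\<close>)
    moreover have "pi - cw dv X2 YQ <= 0"
      by (rule AE_imp_le_continuous[OF lt]) (use op lt in \<open>auto intro!: continuous_intros cW AE_I2\<close>)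
    ultimately show ?thesis by simp
  qed (simp add: tQ)
  have seg: "cw dv \<xi> YQ = pi" if "XQ <= \<xi>" "\<xi> <= X2" for \<xi> using op[of \<xi>] wX2 that by (cases "\<xi> = X2") auto
  have right: "\<exists>\<xi>>X2. \<xi> < X2 + s \<and> \<xi> <= X0 + a \<and> cw dv \<xi> YQ \<noteq> pi" if s: "0 < s" for s
  proof -
    obtain \<xi> where \<xi>: "\<xi> \<in> N" "\<xi> < X2 + s" using cInf_lessD[OF N, of "X2 + s"] s unfolding X2_def by auto
    have "X2 <= \<xi>" using cInf_lower[OF \<xi>(1) bd] unfolding X2_def .
    then have "X2 < \<xi>" using \<xi>(1) wX2 unfolding N_def by (cases "\<xi> = X2") auto
    then show ?thesis using \<xi> unfolding N_def by auto
  qed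
  have X2a: "X2 < X0 + a" using right[of 1] by auto
  have eq: "cx dv X2 YQ = cx dv XQ YQ" "ct dv X2 YQ = ct dv XQ YQ"
    by (rule B.constant_along_contact[OF less_imp_le[OF hpQ] X2 seg]; simp)+
  obtain r1 where r1: "0 < r1" "r1 < XQ - (X0 - a)" "r1 < (X0 + a) - X2" "r1 < YQ - Y0" "r1 < Y0 + a - YQ"
  proof -
    obtain h where h: "0 < h" "h < XQ - (X0 - a)" "h < (X0 + a) - X2" "h < YQ - Y0" "h < Y0 + a - YQ"
      using ex_less_four[of "XQ - (X0 - a)" "(X0 + a) - X2" "YQ - Y0" "Y0 + a - YQ"] Q X2a Yg by (auto simp: abs_less_iff)
    then show thesis by (rule that)
  qed
  have ibr: "inbox r A B" if "XQ - r1 <= A" "A <= X2 + r1" "YQ - r1 <= B" "B <= YQ + r1" for A B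
    using that r1 ra unfolding inbox_def by (auto simp: abs_le_iff)
  have h0: "\<exists>h>0. h < s \<and> h < r1" if "0 < s" for s using ex_less_four[OF that r1(1) that that] by blast
  have cos_left: "\<exists>\<xi><XQ. XQ - s < \<xi> \<and> cos (cw dv \<xi> YQ) \<noteq> -1" if s: "0 < s" for s
  proof -
    obtain h where h: "0 < h" "h < s" "h < r1" using h0[OF s] by blast
    have i: "inbox r (XQ - h) YQ" by (rule ib) (use h r1 Q in auto)
    have w: "cw cv (XQ - h) YQ < pi"
    proof (rule ccontr)
      assume "\<not> cw cv (XQ - h) YQ < pi"
      then have "pi < cw cv XQ YQ" using w_between[OF g i Yg, of XQ] h Q by simp
      then show False using Q(4) by simp
    qed
    have "ct cv (XQ - h) YQ <= ct cv XQ YQ" by (rule A.mono_X(2)[OF good_boxD(2)[OF g i]]) (use h in simp)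
    then have "same_vars cv dv (XQ - h) YQ"
      by (intro same_in_E[OF R good_boxD(2)[OF g i]]) (use Q t i w h in \<open>auto simp: in_E_def\<close>)
    then have "cos (cw dv (XQ - h) YQ) \<noteq> -1" using w good_boxD(16)[OF g i] unfolding same_vars_def by auto
    then show ?thesis by (intro exI[of _ "XQ - h"]) (use h in auto)
  qed
  have cos_right: "\<exists>\<xi>>X2. \<xi> < X2 + s \<and> cos (cw dv \<xi> YQ) \<noteq> -1" if s: "0 < s" for s
  proof -
    obtain \<xi> where \<xi>: "X2 < \<xi>" "\<xi> < X2 + s" "\<xi> <= X0 + a" "cw dv \<xi> YQ \<noteq> pi" using right[OF s] by blast
    have "inbox r \<xi> YQ" by (rule ib) (use \<xi> X2 Q in auto)
    then have "cos (cw dv \<xi> YQ) \<noteq> -1" using good_boxD(16)[OF g] \<xi>(4) by blast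
    then show ?thesis using \<xi> by blast
  qed
  have up: "\<exists>\<xi>>YQ. \<xi> < YQ + s \<and> cos (cz dv XQ \<xi>) \<noteq> -1" if s: "0 < s" for s
  proof -
    obtain h where h: "0 < h" "h < s" "h < r1" using h0[OF s] by blast
    have "cos (cz dv XQ (YQ + h)) \<noteq> -1" by (rule good_boxD(18)[OF g ibr]) (use h X2 in auto)
    then show ?thesis by (intro exI[of _ "YQ + h"]) (use h in auto)
  qed
  have down: "\<exists>\<xi><YQ. YQ - s < \<xi> \<and> cos (cz dv X2 \<xi>) \<noteq> -1" if s: "0 < s" for s
  proof -
    obtain h where h: "0 < h" "h < s" "h < r1" using h0[OF s] by blast
    have "cos (cz dv X2 (YQ - h)) \<noteq> -1" by (rule good_boxD(18)[OF g ibr]) (use h X2 in auto)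
    then show ?thesis by (intro exI[of _ "YQ - h"]) (use h in auto)
  qed
  have loc: "\<exists>m>0. \<forall>A B. 0 <= A + B --> \<bar>cx dv A B - cx dv XQ YQ\<bar> < m --> \<bar>ct dv A B - ct dv XQ YQ\<bar> < m -->
       XQ - s < A \<and> A < X2 + s \<and> YQ - s < B \<and> B < YQ + s" if s: "0 < s" for s
  proof (rule B.localise[OF hpQ X2 eq cos_right cos_left up down s])
    fix m assume "0 < m" "\<And>A B. 0 <= A + B ==> \<bar>cx dv A B - cx dv XQ YQ\<bar> < m ==> \<bar>ct dv A B - ct dv XQ YQ\<bar> < m ==>
       XQ - s < A \<and> A < X2 + s \<and> YQ - s < B \<and> B < YQ + s"
    then show ?thesis by (intro exI[of _ m]) blast
  qed
  have "strong_singularity (\<lambda>x. udiss x (ct dv XQ YQ)) (cx dv XQ YQ)"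
  proof (rule B.strong_singularity_segment[OF _ X2 r1(1) _ loc])
    show "0 < ct dv XQ YQ" using tQ t t0_pos by simp
    show "0 < XQ - r1 + (YQ - r1)" by (rule good_boxD(1)[OF g ibr]) (use r1 X2 in auto)
    show "cos (cw dv \<xi> YQ) = -1" if "XQ <= \<xi>" "\<xi> <= X2" for \<xi> using seg[OF that] by simp
    show "cos (cz dv A B) \<noteq> -1" if "XQ - r1 <= A" "A <= X2 + r1" "YQ - r1 <= B" "B <= YQ + r1" for A B
      by (rule good_boxD(18)[OF g ibr[OF that]])
    show "cos (cw dv A B) \<noteq> -1"
      if a: "XQ - r1 < A" "A < X2 + r1" "YQ - r1 < B" "B < YQ + r1" "ct dv A B = ct dv XQ YQ" "cx dv A B \<noteq> cx dv XQ YQ" for A B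
    proof
      assume c: "cos (cw dv A B) = -1"
      have "inbox r A B" by (rule ibr) (use a in auto)
      then have w: "cw dv A B = pi" using good_boxD(16)[OF g] c by blast
      have "cx dv A B = \<gamma>m (ct dv A B)"
        by (rule contact_points_on_gamma_m[OF R ivl _ _ _ _ _ w]) (use a r1 ra t tQ in auto)
      then show False using a(5,6) tQ by simp
    qed
  qed
  then show ?thesis unfolding tQ .
qed

definition good_Y :: "real => bool" where
  "good_Y Y \<longleftrightarrow> (AE X in lborel. 0 < X + Y --> semilinear_system_at c (dissipative_theta dv X Y) dv X Y)"

lemma AE_good_Y: "AE Y in lborel. good_Y Y"
  unfolding good_Y_def by (rule B.sys_lines(2))

lemma z_difference_deriv:
  assumes "good_Y Y"
  shows "AE X in lborel. 0 < X + Y --> ((\<lambda>X. cz cv X Y - cz dv X Y) has_real_derivative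
     rhs_z c cv X Y - dissipative_theta dv X Y * rhs_z c dv X Y) (at X)"
  using assms unfolding good_Y_def
proof eventually_elim
  case (elim X)
  have "((\<lambda>X. cz cv X Y) has_real_derivative rhs_z c cv X Y) (at X)"
    using system_everywhere[of X Y] by (simp add: semilinear_system_at_iff has_dX_def)
  moreover have "((\<lambda>X. cz dv X Y) has_real_derivative dissipative_theta dv X Y * rhs_z c dv X Y) (at X)" if "0 < X + Y"
    using elim that by (simp add: semilinear_system_at_iff has_dX_def)
  ultimately show ?case using DERIV_diff by blast
qed

lemma z_difference_lipschitz:
  assumes "0 <= X1 + Y"
  obtains L where "L-lipschitz_on {X1..X2} (\<lambda>X. cz cv X Y - cz dv X Y)"
proof -
  have lz: "loc_lipschitz_X (cz cv)" "loc_lipschitz_X (cz dv)" by (rule A.lipX B.lipX; simp)+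
  obtain L where L: "L-lipschitz_on {X1..X2} (\<lambda>X. cz cv X Y)" using loc_lipschitz_X_line[OF lz(1) assms] by blast
  obtain L' where L': "L'-lipschitz_on {X1..X2} (\<lambda>X. cz dv X Y)" using loc_lipschitz_X_line[OF lz(2) assms] by blast
  show thesis by (rule that[OF lipschitz_on_diff[OF L L']])
qed

end

section \<open>The weak singularity on the forward characteristic\<close>

text \<open>The relation \<open>f x - f a = O(x - a)\<close>. Differentiability would be too strong a requirement for the dissipative \<open>w\<close>, which is merely Lipschitz continuous in \<open>Y\<close>.\<close>

definition lip_at :: "(real => real) => real => bool" where
  "lip_at f a \<longleftrightarrow> (\<exists>K\<ge>0. \<forall>\<^sub>F x in nhds a. \<bar>f x - f a\<bar> <= K * \<bar>x - a\<bar>)"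

lemma lip_atE:
  assumes "lip_at f a" obtains K where "0 <= K" "\<forall>\<^sub>F x in nhds a. \<bar>f x - f a\<bar> <= K * \<bar>x - a\<bar>"
  using assms unfolding lip_at_def by blast

lemma lip_at_deriv:
  assumes "(f has_real_derivative D) (at a)"
  shows "lip_at f a"
  unfolding lip_at_def
proof (intro exI[of _ "\<bar>D\<bar> + 1"] conjI)
  have "((\<lambda>y. (f y - f a) / (y - a)) \<longlongrightarrow> D) (at a)" using assms by (simp add: has_field_derivative_iff)
  then have "\<forall>\<^sub>F y in at a. dist ((f y - f a) / (y - a)) D < 1" by (rule tendstoD) simp
  then have "\<forall>\<^sub>F x in at a. \<bar>f x - f a\<bar> <= (\<bar>D\<bar> + 1) * \<bar>x - a\<bar>"
    using eventually_neq_at_within[of a a UNIV]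
  proof eventually_elim
    case (elim y)
    have "\<bar>q\<bar> <= \<bar>D\<bar> + 1" if "\<bar>q - D\<bar> < 1" for q using that by (auto simp: abs_if split: if_splits)
    from this[of "(f y - f a) / (y - a)"] have "\<bar>(f y - f a) / (y - a)\<bar> <= \<bar>D\<bar> + 1"
      using elim(1) unfolding dist_real_def by blast
    then show ?case using elim(2) by (simp add: abs_divide divide_le_eq)
  qed
  then show "\<forall>\<^sub>F x in nhds a. \<bar>f x - f a\<bar> <= (\<bar>D\<bar> + 1) * \<bar>x - a\<bar>"
    unfolding eventually_at_filter
  proof eventually_elim
    case (elim x)
    then show ?case by (cases "x = a") auto
  qed
qed simp

lemma lip_at_tendsto:
  assumes "lip_at f a"
  shows "(f \<longlongrightarrow> f a) (nhds a)"
proof (rule tendstoI)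
  fix e :: real assume e: "0 < e"
  obtain K where K: "0 <= K" "\<forall>\<^sub>F x in nhds a. \<bar>f x - f a\<bar> <= K * \<bar>x - a\<bar>" using assms by (rule lip_atE)
  have "\<forall>\<^sub>F x in nhds a. dist x a < e / (K + 1)"
    using e K(1) by (auto simp: eventually_nhds_metric intro!: exI[of _ "e / (K + 1)"])
  then show "\<forall>\<^sub>F x in nhds a. dist (f x) (f a) < e"
    using K(2)
  proof eventually_elim
    case (elim x)
    have "\<bar>x - a\<bar> * (K + 1) < e" using elim(1) K(1) by (simp add: dist_real_def pos_less_divide_eq)
    moreover have "K * \<bar>x - a\<bar> <= \<bar>x - a\<bar> * (K + 1)" by (simp add: algebra_simps)
    ultimately show ?case using elim(2) by (simp add: dist_real_def)
  qed
qed

lemma lip_at_cong: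
  assumes "\<forall>\<^sub>F x in nhds a. f x = g x" "lip_at f a"
  shows "lip_at g a"
proof -
  have e: "f a = g a" by (rule eventually_nhds_x_imp_x[OF assms(1)])
  obtain K where K: "0 <= K" "\<forall>\<^sub>F x in nhds a. \<bar>f x - f a\<bar> <= K * \<bar>x - a\<bar>" using assms(2) by (rule lip_atE)
  have "\<forall>\<^sub>F x in nhds a. \<bar>g x - g a\<bar> <= K * \<bar>x - a\<bar>"
    using assms(1) K(2) by eventually_elim (simp add: e)
  then show ?thesis unfolding lip_at_def using K(1) by blast
qed

lemma lip_at_const: "lip_at (\<lambda>_. k) a"
  unfolding lip_at_def by (rule exI[of _ 0]) simp

lemma lip_at_bounded_by:
  assumes "lip_at f a" "lip_at g a" "0 <= L"
    and "\<forall>\<^sub>F x in nhds a. \<bar>h x - h a\<bar> <= L * (\<bar>f x - f a\<bar> + \<bar>g x - g a\<bar>)"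
  shows "lip_at h a"
proof -
  obtain K where K: "0 <= K" "\<forall>\<^sub>F x in nhds a. \<bar>f x - f a\<bar> <= K * \<bar>x - a\<bar>" using assms(1) by (rule lip_atE)
  obtain K' where K': "0 <= K'" "\<forall>\<^sub>F x in nhds a. \<bar>g x - g a\<bar> <= K' * \<bar>x - a\<bar>" using assms(2) by (rule lip_atE)
  have "\<forall>\<^sub>F x in nhds a. \<bar>h x - h a\<bar> <= (L * (K + K')) * \<bar>x - a\<bar>"
    using assms(4) K(2) K'(2)
  proof eventually_elim
    case (elim x)
    have "L * (\<bar>f x - f a\<bar> + \<bar>g x - g a\<bar>) <= L * (K * \<bar>x - a\<bar> + K' * \<bar>x - a\<bar>)"
      by (rule mult_left_mono[OF add_mono[OF elim(2,3)] assms(3)])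
    then show ?case using elim(1) by (simp add: algebra_simps)
  qed
  moreover have "0 <= L * (K + K')" using K(1) K'(1) assms(3) by simp
  ultimately show ?thesis unfolding lip_at_def by blast
qed

lemma lip_at_diff: "lip_at f a ==> lip_at g a ==> lip_at (\<lambda>x. f x - g x) a"
proof (rule lip_at_bounded_by[of f a g 1], assumption+)
  have "\<bar>(p - q) - (p' - q')\<bar> <= \<bar>p - p'\<bar> + \<bar>q - q'\<bar>" for p q p' q' :: real by (simp add: abs_if split: if_splits)
  then show "\<forall>\<^sub>F x in nhds a. \<bar>f x - g x - (f a - g a)\<bar> <= 1 * (\<bar>f x - f a\<bar> + \<bar>g x - g a\<bar>)"
    by (intro always_eventually allI) simp
qed simp

lemma lip_at_mult:
  assumes f: "lip_at f a" and g: "lip_at g a"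
  shows "lip_at (\<lambda>x. f x * g x) a"
proof (rule lip_at_bounded_by[OF f g, of "\<bar>f a\<bar> + 1 + \<bar>g a\<bar>"])
  have "\<forall>\<^sub>F x in nhds a. dist (f x) (f a) < 1" by (rule tendstoD[OF lip_at_tendsto[OF f]]) simp
  then show "\<forall>\<^sub>F x in nhds a. \<bar>f x * g x - f a * g a\<bar> <= (\<bar>f a\<bar> + 1 + \<bar>g a\<bar>) * (\<bar>f x - f a\<bar> + \<bar>g x - g a\<bar>)"
  proof eventually_elim
    case (elim x)
    have "\<bar>p\<bar> <= \<bar>q\<bar> + 1" if "\<bar>p - q\<bar> < 1" for p q :: real using that by (auto simp: abs_if split: if_splits)
    then have fx: "\<bar>f x\<bar> <= \<bar>f a\<bar> + 1" using elim by (simp add: dist_real_def)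
    have "f x * g x - f a * g a = f x * (g x - g a) + g a * (f x - f a)" by (simp add: algebra_simps)
    then have "\<bar>f x * g x - f a * g a\<bar> <= \<bar>f x\<bar> * \<bar>g x - g a\<bar> + \<bar>g a\<bar> * \<bar>f x - f a\<bar>"
      by (metis abs_mult abs_triangle_ineq)
    also have "\<dots> <= (\<bar>f a\<bar> + 1 + \<bar>g a\<bar>) * \<bar>g x - g a\<bar> + (\<bar>f a\<bar> + 1 + \<bar>g a\<bar>) * \<bar>f x - f a\<bar>"
      using fx by (intro add_mono mult_right_mono) auto
    also have "\<dots> = (\<bar>f a\<bar> + 1 + \<bar>g a\<bar>) * (\<bar>f x - f a\<bar> + \<bar>g x - g a\<bar>)" by (simp add: algebra_simps)
    finally show ?case .
  qed
qed simp

lemma lip_at_compose: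
  assumes f: "lip_at f a" and g: "(g has_real_derivative D) (at (f a))"
  shows "lip_at (\<lambda>x. g (f x)) a"
proof -
  obtain K where K: "0 <= K" "\<forall>\<^sub>F y in nhds (f a). \<bar>g y - g (f a)\<bar> <= K * \<bar>y - f a\<bar>"
    using lip_at_deriv[OF g] by (rule lip_atE)
  show ?thesis
  proof (rule lip_at_bounded_by[OF f lip_at_const[of 0] K(1)])
    show "\<forall>\<^sub>F x in nhds a. \<bar>g (f x) - g (f a)\<bar> <= K * (\<bar>f x - f a\<bar> + \<bar>0 - 0\<bar>)"
      using eventually_compose_filterlim[OF K(2) lip_at_tendsto[OF f]] by simp
  qed
qed

context singular_origin
begin

lemma w_sigma_growth:
  assumes g: "good_box r"
  shows "\<exists>m>0. \<forall>X Y1 Y2. inbox r X Y1 --> inbox r X Y2 --> Y1 <= Y2 --> m * (Y2 - Y1) <= cw cv X Y2 - cw cv X Y1"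
proof -
  obtain m where m: "0 < m" "\<forall>X Y. inbox r X Y --> m <= rhs_w c cv X Y"
    using box_lower[OF g A.cont_rhs(3)] rhs_signs_box(1)[OF g] by blast
  have "m * (Y2 - Y1) <= cw cv X Y2 - cw cv X Y1" if b: "inbox r X Y1" "inbox r X Y2" "Y1 <= Y2" for X Y1 Y2
  proof -
    have "cw cv X Y1 - m * Y1 <= cw cv X Y2 - m * Y2"
    proof (rule DERIV_nonneg_imp_nondecreasing[where f="\<lambda>Y. cw cv X Y - m * Y", OF b(3)])
      fix y assume y: "Y1 <= y" "y <= Y2"
      have iy: "inbox r X y" using b y unfolding inbox_def by (auto simp: abs_le_iff)
      have "((\<lambda>Y. cw cv X Y - m * Y) has_real_derivative rhs_w c cv X y - m) (at y)"
        using wY_P[of X y] unfolding has_dY_def by (auto intro!: derivative_eq_intros)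
      moreover have "0 <= rhs_w c cv X y - m" using m(2) iy by simp
      ultimately show "\<exists>D. ((\<lambda>Y. cw cv X Y - m * Y) has_real_derivative D) (at y) \<and> 0 <= D" by blast
    qed
    then show ?thesis by (simp add: algebra_simps)
  qed
  then show ?thesis using m(1) by blast
qed

text \<open>At height \<open>Y\<close> the curve lies at a distance of order \<open>sqrt (Y - Y0)\<close> to the left of the axis. From there to the axis the dissipative \<open>z\<close> is constant while the conservative \<open>z\<close> decreases at a positive rate.\<close>

lemma z_gap_at_X0:
  assumes g: "good_box r"
  shows "\<exists>k>0. \<forall>a \<eta>. regime r a \<eta> --> (\<exists>d>0. d <= r \<and> (\<forall>Y. Y0 < Y --> Y < Y0 + d --> good_Y Y --> ct dv X0 Y < t0 + \<eta> -->
     cz cv X0 Y - cz dv X0 Y <= - k * sqrt (Y - Y0)))"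
proof -
  obtain m where m: "0 < m" "\<forall>X Y1 Y2. inbox r X Y1 --> inbox r X Y2 --> Y1 <= Y2 --> m * (Y2 - Y1) <= cw cv X Y2 - cw cv X Y1"
    using w_sigma_growth[OF g] by blast
  have c: "continuous_on half_plane (\<lambda>(X, Y). - rhs_z c cv X Y)"
    using continuous_on_minus[OF A.cont_rhs(4)] by (simp add: split_def)
  have "\<exists>m2>0. \<forall>X Y. inbox r X Y --> m2 <= - rhs_z c cv X Y"
    by (rule box_lower[OF g c]) (use rhs_signs_box(3)[OF g] in simp)
  then obtain m2 where m2: "0 < m2" "\<forall>X Y. inbox r X Y --> m2 <= - rhs_z c cv X Y" by blast
  show ?thesis
  proof (rule w_line_quadratic[OF g])
    fix \<beta> B :: real
    assume B: "0 <= B" and lo: "\<And>X. \<bar>X - X0\<bar> <= r ==> pi - B / 2 * (X - X0)\<^sup>2 <= cw cv X Y0"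
    \<comment> \<open>At the distance \<open>\<phi> sqrt (Y - Y0)\<close> from the axis the quadratic drop of \<open>w\<close> along \<open>Y = Y0\<close> is made up by its growth in \<open>Y\<close>.\<close>
    define \<phi> where "\<phi> = sqrt (m / (B + 1))"
    have \<phi>: "0 < \<phi>" "\<phi>\<^sup>2 = m / (B + 1)" using m(1) B by (simp_all add: \<phi>_def)
    have \<phi>m: "B / 2 * \<phi>\<^sup>2 <= m" using m(1) B unfolding \<phi>(2) by (simp add: field_simps mult_left_mono)
    have "\<exists>d>0. d <= r \<and> (\<forall>Y. Y0 < Y --> Y < Y0 + d --> good_Y Y --> ct dv X0 Y < t0 + \<eta> -->
       cz cv X0 Y - cz dv X0 Y <= - (m2 * \<phi>) * sqrt (Y - Y0))" if R: "regime r a \<eta>" for a \<eta>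
    proof (intro exI[of _ "min r ((a / \<phi>)\<^sup>2)"] conjI allI impI)
      note ra = regimeD(2,3,7)[OF R]
      show "0 < min r ((a / \<phi>)\<^sup>2)" "min r ((a / \<phi>)\<^sup>2) <= r" using ra \<phi> by auto
      fix Y assume Y: "Y0 < Y" "Y < Y0 + min r ((a / \<phi>)\<^sup>2)" and gY: "good_Y Y" and t: "ct dv X0 Y < t0 + \<eta>"
      define s where "s = \<phi> * sqrt (Y - Y0)"
      have s: "0 <= s" "s\<^sup>2 = \<phi>\<^sup>2 * (Y - Y0)" using \<phi>(1) Y(1) by (simp_all add: s_def power_mult_distrib)
      have "sqrt (Y - Y0) < a / \<phi>" by (rule real_less_lsqrt) (use ra \<phi> Y in auto)
      then have sa: "s < a" using \<phi>(1) by (simp add: s_def pos_less_divide_eq mult.commute)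
      have Yr: "Y <= Y0 + r" using Y by simp
      have ib: "inbox r X y" if "X0 - a <= X" "X <= X0" "Y0 <= y" "y <= Y" for X y
        using that ra Yr unfolding inbox_def by (auto simp: abs_le_iff)
      have ws: "pi <= cw cv (X0 - s) Y"
      proof -
        have 1: "m * (Y - Y0) <= cw cv (X0 - s) Y - cw cv (X0 - s) Y0"
          using m(2) ib[of "X0 - s" Y0] ib[of "X0 - s" Y] sa s(1) Y by simp
        have 2: "pi - B / 2 * s\<^sup>2 <= cw cv (X0 - s) Y0" using lo[of "X0 - s"] s(1) sa ra by simp
        have "B / 2 * s\<^sup>2 = (B / 2 * \<phi>\<^sup>2) * (Y - Y0)" by (simp add: s(2))
        also have "\<dots> <= m * (Y - Y0)" using \<phi>m Y(1) by (intro mult_right_mono) auto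
        finally show ?thesis using 1 2 by linarith
      qed
      have ax: "pi <= cw cv X0 Y" using w_on_axis[OF g _ Y(1)] Y(1) Yr by simp
      show "cz cv X0 Y - cz dv X0 Y <= - (m2 * \<phi>) * sqrt (Y - Y0)"
      proof (rule left_end_of_contact[OF R Y(1) Yr _ order_refl t ax])
        show "X0 - a < X0" using ra by simp
        fix X' assume X': "X0 - a < X'" "X' < X0" "cw cv X' Y = pi" "same_vars cv dv X' Y"
          and ct: "\<And>\<xi>. X' <= \<xi> ==> \<xi> <= X0 ==> cw dv \<xi> Y = pi"
        have ls: "X' <= X0 - s"
        proof (rule ccontr)
          assume n: "\<not> X' <= X0 - s"
          have "inbox r (X0 - s) Y" by (rule ib) (use sa s Y in auto)
          then have "pi < cw cv X' Y" using w_between[OF g _ Y(1) ws, of X'] n X'(2) by simp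
          then show False using X'(3) by simp
        qed
        have hp: "0 < X' + Y" by (rule good_boxD(1)[OF g ib]) (use X' Y in auto)
        obtain L where L: "L-lipschitz_on {X'..X0} (\<lambda>X. cz cv X Y - cz dv X Y)"
          using z_difference_lipschitz[of X' Y] hp by auto
        have "(cz cv X0 Y - cz dv X0 Y) - (cz cv X' Y - cz dv X' Y) <= - m2 * (X0 - X')"
        proof (rule lipschitz_AE_deriv_le[where f="\<lambda>X. cz cv X Y - cz dv X Y", OF less_imp_le[OF X'(2)] L])
          show "AE x in lborel. X' < x \<and> x < X0 --> (\<exists>d. ((\<lambda>X. cz cv X Y - cz dv X Y) has_real_derivative d) (at x) \<and> d <= - m2)"
            using z_difference_deriv[OF gY]
          proof eventually_elim
            case (elim x)
            show ?case
            proof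
              assume x: "X' < x \<and> x < X0"
              have i: "inbox r x Y" by (rule ib) (use x X' Y in auto)
              have th: "dissipative_theta dv x Y = 0" by (rule theta_box(2)[OF g i]) (use ct[of x] x in simp)
              have "((\<lambda>X. cz cv X Y - cz dv X Y) has_real_derivative rhs_z c cv x Y) (at x)"
                using elim good_boxD(1)[OF g i] unfolding th by simp
              moreover have "m2 <= - rhs_z c cv x Y" using m2(2) i by blast
              ultimately show "\<exists>d. ((\<lambda>X. cz cv X Y - cz dv X Y) has_real_derivative d) (at x) \<and> d <= - m2" by force
            qed
          qed
        qed
        moreover have "cz cv X' Y = cz dv X' Y" using X'(4) unfolding same_vars_def by blast
        moreover have "m2 * s <= m2 * (X0 - X')" using ls m2(1) by (intro mult_left_mono) auto
        ultimately show ?thesis by (simp add: s_def mult.assoc)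
      qed
    qed
    then show ?thesis using m2(1) \<phi>(1) by (intro exI[of _ "m2 * \<phi>"]) simp
  qed
qed

text \<open>Beyond the axis the difference of the two \<open>z\<close> obeys a linear differential inequality up to an error \<open>O(Y - Y0)\<close>, which is negligible compared with \<open>sqrt (Y - Y0)\<close>; where \<open>\<theta> = 0\<close> the difference decreases anyway.\<close>

lemma z_gap:
  assumes g: "good_box r"
  shows "\<exists>a2>0. \<forall>a \<eta>. a <= a2 --> regime r a \<eta> --> (\<exists>k>0. \<exists>d>0. \<forall>X Y. X0 <= X --> X < X0 + a --> Y0 < Y --> Y < Y0 + d -->
     ct dv X Y < t0 + \<eta> --> cz cv X Y - cz dv X Y <= - k * sqrt (Y - Y0))"
proof -
  obtain k where k: "0 < k" "\<forall>a \<eta>. regime r a \<eta> --> (\<exists>d>0. d <= r \<and> (\<forall>Y. Y0 < Y --> Y < Y0 + d --> good_Y Y --> ct dv X0 Y < t0 + \<eta> -->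
     cz cv X0 Y - cz dv X0 Y <= - k * sqrt (Y - Y0)))" using z_gap_at_X0[OF g] by blast
  obtain C where C: "0 <= C" "\<forall>X Y. inbox r X Y --> same_vars cv dv X Y0 -->
     \<bar>rhs_z c cv X Y - rhs_z c dv X Y\<bar> <= C * (\<bar>cz cv X Y - cz dv X Y\<bar> + \<bar>Y - Y0\<bar>)" using rhs_z_difference[OF g] by blast
  show ?thesis
  proof (rule exI[of _ "1 / (4 * (C + 1))"], rule conjI, use C(1) in simp, intro allI impI)
    fix a \<eta> assume a: "a <= 1 / (4 * (C + 1))" and R: "regime r a \<eta>"
    note ra = regimeD(2,3,7)[OF R]
    obtain d where d: "0 < d" "d <= r" "\<forall>Y. Y0 < Y --> Y < Y0 + d --> good_Y Y --> ct dv X0 Y < t0 + \<eta> -->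
       cz cv X0 Y - cz dv X0 Y <= - k * sqrt (Y - Y0)" using k(2) R by blast
    have Ca: "4 * (C * a) <= 1"
    proof -
      have "a * (4 * (C + 1)) <= 1" using a C(1) by (simp add: pos_le_divide_eq)
      then show ?thesis using ra by (simp add: algebra_simps)
    qed
    have good: "cz cv X Y - cz dv X Y + (k / 2) * sqrt (Y - Y0) <= 0"
      if X: "X0 <= X" "X < X0 + a" and Y: "Y0 < Y" "Y < Y0 + min d (k\<^sup>2)" and t: "ct dv X Y < t0 + \<eta>" and gY: "good_Y Y" for X Y
    proof -
      have ib: "inbox r x y" if "X0 <= x" "x <= X" "Y0 <= y" "y <= Y" for x y
        using that ra X Y d unfolding inbox_def by (auto simp: abs_le_iff)
      have hp0: "0 < X0 + Y" by (rule good_boxD(1)[OF g ib]) (use X Y in auto)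
      have live: "ct dv x Y < t0 + \<eta>" if "X0 <= x" "x <= X" for x
      proof -
        have "ct dv x Y <= ct dv X Y" by (rule B.mono_X(2)) (use hp0 that in auto)
        then show ?thesis using t by simp
      qed
      have same: "same_vars cv dv x Y0" if "X0 <= x" "x <= X" for x
      proof -
        have h: "0 <= x + Y0" by (rule good_boxD(2)[OF g ib]) (use that Y in auto)
        have "ct dv x Y0 <= ct dv x Y" by (rule B.mono_Y(2)) (use h Y in auto)
        then show ?thesis using live[OF that] by (intro tau_in_E(2)[OF R h]) (auto simp: in_E_def)
      qed
      define K where "K = k * sqrt (Y - Y0)"
      have sq: "0 < sqrt (Y - Y0)" "sqrt (Y - Y0) * sqrt (Y - Y0) = Y - Y0" using Y(1) by simp_all
      have K: "0 < K" using k(1) sq by (simp add: K_def)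
      have "sqrt (Y - Y0) <= k" by (rule real_le_lsqrt) (use k(1) Y in auto)
      then have yK: "Y - Y0 <= K" using sq unfolding K_def by (metis mult_right_mono less_imp_le)
      obtain L where L: "L-lipschitz_on {X0..X} (\<lambda>X. cz cv X Y - cz dv X Y)"
        using z_difference_lipschitz[of X0 Y] hp0 by auto
      have "cz cv X Y - cz dv X Y <= - K / 2"
      proof (rule lipschitz_gronwall_neg[where f="\<lambda>X. cz cv X Y - cz dv X Y" and C=C and D="C * (Y - Y0)", OF X(1) L _ K C(1)])
        show "cz cv X0 Y - cz dv X0 Y <= - K" using d(3) Y gY live[of X0] X(1) unfolding K_def by simp
        show "0 <= C * (Y - Y0)" using C(1) Y(1) by simp
        have "C * (Y - Y0) <= C * K" using yK C(1) by (intro mult_left_mono) auto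
        then have "(C * K + C * (Y - Y0)) * (X - X0) <= (2 * (C * K)) * a"
          using X C(1) K by (intro mult_mono) auto
        also have "\<dots> = (4 * (C * a)) * (K / 2)" by simp
        also have "\<dots> <= 1 * (K / 2)" using Ca K by (intro mult_right_mono) auto
        finally show "(C * K + C * (Y - Y0)) * (X - X0) <= K / 2" by simp
        show "AE x in lborel. X0 < x \<and> x < X --> (\<exists>d. ((\<lambda>X. cz cv X Y - cz dv X Y) has_real_derivative d) (at x) \<and>
            d <= C * \<bar>cz cv x Y - cz dv x Y\<bar> + C * (Y - Y0))"
          using z_difference_deriv[OF gY]
        proof eventually_elim
          case (elim x)
          show ?case
          proof
            assume x: "X0 < x \<and> x < X"
            have i: "inbox r x Y" by (rule ib) (use x Y in auto)
            have nn: "0 <= C * \<bar>cz cv x Y - cz dv x Y\<bar> + C * (Y - Y0)" using C(1) Y(1) by simp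
            have "\<bar>rhs_z c cv x Y - rhs_z c dv x Y\<bar> <= C * (\<bar>cz cv x Y - cz dv x Y\<bar> + \<bar>Y - Y0\<bar>)"
              using C(2) i same[of x] x by simp
            then have b1: "rhs_z c cv x Y - rhs_z c dv x Y <= C * \<bar>cz cv x Y - cz dv x Y\<bar> + C * (Y - Y0)"
              using abs_ge_self[of "rhs_z c cv x Y - rhs_z c dv x Y"] Y(1) by (simp add: distrib_left)
            have b2: "rhs_z c cv x Y <= C * \<bar>cz cv x Y - cz dv x Y\<bar> + C * (Y - Y0)"
              using rhs_signs_box(3)[OF g i] nn by simp
            have "rhs_z c cv x Y - dissipative_theta dv x Y * rhs_z c dv x Y <= C * \<bar>cz cv x Y - cz dv x Y\<bar> + C * (Y - Y0)"
              using B.theta[of x Y] b1 b2 by auto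
            then show "\<exists>d. ((\<lambda>X. cz cv X Y - cz dv X Y) has_real_derivative d) (at x) \<and>
              d <= C * \<bar>cz cv x Y - cz dv x Y\<bar> + C * (Y - Y0)" using elim good_boxD(1)[OF g i] by blast
          qed
        qed
      qed
      then show ?thesis by (simp add: K_def)
    qed
    have all: "cz cv X Y - cz dv X Y <= - (k / 2) * sqrt (Y - Y0)"
      if X: "X0 <= X" "X < X0 + a" and Y: "Y0 < Y" "Y < Y0 + min d (k\<^sup>2)" and t: "ct dv X Y < t0 + \<eta>" for X Y
    proof -
      have hp: "0 <= X + Y0" using P_interior X by simp
      have "cz cv X Y - cz dv X Y + (k / 2) * sqrt (Y - Y0) <= 0"
      proof (rule AE_imp_le_continuous[where F="\<lambda>Y. cz cv X Y - cz dv X Y + (k / 2) * sqrt (Y - Y0)", OF Y(1)])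
        show "continuous_on {Y0..Y} (\<lambda>Y. cz cv X Y - cz dv X Y + (k / 2) * sqrt (Y - Y0))"
          by (intro continuous_intros continuous_on_half_plane_vline[OF A.cont_vars(3)] continuous_on_half_plane_vline[OF B.cont_vars(3)] hp)
        show "AE y in lborel. Y0 < y \<and> y < Y --> cz cv X y - cz dv X y + (k / 2) * sqrt (y - Y0) <= 0"
          using AE_good_Y
        proof eventually_elim
          case (elim y)
          show ?case
          proof
            assume y: "Y0 < y \<and> y < Y"
            have "ct dv X y <= ct dv X Y" by (rule B.mono_Y(2)) (use hp y in auto)
            then show "cz cv X y - cz dv X y + (k / 2) * sqrt (y - Y0) <= 0"
              by (intro good[OF X _ _ _ elim]) (use y Y t in auto)
          qed
        qed
      qed (use Y in simp)
      then show ?thesis by simp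
    qed
    show "\<exists>k>0. \<exists>d>0. \<forall>X Y. X0 <= X --> X < X0 + a --> Y0 < Y --> Y < Y0 + d -->
     ct dv X Y < t0 + \<eta> --> cz cv X Y - cz dv X Y <= - k * sqrt (Y - Y0)"
    proof (rule exI[of _ "k / 2"], rule conjI, use k(1) in simp, rule exI[of _ "min d (k\<^sup>2)"], rule conjI)
      show "0 < min d (k\<^sup>2)" using d(1) k(1) by simp
    qed (use all in blast)
  qed
qed

text \<open>The points of the characteristic are regular, so \<open>u_x\<close> is continuous. If it were differentiable there, then \<open>tan (z/2)\<close>, which is determined by \<open>u_x\<close>, \<open>u\<close> and \<open>w\<close>, would satisfy a pointwise Lipschitz condition, and so would the difference of the conservative and the dissipative \<open>z\<close>. To the left of the characteristic this contradicts the square root lower bound, as \<open>Y - Y0\<close> is proportional to the distance from it.\<close>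

lemma weak_singularity_on_forward_characteristic:
  assumes R: "regime r a \<eta>"
    and gap: "\<exists>k>0. \<exists>d>0. \<forall>X Y. X0 <= X --> X < X0 + a --> Y0 < Y --> Y < Y0 + d -->
     ct dv X Y < t0 + \<eta> --> cz cv X Y - cz dv X Y <= - k * sqrt (Y - Y0)"
    and fc: "forward_characteristic cv X0 Y0 \<gamma>f" and t: "t0 < t" "t < t0 + \<eta>"
  shows "weak_singularity (\<lambda>x. udiss x t) (\<gamma>f t)"
proof -
  note g = regimeD(1)[OF R] and ra = regimeD(2,3,7)[OF R]
  obtain k d where k: "0 < k" and d: "0 < d" and gap: "\<And>X Y. X0 <= X ==> X < X0 + a ==> Y0 < Y ==> Y < Y0 + d ==>
     ct dv X Y < t0 + \<eta> ==> cz cv X Y - cz dv X Y <= - k * sqrt (Y - Y0)"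
    using gap by blast
  have tp: "0 < t" using t t0_pos by simp
  have "(\<gamma>f t, t) \<in> {(\<gamma>f t, t) | t. t0 <= t}" using t by auto
  then have "(\<gamma>f t, t) \<in> {(cx cv X Y0, ct cv X Y0) | X. X0 <= X}" using fc unfolding forward_characteristic_def by simp
  then obtain Xt where Xt: "X0 <= Xt" "cx cv Xt Y0 = \<gamma>f t" "ct cv Xt Y0 = t" by auto
  have Xg: "X0 < Xt" using Xt t by (cases "Xt = X0") auto
  have Xa: "Xt < X0 + a"
  proof (rule ccontr)
    assume n: "\<not> Xt < X0 + a"
    have "ct cv (X0 + a) Y0 <= ct cv Xt Y0" by (rule A.mono_X(2)) (use P_interior ra n in auto)
    then show False using Xt(3) t regimeD(5)[OF R] by simp
  qed
  have it: "inbox r Xt Y0" using Xg Xa ra unfolding inbox_def by (auto simp: abs_le_iff)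
  note hp = good_boxD(1)[OF g it]
  have sm: "same_vars cv dv Xt Y0" by (rule same_in_E[OF R less_imp_le[OF hp]]) (use Xt t in \<open>auto simp: in_E_def\<close>)
  have tau: "cx dv Xt Y0 = \<gamma>f t" "ct dv Xt Y0 = t" "cw dv Xt Y0 = cw cv Xt Y0" "cz dv Xt Y0 = cz cv Xt Y0"
    using sm Xt unfolding same_vars_def by auto
  have "cw cv Xt Y0 < pi" by (rule w_on_line[OF g]) (use it Xg in \<open>auto simp: inbox_def\<close>)
  then have reg: "B.reg Xt Y0"
    unfolding B.reg_def using hp good_boxD(16,18)[OF g it] tau(3) by auto
  let ?x = "\<gamma>f t"
  define X where "X x = fst (B.pre x t)" for x
  define Y where "Y x = snd (B.pre x t)" for x
  have XY0: "X ?x = Xt" "Y ?x = Y0" using B.pre_reg[OF reg] unfolding X_def Y_def tau by simp_all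
  have pXY: "0 <= X x + Y x" "cx dv (X x) (Y x) = x" "ct dv (X x) (Y x) = t" for x
    unfolding X_def Y_def using B.pre[of t x] tp by auto
  obtain \<nu> where \<nu>: "0 < \<nu>" "(Y has_real_derivative - \<nu>) (at ?x)"
  proof
    show "0 < 2 / ((1 + cos (cz dv Xt Y0)) * cq dv Xt Y0)"
      using one_plus_cos_pos[of "cz dv Xt Y0"] reg B.q_pos[OF less_imp_le[OF hp]] unfolding B.reg_def by simp
    show "(Y has_real_derivative - (2 / ((1 + cos (cz dv Xt Y0)) * cq dv Xt Y0))) (at ?x)"
      using B.pre_deriv(2)[OF reg] tp unfolding Y_def[abs_def] tau by simp
  qed
  have lY: "lip_at Y ?x" by (rule lip_at_deriv[OF \<nu>(2)])
  have lX: "lip_at X ?x"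
    using lip_at_deriv[OF B.pre_deriv(1)[OF reg]] tp unfolding X_def[abs_def] tau by simp
  obtain s1 where s1: "0 < s1" "\<And>X' Y'. \<bar>X' - Xt\<bar> <= s1 ==> \<bar>Y' - Y0\<bar> <= s1 ==> B.reg X' Y'" using B.reg_nhd[OF reg] by blast
  obtain s2 where s2: "0 < s2" "\<And>X' Y'. \<bar>X' - Xt\<bar> <= s2 ==> \<bar>Y' - Y0\<bar> <= s2 ==> 0 < X' + Y' \<and> \<bar>ct dv X' Y' - ct dv Xt Y0\<bar> <= (t0 + \<eta> - t) / 2"
    using continuous_half_plane_box[OF B.cont_vars(7) hp, of "(t0 + \<eta> - t) / 2"] t by auto
  obtain s where s: "0 < s" "s < s1" "s < s2" "s < d" "s < Xt - X0" "s < X0 + a - Xt" "s < r"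
  proof -
    obtain h where h: "0 < h" "h < s1" "h < s2" "h < d" "h < r" using ex_less_four[OF s1(1) s2(1) d ra(3)] by blast
    obtain h' where h': "0 < h'" "h' < h" "h' < Xt - X0" "h' < X0 + a - Xt" using ex_less_four[OF h(1) h(1), of "Xt - X0" "X0 + a - Xt"] Xg Xa by auto
    show thesis by (rule that[of h']) (use h h' in auto)
  qed
  obtain m where m: "0 < m" "\<And>x. \<bar>x - ?x\<bar> < m ==> \<bar>X x - Xt\<bar> < s \<and> \<bar>Y x - Y0\<bar> < s"
  proof (rule B.localise_reg[OF reg s(1)])
    fix m assume m: "0 < m" "\<And>A B. 0 <= A + B ==> \<bar>cx dv A B - cx dv Xt Y0\<bar> < m ==> \<bar>ct dv A B - ct dv Xt Y0\<bar> < m ==>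
       \<bar>A - Xt\<bar> < s \<and> \<bar>B - Y0\<bar> < s"
    show thesis
    proof (rule that[OF m(1)])
      fix x assume "\<bar>x - ?x\<bar> < m"
      then show "\<bar>X x - Xt\<bar> < s \<and> \<bar>Y x - Y0\<bar> < s" using m(2)[OF pXY(1)[of x]] m(1) by (simp add: pXY tau)
    qed
  qed
  have near: "\<forall>\<^sub>F x in nhds ?x. \<bar>x - ?x\<bar> < m"
    using m(1) unfolding eventually_nhds_metric dist_real_def by blast
  have rg: "B.reg (X x) (Y x)" if "\<bar>x - ?x\<bar> < m" for x using s1(2)[of "X x" "Y x"] m(2)[OF that] s by simp
  have ib: "inbox r A B" if "\<bar>A - Xt\<bar> < s" "\<bar>B - Y0\<bar> < s" for A B
    using that s Xg ra unfolding inbox_def by (auto simp: abs_le_iff abs_less_iff)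
  define sl where "sl x = B.slope (X x) (Y x)" for x
  have der: "((\<lambda>x. udiss x t) has_real_derivative sl x) (at x)" if "\<bar>x - ?x\<bar> < m" for x
    using B.U_deriv[OF rg[OF that]] tp unfolding pXY sl_def by simp
  have dsl: "\<forall>\<^sub>F x in nhds ?x. deriv (\<lambda>x. udiss x t) x = sl x"
    using near by eventually_elim (rule DERIV_imp_deriv[OF der])
  have op: "open {P :: real \<times> real. 0 < fst P + snd P}" by (intro open_Collect_less continuous_intros)
  have cXY: "isCont (\<lambda>x. (X x, Y x)) ?x"
    using DERIV_isCont[OF B.pre_deriv(1)[OF reg]] DERIV_isCont[OF \<nu>(2)] tp
    unfolding X_def[abs_def] tau by (intro isCont_Pair) simp_all
  have cF: "isCont (\<lambda>x. F (X x) (Y x)) ?x" if "continuous_on half_plane (\<lambda>(X, Y). F X Y)" for F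
  proof -
    have "continuous_on {P. 0 < fst P + snd P} (\<lambda>P. F (fst P) (snd P))"
      using continuous_on_subset[OF that, of "{P. 0 < fst P + snd P}"] by (simp add: half_plane_def split_def subset_eq)
    then have "isCont (\<lambda>P. F (fst P) (snd P)) (Xt, Y0)"
      using hp by (simp add: continuous_on_eq_continuous_at[OF op])
    then show ?thesis using isCont_o2[OF cXY, of "\<lambda>P. F (fst P) (snd P)"] XY0 by simp
  qed
  have csl: "isCont sl ?x"
  proof -
    have cc: "isCont (\<lambda>x. c (cu dv (X x) (Y x))) ?x" by (rule isCont_o2[OF cF[OF B.cont_vars(1)] DERIV_isCont[OF A.c_deriv]])
    have tn: "isCont (\<lambda>x. sin (F (X x) (Y x)) / (1 + cos (F (X x) (Y x)))) ?x"
      if "isCont (\<lambda>x. F (X x) (Y x)) ?x" "cos (F Xt Y0) \<noteq> -1" for F :: "real => real => real"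
      using that one_plus_cos_pos[of "F Xt Y0"] by (intro isCont_divide isCont_add isCont_sin' isCont_cos' continuous_const) (auto simp: XY0)
    have "isCont (\<lambda>x. (sin (cw dv (X x) (Y x)) / (1 + cos (cw dv (X x) (Y x))) - sin (cz dv (X x) (Y x)) / (1 + cos (cz dv (X x) (Y x)))) /
        (2 * c (cu dv (X x) (Y x)))) ?x"
      by (rule isCont_divide[OF isCont_diff[OF tn[OF cF[OF B.cont_vars(2)]] tn[OF cF[OF B.cont_vars(3)]]] isCont_mult[OF continuous_const cc]])
         (use reg A.c_ne in \<open>auto simp: B.reg_def\<close>)
    then show ?thesis unfolding sl_def[abs_def] B.slope_def .
  qed
  have nd: "\<not> (deriv (\<lambda>x. udiss x t)) differentiable (at ?x)"
  proof
    assume "deriv (\<lambda>x. udiss x t) differentiable (at ?x)"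
    then obtain D where "(deriv (\<lambda>x. udiss x t) has_real_derivative D) (at ?x)" by (auto simp: real_differentiable_def)
    then have lsl: "lip_at sl ?x" by (rule lip_at_cong[OF dsl lip_at_deriv])
    have lbox: "lip_at (\<lambda>x. F (X x) (Y x)) ?x"
      if L: "0 <= L" "\<And>A B. \<bar>A - Xt\<bar> < s ==> \<bar>B - Y0\<bar> < s ==> \<bar>F A B - F Xt Y0\<bar> <= L * (\<bar>A - Xt\<bar> + \<bar>B - Y0\<bar>)" for F L
    proof (rule lip_at_bounded_by[OF lX lY L(1)])
      show "\<forall>\<^sub>F x in nhds ?x. \<bar>F (X x) (Y x) - F (X ?x) (Y ?x)\<bar> <= L * (\<bar>X x - X ?x\<bar> + \<bar>Y x - Y ?x\<bar>)"
        using near unfolding XY0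
      proof eventually_elim
        case (elim x)
        show ?case by (rule L(2)[OF conjunct1[OF m(2)[OF elim]] conjunct2[OF m(2)[OF elim]]])
      qed
    qed
    have tri: "\<bar>p - q\<bar> <= (L1 + L2) * (u + v)" if "\<bar>p - o'\<bar> <= L2 * v" "\<bar>o' - q\<bar> <= L1 * u" "0 <= L1" "0 <= L2" "0 <= u" "0 <= v"
      for p q o' L1 L2 u v :: real
    proof -
      have "\<bar>p - q\<bar> <= L2 * v + L1 * u" using that(1,2) by (simp add: abs_le_iff)
      moreover have "0 <= L1 * v" "0 <= L2 * u" using that by simp_all
      ultimately show ?thesis by (simp add: algebra_simps)
    qed
    have lbox2: "lip_at (\<lambda>x. F (X x) (Y x)) ?x"
      if lx: "loc_lipschitz_X G" and ly: "loc_lipschitz_Y F" and FG: "\<And>A. \<bar>A - Xt\<bar> < s ==> F A Y0 = G A Y0" for F G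
    proof -
      obtain L1 where L1: "0 <= L1" "\<forall>X1 X2 Y. inbox r X1 Y --> inbox r X2 Y --> \<bar>G X2 Y - G X1 Y\<bar> <= L1 * \<bar>X2 - X1\<bar>"
        using box_lipschitz_X[OF g lx] by blast
      obtain L2 where L2: "0 <= L2" "\<forall>X Y1 Y2. inbox r X Y1 --> inbox r X Y2 --> \<bar>F X Y2 - F X Y1\<bar> <= L2 * \<bar>Y2 - Y1\<bar>"
        using box_lipschitz_Y[OF g ly] by blast
      show ?thesis
      proof (rule lbox[of "L1 + L2"])
        fix A B assume AB: "\<bar>A - Xt\<bar> < s" "\<bar>B - Y0\<bar> < s"
        have i: "inbox r A B" "inbox r A Y0" using ib[OF AB] ib[OF AB(1), of Y0] s(1) by auto
        have 1: "\<bar>F A B - F A Y0\<bar> <= L2 * \<bar>B - Y0\<bar>" using L2(2) i by blast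
        have 2: "\<bar>F A Y0 - F Xt Y0\<bar> <= L1 * \<bar>A - Xt\<bar>" using L1(2) i(2) it FG[OF AB(1)] FG[of Xt] s(1) by simp
        show "\<bar>F A B - F Xt Y0\<bar> <= (L1 + L2) * (\<bar>A - Xt\<bar> + \<bar>B - Y0\<bar>)" by (rule tri[OF 1 2 L1(1) L2(1)]) simp_all
      qed (use L1(1) L2(1) in simp)
    qed
    have sl0: "same_vars cv dv A Y0" if A: "\<bar>A - Xt\<bar> < s" for A
    proof -
      have b: "0 < A + Y0 \<and> \<bar>ct dv A Y0 - ct dv Xt Y0\<bar> <= (t0 + \<eta> - t) / 2" using s2(2)[of A Y0] A s s2(1) by simp
      then have "ct dv A Y0 - t <= (t0 + \<eta> - t) / 2" unfolding tau using abs_le_D1 by blast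
      then have "ct dv A Y0 < t0 + \<eta>" using t by (simp add: field_simps)
      then show ?thesis by (intro tau_in_E(2)[OF R]) (use b in \<open>auto simp: in_E_def\<close>)
    qed
    have lips: "loc_lipschitz_Y (cw dv)" "loc_lipschitz_Y (cu dv)" by (rule B.lipY; simp)+
    have lipu: "loc_lipschitz_X (cu dv)" by (rule B.lipX) simp
    have lw: "lip_at (\<lambda>x. cw dv (X x) (Y x)) ?x"
      by (rule lbox2[OF smooth_imp_loc_lipschitz_X[OF smooth_vars(2)] lips(1)]) (use sl0 in \<open>auto simp: same_vars_def\<close>)
    have lu: "lip_at (\<lambda>x. cu dv (X x) (Y x)) ?x" by (rule lbox2[OF lipu lips(2)]) simp
    have lzs: "lip_at (\<lambda>x. cz cv (X x) (Y x)) ?x" by (rule lbox2[OF smooth_imp_loc_lipschitz_X[OF smooth_vars(3)] smooth_imp_loc_lipschitz_Y[OF smooth_vars(3)]]) simp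
    have wne: "1 + cos (cw dv (X ?x) (Y ?x)) \<noteq> 0" using one_plus_cos_pos[of "cw dv Xt Y0"] reg unfolding XY0 B.reg_def by simp
    have dg: "\<exists>D. ((\<lambda>v. sin v / (1 + cos v)) has_real_derivative D) (at (cw dv (X ?x) (Y ?x)))"
      by (rule exI, (rule derivative_eq_intros refl wne)+)
    then obtain D1 where D1: "((\<lambda>v. sin v / (1 + cos v)) has_real_derivative D1) (at (cw dv (X ?x) (Y ?x)))" by blast
    have "lip_at (\<lambda>x. sin (cw dv (X x) (Y x)) / (1 + cos (cw dv (X x) (Y x))) - 2 * c (cu dv (X x) (Y x)) * sl x) ?x"
      by (intro lip_at_diff lip_at_mult lip_at_const lsl lip_at_compose[OF lw D1] lip_at_compose[OF lu A.c_deriv])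
    from lip_at_compose[OF this DERIV_cmult[OF DERIV_arctan]]
    have "lip_at (\<lambda>x. 2 * arctan (sin (cw dv (X x) (Y x)) / (1 + cos (cw dv (X x) (Y x))) - 2 * c (cu dv (X x) (Y x)) * sl x)) ?x"
      by simp
    then have lzt: "lip_at (\<lambda>x. cz dv (X x) (Y x)) ?x"
    proof (rule lip_at_cong[rotated])
      show "\<forall>\<^sub>F x in nhds ?x. 2 * arctan (sin (cw dv (X x) (Y x)) / (1 + cos (cw dv (X x) (Y x))) - 2 * c (cu dv (X x) (Y x)) * sl x) = cz dv (X x) (Y x)"
        using near
      proof eventually_elim
        case (elim x)
        have i: "inbox r (X x) (Y x)" by (rule ib) (use m(2)[OF elim] in auto)
        let ?z = "cz dv (X x) (Y x)"
        have "sin (cw dv (X x) (Y x)) / (1 + cos (cw dv (X x) (Y x))) - 2 * c (cu dv (X x) (Y x)) * sl x = sin ?z / (1 + cos ?z)"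
          using A.c_ne[of "cu dv (X x) (Y x)"] unfolding sl_def B.slope_def by simp
        also have "\<dots> = tan (?z / 2)" using tan_half[of "?z / 2"] by (simp add: add.commute)
        finally show ?case using good_boxD(9,10)[OF g i] by (simp add: arctan_tan)
      qed
    qed
    obtain K where K: "0 <= K" "\<forall>\<^sub>F x in nhds ?x. \<bar>(cz cv (X x) (Y x) - cz dv (X x) (Y x)) - (cz cv (X ?x) (Y ?x) - cz dv (X ?x) (Y ?x))\<bar> <= K * \<bar>x - ?x\<bar>"
      using lip_at_diff[OF lzs lzt] by (rule lip_atE)
    \<comment> \<open>Left of the characteristic \<open>Y - Y0\<close> is at least proportional to the distance from it.\<close>
    have "((\<lambda>y. (Y y - Y ?x) / (y - ?x)) \<longlongrightarrow> - \<nu>) (at ?x)" using \<nu>(2) by (simp add: has_field_derivative_iff)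
    then have "\<forall>\<^sub>F y in at ?x. (Y y - Y ?x) / (y - ?x) < - \<nu> / 2" by (rule order_tendstoD(2)) (use \<nu>(1) in simp)
    then have e1: "\<forall>\<^sub>F y in at_left ?x. (Y y - Y ?x) / (y - ?x) < - \<nu> / 2" by (simp add: eventually_at_split)
    \<comment> \<open>Below the height \<open>Y0 + \<zeta>\<close> the square root lower bound exceeds the linear upper bound.\<close>
    define \<zeta> where "\<zeta> = (k * \<nu> / (2 * K + 1))\<^sup>2"
    have \<zeta>: "0 < \<zeta>" using k \<nu>(1) K(1) by (simp add: \<zeta>_def)
    have "\<forall>\<^sub>F x in nhds ?x. Y x < Y0 + \<zeta>" using order_tendstoD(2)[OF lip_at_tendsto[OF lY], of "Y0 + \<zeta>"] \<zeta> unfolding XY0 by simp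
    moreover note near K(2)
    ultimately have "\<forall>\<^sub>F x in nhds ?x. \<bar>x - ?x\<bar> < m \<and> Y x < Y0 + \<zeta> \<and> \<bar>cz cv (X x) (Y x) - cz dv (X x) (Y x)\<bar> <= K * \<bar>x - ?x\<bar>"
      unfolding XY0 tau(4) by eventually_elim simp
    then have e2: "\<forall>\<^sub>F x in at_left ?x. \<bar>x - ?x\<bar> < m \<and> Y x < Y0 + \<zeta> \<and> \<bar>cz cv (X x) (Y x) - cz dv (X x) (Y x)\<bar> <= K * \<bar>x - ?x\<bar>"
      unfolding eventually_at_filter by eventually_elim blast
    have "\<forall>\<^sub>F x in at_left ?x. x < ?x" by (simp add: eventually_at_filter)
    with e1 e2 have "\<forall>\<^sub>F x in at_left ?x. False"
    proof eventually_elim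
      case (elim x)
      have dx: "0 < ?x - x" using elim(3) by simp
      have y: "\<nu> / 2 * (?x - x) < Y x - Y0" using elim(1) dx unfolding XY0 by (simp add: field_simps)
      have "0 < \<nu> / 2 * (?x - x)" using \<nu>(1) dx by simp
      with y have Yg: "Y0 < Y x" by linarith
      have b: "\<bar>X x - Xt\<bar> < s" "\<bar>Y x - Y0\<bar> < s" using m(2) elim(2) by blast+
      have "cz cv (X x) (Y x) - cz dv (X x) (Y x) <= - k * sqrt (Y x - Y0)"
        by (rule gap) (use b s Yg pXY t in \<open>auto simp: abs_less_iff\<close>)
      then have "k * sqrt (Y x - Y0) <= K * (?x - x)" using elim(2) dx by (simp add: abs_le_iff)
      then have "(k * sqrt (Y x - Y0)) * \<nu> <= (K * (?x - x)) * \<nu>" using \<nu>(1) by (intro mult_right_mono) auto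
      also have "\<dots> = 2 * K * (\<nu> / 2 * (?x - x))" by simp
      also have "\<dots> <= 2 * K * (Y x - Y0)" using y K(1) by (intro mult_left_mono) auto
      also have "\<dots> = (2 * K * sqrt (Y x - Y0)) * sqrt (Y x - Y0)" using Yg by simp
      finally have "(k * \<nu>) * sqrt (Y x - Y0) <= (2 * K * sqrt (Y x - Y0)) * sqrt (Y x - Y0)" by (simp add: mult_ac)
      then have le: "k * \<nu> <= 2 * K * sqrt (Y x - Y0)" using Yg by (simp add: mult_le_cancel_right)
      have "sqrt (Y x - Y0) < k * \<nu> / (2 * K + 1)"
        by (rule real_less_lsqrt) (use k \<nu>(1) K(1) elim(2) in \<open>auto simp: \<zeta>_def\<close>)
      then have "sqrt (Y x - Y0) * (2 * K + 1) < k * \<nu>" using K(1) by (simp add: pos_less_divide_eq)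
      moreover have "0 < sqrt (Y x - Y0)" using Yg by simp
      moreover have "sqrt (Y x - Y0) * (2 * K + 1) = sqrt (Y x - Y0) + 2 * K * sqrt (Y x - Y0)" by (simp add: algebra_simps)
      ultimately show False using le by linarith
    qed
    then show False by simp
  qed
  show ?thesis unfolding weak_singularity_def
  proof (intro conjI nd)
    show "\<forall>\<^sub>F x in nhds ?x. (\<lambda>x. udiss x t) differentiable (at x)"
      using near by eventually_elim (use der in \<open>auto simp: real_differentiable_def\<close>)
    show "isCont (deriv (\<lambda>x. udiss x t)) ?x" using csl isCont_cong[OF dsl] by blast
  qed
qed

end

section \<open>Comparison with the characteristic through the origin of the singularity\<close>

lemma increment_bounds:
  fixes f :: "real => real"
  assumes ab: "a <= b" and d: "\<And>x. a <= x ==> x <= b ==> (f has_real_derivative f' x) (at x)"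
  shows "(\<And>x. a <= x ==> x <= b ==> f' x <= M) ==> f b - f a <= M * (b - a)"
    "(\<And>x. a <= x ==> x <= b ==> m <= f' x) ==> m * (b - a) <= f b - f a"
    "(\<And>x. a <= x ==> x <= b ==> \<bar>f' x\<bar> <= M) ==> \<bar>f b - f a\<bar> <= M * (b - a)"
proof -
  have "a = b \<or> (\<exists>z. a <= z \<and> z <= b \<and> f b - f a = (b - a) * f' z)"
  proof (cases "a = b")
    case False
    then have "a < b" using ab by simp
    from MVT2[OF this, of f f'] d obtain z where "a < z" "z < b" "f b - f a = (b - a) * f' z" by auto
    then show ?thesis by (intro disjI2 exI[of _ z]) simp
  qed simp
  then consider "a = b" | z where "a <= z" "z <= b" "f b - f a = (b - a) * f' z" by blast
  note C = this
  show "f b - f a <= M * (b - a)" if "\<And>x. a <= x ==> x <= b ==> f' x <= M"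
    using C by cases (use that ab in \<open>auto simp: mult.commute[of M] intro!: mult_left_mono\<close>)
  show "m * (b - a) <= f b - f a" if "\<And>x. a <= x ==> x <= b ==> m <= f' x"
    using C by cases (use that ab in \<open>auto simp: mult.commute[of m] intro!: mult_left_mono\<close>)
  show "\<bar>f b - f a\<bar> <= M * (b - a)" if "\<And>x. a <= x ==> x <= b ==> \<bar>f' x\<bar> <= M"
    using C by cases (use that ab in \<open>auto simp: mult.commute[of M] abs_mult intro!: mult_left_mono\<close>)
qed

lemma one_plus_cos_near_pi: "1 + cos (w::real) <= (w - pi)\<^sup>2" "\<bar>sin w\<bar> <= \<bar>w - pi\<bar>"
proof -
  have 1: "1 + cos w = 2 * (sin ((w - pi) / 2))\<^sup>2"
  proof -
    have "2 * ((w - pi) / 2) = w - pi" by simp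
    then have "cos (w - pi) = 1 - 2 * (sin ((w - pi) / 2))\<^sup>2" using cos_double_sin[of "(w - pi) / 2"] by (simp only:)
    then show ?thesis by (simp add: cos_diff)
  qed
  have "(sin ((w - pi) / 2))\<^sup>2 <= ((w - pi) / 2)\<^sup>2" using abs_sin_x_le_abs_x[of "(w - pi) / 2"] by (simp only: abs_le_square_iff)
  then have "1 + cos w <= 2 * ((w - pi) / 2)\<^sup>2" unfolding 1 by simp
  also have "\<dots> = (w - pi)\<^sup>2 / 2" by (simp add: power_divide)
  finally show "1 + cos w <= (w - pi)\<^sup>2" using zero_le_power2[of "w - pi"] by linarith
  have "sin w = - sin (w - pi)" by (simp add: sin_diff)
  then show "\<bar>sin w\<bar> <= \<bar>w - pi\<bar>" using abs_sin_x_le_abs_x[of "w - pi"] by simp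
qed

text \<open>With \<open>v = (\<pi> - w)/2\<close> the right-hand side is \<open>2 sin\<^sup>2 v\<close>, and \<open>sin v\<close> is at least \<open>v/2\<close> for such \<open>v\<close>.\<close>

lemma one_plus_cos_ge:
  assumes "pi / 2 <= (w::real)" "w <= pi"
  shows "(pi - w)\<^sup>2 / 8 <= 1 + cos w"
proof -
  define v where "v = (pi - w) / 2"
  have v: "0 <= v" "v <= pi / 4" using assms by (simp_all add: v_def)
  have "1 / 2 * (v - 0) <= sin v - sin 0"
  proof (rule increment_bounds(2)[OF v(1) DERIV_sin])
    fix x :: real assume x: "0 <= x" "x <= v"
    have "cos (pi / 3) <= cos x" by (rule cos_monotone_0_pi_le) (use x v in auto)
    then show "1 / 2 <= cos x" by (simp add: cos_60)
  qed
  then have "(v / 2)\<^sup>2 <= (sin v)\<^sup>2" using v by (intro power_mono) auto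
  moreover have "1 + cos w = 2 * (sin v)\<^sup>2"
  proof -
    have "2 * v = pi - w" by (simp add: v_def)
    then have "cos (pi - w) = 1 - 2 * (sin v)\<^sup>2" using cos_double_sin[of v] by (simp only:)
    then show ?thesis by (simp add: cos_diff)
  qed
  moreover have "2 * (v / 2)\<^sup>2 = (pi - w)\<^sup>2 / 8" by (simp add: v_def power_divide)
  ultimately show ?thesis by linarith
qed

lemma (in wave_speed) c_lipschitz_bounded:
  obtains L where "0 <= L" "\<And>v v'. \<bar>v\<bar> <= U ==> \<bar>v'\<bar> <= U ==> \<bar>c v - c v'\<bar> <= L * \<bar>v - v'\<bar>"
proof -
  obtain L where L: "L-lipschitz_on {-U..U} c"
    using C1_lipschitz_on_interval[of "-U" U c "deriv c"] c_deriv continuous_on_subset[OF cont_c(2)] by blast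
  show thesis
  proof (rule that[of L])
    show "0 <= L" by (rule lipschitz_on_nonneg[OF L])
    fix v v' assume "\<bar>v\<bar> <= U" "\<bar>v'\<bar> <= U"
    then have "v \<in> {-U..U}" "v' \<in> {-U..U}" by (auto simp: abs_le_iff)
    then show "\<bar>c v - c v'\<bar> <= L * \<bar>v - v'\<bar>" using lipschitz_onD[OF L] by (simp add: dist_real_def)
  qed
qed

context singular_origin
begin

text \<open>The foot of a point is taken vertically below it on the line \<open>Y = Y0\<close>, or is \<open>P\<close> if the point lies to the left of the axis. For an elapsed time \<open>T\<close> the value of \<open>u\<close> at the foot differs by \<open>O(T)\<close>, but \<open>x + k t\<close> only by \<open>O(T (E + T))\<close> if \<open>k\<close> is within \<open>E\<close> of the wave speed at the foot.\<close>

definition descends :: "char_vars => real => real => real => real => bool" where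
  "descends sv K k0 X Y \<longleftrightarrow> (let T = ct sv X Y - t0; X' = max X0 X in
     \<bar>cu sv X Y - cu cv X' Y0\<bar> <= K * T \<and>
     (\<forall>k E. 0 <= k --> k <= k0 --> \<bar>k - c (cu cv X' Y0)\<bar> <= E -->
        \<bar>(cx sv X Y + k * ct sv X Y) - (cx cv X' Y0 + k * ct cv X' Y0)\<bar> <= K * T * (E + T)))"

text \<open>Downwards the derivative of \<open>x + k t\<close> is \<open>(k - c) t_Y\<close>, where \<open>k - c\<close> is bounded by \<open>E\<close> and the variation of \<open>u\<close>. Left of the axis a horizontal piece is needed first, on which \<open>w - \<pi>\<close> is of order \<open>Y - Y0\<close>, so that \<open>1 + cos w\<close> is of second order. As \<open>t\<close> grows at a positive rate with \<open>Y\<close>, \<open>Y - Y0\<close> is of order \<open>T\<close>.\<close>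

lemma ex_descends:
  assumes S: "char_sol c \<theta> sv u0 u1" and g: "good_box r"
    and zne: "\<forall>X Y. inbox r X Y --> cos (cz sv X Y) \<noteq> -1" and tP: "ct sv X0 Y0 = t0" and N: "0 <= N" and k0: "0 <= k0"
  shows "\<exists>K\<ge>0. \<exists>a3>0. \<forall>a X Y. 0 < a --> a <= a3 --> X0 - a < X --> inbox r X Y --> Y0 < Y -->
     (\<forall>\<xi>. X <= \<xi> --> \<xi> <= X0 --> 1 + cos (cw sv \<xi> Y) <= N * (Y - Y0)\<^sup>2 \<and> \<bar>sin (cw sv \<xi> Y)\<bar> <= N * (Y - Y0)) -->
     cu sv (max X0 X) Y0 = cu cv (max X0 X) Y0 --> cx sv (max X0 X) Y0 = cx cv (max X0 X) Y0 -->
     ct sv (max X0 X) Y0 = ct cv (max X0 X) Y0 --> descends sv K k0 X Y"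
proof -
  interpret S: char_sol c \<theta> sv u0 u1 by (rule S)
  have r0: "0 < r" by (rule good_box_pos[OF g])
  define P where "P X Y = cp sv X Y / (4 * c (cu sv X Y))" for X Y
  have cP: "continuous_on half_plane (\<lambda>(X, Y). P X Y)" "continuous_on half_plane (\<lambda>(X, Y). c (cu sv X Y))"
    unfolding P_def split_def by (intro continuous_intros S.cont_fst_snd S.cont_c_u ballI; simp add: A.c_ne)+
  obtain M1 where M1: "0 <= M1" "\<forall>X Y. inbox r X Y --> \<bar>rhs_uY c sv X Y\<bar> <= M1" using box_bounded[OF g S.cont_rhs(2)] by blast
  obtain M2 where M2: "0 <= M2" "\<forall>X Y. inbox r X Y --> \<bar>rhs_tY c sv X Y\<bar> <= M2" using box_bounded[OF g S.cont_rhs(10)] by blast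
  obtain M3 where M3: "0 <= M3" "\<forall>X Y. inbox r X Y --> \<bar>P X Y\<bar> <= M3" using box_bounded[OF g cP(1)] by blast
  obtain M4 where M4: "0 <= M4" "\<forall>X Y. inbox r X Y --> \<bar>c (cu sv X Y)\<bar> <= M4" using box_bounded[OF g cP(2)] by blast
  obtain U where U: "0 <= U" "\<forall>X Y. inbox r X Y --> \<bar>cu sv X Y\<bar> <= U" using box_bounded[OF g S.cont_vars(1)] by blast
  have "\<exists>m>0. \<forall>X Y. inbox r X Y --> m <= rhs_tY c sv X Y"
    by (rule box_lower[OF g S.cont_rhs(10)]) (use S.rhs_signs(8) good_boxD(1,2)[OF g] zne in auto)
  then obtain m where m: "0 < m" "\<forall>X Y. inbox r X Y --> m <= rhs_tY c sv X Y" by blast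
  define M where "M = M1 + M2 + M3 + M4 + k0"
  have M: "0 <= M" "k0 <= M" using M1(1) M2(1) M3(1) M4(1) k0 by (simp_all add: M_def)
  have bd: "\<bar>rhs_uY c sv X Y\<bar> <= M" "\<bar>rhs_tY c sv X Y\<bar> <= M" "\<bar>P X Y\<bar> <= M" "\<bar>c (cu sv X Y)\<bar> <= M" if "inbox r X Y" for X Y
  proof -
    have "\<bar>rhs_uY c sv X Y\<bar> <= M1" "\<bar>rhs_tY c sv X Y\<bar> <= M2" "\<bar>P X Y\<bar> <= M3" "\<bar>c (cu sv X Y)\<bar> <= M4"
      using M1(2) M2(2) M3(2) M4(2) that by blast+
    then show "\<bar>rhs_uY c sv X Y\<bar> <= M" "\<bar>rhs_tY c sv X Y\<bar> <= M" "\<bar>P X Y\<bar> <= M" "\<bar>c (cu sv X Y)\<bar> <= M"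
      using M1(1) M2(1) M3(1) M4(1) k0 unfolding M_def by linarith+
  qed
  show ?thesis
  proof (rule A.c_lipschitz_bounded[of U])
    fix L assume L: "0 <= L" "\<And>v v'. \<bar>v\<bar> <= U ==> \<bar>v'\<bar> <= U ==> \<bar>c v - c v'\<bar> <= L * \<bar>v - v'\<bar>"
    \<comment> \<open>Horizontal pieces of length at most \<open>a3\<close> cost at most half of the time gained along the vertical one.\<close>
    define a3 where "a3 = m / (2 * (N * M * r + 1))"
    have NM: "0 <= N * M * r" using N M r0 by simp
    have a3: "0 < a3" using m(1) NM by (simp add: a3_def)
    define K1 where "K1 = 2 / m"
    define K' where "K' = M + L * M * M + 2 * M * (N * M) * r"
    define K where "K = (M + N * M * r) * K1 + K' * K1 * (K1 + 1)"
    have K1: "0 <= K1" using m(1) by (simp add: K1_def)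
    have K': "0 <= K'" using M L(1) N r0 by (simp add: K'_def)
    have Kparts: "0 <= (M + N * M * r) * K1" "0 <= K' * K1 * (K1 + 1)" using K1 K' M NM by simp_all
    have main: "descends sv K k0 X Y"
      if a: "0 < a" "a <= a3" "X0 - a < X" and b: "inbox r X Y" and Y: "Y0 < Y"
        and hz: "\<And>\<xi>. X <= \<xi> ==> \<xi> <= X0 ==> 1 + cos (cw sv \<xi> Y) <= N * (Y - Y0)\<^sup>2 \<and> \<bar>sin (cw sv \<xi> Y)\<bar> <= N * (Y - Y0)"
        and same: "cu sv (max X0 X) Y0 = cu cv (max X0 X) Y0" "cx sv (max X0 X) Y0 = cx cv (max X0 X) Y0" "ct sv (max X0 X) Y0 = ct cv (max X0 X) Y0"
      for a X Y
    proof -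
      define X' where "X' = max X0 X"
      define y where "y = Y - Y0"
      define T where "T = ct sv X Y - t0"
      have y: "0 < y" "y <= r" using Y b by (auto simp: y_def inbox_def)
      have ib: "inbox r \<xi> \<upsilon>" if "X <= \<xi>" "\<xi> <= X'" "Y0 <= \<upsilon>" "\<upsilon> <= Y" for \<xi> \<upsilon>
        using that b r0 unfolding inbox_def X'_def by (auto simp: abs_le_iff max_def split: if_splits)
      have XX': "X <= X'" "X0 <= X'" by (auto simp: X'_def)
      have ibv: "inbox r X' \<upsilon>" if "Y0 <= \<upsilon>" "\<upsilon> <= Y" for \<upsilon> by (rule ib) (use that XX' in auto)
      have hpv: "0 < X' + \<upsilon>" if "Y0 <= \<upsilon>" "\<upsilon> <= Y" for \<upsilon> by (rule good_boxD(1)[OF g ibv[OF that]])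
      have Yle: "Y0 <= Y" using Y by simp
      \<comment> \<open>Along vertical lines \<open>x + k t\<close> varies only through the factor \<open>k - c\<close>.\<close>
      have uv: "\<bar>cu sv X' \<upsilon> - cu sv X' Y0\<bar> <= M * (\<upsilon> - Y0)" if v: "Y0 <= \<upsilon>" "\<upsilon> <= Y" for \<upsilon>
      proof (rule increment_bounds(3)[where f="\<lambda>Y. cu sv X' Y" and f'="\<lambda>Y. rhs_uY c sv X' Y", OF v(1)])
        fix x assume x: "Y0 <= x" "x <= \<upsilon>"
        show "((\<lambda>Y. cu sv X' Y) has_real_derivative rhs_uY c sv X' x) (at x)" using S.C1(2)[OF hpv[of x]] x v unfolding has_dY_def by simp
        show "\<bar>rhs_uY c sv X' x\<bar> <= M" by (rule bd(1)[OF ibv]) (use x v in auto)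
      qed
      have tv: "m * y <= ct sv X' Y - ct sv X' Y0"
        unfolding y_def
      proof (rule increment_bounds(2)[where f="\<lambda>Y. ct sv X' Y" and f'="\<lambda>Y. rhs_tY c sv X' Y", OF Yle])
        fix x assume x: "Y0 <= x" "x <= Y"
        show "((\<lambda>Y. ct sv X' Y) has_real_derivative rhs_tY c sv X' x) (at x)" using S.C1(6)[OF hpv[OF x]] unfolding has_dY_def by simp
        show "m <= rhs_tY c sv X' x" using m(2) ibv[OF x] by blast
      qed
      have Fv: "\<bar>(cx sv X' Y + k * ct sv X' Y) - (cx sv X' Y0 + k * ct sv X' Y0)\<bar> <= (E + L * (M * y)) * M * y"
        if kE: "\<bar>k - c (cu sv X' Y0)\<bar> <= E" for k E
        unfolding y_def
      proof (rule increment_bounds(3)[where f="\<lambda>Y. cx sv X' Y + k * ct sv X' Y" and f'="\<lambda>Y. rhs_xY sv X' Y + k * rhs_tY c sv X' Y", OF Yle])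
        fix x assume x: "Y0 <= x" "x <= Y"
        show "((\<lambda>Y. cx sv X' Y + k * ct sv X' Y) has_real_derivative rhs_xY sv X' x + k * rhs_tY c sv X' x) (at x)"
          using S.C1(4,6)[OF hpv[OF x]] unfolding has_dY_def by (auto intro!: derivative_eq_intros)
        have "\<bar>c (cu sv X' Y0) - c (cu sv X' x)\<bar> <= L * \<bar>cu sv X' Y0 - cu sv X' x\<bar>"
          by (rule L(2)) (use U(2) ibv x Yle in auto)
        also have "\<dots> <= L * (M * (x - Y0))" using uv[OF x] L(1) by (intro mult_left_mono) (auto simp: abs_minus_commute)
        also have "\<dots> <= L * (M * (Y - Y0))" using x L(1) M(1) by (intro mult_left_mono) auto
        finally have "\<bar>k - c (cu sv X' x)\<bar> <= E + L * (M * (Y - Y0))"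
          using kE abs_triangle_ineq[of "k - c (cu sv X' Y0)" "c (cu sv X' Y0) - c (cu sv X' x)"] by simp
        then have "\<bar>k - c (cu sv X' x)\<bar> * \<bar>rhs_tY c sv X' x\<bar> <= (E + L * (M * (Y - Y0))) * M"
          using bd(2)[OF ibv[OF x]] by (intro mult_mono) auto
        moreover have "rhs_xY sv X' x + k * rhs_tY c sv X' x = (k - c (cu sv X' x)) * rhs_tY c sv X' x"
          unfolding S.rhs_x_t(2) by (simp add: algebra_simps)
        ultimately show "\<bar>rhs_xY sv X' x + k * rhs_tY c sv X' x\<bar> <= (E + L * (M * (Y - Y0))) * M" by (simp add: abs_mult)
      qed
      \<comment> \<open>Left of the axis the path to it is nearly characteristic: \<open>1 + cos w\<close> is quadratically small.\<close>
      have H: "\<bar>cu sv X' Y - cu sv X Y\<bar> <= (N * y * M) * r \<and> ct sv X' Y - ct sv X Y <= (N * y\<^sup>2 * M) * a \<and>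
        (\<forall>k. 0 <= k --> k <= k0 --> \<bar>(cx sv X' Y + k * ct sv X' Y) - (cx sv X Y + k * ct sv X Y)\<bar> <= (2 * M * (N * y\<^sup>2 * M)) * r)"
      proof (cases "X0 <= X")
        case True
        then have "X' = X" by (simp add: X'_def)
        then show ?thesis using N M y a r0 by simp
      next
        case False
        then have e: "X' = X0" and le: "X <= X0" by (auto simp: X'_def)
        have Xr: "X0 - X <= r" "X0 - X <= a" using b a by (auto simp: inbox_def abs_le_iff)
        have ibh: "inbox r x Y" if "X <= x" "x <= X0" for x by (rule ib) (use that e Yle in auto)
        have hph: "0 < x + Y" if "X <= x" "x <= X0" for x by (rule good_boxD(1)[OF g ibh[OF that]])
        have tX: "0 <= rhs_tX c sv x Y \<and> rhs_tX c sv x Y <= N * y\<^sup>2 * M" if x: "X <= x" "x <= X0" for x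
        proof
          show "0 <= rhs_tX c sv x Y" using S.rhs_signs(3)[of x Y] hph[OF x] by simp
          have "rhs_tX c sv x Y = (1 + cos (cw sv x Y)) * P x Y" by (simp add: rhs_tX_def P_def)
          also have "\<dots> <= (1 + cos (cw sv x Y)) * M"
            using bd(3)[OF ibh[OF x]] one_plus_cos_nonneg[of "cw sv x Y"] by (intro mult_left_mono) auto
          also have "\<dots> <= N * y\<^sup>2 * M" using hz[OF x] M(1) unfolding y_def by (intro mult_right_mono) auto
          finally show "rhs_tX c sv x Y <= N * y\<^sup>2 * M" .
        qed
        have "\<bar>cu sv X0 Y - cu sv X Y\<bar> <= (N * y * M) * (X0 - X)"
        proof (rule increment_bounds(3)[where f="\<lambda>X. cu sv X Y" and f'="\<lambda>X. rhs_uX c sv X Y", OF le])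
          fix x assume x: "X <= x" "x <= X0"
          show "((\<lambda>X. cu sv X Y) has_real_derivative rhs_uX c sv x Y) (at x)" using S.C1(1)[OF hph[OF x]] unfolding has_dX_def .
          have "\<bar>sin (cw sv x Y)\<bar> * \<bar>P x Y\<bar> <= (N * y) * M"
            using hz[OF x] bd(3)[OF ibh[OF x]] N y unfolding y_def by (intro mult_mono) auto
          moreover have "rhs_uX c sv x Y = sin (cw sv x Y) * P x Y" by (simp add: rhs_uX_def P_def)
          ultimately show "\<bar>rhs_uX c sv x Y\<bar> <= N * y * M" by (simp add: abs_mult)
        qed
        also have "\<dots> <= (N * y * M) * r" using Xr N y M by (intro mult_left_mono) auto
        finally have 1: "\<bar>cu sv X0 Y - cu sv X Y\<bar> <= (N * y * M) * r" .
        have "ct sv X0 Y - ct sv X Y <= (N * y\<^sup>2 * M) * (X0 - X)"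
          by (rule increment_bounds(1)[where f="\<lambda>X. ct sv X Y" and f'="\<lambda>X. rhs_tX c sv X Y", OF le])
             (use S.C1(5)[OF hph] tX in \<open>auto simp: has_dX_def\<close>)
        also have "\<dots> <= (N * y\<^sup>2 * M) * a" using Xr N y M by (intro mult_left_mono) auto
        finally have 2: "ct sv X0 Y - ct sv X Y <= (N * y\<^sup>2 * M) * a" .
        have 3: "\<bar>(cx sv X0 Y + k * ct sv X0 Y) - (cx sv X Y + k * ct sv X Y)\<bar> <= (2 * M * (N * y\<^sup>2 * M)) * r" if k: "0 <= k" "k <= k0" for k
        proof -
          have "\<bar>(cx sv X0 Y + k * ct sv X0 Y) - (cx sv X Y + k * ct sv X Y)\<bar> <= (2 * M * (N * y\<^sup>2 * M)) * (X0 - X)"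
          proof (rule increment_bounds(3)[where f="\<lambda>X. cx sv X Y + k * ct sv X Y" and f'="\<lambda>X. rhs_xX sv X Y + k * rhs_tX c sv X Y", OF le])
            fix x assume x: "X <= x" "x <= X0"
            show "((\<lambda>X. cx sv X Y + k * ct sv X Y) has_real_derivative rhs_xX sv x Y + k * rhs_tX c sv x Y) (at x)"
              using S.C1(3,5)[OF hph[OF x]] unfolding has_dX_def by (auto intro!: derivative_eq_intros)
            have ck: "\<bar>c (cu sv x Y) + k\<bar> <= 2 * M" using bd(4)[OF ibh[OF x]] k M(2) by (auto simp: abs_le_iff)
            have "\<bar>c (cu sv x Y) + k\<bar> * \<bar>rhs_tX c sv x Y\<bar> <= (2 * M) * (N * y\<^sup>2 * M)"
              by (rule mult_mono[OF ck]) (use tX[OF x] M(1) in auto)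
            moreover have "rhs_xX sv x Y + k * rhs_tX c sv x Y = (c (cu sv x Y) + k) * rhs_tX c sv x Y"
              unfolding S.rhs_x_t(1) by (simp add: algebra_simps)
            ultimately show "\<bar>rhs_xX sv x Y + k * rhs_tX c sv x Y\<bar> <= 2 * M * (N * y\<^sup>2 * M)" by (simp add: abs_mult)
          qed
          also have "\<dots> <= (2 * M * (N * y\<^sup>2 * M)) * r" using Xr N M by (intro mult_left_mono) auto
          finally show ?thesis .
        qed
        show ?thesis unfolding e using 1 2 3 by blast
      qed
      \<comment> \<open>The choice of \<open>a3\<close> lets the gain of \<open>t\<close> along the vertical part win over the loss along the horizontal one.\<close>
      have yT: "y <= K1 * T"
      proof -
        have "t0 <= ct sv X' Y0" using S.mono_X(2)[of X0 Y0 X'] P_interior XX' tP by simp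
        then have low: "m * y - (N * y\<^sup>2 * M) * a <= T" using tv H unfolding T_def by linarith
        have "a * (2 * (N * M * r + 1)) <= m" using a(2) NM by (simp add: a3_def pos_le_divide_eq)
        then have "(N * M * r) * a <= m / 2" using a(1) by (simp add: algebra_simps)
        then have h: "((N * M * r) * a) * y <= m / 2 * y" using y by (intro mult_right_mono) auto
        have "(N * M * a * y) * y <= (N * M * a * y) * r" by (rule mult_left_mono) (use y N M a in auto)
        then have "(N * y\<^sup>2 * M) * a <= ((N * M * r) * a) * y" by (simp add: power2_eq_square mult_ac)
        then have "m / 2 * y <= T" using low h by (simp add: field_simps)
        then show ?thesis using m(1) by (simp add: K1_def field_simps)
      qed
      have T: "0 < T"
      proof (rule ccontr)
        assume "\<not> 0 < T"
        then have "K1 * T <= 0" using K1 by (simp add: mult_nonneg_nonpos)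
        then show False using yT y(1) by linarith
      qed
      have eqs: "cu sv X' Y0 = cu cv X' Y0" "cx sv X' Y0 = cx cv X' Y0" "ct sv X' Y0 = ct cv X' Y0" using same unfolding X'_def by auto
      have c1: "\<bar>cu sv X Y - cu cv X' Y0\<bar> <= K * T"
      proof -
        have tri: "\<bar>p - q\<bar> <= e1 + e2" if "\<bar>o' - p\<bar> <= e1" "\<bar>o' - q\<bar> <= e2" for p q o' e1 e2 :: real using that by (simp add: abs_le_iff)
        have "\<bar>cu sv X Y - cu sv X' Y0\<bar> <= (N * y * M) * r + M * y" by (rule tri[OF conjunct1[OF H] uv[OF Yle order_refl, folded y_def]])
        also have "\<dots> = (M + N * M * r) * y" by (simp add: algebra_simps)
        also have "\<dots> <= (M + N * M * r) * (K1 * T)" using yT M NM by (intro mult_left_mono) auto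
        also have "\<dots> = ((M + N * M * r) * K1) * T" by (simp only: mult.assoc)
        also have "\<dots> <= K * T" using Kparts T unfolding K_def by (intro mult_right_mono) linarith+
        finally show ?thesis unfolding eqs .
      qed
      have c2: "\<bar>(cx sv X Y + k * ct sv X Y) - (cx cv X' Y0 + k * ct cv X' Y0)\<bar> <= K * T * (E + T)"
        if k: "0 <= k" "k <= k0" and kE: "\<bar>k - c (cu cv X' Y0)\<bar> <= E" for k E
      proof -
        have E: "0 <= E" using kE by (meson abs_ge_zero order_trans)
        have tri: "\<bar>p - q\<bar> <= e1 + e2" if "\<bar>o' - p\<bar> <= e1" "\<bar>o' - q\<bar> <= e2" for p q o' e1 e2 :: real using that by (simp add: abs_le_iff)
        have "\<bar>(cx sv X Y + k * ct sv X Y) - (cx sv X' Y0 + k * ct sv X' Y0)\<bar> <= (2 * M * (N * y\<^sup>2 * M)) * r + (E + L * (M * y)) * M * y"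
          by (rule tri[OF _ Fv]) (use H[THEN conjunct2, THEN conjunct2, rule_format, OF k] kE eqs in auto)
        also have "\<dots> = M * y * E + (L * M * M + 2 * M * (N * M) * r) * (y * y)" by (simp add: algebra_simps power2_eq_square)
        also have "\<dots> <= K' * y * E + K' * (y * y)"
          using y E M L(1) N r0 by (intro add_mono mult_right_mono) (auto simp: K'_def)
        also have "\<dots> = K' * (y * (E + y))" by (simp add: algebra_simps)
        also have "\<dots> <= K' * ((K1 * T) * (E + K1 * T))" using yT y E K' by (intro mult_left_mono mult_mono) auto
        also have "\<dots> <= K' * ((K1 * T) * ((K1 + 1) * (E + T)))"
        proof (intro mult_left_mono K')
          have "0 <= K1 * E" using K1 E by simp
          then show "E + K1 * T <= (K1 + 1) * (E + T)" using T by (simp add: algebra_simps)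
        qed (use K1 T in auto)
        also have "\<dots> = (K' * K1 * (K1 + 1)) * (T * (E + T))" by (simp only: mult_ac)
        also have "\<dots> <= K * (T * (E + T))" using Kparts T E by (intro mult_right_mono) (auto simp: K_def)
        finally show ?thesis unfolding eqs by (simp only: mult.assoc)
      qed
      show ?thesis unfolding descends_def Let_def X'_def[symmetric] T_def[symmetric] using c1 c2 by blast
    qed
    have "0 <= K" using Kparts by (simp add: K_def)
    show ?thesis
    proof (rule exI[of _ K], rule conjI[OF \<open>0 <= K\<close>], rule exI[of _ a3], rule conjI[OF a3], intro allI impI)
      fix a X Y
      assume a: "0 < a" "a <= a3" "X0 - a < X" "inbox r X Y" "Y0 < Y"
        and hz: "\<forall>\<xi>. X <= \<xi> --> \<xi> <= X0 --> 1 + cos (cw sv \<xi> Y) <= N * (Y - Y0)\<^sup>2 \<and> \<bar>sin (cw sv \<xi> Y)\<bar> <= N * (Y - Y0)"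
        and same: "cu sv (max X0 X) Y0 = cu cv (max X0 X) Y0" "cx sv (max X0 X) Y0 = cx cv (max X0 X) Y0"
          "ct sv (max X0 X) Y0 = ct cv (max X0 X) Y0"
      show "descends sv K k0 X Y" by (rule main[OF a _ same]) (simp add: hz)
    qed
  qed
qed

end

section \<open>Distance of the two solutions\<close>

lemma le_of_square_le:
  assumes "0 <= K" "0 < (T::real)" "d\<^sup>2 <= K * T * (d + T)"
  shows "d <= (K + 1) * T"
proof (rule ccontr)
  assume n: "\<not> d <= (K + 1) * T"
  have T0: "0 <= (K + 1) * T" using assms by simp
  then have d: "0 < d" using n by linarith
  have "((K + 1) * T) * d < d * d" using n d by (intro mult_strict_right_mono) auto
  then have 1: "K * T * d + T * d < d * d" by (simp add: algebra_simps)
  have "T * ((K + 1) * T) <= T * d" using n assms(2) by (intro mult_left_mono) auto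
  then have 2: "K * T * T + T * T <= T * d" by (simp add: algebra_simps)
  have 3: "d * d <= K * T * d + K * T * T" using assms(3) by (simp add: power2_eq_square distrib_left)
  have 4: "0 < T * T" using assms(2) by simp
  have "False" if "p + q < e" "s + v <= q" "e <= p + s" "0 < v" for p q e s v :: real using that by linarith
  from this[OF 1 2 3 4] show False .
qed

context singular_origin
begin

text \<open>Between the left branch and the axis \<open>w\<close> exceeds \<open>\<pi>\<close>, but only by \<open>O(Y - Y0)\<close>, since \<open>w <= \<pi>\<close> on the line \<open>Y = Y0\<close>.\<close>

lemma sigma_angle_above_curve:
  assumes g: "good_box r"
  shows "\<exists>N\<ge>0. \<forall>X Y \<xi>. inbox r X Y --> Y0 < Y --> pi < cw cv X Y --> X <= \<xi> --> \<xi> <= X0 -->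
     1 + cos (cw cv \<xi> Y) <= N * (Y - Y0)\<^sup>2 \<and> \<bar>sin (cw cv \<xi> Y)\<bar> <= N * (Y - Y0)"
proof -
  have "loc_lipschitz_Y (cw cv)" by (rule A.lipY) simp
  then obtain L where L: "0 <= L" "\<forall>X Y1 Y2. inbox r X Y1 --> inbox r X Y2 --> \<bar>cw cv X Y2 - cw cv X Y1\<bar> <= L * \<bar>Y2 - Y1\<bar>"
    using box_lipschitz_Y[OF g] by blast
  have "1 + cos (cw cv \<xi> Y) <= (L + L\<^sup>2) * (Y - Y0)\<^sup>2 \<and> \<bar>sin (cw cv \<xi> Y)\<bar> <= (L + L\<^sup>2) * (Y - Y0)"
    if b: "inbox r X Y" and Y: "Y0 < Y" and w: "pi < cw cv X Y" and \<xi>: "X <= \<xi>" "\<xi> <= X0" for X Y \<xi>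
  proof -
    have i: "inbox r \<xi> Y" "inbox r \<xi> Y0" using b \<xi> good_box_pos[OF g] unfolding inbox_def by (auto simp: abs_le_iff)
    have lo: "pi < cw cv \<xi> Y" using w_between[OF g b Y, of \<xi>] w \<xi> by (cases "\<xi> = X") auto
    have "cw cv \<xi> Y0 <= pi" using w_on_line[OF g, of \<xi>] w_P i(2) by (cases "\<xi> = X0") (auto simp: inbox_def)
    moreover have "\<bar>cw cv \<xi> Y - cw cv \<xi> Y0\<bar> <= L * \<bar>Y - Y0\<bar>" using L(2) i by blast
    ultimately have v: "0 <= cw cv \<xi> Y - pi" "cw cv \<xi> Y - pi <= L * (Y - Y0)" using lo Y by (auto simp: abs_le_iff)
    have "1 + cos (cw cv \<xi> Y) <= (cw cv \<xi> Y - pi)\<^sup>2" by (rule one_plus_cos_near_pi(1))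
    also have "\<dots> <= (L * (Y - Y0))\<^sup>2" using v by (intro power_mono)
    also have "\<dots> <= (L + L\<^sup>2) * (Y - Y0)\<^sup>2" using L(1) by (simp add: power_mult_distrib distrib_right)
    finally have 1: "1 + cos (cw cv \<xi> Y) <= (L + L\<^sup>2) * (Y - Y0)\<^sup>2" .
    have "\<bar>sin (cw cv \<xi> Y)\<bar> <= \<bar>cw cv \<xi> Y - pi\<bar>" by (rule one_plus_cos_near_pi(2))
    also have "\<dots> <= L * (Y - Y0)" using v by simp
    also have "\<dots> <= (L + L\<^sup>2) * (Y - Y0)" using Y by (intro mult_right_mono) auto
    finally show ?thesis using 1 by blast
  qed
  then show ?thesis using L(1) by (intro exI[of _ "L + L\<^sup>2"]) simp
qed

text \<open>Contact holds as long as the time is below the bound, and time does not advance during contact; so the bound is not reached before the axis.\<close>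

lemma tau_contact_up_to_axis:
  assumes R: "regime r a \<eta>" and b: "inbox r X Y" and X: "X0 - a < X" "X <= X0" and Y: "Y0 < Y"
    and t: "ct dv X Y < t0 + \<eta>" and w: "pi < cw cv X Y" and \<xi>: "X <= \<xi>" "\<xi> <= X0"
  shows "cw dv \<xi> Y = pi"
proof -
  note g = regimeD(1)[OF R]
  have hp: "0 <= X + Y" by (rule good_boxD(2)[OF g b])
  have ct: "cw dv s Y = pi" if s: "X <= s" "s <= X0" "ct dv s Y < t0 + \<eta>" for s
  proof (rule w_tau_behind_curve[OF R _ _ s(2,3)])
    show "inbox r s Y" using b s regimeD(7)[OF R] unfolding inbox_def by (auto simp: abs_le_iff)
    show "X0 - a < s" using X s by simp
    show "pi <= cw cv s Y" using w_between[OF g b Y, of s] w s by (cases "s = X") auto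
  qed
  have "ct dv X0 Y < t0 + \<eta>"
  proof (rule ccontr)
    assume n: "\<not> ct dv X0 Y < t0 + \<eta>"
    define v where "v = (ct dv X Y + (t0 + \<eta>)) / 2"
    have v: "ct dv X Y < v" "v < t0 + \<eta>" using t by (simp_all add: v_def field_simps)
    have "continuous_on {X..X0} (\<lambda>X. ct dv X Y)" by (rule continuous_on_half_plane_line[OF B.cont_vars(7) hp])
    then obtain s where s: "X <= s" "s <= X0" "ct dv s Y = v" using IVT'[of "\<lambda>X. ct dv X Y" X v X0] v n X by auto
    have "ct dv s Y = ct dv X Y"
    proof (rule B.constant_along_contact(2)[OF hp s(1)])
      fix x assume x: "X <= x" "x <= s"
      have "ct dv x Y <= ct dv s Y" by (rule B.mono_X(2)) (use x hp in auto)
      then show "cw dv x Y = pi" using ct[of x] x s v by simp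
    qed
    then show False using s(3) v by simp
  qed
  moreover have "ct dv \<xi> Y <= ct dv X0 Y" by (rule B.mono_X(2)) (use hp \<xi> in auto)
  ultimately show ?thesis using ct \<xi> by simp
qed

text \<open>On the line \<open>\<pi> - w\<close> is comparable to the square of \<open>X - X0\<close>; \<open>x_X\<close> is of second and \<open>u_X\<close> of first order in this quantity.\<close>

lemma line_estimates:
  assumes g: "good_box r"
  shows "\<exists>\<mu>>0. \<exists>V\<ge>0. \<forall>X1 X2. X0 <= X1 --> X1 <= X2 --> X2 <= X0 + r -->
     \<mu> * (X2 - X0) ^ 4 * (X2 - X1) <= cx cv X2 Y0 - cx cv X1 Y0 \<and>
     \<bar>cu cv X2 Y0 - cu cv X1 Y0\<bar> <= V * (X2 - X0)\<^sup>2 * (X2 - X1)"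
proof -
  obtain pm where pm: "0 < pm" "\<forall>X Y. inbox r X Y --> pm <= cp cv X Y"
    using box_lower[OF g A.cont_vars(4)] A.p_pos good_boxD(2)[OF g] by blast
  have "continuous_on half_plane (\<lambda>(X, Y). cp cv X Y / (4 * c (cu cv X Y)))"
    unfolding split_def by (intro continuous_intros A.cont_fst_snd A.cont_c_u ballI; simp add: A.c_ne)
  then obtain M where M: "0 <= M" "\<forall>X Y. inbox r X Y --> \<bar>cp cv X Y / (4 * c (cu cv X Y))\<bar> <= M"
    using box_bounded[OF g, of "\<lambda>X Y. cp cv X Y / (4 * c (cu cv X Y))"] by blast
  show ?thesis
  proof (rule w_line_quadratic[OF g])
    fix \<beta> B :: real
    assume \<beta>: "0 < \<beta>" "\<And>X. \<bar>X - X0\<bar> <= r ==> cw cv X Y0 <= pi - \<beta> / 2 * (X - X0)\<^sup>2"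
      and B: "0 <= B" "\<And>X. \<bar>X - X0\<bar> <= r ==> pi - B / 2 * (X - X0)\<^sup>2 <= cw cv X Y0"
    define \<mu> where "\<mu> = \<beta>\<^sup>2 * pm / 640"
    define V where "V = B / 2 * M"
    have \<mu>: "0 < \<mu>" using \<beta>(1) pm(1) by (simp add: \<mu>_def)
    have V: "0 <= V" using B(1) M(1) by (simp add: V_def)
    have "\<mu> * (X2 - X0) ^ 4 * (X2 - X1) <= cx cv X2 Y0 - cx cv X1 Y0 \<and>
       \<bar>cu cv X2 Y0 - cu cv X1 Y0\<bar> <= V * (X2 - X0)\<^sup>2 * (X2 - X1)" if X: "X0 <= X1" "X1 <= X2" "X2 <= X0 + r" for X1 X2
    proof
      have ib: "inbox r x Y0" "\<bar>x - X0\<bar> <= r" if "X1 <= x" "x <= X2" for x using that X good_box_pos[OF g] by (auto simp: inbox_def)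
      have w: "pi / 2 <= cw cv x Y0" "cw cv x Y0 <= pi" "\<beta> / 2 * (x - X0)\<^sup>2 <= pi - cw cv x Y0" "\<bar>cw cv x Y0 - pi\<bar> <= B / 2 * (x - X0)\<^sup>2"
        if x: "X1 <= x" "x <= X2" for x
      proof -
        show "pi / 2 <= cw cv x Y0" using good_boxD(3)[OF g ib(1)[OF x]] by simp
        show 1: "\<beta> / 2 * (x - X0)\<^sup>2 <= pi - cw cv x Y0" using \<beta>(2)[OF ib(2)[OF x]] by simp
        have "0 <= \<beta> / 2 * (x - X0)\<^sup>2" using \<beta>(1) by simp
        then show 2: "cw cv x Y0 <= pi" using 1 by linarith
        show "\<bar>cw cv x Y0 - pi\<bar> <= B / 2 * (x - X0)\<^sup>2" using B(2)[OF ib(2)[OF x]] 2 by (simp add: abs_le_iff)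
      qed
      have hp: "0 < x + Y0" if "X1 <= x" for x using that X P_interior by simp
      have "0 * (X2 - X1) <= (cx cv X2 Y0 - \<mu> * (X2 - X0) ^ 5) - (cx cv X1 Y0 - \<mu> * (X1 - X0) ^ 5)"
      proof (rule increment_bounds(2)[where f="\<lambda>X. cx cv X Y0 - \<mu> * (X - X0) ^ 5" and f'="\<lambda>X. rhs_xX cv X Y0 - 5 * \<mu> * (X - X0) ^ 4", OF X(2)])
        fix x assume x: "X1 <= x" "x <= X2"
        show "((\<lambda>X. cx cv X Y0 - \<mu> * (X - X0) ^ 5) has_real_derivative rhs_xX cv x Y0 - 5 * \<mu> * (x - X0) ^ 4) (at x)"
          using A.C1(3)[OF hp[OF x(1)]] unfolding has_dX_def by (auto intro!: derivative_eq_intros)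
        have "(\<beta> / 2 * (x - X0)\<^sup>2)\<^sup>2 <= (pi - cw cv x Y0)\<^sup>2" by (rule power_mono[OF w(3)[OF x]]) (use \<beta>(1) in simp)
        then have "(\<beta> / 2 * (x - X0)\<^sup>2)\<^sup>2 / 8 <= 1 + cos (cw cv x Y0)" using one_plus_cos_ge[OF w(1,2)[OF x]] by linarith
        then have "(\<beta> / 2 * (x - X0)\<^sup>2)\<^sup>2 / 8 * pm <= (1 + cos (cw cv x Y0)) * cp cv x Y0"
          using pm ib(1)[OF x] one_plus_cos_nonneg[of "cw cv x Y0"] by (intro mult_mono) auto
        moreover have "(\<beta> / 2 * (x - X0)\<^sup>2)\<^sup>2 / 8 * pm = 4 * (5 * \<mu> * (x - X0) ^ 4)"
          by (simp add: \<mu>_def power_mult_distrib power_divide flip: power_mult)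
        ultimately have "5 * \<mu> * (x - X0) ^ 4 <= (1 + cos (cw cv x Y0)) * cp cv x Y0 / 4" by linarith
        then show "0 <= rhs_xX cv x Y0 - 5 * \<mu> * (x - X0) ^ 4" unfolding rhs_xX_def by linarith
      qed
      then have "\<mu> * ((X2 - X0) ^ 5 - (X1 - X0) ^ 5) <= cx cv X2 Y0 - cx cv X1 Y0" by (simp add: right_diff_distrib)
      moreover have "(X2 - X0) ^ 4 * (X2 - X1) <= (X2 - X0) ^ 5 - (X1 - X0) ^ 5"
      proof -
        have "(X1 - X0) ^ 4 * (X1 - X0) <= (X2 - X0) ^ 4 * (X1 - X0)" using X by (intro mult_right_mono power_mono) auto
        moreover have "(X1 - X0) ^ 5 = (X1 - X0) ^ 4 * (X1 - X0)" "(X2 - X0) ^ 5 = (X2 - X0) ^ 4 * (X2 - X0)"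
          by (simp_all add: eval_nat_numeral)
        moreover have "(X2 - X0) ^ 4 * (X2 - X1) = (X2 - X0) ^ 4 * (X2 - X0) - (X2 - X0) ^ 4 * (X1 - X0)" by (simp add: algebra_simps)
        ultimately show ?thesis by linarith
      qed
      then have "\<mu> * ((X2 - X0) ^ 4 * (X2 - X1)) <= \<mu> * ((X2 - X0) ^ 5 - (X1 - X0) ^ 5)" using \<mu> by (intro mult_left_mono) auto
      ultimately show "\<mu> * (X2 - X0) ^ 4 * (X2 - X1) <= cx cv X2 Y0 - cx cv X1 Y0" by (simp add: mult.assoc)
      show "\<bar>cu cv X2 Y0 - cu cv X1 Y0\<bar> <= V * (X2 - X0)\<^sup>2 * (X2 - X1)"
      proof (rule increment_bounds(3)[where f="\<lambda>X. cu cv X Y0" and f'="\<lambda>X. rhs_uX c cv X Y0", OF X(2)])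
        fix x assume x: "X1 <= x" "x <= X2"
        show "((\<lambda>X. cu cv X Y0) has_real_derivative rhs_uX c cv x Y0) (at x)" using A.C1(1)[OF hp[OF x(1)]] unfolding has_dX_def .
        have "\<bar>sin (cw cv x Y0)\<bar> <= B / 2 * (x - X0)\<^sup>2" using one_plus_cos_near_pi(2) w(4)[OF x] by (rule order_trans)
        also have "\<dots> <= B / 2 * (X2 - X0)\<^sup>2" using x X B(1) by (intro mult_left_mono power_mono) auto
        finally have "\<bar>sin (cw cv x Y0)\<bar> * \<bar>cp cv x Y0 / (4 * c (cu cv x Y0))\<bar> <= (B / 2 * (X2 - X0)\<^sup>2) * M"
          using M ib(1)[OF x] B(1) by (intro mult_mono) auto
        moreover have "rhs_uX c cv x Y0 = sin (cw cv x Y0) * (cp cv x Y0 / (4 * c (cu cv x Y0)))" by (simp add: rhs_uX_def)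
        ultimately show "\<bar>rhs_uX c cv x Y0\<bar> <= V * (X2 - X0)\<^sup>2" by (simp only: abs_mult V_def mult_ac)
      qed
    qed
    then show ?thesis using \<mu> V by blast
  qed
qed

lemma descendsD:
  assumes "descends sv K k0 X Y"
  shows "\<bar>cu sv X Y - cu cv (max X0 X) Y0\<bar> <= K * (ct sv X Y - t0)"
    "0 <= k ==> k <= k0 ==> \<bar>k - c (cu cv (max X0 X) Y0)\<bar> <= E ==>
       \<bar>(cx sv X Y + k * ct sv X Y) - (cx cv (max X0 X) Y0 + k * ct cv (max X0 X) Y0)\<bar> <= K * (ct sv X Y - t0) * (E + (ct sv X Y - t0))"
  using assms unfolding descends_def Let_def by blast+

text \<open>If one of the two preimages lies in the region of agreement, the values coincide. Otherwise both have feet on the line \<open>Y = Y0\<close>; the estimates for \<open>x + k t\<close> and for \<open>u\<close> on this line combine to a quadratic inequality for the difference of \<open>u\<close> at the feet.\<close>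

lemma solutions_close:
  assumes g: "good_box r"
  shows "\<exists>a4>0. \<forall>a \<eta>. a <= a4 --> regime r a \<eta> -->
     (\<exists>C. \<forall>t x. t0 < t --> t < t0 + \<eta> --> \<bar>ucons x t - udiss x t\<bar> <= C * (t - t0))"
proof -
  obtain N where N: "0 <= N" "\<forall>X Y \<xi>. inbox r X Y --> Y0 < Y --> pi < cw cv X Y --> X <= \<xi> --> \<xi> <= X0 -->
     1 + cos (cw cv \<xi> Y) <= N * (Y - Y0)\<^sup>2 \<and> \<bar>sin (cw cv \<xi> Y)\<bar> <= N * (Y - Y0)" using sigma_angle_above_curve[OF g] by blast
  have "continuous_on half_plane (\<lambda>(X, Y). c (cu cv X Y))" using A.cont_c_u(1) by (simp add: split_def)
  then obtain k0 where k0: "0 <= k0" "\<forall>X Y. inbox r X Y --> \<bar>c (cu cv X Y)\<bar> <= k0" using box_bounded[OF g] by blast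
  obtain U where U: "0 <= U" "\<forall>X Y. inbox r X Y --> \<bar>cu cv X Y\<bar> <= U" using box_bounded[OF g A.cont_vars(1)] by blast
  have tP: "ct dv X0 Y0 = t0" using same_at_P unfolding same_vars_def by simp
  have zA: "\<forall>X Y. inbox r X Y --> cos (cz cv X Y) \<noteq> -1" and zB: "\<forall>X Y. inbox r X Y --> cos (cz dv X Y) \<noteq> -1"
    using good_boxD(17,18)[OF g] by blast+
  obtain Ks as where Ks: "0 <= Ks" "0 < as" "\<forall>a X Y. 0 < a --> a <= as --> X0 - a < X --> inbox r X Y --> Y0 < Y -->
     (\<forall>\<xi>. X <= \<xi> --> \<xi> <= X0 --> 1 + cos (cw cv \<xi> Y) <= N * (Y - Y0)\<^sup>2 \<and> \<bar>sin (cw cv \<xi> Y)\<bar> <= N * (Y - Y0)) -->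
     cu cv (max X0 X) Y0 = cu cv (max X0 X) Y0 --> cx cv (max X0 X) Y0 = cx cv (max X0 X) Y0 -->
     ct cv (max X0 X) Y0 = ct cv (max X0 X) Y0 --> descends cv Ks k0 X Y"
    using ex_descends[OF A.char_sol_axioms g zA refl N(1) k0(1)] by (elim exE conjE) (rule that; assumption)
  obtain Kt at' where Kt: "0 <= Kt" "0 < at'" "\<forall>a X Y. 0 < a --> a <= at' --> X0 - a < X --> inbox r X Y --> Y0 < Y -->
     (\<forall>\<xi>. X <= \<xi> --> \<xi> <= X0 --> 1 + cos (cw dv \<xi> Y) <= N * (Y - Y0)\<^sup>2 \<and> \<bar>sin (cw dv \<xi> Y)\<bar> <= N * (Y - Y0)) -->
     cu dv (max X0 X) Y0 = cu cv (max X0 X) Y0 --> cx dv (max X0 X) Y0 = cx cv (max X0 X) Y0 -->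
     ct dv (max X0 X) Y0 = ct cv (max X0 X) Y0 --> descends dv Kt k0 X Y"
    using ex_descends[OF B.char_sol_axioms g zB tP N(1) k0(1)] by (elim exE conjE) (rule that; assumption)
  obtain \<mu> V where \<mu>: "0 < \<mu>" and V: "0 <= V" and line: "\<forall>X1 X2. X0 <= X1 --> X1 <= X2 --> X2 <= X0 + r -->
     \<mu> * (X2 - X0) ^ 4 * (X2 - X1) <= cx cv X2 Y0 - cx cv X1 Y0 \<and>
     \<bar>cu cv X2 Y0 - cu cv X1 Y0\<bar> <= V * (X2 - X0)\<^sup>2 * (X2 - X1)" using line_estimates[OF g] by (elim exE conjE) (rule that; assumption)
  have r0: "0 < r" by (rule good_box_pos[OF g])
  have key: "\<mu> * (cu cv X2 Y0 - cu cv X1 Y0)\<^sup>2 <= V\<^sup>2 * r * G"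
    if X: "X0 <= X1" "X1 <= X2" "X2 <= X0 + r" and k: "0 <= k"
      and G: "\<bar>(cx cv X2 Y0 + k * ct cv X2 Y0) - (cx cv X1 Y0 + k * ct cv X1 Y0)\<bar> <= G" for X1 X2 k G
  proof -
    define h where "h = X2 - X0"
    define d where "d = X2 - X1"
    have hd: "0 <= h" "0 <= d" "d <= r" using X by (auto simp: h_def d_def)
    have l: "\<mu> * h ^ 4 * d <= cx cv X2 Y0 - cx cv X1 Y0" "\<bar>cu cv X2 Y0 - cu cv X1 Y0\<bar> <= V * h\<^sup>2 * d"
      using line[rule_format, OF X] unfolding h_def d_def by simp_all
    have "0 <= ct cv X2 Y0 - ct cv X1 Y0" using A.mono_X(2)[of X1 Y0 X2] X P_interior by simp
    then have "0 <= k * (ct cv X2 Y0 - ct cv X1 Y0)" using k by simp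
    then have "cx cv X2 Y0 - cx cv X1 Y0 <= G" using abs_le_D1[OF G] by (simp add: right_diff_distrib)
    then have hG: "\<mu> * h ^ 4 * d <= G" using l(1) by linarith
    have "0 <= G" using G by (meson abs_ge_zero order_trans)
    have "(cu cv X2 Y0 - cu cv X1 Y0)\<^sup>2 <= (V * h\<^sup>2 * d)\<^sup>2" using power_mono[OF l(2), of 2] by simp
    then have "\<mu> * (cu cv X2 Y0 - cu cv X1 Y0)\<^sup>2 <= \<mu> * (V * h\<^sup>2 * d)\<^sup>2" using \<mu> by simp
    also have "\<dots> = V\<^sup>2 * d * (\<mu> * h ^ 4 * d)" by (simp add: power2_eq_square power4_eq_xxxx mult_ac)
    also have "\<dots> <= V\<^sup>2 * d * G" using hG hd by (intro mult_left_mono) auto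
    also have "\<dots> <= V\<^sup>2 * r * G" using hd \<open>0 <= G\<close> by (intro mult_right_mono mult_left_mono) auto
    finally show ?thesis .
  qed
  show ?thesis
  proof (rule A.c_lipschitz_bounded[of U])
    fix L assume L: "0 <= L" "\<And>v v'. \<bar>v\<bar> <= U ==> \<bar>v'\<bar> <= U ==> \<bar>c v - c v'\<bar> <= L * \<bar>v - v'\<bar>"
    define K3 where "K3 = Ks + Kt * (L + 1)"
    define K4 where "K4 = V\<^sup>2 * r * K3 / \<mu>"
    have K3: "0 <= K3" "Ks <= K3" using Ks(1) Kt(1) L(1) by (simp_all add: K3_def)
    have K4: "0 <= K4" using K3 r0 \<mu> by (simp add: K4_def)
    define C where "C = Ks + (K4 + 1) + Kt"
    have C: "0 <= C" using Ks(1) Kt(1) K4 by (simp add: C_def)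
    have main: "\<bar>ucons x t - udiss x t\<bar> <= C * (t - t0)"
      if a: "a <= min as at'" and R: "regime r a \<eta>" and t: "t0 < t" "t < t0 + \<eta>" for a \<eta> t x
    proof -
      have tp: "0 <= t" using t t0_pos by simp
      note ra = regimeD(2,3)[OF R]
      define T where "T = t - t0"
      have T: "0 < T" using t by (simp add: T_def)
      define XA where "XA = fst (A.pre x t)" define YA where "YA = snd (A.pre x t)"
      define XB where "XB = fst (B.pre x t)" define YB where "YB = snd (B.pre x t)"
      have pA: "0 <= XA + YA" "cx cv XA YA = x" "ct cv XA YA = t" "ucons x t = cu cv XA YA"
        unfolding XA_def YA_def using A.pre[OF tp] A.U_pre[OF tp] by auto
      have pB: "0 <= XB + YB" "cx dv XB YB = x" "ct dv XB YB = t" "udiss x t = cu dv XB YB"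
        unfolding XB_def YB_def using B.pre[OF tp] B.U_pre[OF tp] by auto
      consider "in_E r a XA YA" | "in_E r a XB YB" | "\<not> in_E r a XA YA" "\<not> in_E r a XB YB" by blast
      then show ?thesis
      proof cases
        case 1
        have "same_vars cv dv XA YA" by (rule same_in_E[OF R pA(1) _ 1]) (use pA t in simp)
        then have "udiss x t = ucons x t" using B.U_eq[OF pA(1)] pA unfolding same_vars_def by simp
        then show ?thesis using C t by simp
      next
        case 2
        have "same_vars cv dv XB YB" by (rule tau_in_E(2)[OF R pB(1) 2]) (use pB t in simp)
        then have "udiss x t = ucons x t" using A.U_eq[OF pB(1)] pB unfolding same_vars_def by simp
        then show ?thesis using C t by simp
      next
        case 3
        have tA: "ct cv XA YA < t0 + \<eta>" and tB: "ct dv XB YB < t0 + \<eta>" using pA pB t by auto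
        note oA = sigma_outside_E[OF R pA(1) tA 3(1)] and oB = tau_outside_E[OF R pB(1) tB 3(2)]
        define X1 where "X1 = max X0 XA" define X2 where "X2 = max X0 XB"
        have X12: "X0 <= X1" "X1 <= X0 + r" "X0 <= X2" "X2 <= X0 + r" using oA oB ra r0 by (auto simp: X1_def X2_def)
        have ib: "inbox r X1 Y0" "inbox r X2 Y0" using X12 r0 by (auto simp: inbox_def)
        have dA: "descends cv Ks k0 XA YA"
        proof (rule Ks(3)[rule_format, OF ra(1) _ oA(1,4,3) _ refl refl refl])
          show "a <= as" using a by simp
          fix \<xi> assume \<xi>: "XA <= \<xi>" "\<xi> <= X0"
          then show "1 + cos (cw cv \<xi> YA) <= N * (YA - Y0)\<^sup>2 \<and> \<bar>sin (cw cv \<xi> YA)\<bar> <= N * (YA - Y0)"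
            using N(2) oA(3,4,5) by simp
        qed
        have sB: "same_vars cv dv X2 Y0"
        proof (cases "XB <= X0")
          case True then show ?thesis using same_at_P by (simp add: X2_def)
        next
          case False
          then have e: "X2 = XB" by (simp add: X2_def)
          have h: "0 <= XB + Y0" using False P_interior by simp
          have "ct dv XB Y0 <= ct dv XB YB" by (rule B.mono_Y(2)) (use h oB in auto)
          then show ?thesis unfolding e by (intro tau_in_E(2)[OF R h]) (use tB in \<open>auto simp: in_E_def\<close>)
        qed
        have cB: "1 + cos (cw dv \<xi> YB) <= N * (YB - Y0)\<^sup>2 \<and> \<bar>sin (cw dv \<xi> YB)\<bar> <= N * (YB - Y0)" if \<xi>: "XB <= \<xi>" "\<xi> <= X0" for \<xi>
        proof -
          have "XB <= X0" using \<xi> by simp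
          then have "cw dv \<xi> YB = pi" using tau_contact_up_to_axis[OF R oB(4,1) _ oB(3) tB _ \<xi>] oB(5) by blast
          then show ?thesis using N(1) oB(3) by simp
        qed
        have aB: "a <= at'" using a by simp
        have dB: "descends dv Kt k0 XB YB"
          by (rule Kt(3)[rule_format, OF ra(1) aB oB(1,4,3) cB])
             (use sB in \<open>auto simp: same_vars_def X2_def\<close>)
        define k where "k = c (cu cv X1 Y0)"
        define \<Delta> where "\<Delta> = \<bar>cu cv X1 Y0 - cu cv X2 Y0\<bar>"
        have \<Delta>: "0 <= \<Delta>" by (simp add: \<Delta>_def)
        have k: "0 <= k" "k <= k0" using A.c_pos[of "cu cv X1 Y0"] k0(2) ib(1) by (auto simp: k_def abs_le_iff)
        have uA: "\<bar>ucons x t - cu cv X1 Y0\<bar> <= Ks * T"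
          using descendsD(1)[OF dA] unfolding X1_def T_def pA(3,4) .
        have FA: "\<bar>(x + k * t) - (cx cv X1 Y0 + k * ct cv X1 Y0)\<bar> <= Ks * T * (0 + T)"
        proof -
          have "\<bar>k - c (cu cv (max X0 XA) Y0)\<bar> <= 0" by (simp add: k_def X1_def)
          from descendsD(2)[OF dA k this] show ?thesis unfolding X1_def T_def pA(2,3) .
        qed
        have uB: "\<bar>udiss x t - cu cv X2 Y0\<bar> <= Kt * T"
          using descendsD(1)[OF dB] unfolding X2_def T_def pB(3,4) .
        have "\<bar>k - c (cu cv X2 Y0)\<bar> <= L * \<Delta>" unfolding k_def \<Delta>_def by (rule L(2)) (use U(2) ib in auto)
        from descendsD(2)[OF dB k this[unfolded X2_def]]
        have FB: "\<bar>(x + k * t) - (cx cv X2 Y0 + k * ct cv X2 Y0)\<bar> <= Kt * T * (L * \<Delta> + T)"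
          unfolding X2_def T_def pB(2,3) .
        define G where "G = K3 * T * (\<Delta> + T)"
        have GG: "Ks * T * (0 + T) + Kt * T * (L * \<Delta> + T) <= G"
        proof -
          have "G - (Ks * T * (0 + T) + Kt * T * (L * \<Delta> + T)) = Ks * T * \<Delta> + Kt * (L * T) * T + Kt * T * \<Delta>"
            by (simp add: G_def K3_def algebra_simps)
          moreover have "0 <= Ks * T * \<Delta>" "0 <= Kt * (L * T) * T" "0 <= Kt * T * \<Delta>" using Ks(1) Kt(1) L(1) T \<Delta> by simp_all
          ultimately show ?thesis by linarith
        qed
        have tri: "\<bar>p - q\<bar> <= e1 + e2" if "\<bar>o' - p\<bar> <= e1" "\<bar>o' - q\<bar> <= e2" for p q o' e1 e2 :: real using that by (simp add: abs_le_iff)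
        have F12: "\<bar>(cx cv X1 Y0 + k * ct cv X1 Y0) - (cx cv X2 Y0 + k * ct cv X2 Y0)\<bar> <= G" by (rule order_trans[OF tri[OF FA FB] GG])
        have sq: "\<mu> * \<Delta>\<^sup>2 <= V\<^sup>2 * r * G"
        proof (cases "X1 <= X2")
          case True
          have "\<mu> * (cu cv X2 Y0 - cu cv X1 Y0)\<^sup>2 <= V\<^sup>2 * r * G" by (rule key[OF X12(1) True X12(4) k(1)]) (use F12 in \<open>simp add: abs_minus_commute\<close>)
          then show ?thesis by (simp add: \<Delta>_def power2_commute)
        next
          case False
          then have "\<mu> * (cu cv X1 Y0 - cu cv X2 Y0)\<^sup>2 <= V\<^sup>2 * r * G" by (intro key[OF X12(3) _ X12(2) k(1) F12]) simp
          then show ?thesis by (simp add: \<Delta>_def)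
        qed
        have "\<Delta>\<^sup>2 <= K4 * T * (\<Delta> + T)" using sq \<mu> by (simp add: K4_def G_def field_simps)
        then have "\<Delta> <= (K4 + 1) * T" by (rule le_of_square_le[OF K4 T])
        moreover have "\<bar>p - q\<bar> <= \<bar>p - u\<bar> + \<bar>u - v\<bar> + \<bar>q - v\<bar>" for p q u v :: real by (simp add: abs_if split: if_splits)
        from this[of "ucons x t" "udiss x t" "cu cv X1 Y0" "cu cv X2 Y0"]
        have "\<bar>ucons x t - udiss x t\<bar> <= \<bar>ucons x t - cu cv X1 Y0\<bar> + \<Delta> + \<bar>udiss x t - cu cv X2 Y0\<bar>" by (simp only: \<Delta>_def)
        ultimately have "\<bar>ucons x t - udiss x t\<bar> <= Ks * T + (K4 + 1) * T + Kt * T" using uA uB by linarith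
        also have "\<dots> = C * T" by (simp add: C_def algebra_simps)
        finally show ?thesis by (simp add: T_def)
      qed
    qed
    show ?thesis
    proof (rule exI[of _ "min as at'"], rule conjI)
      show "0 < min as at'" using Ks(2) Kt(2) by simp
      show "\<forall>a \<eta>. a <= min as at' --> regime r a \<eta> -->
         (\<exists>C. \<forall>t x. t0 < t --> t < t0 + \<eta> --> \<bar>ucons x t - udiss x t\<bar> <= C * (t - t0))"
        by (intro allI impI exI[of _ C]) (rule main)
    qed
  qed
qed

end

section \<open>Behaviour after the singularity\<close>

context singular_origin
begin

lemma dissipative_conclusion:
  assumes fc: "forward_characteristic cv X0 Y0 \<gamma>f"
  shows "(\<forall>\<^sub>F t in at_right t0. strong_singularity (\<lambda>x. udiss x t) (\<gamma>m t) \<and> weak_singularity (\<lambda>x. udiss x t) (\<gamma>f t)) \<and>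
    (\<exists>C. \<forall>\<^sub>F t in at_right t0. \<forall>x. \<bar>ucons x t - udiss x t\<bar> <= C * (t - t0))"
proof -
  obtain r where g: "good_box r" using ex_good_box by blast
  obtain a2 where a2: "0 < a2" "\<forall>a \<eta>. a <= a2 --> regime r a \<eta> --> (\<exists>k>0. \<exists>d>0. \<forall>X Y. X0 <= X --> X < X0 + a --> Y0 < Y --> Y < Y0 + d -->
     ct dv X Y < t0 + \<eta> --> cz cv X Y - cz dv X Y <= - k * sqrt (Y - Y0))"
    using z_gap[OF g] by (elim exE conjE) (rule that; assumption)
  obtain a4 where a4: "0 < a4" "\<forall>a \<eta>. a <= a4 --> regime r a \<eta> -->
     (\<exists>C. \<forall>t x. t0 < t --> t < t0 + \<eta> --> \<bar>ucons x t - udiss x t\<bar> <= C * (t - t0))"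
    using solutions_close[OF g] by (elim exE conjE) (rule that; assumption)
  show ?thesis
  proof (rule contact_slices_are_intervals[OF g])
    fix a1
    assume a1: "0 < a1" "a1 <= r" and slices: "\<And>a \<eta> X1 X2 Y. a <= a1 ==> regime r a \<eta> ==> X0 <= X1 ==> X1 <= X2 ==> X2 < X0 + a ==>
     Y0 < Y ==> Y <= Y0 + r ==> ct dv X2 Y < t0 + \<eta> ==> cw dv X2 Y = pi ==> cw dv X1 Y = pi"
    have "0 < min a1 (min a2 a4)" "min a1 (min a2 a4) <= r" using a1 a2(1) a4(1) by auto
    then obtain a \<eta> where a: "a <= min a1 (min a2 a4)" and R: "regime r a \<eta>" using ex_regime[OF g] by blast
    have le: "a <= a1" "a <= a2" "a <= a4" using a by auto
    obtain C where C: "\<forall>t x. t0 < t --> t < t0 + \<eta> --> \<bar>ucons x t - udiss x t\<bar> <= C * (t - t0)"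
      using a4(2)[rule_format, OF le(3) R] by blast
    have \<eta>: "t0 < t0 + \<eta>" using regimeD(8)[OF R] by simp
    have ss: "strong_singularity (\<lambda>x. udiss x t) (\<gamma>m t)" if "t0 < t" "t < t0 + \<eta>" for t
      by (rule dissipative_strong_singularity[OF R slices[OF le(1) R] that])
    have wk: "weak_singularity (\<lambda>x. udiss x t) (\<gamma>f t)" if "t0 < t" "t < t0 + \<eta>" for t
      by (rule weak_singularity_on_forward_characteristic[OF R a2(2)[rule_format, OF le(2) R] fc that])
    have "\<forall>\<^sub>F t in at_right t0. t0 < t \<and> t < t0 + \<eta>"
      unfolding eventually_at_right_field using \<eta> by blast
    then have "\<forall>\<^sub>F t in at_right t0. strong_singularity (\<lambda>x. udiss x t) (\<gamma>m t) \<and> weak_singularity (\<lambda>x. udiss x t) (\<gamma>f t)"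
      "\<forall>\<^sub>F t in at_right t0. \<forall>x. \<bar>ucons x t - udiss x t\<bar> <= C * (t - t0)"
      using ss wk C by (auto elim!: eventually_mono)
    then show ?thesis by blast
  qed
qed

end

theorem theorem4:
  fixes c u0 u1 :: "real \<Rightarrow> real"
    and ucons udiss :: "real \<Rightarrow> real \<Rightarrow> real"
    and \<sigma> :: char_vars
    and X0 Y0 \<kappa> x0 t0 :: real
    and \<gamma>m \<gamma>p \<gamma>f :: "real \<Rightarrow> real"
  assumes "assumption_A c"
    and "\<forall>v. deriv c v > 0"
    and "smooth_H1_L2_data u0 u1"
    and "conservative_solution c u0 u1 \<sigma> ucons"
    and "dissipative_solution c u0 u1 udiss"
    and "type2_origin_point \<sigma> X0 Y0 \<kappa>"
    and "x0 = cx \<sigma> X0 Y0" and "t0 = ct \<sigma> X0 Y0" and "t0 > 0"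
    and "only_singularity \<sigma> X0 Y0 \<kappa> \<gamma>m \<gamma>p"
    and "forward_characteristic \<sigma> X0 Y0 \<gamma>f"
  shows
    "(\<forall>\<^sub>F t in at_right t0.
        strong_singularity (\<lambda>x. ucons x t) (\<gamma>m t) \<and>
        strong_singularity (\<lambda>x. ucons x t) (\<gamma>p t) \<and>
        smooth_on (- {\<gamma>m t, \<gamma>p t}) (\<lambda>x. ucons x t)) \<and>
     (\<forall>\<^sub>F t in at_right t0.
        strong_singularity (\<lambda>x. udiss x t) (\<gamma>m t) \<and>
        weak_singularity (\<lambda>x. udiss x t) (\<gamma>f t)) \<and>
     (\<exists>C. \<forall>\<^sub>F t in at_right t0. \<forall>x. \<bar>ucons x t - udiss x t\<bar> \<le> C * (t - t0))"
proof -
  obtain c0 where c0: "smooth_on UNIV c" "0 < c0" "\<And>v. c0 \<le> c v"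
    using assms(1) unfolding assumption_A_def by blast
  have ws: "wave_speed c"
    by (rule wave_speed.intro[OF c0(1)]) (rule less_le_trans[OF c0(2,3)])
  obtain \<tau> where \<tau>: "dissipative_vars c u0 u1 \<tau>" "is_graph_of udiss \<tau>"
    using assms(5) unfolding dissipative_solution_def by blast
  have \<sigma>: "conservative_vars c u0 u1 \<sigma>" "is_graph_of ucons \<sigma>"
    using assms(4) unfolding conservative_solution_def by blast+
  obtain \<delta> \<epsilon> \<psi> where os: "0 < \<delta>" "level_curve \<sigma> X0 Y0 \<kappa> \<epsilon> \<psi>"
    "branch_image \<sigma> {(X, \<psi> X) | X. X \<in> {X0-\<epsilon><..<X0}} (ct \<sigma> X0 Y0) \<delta> \<gamma>m"
    "branch_image \<sigma> {(X, \<psi> X) | X. X \<in> {X0<..<X0+\<epsilon>}} (ct \<sigma> X0 Y0) \<delta> \<gamma>p"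
    "\<forall>t\<in>{ct \<sigma> X0 Y0<..ct \<sigma> X0 Y0+\<delta>}. \<gamma>m t < \<gamma>p t"
    "\<forall>X Y. 0 \<le> ct \<sigma> X Y \<and> ct \<sigma> X Y \<le> ct \<sigma> X0 Y0 + \<delta> \<and> (eq_pi_mod (cw \<sigma> X Y) \<or> eq_pi_mod (cz \<sigma> X Y))
       \<longrightarrow> (X, Y) \<in> {(X0, Y0)} \<union> {(X, \<psi> X) | X. X \<in> {X0-\<epsilon><..<X0}} \<union> {(X, \<psi> X) | X. X \<in> {X0<..<X0+\<epsilon>}}"
    using assms(10) unfolding only_singularity_def Let_def by (elim exE conjE) (rule that; assumption)
  have "singular_origin c \<sigma> u0 u1 ucons \<tau> udiss X0 Y0 \<kappa> \<delta> \<epsilon> \<psi> \<gamma>m \<gamma>p"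
  proof (rule singular_origin.intro[OF cons_diss.intro singular_origin_axioms.intro])
    show "char_graph c (\<lambda>_ _. 1) \<sigma> u0 u1 ucons" by (rule conservative_char_graph[OF ws \<sigma>])
    show "char_graph c (dissipative_theta \<tau>) \<tau> u0 u1 udiss" by (rule dissipative_char_graph[OF ws \<tau>])
    show "0 < deriv c v" for v using assms(2) by blast
    show "0 < ct \<sigma> X0 Y0" using assms(8,9) by simp
    show "\<gamma>m t < \<gamma>p t" if "ct \<sigma> X0 Y0 < t" "t \<le> ct \<sigma> X0 Y0 + \<delta>" for t using os(5) that by simp
    show "(X, Y) \<in> {(X0, Y0)} \<union> {(X, \<psi> X) | X. X \<in> {X0-\<epsilon><..<X0}} \<union> {(X, \<psi> X) | X. X \<in> {X0<..<X0+\<epsilon>}}"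
      if "0 \<le> ct \<sigma> X Y" "ct \<sigma> X Y \<le> ct \<sigma> X0 Y0 + \<delta>" "eq_pi_mod (cw \<sigma> X Y) \<or> eq_pi_mod (cz \<sigma> X Y)" for X Y
      using os(6)[rule_format, OF conjI[OF that(1) conjI[OF that(2,3)]]] .
  qed (fact \<sigma>(1) assms(6) os)+
  then interpret singular_origin c \<sigma> u0 u1 ucons \<tau> udiss X0 Y0 \<kappa> \<delta> \<epsilon> \<psi> \<gamma>m \<gamma>p .
  show ?thesis unfolding assms(8) using conservative_conclusion dissipative_conclusion[OF assms(11)] by blast
qed

end
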